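(* Let $n\ge 2$ be even, let $0<h_1<h_2<\dots<h_n=1$, and let $a_i\in\mathbb{R}$, $b_i>0$ for $i=1,\dots,n$; put $(a_0,b_0)=(a_n,b_n)$. Consider on $[0,1]^2$ the piecewise constant vector field $$Z(x,y)=\begin{cases}(a_i,b_i) & \text{if } y\in[h_i,h_{i+1}],\ i=1,2,\dots,n-1,\\ (a_n,b_n) & \text{if } y\in[0,h_1].\end{cases}$$ For $\alpha_i>0$, $i=1,\dots,n$, let $$f(x,y)=\begin{cases}\alpha_i & \text{if } y\in[h_i,h_{i+1}],\ i=1,2,\dots,n-1,\\ \alpha_n & \text{if } y\in[0,h_1],\end{cases}$$ and let $\lambda$ denote Lebesgue measure. (a) The Filippov system $Z$ defined on the torus $\mathbb{T}^2$ preserves the measure $\nu=f\cdot\lambda$ if and only if, for some $C>0$, $\alpha_i=C/b_i$ for all $i\in\{1,2,\dots,n\}$. (b) Assume in addition that $h_1=h_n-h_{n-1}$ and $h_i-h_{i-1}=h_{n-i+1}-h_{n-i}$ for $i\in\{1,2,\dots,n/2-1\}$ (with $h_0=0$). The Filippov system $Z$ defined on the Klein bottle $\mathbb{K}^2$ preserves the measure $\nu=f\cdot\lambda$ if and only if, for some $C>0$, $\alpha_i=C/b_i$ for all $i\in\{1,2,\dots,n\}$, and $a_i/b_i=a_{n-i-1}/b_{n-i-1}$ for all $i\in\{0,1,\dots,n/2-1\}$.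
   Context: Surfaces: $\mathbb{T}^2$ is the quotient of $[0,1]^2$ by $(x,0)\sim(x,1)$ and $(0,y)\sim(1,y)$. $\mathbb{K}^2$ is the quotient of $[0,1]^2$ by $(x,0)\sim(x,1)$ (orientation preserved) and $(0,y)\sim(1,1-y)$ (orientation reversed). Both carry the flat metric and the Lebesgue measure $\lambda$ induced from $[0,1]^2$; $f\cdot\lambda$ is the measure with density $f$ (values on the finitely many lines where $f$ is ambiguous are irrelevant). Discontinuity set: on $\mathbb{T}^2$ it is the union of the closed curves $\Sigma_i=[0,1]\times\{h_i\}$, $i=1,\dots,n$ (with $\Sigma_n=[0,1]\times\{0\}=[0,1]\times\{1\}$). On $\mathbb{K}^2$ there is in addition $\Sigma_0=\{0\}\times[0,1]=\{1\}\times[0,1]$, because the gluing along the vertical sides reverses the second component of vectors. Filippov's convention: solutions are the absolutely continuous curves $\phi$ with $\dot\phi(t)\in\mathcal{F}_Z(\phi(t))$ for almost every $t$, where $\mathcal F_Z(q)=\{Z(q)\}$ at points off the discontinuity set, and at a point $q$ of the discontinuity set $\mathcal F_Z(q)$ is the convex hull of the limit values of $Z$ at $q$ from the adjacent regions of continuity, computed in a local flat chart around $q$ (so, at a point lying on a single discontinuity curve, the segment joining the two one-sided limits). Let $\mathcal{S}_Z(q)$ be the set of maximal solutions with $\phi(0)=q$, $Z_t(q)=\{\phi(t):\phi\in\mathcal S_Z(q)\}$ and $Z_t(A)=\bigcup_{q\in A}Z_t(q)$. The system preserves a Borel measure $\mu$ if $\mu(Z_t(A))=\mu(A)$ for every Borel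 set $A$ and every $t\in\mathbb{R}$. *)

theory Defs
  imports "HOL-Analysis.Analysis"
begin

section \<open>The torus and the Klein bottle as quotients of the unit square\<close>

definition unit_square :: "(real \<times> real) set" where
  "unit_square = {0..1} \<times> {0..1}"

inductive torus_glue :: "real \<times> real \<Rightarrow> real \<times> real \<Rightarrow> bool" where
  "0 \<le> x \<Longrightarrow> x \<le> 1 \<Longrightarrow> torus_glue (x, 0) (x, 1)"
| "0 \<le> y \<Longrightarrow> y \<le> 1 \<Longrightarrow> torus_glue (0, y) (1, y)"

inductive klein_glue :: "real \<times> real \<Rightarrow> real \<times> real \<Rightarrow> bool" where
  "0 \<le> x \<Longrightarrow> x \<le> 1 \<Longrightarrow> klein_glue (x, 0) (x, 1)"
| "0 \<le> y \<Longrightarrow> y \<le> 1 \<Longrightarrow> klein_glue (0, y) (1, 1 - y)"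

text \<open>A point of the quotient surface is an equivalence class of the relation generated by the
  gluing.\<close>

definition torus_pt :: "real \<times> real \<Rightarrow> (real \<times> real) set" where
  "torus_pt p = {q. equivclp torus_glue p q}"

definition klein_pt :: "real \<times> real \<Rightarrow> (real \<times> real) set" where
  "klein_pt p = {q. equivclp klein_glue p q}"

text \<open>The Borel sigma-algebra of the quotient topology on \<open>pt ` unit_square\<close>, and the measure
  \<open>f \<cdot> \<lambda>\<close>, where \<open>\<lambda>\<close> is the image of Lebesgue measure on the square.\<close>

definition quotient_borel :: "(real \<times> real \<Rightarrow> 'q) \<Rightarrow> 'q measure" where
  "quotient_borel pt = sigma (pt ` unit_square)
     {U. U \<subseteq> pt ` unit_square \<and> openin (top_of_set unit_square) {p \<in> unit_square. pt p \<in> U}}"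

definition weighted_area ::
    "(real \<times> real \<Rightarrow> 'q) \<Rightarrow> (real \<times> real \<Rightarrow> real) \<Rightarrow> 'q measure" where
  "weighted_area pt f =
     distr (density (restrict_space lborel unit_square) (\<lambda>p. ennreal (f p))) (quotient_borel pt) pt"

section \<open>Flat charts\<close>

text \<open>The developing maps from the plane onto the surfaces. They are the universal coverings and
  local isometries, so their restrictions to small discs are inverses of local flat charts, and
  every local flat chart is of this form up to a rigid motion. A unit column \<open>[k, k+1) \<times> \<real>\<close> with
  \<open>k\<close> odd is developed onto the Klein bottle with the second coordinate reversed.\<close>

definition torus_fold :: "real \<times> real \<Rightarrow> real \<times> real" where
  "torus_fold p = (frac (fst p), frac (snd p))"

definition klein_fold :: "real \<times> real \<Rightarrow> real \<times> real" where
  "klein_fold p = (frac (fst p), if even \<lfloor>fst p\<rfloor> then frac (snd p) else frac (1 - snd p))"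

definition torus_dev :: "real \<times> real \<Rightarrow> (real \<times> real) set" where
  "torus_dev p = torus_pt (torus_fold p)"

definition klein_dev :: "real \<times> real \<Rightarrow> (real \<times> real) set" where
  "klein_dev p = klein_pt (klein_fold p)"

text \<open>The coordinate expressions, in these charts, of a vector field given on the square.\<close>

definition torus_field :: "(real \<times> real \<Rightarrow> real \<times> real) \<Rightarrow> real \<times> real \<Rightarrow> real \<times> real" where
  "torus_field Z p = Z (torus_fold p)"

definition klein_field :: "(real \<times> real \<Rightarrow> real \<times> real) \<Rightarrow> real \<times> real \<Rightarrow> real \<times> real" where
  "klein_field Z p =
     (let v = Z (klein_fold p) in (fst v, if even \<lfloor>fst p\<rfloor> then snd v else - snd v))"

lemma torus_glue_eq: "torus_glue p q \<Longrightarrow> torus_pt p = torus_pt q"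
  unfolding torus_pt_def
  by (auto intro: equivclp_sym equivclp_trans r_into_equivclp)

lemma klein_glue_eq: "klein_glue p q \<Longrightarrow> klein_pt p = klein_pt q"
  unfolding klein_pt_def
  by (auto intro: equivclp_sym equivclp_trans r_into_equivclp)

lemma torus_dev_square:
  assumes "p \<in> unit_square"
  shows "torus_dev p = torus_pt p"
proof -
  obtain x y where p: "p = (x, y)" "0 \<le> x" "x \<le> 1" "0 \<le> y" "y \<le> 1"
    using assms by (auto simp: unit_square_def)
  have fr: "frac z = (if z = 1 then 0 else z)" if "0 \<le> z" "z \<le> 1" for z :: real
    using that by (auto simp: frac_eq)
  have y: "torus_pt (x, frac y) = torus_pt (x, y)"
    using p fr[of y] torus_glue_eq[OF torus_glue.intros(1)[of x]] by auto
  have "torus_pt (frac x, frac y) = torus_pt (x, frac y)"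
    using p fr[of x] torus_glue_eq[OF torus_glue.intros(2)[of "frac y"]]
    by (auto simp: less_imp_le frac_lt_1)
  then show ?thesis by (simp add: torus_dev_def torus_fold_def p y)
qed

lemma klein_dev_square:
  assumes "p \<in> unit_square"
  shows "klein_dev p = klein_pt p"
proof -
  obtain x y where p: "p = (x, y)" "0 \<le> x" "x \<le> 1" "0 \<le> y" "y \<le> 1"
    using assms by (auto simp: unit_square_def)
  have fr: "frac z = (if z = 1 then 0 else z)" if "0 \<le> z" "z \<le> 1" for z :: real
    using that by (auto simp: frac_eq)
  have y: "klein_pt (u, frac z) = klein_pt (u, z)"
    if "0 \<le> u" "u \<le> 1" "0 \<le> z" "z \<le> 1" for u z
    using that fr[of z] klein_glue_eq[OF klein_glue.intros(1)[of u]] by auto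
  show ?thesis
  proof (cases "x = 1")
    case True
    have "klein_dev p = klein_pt (0, frac (1 - y))"
      by (simp add: klein_dev_def klein_fold_def p True)
    also have "\<dots> = klein_pt (0, 1 - y)" using p by (intro y) auto
    also have "\<dots> = klein_pt (1, y)"
      using klein_glue_eq[OF klein_glue.intros(2)[of "1 - y"]] p by simp
    finally show ?thesis by (simp add: p True)
  next
    case False
    then have "\<lfloor>x\<rfloor> = 0" using p by linarith
    then show ?thesis using p y[of x y] by (simp add: klein_dev_def klein_fold_def frac_def)
  qed
qed

lemma klein_dev_shift:
  "klein_dev (x, y + 1) = klein_dev (x, y)" "klein_dev (x + 1, y) = klein_dev (x, 1 - y)"
  using frac_1_eq[of "- y"] frac_1_eq[of y] frac_1_eq[of x]
  by (simp_all add: klein_dev_def klein_fold_def add.commute)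

section \<open>Filippov solutions\<close>

text \<open>Absolute continuity on every compact subinterval of \<open>S\<close>.\<close>

definition locally_abs_continuous_on :: "real set \<Rightarrow> (real \<Rightarrow> 'a::metric_space) \<Rightarrow> bool" where
  "locally_abs_continuous_on S g \<longleftrightarrow>
     (\<forall>c d. {c..d} \<subseteq> S \<longrightarrow>
       (\<forall>\<epsilon>>0. \<exists>\<delta>>0. \<forall>(m::nat) u v.
          (\<forall>i<m. c \<le> u i \<and> u i \<le> v i \<and> v i \<le> d) \<and>
          (\<forall>i<m. \<forall>j<m. i \<noteq> j \<longrightarrow> {u i<..<v i} \<inter> {u j<..<v j} = {}) \<and>
          (\<Sum>i<m. v i - u i) < \<delta>
          \<longrightarrow> (\<Sum>i<m. dist (g (u i)) (g (v i))) < \<epsilon>))"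

text \<open>In the following, \<open>D\<close> is a closed discontinuity set in the plane and \<open>W\<close> a planar vector
  field; the components of \<open>- D\<close> are the regions of continuity.\<close>

definition filippov_set ::
    "(real \<times> real) set \<Rightarrow> (real \<times> real \<Rightarrow> real \<times> real) \<Rightarrow> real \<times> real \<Rightarrow> (real \<times> real) set" where
  "filippov_set D W p =
     (if p \<in> D
      then convex hull {v. \<exists>R \<in> components (- D). p \<in> closure R \<and> (W \<longlongrightarrow> v) (at p within R)}
      else {W p})"

text \<open>Here \<open>dev\<close> is the developing map of the surface, \<open>D\<close> the discontinuity set on the surface, and
  \<open>W\<close> the chart expression of the vector field. Near every time of its interval \<open>I\<close>, a solution
  \<open>\<phi>\<close> is read in a flat chart, as \<open>\<psi>\<close>. The interval \<open>I\<close> may be of any kind, and the values of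
  \<open>\<phi>\<close> outside \<open>I\<close> carry no meaning.\<close>

definition filippov_solution ::
    "(real \<times> real \<Rightarrow> 'q) \<Rightarrow> 'q set \<Rightarrow> (real \<times> real \<Rightarrow> real \<times> real) \<Rightarrow>
     real set \<Rightarrow> (real \<Rightarrow> 'q) \<Rightarrow> bool" where
  "filippov_solution dev D W I \<phi> \<longleftrightarrow>
     is_interval I \<and>
     (\<forall>s\<in>I. \<exists>e>0. \<exists>\<psi>.
        locally_abs_continuous_on (I \<inter> ball s e) \<psi> \<and>
        (\<forall>t \<in> I \<inter> ball s e. \<phi> t = dev (\<psi> t)) \<and>
        (AE t in lborel. t \<in> I \<inter> ball s e \<longrightarrow>
           (\<exists>v \<in> filippov_set (dev -` D) W (\<psi> t).
              (\<psi> has_vector_derivative v) (at t within I \<inter> ball s e))))"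

definition maximal_solutions ::
    "(real \<times> real \<Rightarrow> 'q) \<Rightarrow> 'q set \<Rightarrow> (real \<times> real \<Rightarrow> real \<times> real) \<Rightarrow>
     'q \<Rightarrow> (real set \<times> (real \<Rightarrow> 'q)) set" where
  "maximal_solutions dev D W q =
     {(I, \<phi>). filippov_solution dev D W I \<phi> \<and> 0 \<in> I \<and> \<phi> 0 = q \<and>
        \<not> (\<exists>J \<psi>. filippov_solution dev D W J \<psi> \<and> I \<subset> J \<and> (\<forall>t\<in>I. \<psi> t = \<phi> t))}"

definition filippov_image ::
    "(real \<times> real \<Rightarrow> 'q) \<Rightarrow> 'q set \<Rightarrow> (real \<times> real \<Rightarrow> real \<times> real) \<Rightarrow>
     real \<Rightarrow> 'q set \<Rightarrow> 'q set" where
  "filippov_image dev D W t A =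
     (\<Union>q\<in>A. {\<phi> t | I \<phi>. (I, \<phi>) \<in> maximal_solutions dev D W q \<and> t \<in> I})"

text \<open>The flow is set-valued, so the image of a Borel set is only required to be measurable for the
  completed measure.\<close>

definition preserves_measure :: "(real \<Rightarrow> 'q set \<Rightarrow> 'q set) \<Rightarrow> 'q measure \<Rightarrow> bool" where
  "preserves_measure \<Phi> M \<longleftrightarrow>
     (\<forall>A \<in> sets M. \<forall>t. \<Phi> t A \<in> sets (completion M) \<and>
        emeasure (completion M) (\<Phi> t A) = emeasure M A)"

section \<open>Piecewise constant data on horizontal strips\<close>

text \<open>The index of the strip containing height \<open>y\<close>, for \<open>y \<in> [0, 1]\<close>; heights \<open>y = h i\<close> are assigned
  to the upper strip, which affects neither the Filippov solutions nor the measure.\<close>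

definition strip :: "nat \<Rightarrow> (nat \<Rightarrow> real) \<Rightarrow> real \<Rightarrow> nat" where
  "strip n h y = (if y < h 1 then n else Max {i \<in> {1..n-1}. h i \<le> y})"

definition strip_field ::
    "nat \<Rightarrow> (nat \<Rightarrow> real) \<Rightarrow> (nat \<Rightarrow> real) \<Rightarrow> (nat \<Rightarrow> real) \<Rightarrow> real \<times> real \<Rightarrow> real \<times> real" where
  "strip_field n h a b p = (a (strip n h (snd p)), b (strip n h (snd p)))"

definition strip_density ::
    "nat \<Rightarrow> (nat \<Rightarrow> real) \<Rightarrow> (nat \<Rightarrow> real) \<Rightarrow> real \<times> real \<Rightarrow> real" where
  "strip_density n h \<alpha> p = \<alpha> (strip n h (snd p))"

definition torus_disc :: "nat \<Rightarrow> (nat \<Rightarrow> real) \<Rightarrow> (real \<times> real) set set" where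
  "torus_disc n h = torus_pt ` (\<Union>i\<in>{1..n}. {0..1} \<times> {h i})"

definition klein_disc :: "nat \<Rightarrow> (nat \<Rightarrow> real) \<Rightarrow> (real \<times> real) set set" where
  "klein_disc n h = klein_pt ` ((\<Union>i\<in>{1..n}. {0..1} \<times> {h i}) \<union> {0} \<times> {0..1})"

definition torus_flow ::
    "nat \<Rightarrow> (nat \<Rightarrow> real) \<Rightarrow> (nat \<Rightarrow> real) \<Rightarrow> (nat \<Rightarrow> real) \<Rightarrow>
     real \<Rightarrow> (real \<times> real) set set \<Rightarrow> (real \<times> real) set set" where
  "torus_flow n h a b =
     filippov_image torus_dev (torus_disc n h) (torus_field (strip_field n h a b))"

definition klein_flow ::
    "nat \<Rightarrow> (nat \<Rightarrow> real) \<Rightarrow> (nat \<Rightarrow> real) \<Rightarrow> (nat \<Rightarrow> real) \<Rightarrow>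
     real \<Rightarrow> (real \<times> real) set set \<Rightarrow> (real \<times> real) set set" where
  "klein_flow n h a b =
     filippov_image klein_dev (klein_disc n h) (klein_field (strip_field n h a b))"

end

theory Submission
  imports Defs
begin

text \<open>Everything is read in the plane, through the developing map. Next to a line of discontinuity which
  the field crosses, the orbits are straightened by a piecewise linear change of coordinates in which
  the motion is a translation, and Lebesgue measure in these coordinates has density
  \<open>1 / \<bar>normal velocity\<bar>\<close> in the original ones. Hence \<open>f \<cdot> \<lambda>\<close> is preserved if and only if the
  flux \<open>f * \<bar>normal velocity\<bar>\<close> agrees on both sides of every crossed line. For the lines
  \<open>y = h i\<close> this says that \<open>\<alpha> i * b i\<close> does not depend on \<open>i\<close>; for the seam of the Klein bottle,
  that the slopes \<open>a / b\<close> on both sides agree (if they have opposite signs, the field slides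
  along the seam and maps a set of positive measure to a null set, in one direction of time).

  Conversely, solutions need not be unique at the points where several lines meet, and may turn
  around such a point arbitrarily often. But the field is then the Hamiltonian field, divided by
  the density, of a continuous function which is constant along all solutions; so the solutions through
  the countably many exceptional points stay in countably many level sets, which are null sets,
  and the other ones stay away from the exceptional points. It follows that the flow does not
  increase outer measure; applied to a set and to its complement, this gives
  measurability and invariance.\<close>

section \<open>Absolutely continuous curves and differential inclusions\<close>

text \<open>Images are estimated from above only, in outer measure, because the set reached by all
  solutions need not be measurable and has no explicit form where uniqueness fails. The matching
  lower bound comes from existence: through every point outside a null set runs a solution defined
  for all times, so the images of a set and of its complement cover almost the whole surface. The
  speed limit makes all solutions uniformly Lipschitz, which supplies the compactness behind uniform
  existence times.

  The delicate case is slope zero at the seam. Both fields are then parallel to it, and no curve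
  along the seam solves the smaller inclusion. Such a piece of the seam lies on a level of the first
  integral that contains an exceptional point, hence in a discarded null set.

  The symmetry hypotheses leave the middle height free. This does no harm, because one of the slope
  conditions equates the slopes of the two middle strips.\<close>

lemma lipschitz_imp_locally_abs_continuous:
  assumes "C-lipschitz_on S g"
  shows "locally_abs_continuous_on S g"
  unfolding locally_abs_continuous_on_def
proof (intro allI impI)
  fix c d \<epsilon> :: real assume S: "{c..d} \<subseteq> S" and e: "\<epsilon> > 0"
  have C: "C \<ge> 0" using assms lipschitz_on_nonneg by blast
  show "\<exists>\<delta>>0. \<forall>(m::nat) u v.
          (\<forall>i<m. c \<le> u i \<and> u i \<le> v i \<and> v i \<le> d) \<and>
          (\<forall>i<m. \<forall>j<m. i \<noteq> j \<longrightarrow> {u i<..<v i} \<inter> {u j<..<v j} = {}) \<and>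
          (\<Sum>i<m. v i - u i) < \<delta>
          \<longrightarrow> (\<Sum>i<m. dist (g (u i)) (g (v i))) < \<epsilon>"
  proof (intro exI[of _ "\<epsilon> / (C + 1)"] conjI allI impI; (elim conjE)?)
    show "0 < \<epsilon> / (C + 1)" using e C by simp
    fix m :: nat and u v :: "nat \<Rightarrow> real"
    assume uv: "\<forall>i<m. c \<le> u i \<and> u i \<le> v i \<and> v i \<le> d"
      and lt: "(\<Sum>i<m. v i - u i) < \<epsilon> / (C + 1)"
    have "(\<Sum>i<m. dist (g (u i)) (g (v i))) \<le> (\<Sum>i<m. (C + 1) * (v i - u i))"
    proof (rule sum_mono)
      fix i assume "i \<in> {..<m}"
      then have i: "c \<le> u i" "u i \<le> v i" "v i \<le> d" using uv by auto
      then have "u i \<in> S" "v i \<in> S" using S by auto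
      from lipschitz_onD[OF assms this] have "dist (g (u i)) (g (v i)) \<le> C * (v i - u i)"
        using i by (simp add: dist_real_def)
      also have "\<dots> \<le> (C + 1) * (v i - u i)" using i by (intro mult_right_mono) auto
      finally show "dist (g (u i)) (g (v i)) \<le> (C + 1) * (v i - u i)" .
    qed
    also have "\<dots> = (C + 1) * (\<Sum>i<m. v i - u i)" by (simp add: sum_distrib_left)
    also have "\<dots> < \<epsilon>" using lt C by (simp add: field_simps)
    finally show "(\<Sum>i<m. dist (g (u i)) (g (v i))) < \<epsilon>" .
  qed
qed

lemma locally_abs_continuous_on_subset:
  assumes ac: "locally_abs_continuous_on S g" and sub: "T \<subseteq> S"
  shows "locally_abs_continuous_on T g"
  unfolding locally_abs_continuous_on_def
proof (intro allI, rule impI)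
  fix c d :: real assume "{c..d} \<subseteq> T"
  then have "{c..d} \<subseteq> S" using sub by (rule subset_trans)
  then show "\<forall>\<epsilon>>0. \<exists>\<delta>>0. \<forall>(m::nat) u v.
          (\<forall>i<m. c \<le> u i \<and> u i \<le> v i \<and> v i \<le> d) \<and>
          (\<forall>i<m. \<forall>j<m. i \<noteq> j \<longrightarrow> {u i<..<v i} \<inter> {u j<..<v j} = {}) \<and>
          (\<Sum>i<m. v i - u i) < \<delta>
          \<longrightarrow> (\<Sum>i<m. dist (g (u i)) (g (v i))) < \<epsilon>"
    by (rule ac[unfolded locally_abs_continuous_on_def, THEN spec, THEN spec, THEN mp])
qed

text \<open>Intervals of a division overlap only in end points, so the total length of the chosen
  ones is the measure of a disjoint union of open intervals inside \<open>U\<close>.\<close>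

lemma sum_content_le_measure:
  fixes p :: "(real \<times> real set) set"
  assumes fin: "finite q" and p: "p tagged_division_of {c..d}" and q: "q \<subseteq> p"
    and sub: "\<And>x K. (x, K) \<in> q \<Longrightarrow> K \<subseteq> U" and U: "U \<in> sets lborel" "emeasure lborel U < ennreal \<delta>"
  shows "(\<Sum>(x,K)\<in>q. Sup K - Inf K) < \<delta>"
proof -
  have K: "\<exists>a b. K = {a..b} \<and> a \<le> b" if "(x, K) \<in> q" for x K
  proof -
    have "x \<in> K" "\<exists>a b. K = cbox a b" using tagged_division_ofD(2,4)[OF p, of x K] that q by auto
    then obtain a b where "K = {a..b}" by auto
    with \<open>x \<in> K\<close> show ?thesis by (intro exI[of _ a] exI[of _ b]) auto
  qed
  have SI: "K = {Inf K..Sup K}" "Inf K \<le> Sup K" if xK: "(x, K) \<in> q" for x K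
  proof -
    obtain a b where "K = {a..b}" "a \<le> b" using K[OF xK] by blast
    then show "K = {Inf K..Sup K}" "Inf K \<le> Sup K" by simp_all
  qed
  have dis: "disjoint_family_on (\<lambda>(x,K). {Inf K<..<Sup K}) q"
    unfolding disjoint_family_on_def
  proof (intro ballI impI)
    fix s t assume st: "s \<in> q" "t \<in> q" "s \<noteq> t"
    obtain x K y J where eq: "s = (x, K)" "t = (y, J)" by (cases s, cases t) auto
    have "interior K \<inter> interior J = {}"
      using tagged_division_ofD(5)[OF p, of x K y J] st eq q by auto
    moreover have "(x, K) \<in> q" "(y, J) \<in> q" using st eq by auto
    ultimately have "interior {Inf K..Sup K} \<inter> interior {Inf J..Sup J} = {}"
      using SI(1) by metis
    then show "(case s of (x,K) \<Rightarrow> {Inf K<..<Sup K}) \<inter> (case t of (x,K) \<Rightarrow> {Inf K<..<Sup K}) = {}"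
      by (simp add: eq interior_atLeastAtMost_real)
  qed
  have "ennreal (\<Sum>(x,K)\<in>q. Sup K - Inf K) = (\<Sum>s\<in>q. emeasure lborel (case s of (x,K) \<Rightarrow> {Inf K<..<Sup K}))"
    using SI(2) by (subst sum_ennreal[symmetric]) (auto intro!: sum.cong)
  also have "\<dots> = emeasure lborel (\<Union>s\<in>q. case s of (x,K) \<Rightarrow> {Inf K<..<Sup K})"
    using fin dis by (intro sum_emeasure) auto
  also have "\<dots> \<le> emeasure lborel U"
  proof (rule emeasure_mono[OF _ U(1)])
    show "(\<Union>s\<in>q. case s of (x,K) \<Rightarrow> {Inf K<..<Sup K}) \<subseteq> U"
    proof clarsimp
      fix y x K assume a: "(x, K) \<in> q" "Inf K < y" "y < Sup K"
      then have "y \<in> {Inf K..Sup K}" by simp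
      then have "y \<in> K" using SI(1)[OF a(1)] by blast
      then show "y \<in> U" using sub[OF a(1)] by auto
    qed
  qed
  also have "\<dots> < ennreal \<delta>" by fact
  finally have "ennreal (\<Sum>(x,K)\<in>q. Sup K - Inf K) < ennreal \<delta>" .
  moreover have "0 \<le> (\<Sum>(x,K)\<in>q. Sup K - Inf K)" using SI(2) by (intro sum_nonneg) auto
  ultimately show ?thesis by (simp add: ennreal_less_iff)
qed

text \<open>Absolute continuity is phrased for families indexed by an initial segment of the
  naturals; an enumeration of \<open>q\<close> transfers it to the intervals of a division.\<close>

lemma abs_continuous_sum_less:
  fixes g :: "real \<Rightarrow> 'a::metric_space"
  assumes p: "p tagged_division_of {c..d}" and q: "q \<subseteq> p" and fin: "finite q"
    and \<delta>: "\<And>(m::nat) u v.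
          (\<forall>i<m. c \<le> u i \<and> u i \<le> v i \<and> v i \<le> d) \<Longrightarrow>
          (\<forall>i<m. \<forall>j<m. i \<noteq> j \<longrightarrow> {u i<..<v i} \<inter> {u j<..<v j} = {}) \<Longrightarrow>
          (\<Sum>i<m. v i - u i) < \<delta>
          \<Longrightarrow> (\<Sum>i<m. dist (g (u i)) (g (v i))) < \<epsilon>"
    and len: "(\<Sum>(x,K)\<in>q. Sup K - Inf K) < \<delta>"
  shows "(\<Sum>(x,K)\<in>q. dist (g (Inf K)) (g (Sup K))) < \<epsilon>"
proof -
  obtain f where f: "bij_betw f {..<card q} q"
    using ex_bij_betw_nat_finite[OF fin] by (auto simp: atLeast0LessThan)
  define u v where "u i = Inf (snd (f i))" and "v i = Sup (snd (f i))" for i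
  have K: "\<exists>a b. K = {a..b} \<and> a \<le> b \<and> c \<le> a \<and> b \<le> d" if "(x, K) \<in> q" for x K
  proof -
    have "(x, K) \<in> p" using that q by auto
    note tagged_division_ofD(2,3,4)[OF p this]
    then have "x \<in> K" "K \<subseteq> {c..d}" "\<exists>a b. K = cbox a b" by simp_all
    then obtain a b where "K = {a..b}" by auto
    moreover then have "a \<le> b" using \<open>x \<in> K\<close> by auto
    ultimately show ?thesis using \<open>K \<subseteq> {c..d}\<close> by auto
  qed
  have fi: "f i \<in> q" if "i < card q" for i using f that by (auto simp: bij_betw_def)
  have uv: "snd (f i) = {u i..v i} \<and> c \<le> u i \<and> u i \<le> v i \<and> v i \<le> d" if i: "i < card q" for i
  proof -
    obtain a b where "snd (f i) = {a..b}" "a \<le> b" "c \<le> a" "b \<le> d"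
      using K[of "fst (f i)" "snd (f i)"] fi[OF i] by auto
    then show ?thesis unfolding u_def v_def by simp
  qed
  have "(\<Sum>i<card q. dist (g (u i)) (g (v i))) < \<epsilon>"
  proof (rule \<delta>)
    show "\<forall>i<card q. c \<le> u i \<and> u i \<le> v i \<and> v i \<le> d" using uv by auto
    show "\<forall>i<card q. \<forall>j<card q. i \<noteq> j \<longrightarrow> {u i<..<v i} \<inter> {u j<..<v j} = {}"
    proof (intro allI impI)
      fix i j assume ij: "i < card q" "j < card q" "i \<noteq> j"
      then have "f i \<noteq> f j" using f by (auto simp: bij_betw_def inj_on_def)
      then have "interior (snd (f i)) \<inter> interior (snd (f j)) = {}"
        using tagged_division_ofD(5)[OF p, of "fst (f i)" "snd (f i)" "fst (f j)" "snd (f j)"]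
          fi[OF ij(1)] fi[OF ij(2)] q by auto
      then show "{u i<..<v i} \<inter> {u j<..<v j} = {}"
        using uv[OF ij(1)] uv[OF ij(2)] by (simp add: interior_atLeastAtMost_real)
    qed
    have "(\<Sum>i<card q. v i - u i) = (\<Sum>(x,K)\<in>q. Sup K - Inf K)"
      unfolding u_def v_def by (subst sum.reindex_bij_betw[OF f, symmetric]) (simp add: split_beta)
    then show "(\<Sum>i<card q. v i - u i) < \<delta>" using len by simp
  qed
  also have "(\<Sum>i<card q. dist (g (u i)) (g (v i))) = (\<Sum>(x,K)\<in>q. dist (g (Inf K)) (g (Sup K)))"
    unfolding u_def v_def by (subst sum.reindex_bij_betw[OF f, symmetric]) (simp add: split_beta)
  finally show ?thesis .
qed

text \<open>A gauge is chosen so that the tags in the exceptional null set only carry intervals of small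
  total length, where absolute continuity applies, and the other tags control the increment of
  \<open>g\<close> by the derivative.\<close>

lemma abs_continuous_dist_bound:
  fixes g :: "real \<Rightarrow> 'a::real_normed_vector"
  assumes cd: "c \<le> d" and ac: "locally_abs_continuous_on {c..d} g"
    and der: "AE t in lborel. t \<in> {c..d} \<longrightarrow>
      (\<exists>v. norm v \<le> L \<and> (g has_vector_derivative v) (at t within {c..d}))"
  shows "dist (g c) (g d) \<le> L * (d - c)"
proof (rule field_le_epsilon)
  fix e :: real assume "0 < e"
  \<comment> \<open>The tags in \<open>N\<close> cost \<open>\<epsilon>\<close> and the others
    \<open>\<epsilon> * (d - c)\<close>, together at most \<open>e\<close>; the denominator is
    positive even for \<open>c = d\<close>.\<close>
  define \<epsilon> where "\<epsilon> = e / (d - c + 2)"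
  have \<epsilon>: "\<epsilon> > 0" using \<open>0 < e\<close> cd by (simp add: \<epsilon>_def)
  obtain \<delta> where \<delta>: "\<delta> > 0" "\<And>(m::nat) u v.
          (\<forall>i<m. c \<le> u i \<and> u i \<le> v i \<and> v i \<le> d) \<Longrightarrow>
          (\<forall>i<m. \<forall>j<m. i \<noteq> j \<longrightarrow> {u i<..<v i} \<inter> {u j<..<v j} = {}) \<Longrightarrow>
          (\<Sum>i<m. v i - u i) < \<delta>
          \<Longrightarrow> (\<Sum>i<m. dist (g (u i)) (g (v i))) < \<epsilon>"
    using ac[unfolded locally_abs_continuous_on_def, rule_format, of c d \<epsilon>] \<epsilon> by auto
  obtain N where N: "N \<in> null_sets lborel"
    "{t. \<not> (t \<in> {c..d} \<longrightarrow> (\<exists>v. norm v \<le> L \<and> (g has_vector_derivative v) (at t within {c..d})))} \<subseteq> N"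
    using der by (auto elim!: AE_E simp: null_sets_def)
  obtain U where U: "open U" "N \<subseteq> U" "emeasure lborel (U - N) < ennreal \<delta>"
    using outer_regular_lborel[of N \<delta>] N \<delta>(1) by (auto simp: null_sets_def)
  have U\<delta>: "emeasure lborel U < ennreal \<delta>"
    using U N emeasure_Diff_null_set[OF N(1), of U] by simp
  have "\<exists>r>0. (t \<in> N \<longrightarrow> ball t r \<subseteq> U) \<and> (t \<in> {c..d} - N \<longrightarrow>
         (\<forall>s\<in>{c..d}. \<bar>s - t\<bar> < r \<longrightarrow> norm (g s - g t) \<le> (L + \<epsilon>) * \<bar>s - t\<bar>))" for t
  proof (cases "t \<in> N")
    case True
    then show ?thesis using U by (metis DiffD2 open_contains_ball subsetD)
  next
    case False
    show ?thesis
    proof (cases "t \<in> {c..d}")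
      case True
      then obtain v where v: "norm v \<le> L" "(g has_vector_derivative v) (at t within {c..d})"
        using N False by auto
      then obtain r where r: "r > 0" "\<And>s. s \<in> {c..d} \<Longrightarrow> norm (s - t) < r \<Longrightarrow>
          norm (g s - g t - (s - t) *\<^sub>R v) \<le> \<epsilon> * norm (s - t)"
        unfolding has_vector_derivative_def has_derivative_within_alt using \<epsilon> by blast
      have "norm (g s - g t) \<le> (L + \<epsilon>) * \<bar>s - t\<bar>" if s: "s \<in> {c..d}" "\<bar>s - t\<bar> < r" for s
      proof -
        have "norm (g s - g t) \<le> norm (g s - g t - (s - t) *\<^sub>R v) + norm ((s - t) *\<^sub>R v)"
          by (metis diff_add_cancel norm_triangle_ineq)
        also have "\<dots> \<le> \<epsilon> * \<bar>s - t\<bar> + \<bar>s - t\<bar> * L"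
          using r(2)[of s] s v(1) by (intro add_mono) (auto intro: mult_left_mono)
        finally show ?thesis by (simp add: algebra_simps)
      qed
      then show ?thesis using r(1) False by blast
    next
      case f: False
      then show ?thesis using False by (intro exI[of _ 1]) auto
    qed
  qed
  then obtain r where r: "\<And>t. r t > 0" "\<And>t. t \<in> N \<Longrightarrow> ball t (r t) \<subseteq> U"
    "\<And>t s. t \<in> {c..d} - N \<Longrightarrow> s \<in> {c..d} \<Longrightarrow> \<bar>s - t\<bar> < r t \<Longrightarrow> norm (g s - g t) \<le> (L + \<epsilon>) * \<bar>s - t\<bar>"
    by metis
  have "gauge (\<lambda>t. ball t (r t))" using r(1) by (simp add: gauge_ball_dependent)
  then obtain p where p: "p tagged_division_of {c..d}" "(\<lambda>t. ball t (r t)) fine p"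
    using fine_division_exists_real[of "\<lambda>t. ball t (r t)" c d] by blast
  define q where "q = {(x, K) \<in> p. x \<in> N}"
  have finp: "finite p" using p(1) by blast
  have qp: "q \<subseteq> p" by (auto simp: q_def)
  have finq: "finite q" using finp qp finite_subset by blast
  have D: "(\<Sum>(x,K)\<in>q. dist (g (Inf K)) (g (Sup K))) < \<epsilon>"
  proof (rule abs_continuous_sum_less[OF p(1) qp finq \<delta>(2)], assumption+)
    show "(\<Sum>(x,K)\<in>q. Sup K - Inf K) < \<delta>"
    proof (rule sum_content_le_measure[OF finq p(1) qp _ _ U\<delta>])
      show "K \<subseteq> U" if "(x, K) \<in> q" for x K
      proof -
        have "(x, K) \<in> p" "x \<in> N" using that by (auto simp: q_def)
        then have "K \<subseteq> ball x (r x)" "ball x (r x) \<subseteq> U" using p(2) r(2) by (auto simp: fine_def)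
        then show ?thesis by (rule subset_trans)
      qed
    qed (use U in auto)
  qed
  have R: "(\<Sum>(x,K)\<in>p - q. dist (g (Inf K)) (g (Sup K))) \<le> (\<Sum>(x,K)\<in>p - q. (L + \<epsilon>) * (Sup K - Inf K))"
  proof (intro sum_mono, clarify)
    fix x K assume xK: "(x, K) \<in> p" "(x, K) \<notin> q"
    have x: "x \<in> K" "K \<subseteq> {c..d}" "\<exists>a b. K = cbox a b" "K \<subseteq> ball x (r x)"
      using tagged_division_ofD(2,3,4)[OF p(1) xK(1)] p(2) xK(1) by (auto simp: fine_def)
    then obtain a b where K: "K = {a..b}" "a \<le> x" "x \<le> b" by auto
    have "a \<in> K" "b \<in> K" using K by auto
    then have "a \<in> {c..d}" "b \<in> {c..d}" "a \<in> ball x (r x)" "b \<in> ball x (r x)" using x by auto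
    moreover have "x \<in> {c..d} - N" using x xK by (auto simp: q_def)
    ultimately have "norm (g a - g x) \<le> (L + \<epsilon>) * (x - a)" "norm (g b - g x) \<le> (L + \<epsilon>) * (b - x)"
      using r(3)[of x a] r(3)[of x b] K by (auto simp: dist_real_def)
    then have "dist (g a) (g b) \<le> (L + \<epsilon>) * (b - a)"
      using dist_triangle[of "g a" "g b" "g x"] by (simp add: dist_norm norm_minus_commute algebra_simps)
    then show "dist (g (Inf K)) (g (Sup K)) \<le> (L + \<epsilon>) * (Sup K - Inf K)" using K by simp
  qed
  \<comment> \<open>No sign is assumed for \<open>L\<close>. If \<open>L + \<epsilon> < 0\<close>,
    no vector satisfies the norm bound, so all of \<open>{c..d}\<close> lies in the null set
    \<open>N\<close>.\<close>
  have L\<epsilon>: "0 \<le> L + \<epsilon> \<or> c = d"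
  proof (rule ccontr)
    assume a: "\<not> (0 \<le> L + \<epsilon> \<or> c = d)"
    have "emeasure lborel {c..d} = 0"
    proof -
      have "{c..d} \<subseteq> N"
      proof
        fix t assume "t \<in> {c..d}"
        moreover have "\<not> norm v \<le> L" for v :: 'a using norm_ge_zero[of v] a \<epsilon> by linarith
        ultimately show "t \<in> N" using N(2) by blast
      qed
      then show ?thesis using N(1) by (meson emeasure_eq_0 null_setsD1 null_setsD2)
    qed
    then show False using a cd by simp
  qed
  have "dist (g c) (g d) = norm (\<Sum>(x,K)\<in>p. g (Sup K) - g (Inf K))"
    using additive_tagged_division_1[OF cd p(1), of g] by (simp add: dist_norm norm_minus_commute)
  also have "\<dots> \<le> (\<Sum>(x,K)\<in>p. dist (g (Inf K)) (g (Sup K)))"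
    by (intro order_trans[OF norm_sum] sum_mono) (auto simp: dist_norm norm_minus_commute)
  also have "\<dots> = (\<Sum>(x,K)\<in>q. dist (g (Inf K)) (g (Sup K))) + (\<Sum>(x,K)\<in>p - q. dist (g (Inf K)) (g (Sup K)))"
    using sum.subset_diff[OF qp finp] by (simp add: add.commute)
  also have "\<dots> \<le> \<epsilon> + (\<Sum>(x,K)\<in>p - q. (L + \<epsilon>) * (Sup K - Inf K))" using D R by linarith
  also have "\<dots> \<le> \<epsilon> + (L + \<epsilon>) * (d - c)"
  proof -
    have le: "Inf K \<le> Sup K" if "(x, K) \<in> p" for x K
    proof -
      have "x \<in> K" "\<exists>a b. K = cbox a b" using tagged_division_ofD(2,4)[OF p(1) that] by auto
      then obtain a b where "K = {a..b}" "a \<le> b" by auto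
      then show ?thesis by simp
    qed
    have "(\<Sum>(x,K)\<in>p - q. Sup K - Inf K) \<le> (\<Sum>(x,K)\<in>p. Sup K - Inf K)"
      using le by (intro sum_mono2[OF finp]) auto
    also have "\<dots> = d - c" using additive_tagged_division_1[OF cd p(1), of "\<lambda>x. x"] by simp
    finally have *: "(\<Sum>(x,K)\<in>p - q. Sup K - Inf K) \<le> d - c" .
    have "(\<Sum>(x,K)\<in>p - q. (L + \<epsilon>) * (Sup K - Inf K)) = (L + \<epsilon>) * (\<Sum>(x,K)\<in>p - q. Sup K - Inf K)"
      by (simp add: sum_distrib_left split_beta)
    moreover have "(\<Sum>(x,K)\<in>p - q. Sup K - Inf K) \<ge> 0" by (rule sum_nonneg) (use le in auto)
    moreover have "(L + \<epsilon>) * (\<Sum>(x,K)\<in>p - q. Sup K - Inf K) \<le> (L + \<epsilon>) * (d - c)"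
      if "c \<noteq> d" using * L\<epsilon> that by (intro mult_left_mono) auto
    moreover have "(\<Sum>(x,K)\<in>p - q. Sup K - Inf K) = 0" if "c = d"
      using * that calculation(2) by linarith
    ultimately show ?thesis by (cases "c = d") simp_all
  qed
  also have "\<dots> \<le> L * (d - c) + e"
  proof -
    have "\<epsilon> * (d - c + 2) = e" using cd by (simp add: \<epsilon>_def)
    then have "\<epsilon> + \<epsilon> * (d - c) \<le> e" using \<epsilon> by (simp add: algebra_simps)
    then show ?thesis by (simp add: algebra_simps)
  qed
  finally show "dist (g c) (g d) \<le> L * (d - c) + e" .
qed

lemma lipschitz_AE_dist_bound:
  fixes g :: "real \<Rightarrow> 'a::real_normed_vector"
  assumes "c \<le> d" and "C-lipschitz_on {c..d} g"
    and "AE t in lborel. t \<in> {c..d} \<longrightarrow>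
      (\<exists>v. norm v \<le> L \<and> (g has_vector_derivative v) (at t within {c..d}))"
  shows "dist (g c) (g d) \<le> L * (d - c)"
  using assms by (intro abs_continuous_dist_bound lipschitz_imp_locally_abs_continuous)

lemma lipschitz_on_diff_linear:
  fixes g :: "real \<Rightarrow> 'a::real_normed_vector"
  assumes "C-lipschitz_on S g"
  shows "(C + norm m)-lipschitz_on S (\<lambda>t. g t - t *\<^sub>R m)"
proof (rule lipschitz_onI)
  fix s t assume st: "s \<in> S" "t \<in> S"
  have "dist (g s - s *\<^sub>R m) (g t - t *\<^sub>R m) = norm ((g s - g t) - (s - t) *\<^sub>R m)"
    by (simp add: dist_norm algebra_simps)
  also have "\<dots> \<le> norm (g s - g t) + norm ((s - t) *\<^sub>R m)" by (rule norm_triangle_ineq4)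
  also have "\<dots> \<le> C * \<bar>s - t\<bar> + \<bar>s - t\<bar> * norm m"
    using lipschitz_onD[OF assms st] by (simp add: dist_norm)
  finally show "dist (g s - s *\<^sub>R m) (g t - t *\<^sub>R m) \<le> (C + norm m) * dist s t"
    by (simp add: dist_real_def algebra_simps)
qed (use lipschitz_on_nonneg[OF assms] in simp)

text \<open>Subtracting the linear function with slope \<open>m\<close> leaves a curve with
  derivative zero almost everywhere, which is constant by the distance bound with
  \<open>L = 0\<close>.\<close>

lemma lipschitz_AE_affine:
  fixes g :: "real \<Rightarrow> 'a::real_normed_vector"
  assumes lip: "C-lipschitz_on {c..d} g"
    and der: "AE t in lborel. t \<in> {c..d} \<longrightarrow> (g has_vector_derivative m) (at t within {c..d})"
    and "t0 \<in> {c..d}" "t1 \<in> {c..d}"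
  shows "g t1 = g t0 + (t1 - t0) *\<^sub>R m"
proof -
  have *: "g b = g a + (b - a) *\<^sub>R m" if ab: "a \<le> b" "a \<in> {c..d}" "b \<in> {c..d}" for a b
  proof -
    have sub: "{a..b} \<subseteq> {c..d}" using ab by auto
    have "dist (g a - a *\<^sub>R m) (g b - b *\<^sub>R m) \<le> 0 * (b - a)"
    proof (rule lipschitz_AE_dist_bound[OF ab(1)])
      show "(C + norm m)-lipschitz_on {a..b} (\<lambda>t. g t - t *\<^sub>R m)"
        by (rule lipschitz_on_diff_linear[OF lipschitz_on_subset[OF lip sub]])
      show "AE t in lborel. t \<in> {a..b} \<longrightarrow>
        (\<exists>v. norm v \<le> 0 \<and> ((\<lambda>t. g t - t *\<^sub>R m) has_vector_derivative v) (at t within {a..b}))"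
        using der
      proof eventually_elim
        case (elim t)
        show ?case
        proof
          assume t: "t \<in> {a..b}"
          then have "(g has_vector_derivative m) (at t within {a..b})"
            using elim sub has_vector_derivative_within_subset by blast
          then have "((\<lambda>t. g t - t *\<^sub>R m) has_vector_derivative m - m) (at t within {a..b})"
            by (intro derivative_eq_intros) auto
          then show "\<exists>v. norm v \<le> 0 \<and> ((\<lambda>t. g t - t *\<^sub>R m) has_vector_derivative v) (at t within {a..b})"
            by auto
        qed
      qed
    qed
    then show ?thesis by (simp add: algebra_simps)
  qed
  show ?thesis
  proof (cases "t0 \<le> t1")
    case True then show ?thesis using *[of t0 t1] assms by simp
  next
    case False then show ?thesis using *[of t1 t0] assms by (simp add: algebra_simps)
  qed
qed

text \<open>The distance bound is symmetric, so the slope \<open>k\<close> midway between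
  \<open>m\<close> and \<open>M\<close> is subtracted first. The remaining derivative is at most
  \<open>(M - m) / 2\<close> in norm, and one half of the resulting two-sided estimate is the
  claim.\<close>

lemma lipschitz_AE_lower_bound:
  fixes g :: "real \<Rightarrow> real"
  assumes ab: "a \<le> b" and sub: "{a..b} \<subseteq> S" and lip: "C-lipschitz_on S g"
    and der: "AE t in lborel. t \<in> S \<longrightarrow>
      (\<exists>v. m \<le> v \<and> v \<le> M \<and> (g has_vector_derivative v) (at t within S))"
  shows "g b - g a \<ge> m * (b - a)"
proof -
  define k where "k = (m + M) / 2"
  have "dist (g a - a *\<^sub>R k) (g b - b *\<^sub>R k) \<le> ((M - m) / 2) * (b - a)"
  proof (rule lipschitz_AE_dist_bound[OF ab])
    show "(C + norm k)-lipschitz_on {a..b} (\<lambda>t. g t - t *\<^sub>R k)"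
      by (rule lipschitz_on_diff_linear[OF lipschitz_on_subset[OF lip sub]])
    show "AE t in lborel. t \<in> {a..b} \<longrightarrow>
      (\<exists>v. norm v \<le> (M - m) / 2 \<and> ((\<lambda>t. g t - t *\<^sub>R k) has_vector_derivative v) (at t within {a..b}))"
      using der
    proof eventually_elim
      case (elim t)
      show ?case
      proof
        assume t: "t \<in> {a..b}"
        then obtain v where v: "m \<le> v" "v \<le> M" "(g has_vector_derivative v) (at t within {a..b})"
          using elim sub has_vector_derivative_within_subset by blast
        then have "((\<lambda>t. g t - t *\<^sub>R k) has_vector_derivative v - k) (at t within {a..b})"
          by (intro derivative_eq_intros) auto
        moreover have "norm (v - k) \<le> (M - m) / 2"
          using v by (simp add: k_def field_simps abs_le_iff)
        ultimately show "\<exists>v. norm v \<le> (M - m) / 2 \<and> ((\<lambda>t. g t - t *\<^sub>R k) has_vector_derivative v) (at t within {a..b})"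
          by blast
      qed
    qed
  qed
  then have "\<bar>(g a - a * k) - (g b - b * k)\<bar> \<le> ((M - m) / 2) * (b - a)" by (simp add: dist_real_def)
  then show ?thesis by (simp add: k_def field_simps abs_le_iff)
qed

text \<open>A fixed Lipschitz constant takes the place of absolute continuity: it survives
  restriction and gluing unchanged and bounds how far any solution travels in a given time.\<close>

definition inclusion_solution ::
    "real \<Rightarrow> (real \<times> real \<Rightarrow> (real \<times> real) set) \<Rightarrow> real set \<Rightarrow> (real \<Rightarrow> real \<times> real) \<Rightarrow> bool" where
  "inclusion_solution L V I \<psi> \<longleftrightarrow> L-lipschitz_on I \<psi> \<and>
     (AE t in lborel. t \<in> I \<longrightarrow> (\<exists>v\<in>V (\<psi> t). (\<psi> has_vector_derivative v) (at t within I)))"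

lemma inclusion_solution_subset:
  assumes "inclusion_solution L V I \<psi>" "J \<subseteq> I"
  shows "inclusion_solution L V J \<psi>"
  unfolding inclusion_solution_def
proof
  show "L-lipschitz_on J \<psi>" using assms lipschitz_on_subset by (auto simp: inclusion_solution_def)
  have "AE t in lborel. t \<in> I \<longrightarrow> (\<exists>v\<in>V (\<psi> t). (\<psi> has_vector_derivative v) (at t within I))"
    using assms by (auto simp: inclusion_solution_def)
  then show "AE t in lborel. t \<in> J \<longrightarrow> (\<exists>v\<in>V (\<psi> t). (\<psi> has_vector_derivative v) (at t within J))"
    by eventually_elim (use assms(2) has_vector_derivative_within_subset in blast)
qed

lemma inclusion_solution_mono:
  assumes "inclusion_solution L V I \<psi>" "\<And>p. V p \<subseteq> V' p"
  shows "inclusion_solution L V' I \<psi>"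
  unfolding inclusion_solution_def
proof
  have "AE t in lborel. t \<in> I \<longrightarrow> (\<exists>v\<in>V (\<psi> t). (\<psi> has_vector_derivative v) (at t within I))"
    using assms by (auto simp: inclusion_solution_def)
  then show "AE t in lborel. t \<in> I \<longrightarrow> (\<exists>v\<in>V' (\<psi> t). (\<psi> has_vector_derivative v) (at t within I))"
    by eventually_elim (use assms(2) in blast)
qed (use assms in \<open>auto simp: inclusion_solution_def\<close>)

lemma inclusion_solution_cong:
  assumes "inclusion_solution L V I \<psi>" "\<And>t. t \<in> I \<Longrightarrow> \<psi> t = \<phi> t"
  shows "inclusion_solution L V I \<phi>"
  unfolding inclusion_solution_def
proof
  have "L-lipschitz_on I \<psi>" using assms by (auto simp: inclusion_solution_def)
  then show "L-lipschitz_on I \<phi>" using assms(2) by (simp add: lipschitz_on_def)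
  have "AE t in lborel. t \<in> I \<longrightarrow> (\<exists>v\<in>V (\<psi> t). (\<psi> has_vector_derivative v) (at t within I))"
    using assms by (auto simp: inclusion_solution_def)
  then show "AE t in lborel. t \<in> I \<longrightarrow> (\<exists>v\<in>V (\<phi> t). (\<phi> has_vector_derivative v) (at t within I))"
  proof eventually_elim
    case (elim t)
    show ?case
    proof
      assume t: "t \<in> I"
      then obtain v where "v \<in> V (\<psi> t)" "(\<psi> has_vector_derivative v) (at t within I)" using elim by auto
      then have "(\<phi> has_vector_derivative v) (at t within I)"
        using has_vector_derivative_transform[OF t, of \<phi> \<psi>] assms(2) by auto
      with \<open>v \<in> V (\<psi> t)\<close> show "\<exists>v\<in>V (\<phi> t). (\<phi> has_vector_derivative v) (at t within I)"
        using assms(2)[OF t] by auto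
    qed
  qed
qed

lemma inclusion_solution_glue:
  assumes 1: "inclusion_solution L V {a..b} \<psi>" and 2: "inclusion_solution L V {b..c} \<psi>"
    and "a \<le> b" "b \<le> c"
  shows "inclusion_solution L V {a..c} \<psi>"
  unfolding inclusion_solution_def
proof
  have "L-lipschitz_on {a..b} \<psi>" "L-lipschitz_on {b..c} \<psi>"
    using assms by (auto simp: inclusion_solution_def)
  then show "L-lipschitz_on {a..c} \<psi>"
    using lipschitz_on_concat[of L a b \<psi> c \<psi>] by (simp cong: if_cong)
  have "AE t in lborel. t \<in> {a..b} \<longrightarrow> (\<exists>v\<in>V (\<psi> t). (\<psi> has_vector_derivative v) (at t within {a..b}))"
    "AE t in lborel. t \<in> {b..c} \<longrightarrow> (\<exists>v\<in>V (\<psi> t). (\<psi> has_vector_derivative v) (at t within {b..c}))"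
    using assms by (auto simp: inclusion_solution_def)
  \<comment> \<open>Away from these three times the derivative within either interval is two-sided,
    so it is also the derivative within the union.\<close>
  moreover have "AE t in lborel. t \<notin> {a, b, c}"
    by (rule AE_not_in) (intro finite_imp_null_set_lborel, simp)
  ultimately show "AE t in lborel. t \<in> {a..c} \<longrightarrow> (\<exists>v\<in>V (\<psi> t). (\<psi> has_vector_derivative v) (at t within {a..c}))"
  proof eventually_elim
    case (elim t)
    show ?case
    proof
      assume t: "t \<in> {a..c}"
      consider "t \<in> {a<..<b}" | "t \<in> {b<..<c}" using t elim(3) by fastforce
      then obtain v where "v \<in> V (\<psi> t)" "(\<psi> has_vector_derivative v) (at t)"
      proof cases
        case 1
        then have "t \<in> {a..b}" "t \<in> interior {a..b}" by (auto simp: interior_atLeastAtMost_real)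
        then show ?thesis using that elim(1) at_within_interior[of t "{a..b}"] by auto
      next
        case 2
        then have "t \<in> {b..c}" "t \<in> interior {b..c}" by (auto simp: interior_atLeastAtMost_real)
        then show ?thesis using that elim(2) at_within_interior[of t "{b..c}"] by auto
      qed
      then show "\<exists>v\<in>V (\<psi> t). (\<psi> has_vector_derivative v) (at t within {a..c})"
        using has_vector_derivative_at_within by blast
    qed
  qed
qed

text \<open>The bridge from absolutely continuous solutions to uniformly Lipschitz ones: the
  velocities in \<open>V\<close> are bounded by \<open>L\<close>, so the distance bound applies on
  every subinterval.\<close>

lemma abs_continuous_inclusion_solution:
  assumes ac: "locally_abs_continuous_on {c..d} \<psi>" and V: "\<And>p v. v \<in> V p \<Longrightarrow> norm v \<le> L" "0 \<le> L"
    and der: "AE t in lborel. t \<in> {c..d} \<longrightarrow> (\<exists>v\<in>V (\<psi> t). (\<psi> has_vector_derivative v) (at t within {c..d}))"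
  shows "inclusion_solution L V {c..d} \<psi>"
  unfolding inclusion_solution_def
proof
  have *: "dist (\<psi> a) (\<psi> b) \<le> L * (b - a)" if ab: "a \<le> b" "a \<in> {c..d}" "b \<in> {c..d}" for a b
  proof (rule abs_continuous_dist_bound[OF ab(1)])
    have sub: "{a..b} \<subseteq> {c..d}" using ab by auto
    show "locally_abs_continuous_on {a..b} \<psi>"
      by (rule locally_abs_continuous_on_subset[OF ac sub])
    show "AE t in lborel. t \<in> {a..b} \<longrightarrow>
        (\<exists>v. norm v \<le> L \<and> (\<psi> has_vector_derivative v) (at t within {a..b}))"
      using der
    proof eventually_elim
      case (elim t)
      show ?case
      proof
        assume "t \<in> {a..b}"
        then obtain v where v: "v \<in> V (\<psi> t)" "(\<psi> has_vector_derivative v) (at t within {c..d})"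
          using elim sub by auto
        then show "\<exists>v. norm v \<le> L \<and> (\<psi> has_vector_derivative v) (at t within {a..b})"
          using V(1)[OF v(1)] has_vector_derivative_within_subset[OF v(2) sub] by blast
      qed
    qed
  qed
  show "L-lipschitz_on {c..d} \<psi>"
  proof (rule lipschitz_onI)
    fix s t assume "s \<in> {c..d}" "t \<in> {c..d}"
    then show "dist (\<psi> s) (\<psi> t) \<le> L * dist s t"
      using *[of s t] *[of t s] by (cases "s \<le> t") (auto simp: dist_real_def dist_commute)
  qed fact
qed fact

section \<open>Straightening a field across a line\<close>

definition kink :: "real \<Rightarrow> real \<Rightarrow> real \<Rightarrow> real \<Rightarrow> real" where
  "kink \<eta> p q y = (if y \<le> \<eta> then p * (y - \<eta>) else q * (y - \<eta>))"

lemma kink_measurable[measurable]: "kink \<eta> p q \<in> borel_measurable borel"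
  unfolding kink_def[abs_def] by measurable

lemma kink_lipschitz: "\<bar>kink \<eta> p q y - kink \<eta> p q z\<bar> \<le> (\<bar>p\<bar> + \<bar>q\<bar>) * \<bar>y - z\<bar>"
proof -
  have *: "\<bar>kink \<eta> p q y - kink \<eta> p q z\<bar> \<le> (\<bar>p\<bar> + \<bar>q\<bar>) * (z - y)" if "y \<le> z" for y z
  proof -
    consider "z \<le> \<eta>" | "\<eta> < y" | "y \<le> \<eta>" "\<eta> < z" by linarith
    then show ?thesis
    proof cases
      case 1
      then have "kink \<eta> p q y - kink \<eta> p q z = p * (y - z)"
        using that by (simp add: kink_def algebra_simps)
      then have "\<bar>kink \<eta> p q y - kink \<eta> p q z\<bar> = \<bar>p\<bar> * (z - y)"
        using that by (simp add: abs_mult)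
      also have "\<dots> \<le> (\<bar>p\<bar> + \<bar>q\<bar>) * (z - y)" using that by (intro mult_right_mono) auto
      finally show ?thesis .
    next
      case 2
      then have "kink \<eta> p q y - kink \<eta> p q z = q * (y - z)"
        using that by (simp add: kink_def algebra_simps)
      then have "\<bar>kink \<eta> p q y - kink \<eta> p q z\<bar> = \<bar>q\<bar> * (z - y)"
        using that by (simp add: abs_mult)
      also have "\<dots> \<le> (\<bar>p\<bar> + \<bar>q\<bar>) * (z - y)" using that by (intro mult_right_mono) auto
      finally show ?thesis .
    next
      case 3
      then have "\<bar>kink \<eta> p q y - kink \<eta> p q z\<bar> \<le> \<bar>p * (y - \<eta>)\<bar> + \<bar>q * (z - \<eta>)\<bar>"
        by (simp add: kink_def)
      also have "\<dots> = \<bar>p\<bar> * (\<eta> - y) + \<bar>q\<bar> * (z - \<eta>)" using 3 by (simp add: abs_mult)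
      also have "\<dots> \<le> \<bar>p\<bar> * (z - y) + \<bar>q\<bar> * (z - y)" using 3 by (intro add_mono mult_left_mono) auto
      finally show ?thesis by (simp add: algebra_simps)
    qed
  qed
  show ?thesis using *[of y z] *[of z y] by (cases "y \<le> z") (auto simp: abs_minus_commute)
qed

lemma kink_has_derivative:
  assumes "y \<noteq> \<eta>"
  shows "(kink \<eta> p q has_real_derivative (if y < \<eta> then p else q)) (at y)"
proof (cases "y < \<eta>")
  case True
  have "((\<lambda>y. p * (y - \<eta>)) has_real_derivative p) (at y)" by (auto intro!: derivative_eq_intros)
  moreover have "eventually (\<lambda>y. p * (y - \<eta>) = kink \<eta> p q y) (nhds y)"
    by (rule eventually_mono[OF eventually_nhds_in_open[OF open_lessThan, of y \<eta>]])
      (use True in \<open>auto simp: kink_def\<close>)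
  ultimately show ?thesis using True DERIV_cong_ev[OF refl _ refl] by fastforce
next
  case False
  have "((\<lambda>y. q * (y - \<eta>)) has_real_derivative q) (at y)" by (auto intro!: derivative_eq_intros)
  moreover have "eventually (\<lambda>y. q * (y - \<eta>) = kink \<eta> p q y) (nhds y)"
    by (rule eventually_mono[OF eventually_nhds_in_open[OF open_greaterThan, of y \<eta>]])
      (use False assms in \<open>auto simp: kink_def\<close>)
  ultimately show ?thesis using False DERIV_cong_ev[OF refl _ refl] by fastforce
qed

text \<open>Substitution on each half line separately: with positive slopes, \<open>kink\<close>
  maps the half lines below and above \<open>\<eta>\<close> affinely onto those below and above
  0.\<close>

lemma nn_integral_kink:
  fixes h :: "real \<Rightarrow> ennreal"
  assumes [measurable]: "h \<in> borel_measurable borel" and pq: "p > 0" "q > 0"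
  shows "(\<integral>\<^sup>+y. h (kink \<eta> p q y) * ennreal (if y \<le> \<eta> then p else q) \<partial>lborel) = (\<integral>\<^sup>+y. h y \<partial>lborel)"
proof -
  have "(\<integral>\<^sup>+y. h y \<partial>lborel) = (\<integral>\<^sup>+y. h y * indicator {..0} y + h y * indicator {0<..} y \<partial>lborel)"
    by (intro nn_integral_cong) (auto simp: indicator_def)
  also have "\<dots> = (\<integral>\<^sup>+y. h y * indicator {..0} y \<partial>lborel) + (\<integral>\<^sup>+y. h y * indicator {0<..} y \<partial>lborel)"
    by (rule nn_integral_add) measurable
  also have "(\<integral>\<^sup>+y. h y * indicator {..0} y \<partial>lborel) =
      (\<integral>\<^sup>+y. h (kink \<eta> p q y) * ennreal p * indicator {..\<eta>} y \<partial>lborel)"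
    using pq by (subst nn_integral_real_affine[where c=p and t="- p * \<eta>"])
      (auto simp: nn_integral_cmult[symmetric] kink_def indicator_def algebra_simps intro!: nn_integral_cong)
  also have "(\<integral>\<^sup>+y. h y * indicator {0<..} y \<partial>lborel) =
      (\<integral>\<^sup>+y. h (kink \<eta> p q y) * ennreal q * indicator {\<eta><..} y \<partial>lborel)"
    using pq by (subst nn_integral_real_affine[where c=q and t="- q * \<eta>"])
      (auto simp: nn_integral_cmult[symmetric] kink_def indicator_def algebra_simps intro!: nn_integral_cong)
  also have "(\<integral>\<^sup>+y. h (kink \<eta> p q y) * ennreal p * indicator {..\<eta>} y \<partial>lborel) +
      (\<integral>\<^sup>+y. h (kink \<eta> p q y) * ennreal q * indicator {\<eta><..} y \<partial>lborel) =
      (\<integral>\<^sup>+y. h (kink \<eta> p q y) * ennreal p * indicator {..\<eta>} y + h (kink \<eta> p q y) * ennreal q * indicator {\<eta><..} y \<partial>lborel)"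
    by (rule nn_integral_add[symmetric]) measurable
  also have "\<dots> = (\<integral>\<^sup>+y. h (kink \<eta> p q y) * ennreal (if y \<le> \<eta> then p else q) \<partial>lborel)"
    by (intro nn_integral_cong) (auto simp: indicator_def)
  finally show ?thesis ..
qed

text \<open>Coordinates straightening the orbits of a planar field which is \<open>w1\<close> below and \<open>w2\<close> above the
  line at height \<open>\<eta>\<close>: the first one is a first integral, the second one is the time, up to sign.\<close>

definition straighten :: "real \<Rightarrow> real \<times> real \<Rightarrow> real \<times> real \<Rightarrow> real \<times> real \<Rightarrow> real \<times> real" where
  "straighten \<eta> w1 w2 q =
     (fst q - kink \<eta> (fst w1 / snd w1) (fst w2 / snd w2) (snd q),
      kink \<eta> (1 / \<bar>snd w1\<bar>) (1 / \<bar>snd w2\<bar>) (snd q))"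

definition unstraighten :: "real \<Rightarrow> real \<times> real \<Rightarrow> real \<times> real \<Rightarrow> real \<times> real \<Rightarrow> real \<times> real" where
  "unstraighten \<eta> w1 w2 g =
     (let y = \<eta> + kink 0 \<bar>snd w1\<bar> \<bar>snd w2\<bar> (snd g)
      in (fst g + kink \<eta> (fst w1 / snd w1) (fst w2 / snd w2) y, y))"

text \<open>The Jacobian determinant of \<open>straighten\<close>, and thus the density whose
  measure becomes Lebesgue measure in the straightening coordinates.\<close>

definition slowness :: "real \<Rightarrow> real \<times> real \<Rightarrow> real \<times> real \<Rightarrow> real \<times> real \<Rightarrow> real" where
  "slowness \<eta> w1 w2 q = (if snd q \<le> \<eta> then 1 / \<bar>snd w1\<bar> else 1 / \<bar>snd w2\<bar>)"

lemma straighten_measurable[measurable]: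
  "straighten \<eta> w1 w2 \<in> borel_measurable borel" "unstraighten \<eta> w1 w2 \<in> borel_measurable borel"
  "slowness \<eta> w1 w2 \<in> borel_measurable borel"
  unfolding straighten_def[abs_def] unstraighten_def[abs_def] slowness_def[abs_def] Let_def
  by (simp_all flip: borel_prod) measurable

lemma kink_inverse:
  assumes "p > 0" "q > 0"
  shows "\<eta> + kink 0 p q (kink \<eta> (1/p) (1/q) y) = y" "kink \<eta> (1/p) (1/q) (\<eta> + kink 0 p q w) = w"
  using assms by (auto simp: kink_def zero_less_mult_iff mult_le_0_iff divide_le_0_iff)

lemma straighten_inverse:
  assumes "snd w1 \<noteq> 0" "snd w2 \<noteq> 0"
  shows "unstraighten \<eta> w1 w2 (straighten \<eta> w1 w2 q) = q"
    "straighten \<eta> w1 w2 (unstraighten \<eta> w1 w2 g) = g"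
  using assms by (simp_all add: straighten_def unstraighten_def kink_inverse Let_def prod_eq_iff)

text \<open>By Fubini: at fixed height, \<open>straighten\<close> shifts the first coordinate, which
  the inner integral does not see; the height itself is transformed by a
  \<open>kink\<close>.\<close>

lemma nn_integral_straighten:
  fixes h :: "real \<times> real \<Rightarrow> ennreal"
  assumes h[measurable]: "h \<in> borel_measurable borel" and n: "snd w1 \<noteq> 0" "snd w2 \<noteq> 0"
  shows "(\<integral>\<^sup>+q. h (straighten \<eta> w1 w2 q) * ennreal (slowness \<eta> w1 w2 q) \<partial>lborel) = (\<integral>\<^sup>+q. h q \<partial>lborel)"
proof -
  have h'[measurable]: "h \<in> borel_measurable (borel \<Otimes>\<^sub>M borel)" using h by (simp add: borel_prod)
  let ?S = "kink \<eta> (fst w1 / snd w1) (fst w2 / snd w2)" and ?T = "kink \<eta> (1 / \<bar>snd w1\<bar>) (1 / \<bar>snd w2\<bar>)"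
  let ?d = "\<lambda>y. ennreal (if y \<le> \<eta> then 1 / \<bar>snd w1\<bar> else 1 / \<bar>snd w2\<bar>)"
  have "(\<integral>\<^sup>+q. h (straighten \<eta> w1 w2 q) * ennreal (slowness \<eta> w1 w2 q) \<partial>lborel) =
      (\<integral>\<^sup>+q. h (straighten \<eta> w1 w2 q) * ennreal (slowness \<eta> w1 w2 q) \<partial>(lborel \<Otimes>\<^sub>M lborel))"
    by (simp add: lborel_prod)
  also have "\<dots> = (\<integral>\<^sup>+y. \<integral>\<^sup>+x. h (x - ?S y, ?T y) * ?d y \<partial>lborel \<partial>lborel)"
    by (subst lborel_pair.nn_integral_snd[symmetric])
      (simp_all add: straighten_def[abs_def] slowness_def[abs_def])
  also have "\<dots> = (\<integral>\<^sup>+y. (\<integral>\<^sup>+x. h (x, ?T y) \<partial>lborel) * ?d y \<partial>lborel)"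
  proof (intro nn_integral_cong)
    fix y :: real
    have "(\<integral>\<^sup>+x. h (x - ?S y, ?T y) * ?d y \<partial>lborel) = (\<integral>\<^sup>+x. h (x - ?S y, ?T y) \<partial>lborel) * ?d y"
      by (rule nn_integral_multc) measurable
    also have "(\<integral>\<^sup>+x. h (x - ?S y, ?T y) \<partial>lborel) = (\<integral>\<^sup>+x. h (x, ?T y) \<partial>lborel)"
      by (subst (2) nn_integral_real_affine[where c=1 and t="- ?S y"]) (simp_all add: algebra_simps)
    finally show "(\<integral>\<^sup>+x. h (x - ?S y, ?T y) * ?d y \<partial>lborel) = (\<integral>\<^sup>+x. h (x, ?T y) \<partial>lborel) * ?d y" .
  qed
  also have "\<dots> = (\<integral>\<^sup>+y. \<integral>\<^sup>+x. h (x, y) \<partial>lborel \<partial>lborel)"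
    using n by (intro nn_integral_kink[where h="\<lambda>y. \<integral>\<^sup>+x. h (x, y) \<partial>lborel"]) simp_all
  also have "\<dots> = (\<integral>\<^sup>+q. h q \<partial>(lborel \<Otimes>\<^sub>M lborel))"
    by (subst lborel_pair.nn_integral_snd[symmetric]) simp_all
  finally show ?thesis by (simp add: lborel_prod)
qed

text \<open>The swap turns the vertical seams into horizontal lines, so that one theory serves both.
  Both maps are isometric involutions.\<close>

definition coord_perm :: "(real \<times> real \<Rightarrow> real \<times> real) \<Rightarrow> bool" where
  "coord_perm P \<longleftrightarrow> P = id \<or> P = prod.swap"

lemma coord_perm_simps:
  assumes "coord_perm P"
  shows "P (P q) = q" "norm (P q) = norm q" "P (q + r) = P q + P r" "P (c *\<^sub>R q) = c *\<^sub>R P q" "dist (P q) (P r) = dist q r"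
  using assms by (auto simp: coord_perm_def prod.swap_def norm_prod_def dist_prod_def add.commute)

lemma coord_perm_bounded_linear: "coord_perm P \<Longrightarrow> bounded_linear P"
  using coord_perm_simps by (intro bounded_linear_intro[where K=1]) auto

lemma coord_perm_measurable[measurable (raw)]:
  assumes "coord_perm P" shows "P \<in> borel_measurable borel"
  using bounded_linear.continuous_on[OF coord_perm_bounded_linear[OF assms] continuous_on_id]
  by (simp add: borel_measurable_continuous_onI)

lemma nn_integral_coord_perm:
  fixes h :: "real \<times> real \<Rightarrow> ennreal"
  assumes P: "coord_perm P" and h[measurable]: "h \<in> borel_measurable borel"
  shows "(\<integral>\<^sup>+q. h (P q) \<partial>lborel) = (\<integral>\<^sup>+q. h q \<partial>lborel)"
  using P unfolding coord_perm_def
proof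
  assume P: "P = prod.swap"
  have h'[measurable]: "h \<in> borel_measurable (borel \<Otimes>\<^sub>M borel)" using h by (simp add: borel_prod)
  have "(\<integral>\<^sup>+q. h q \<partial>(lborel \<Otimes>\<^sub>M lborel)) =
      (\<integral>\<^sup>+q. h q \<partial>(distr (lborel \<Otimes>\<^sub>M lborel) (lborel \<Otimes>\<^sub>M lborel) (\<lambda>(x, y). (y, x))))"
    using arg_cong[OF lborel_pair.distr_pair_swap, of "\<lambda>M. integral\<^sup>N M h"] .
  also have "\<dots> = (\<integral>\<^sup>+q. h (prod.swap q) \<partial>(lborel \<Otimes>\<^sub>M lborel))"
    by (subst nn_integral_distr) (simp_all add: split_beta prod.swap_def)
  finally show ?thesis by (simp add: P lborel_prod)
qed simp

text \<open>A translation in straightening coordinates, read in the original ones; as a bijection of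
  the whole plane it extends the local motion across the line. In its uses \<open>s\<close> is the
  elapsed time multiplied by the sign of the normal velocity.\<close>

definition carry :: "(real \<times> real \<Rightarrow> real \<times> real) \<Rightarrow> real \<Rightarrow> real \<times> real \<Rightarrow> real \<times> real \<Rightarrow> real \<Rightarrow> real \<times> real \<Rightarrow> real \<times> real" where
  "carry P \<eta> w1 w2 s q = P (unstraighten \<eta> w1 w2 (straighten \<eta> w1 w2 (P q) + (0, s)))"

lemma carry_inverse:
  assumes "coord_perm P" "snd w1 \<noteq> 0" "snd w2 \<noteq> 0"
  shows "carry P \<eta> w1 w2 (- s) (carry P \<eta> w1 w2 s q) = q"
  using assms
  by (simp add: carry_def coord_perm_simps straighten_inverse add.assoc flip: zero_prod_def)

lemma carry_measurable[measurable (raw)]: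
  assumes "coord_perm P"
  shows "carry P \<eta> w1 w2 s \<in> borel_measurable borel"
proof -
  have [measurable]: "P \<in> borel_measurable borel" using assms by (rule coord_perm_measurable)
  show ?thesis unfolding carry_def[abs_def] by measurable
qed

lemma carry_image_eq_vimage:
  assumes "coord_perm P" "snd w1 \<noteq> 0" "snd w2 \<noteq> 0"
  shows "carry P \<eta> w1 w2 s ` E = carry P \<eta> w1 w2 (- s) -` E"
  using carry_inverse[OF assms] by (auto simp: image_iff) (metis minus_minus)

lemma carry_image_measurable:
  assumes "coord_perm P" "snd w1 \<noteq> 0" "snd w2 \<noteq> 0" "E \<in> sets borel"
  shows "carry P \<eta> w1 w2 s ` E \<in> sets borel"
  using measurable_sets_borel[OF carry_measurable[OF assms(1)] assms(4)]
  by (simp add: carry_image_eq_vimage[OF assms(1-3)])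

lemma nn_integral_translate:
  fixes h :: "real \<times> real \<Rightarrow> ennreal"
  assumes h[measurable]: "h \<in> borel_measurable borel"
  shows "(\<integral>\<^sup>+q. h (q + c) \<partial>lborel) = (\<integral>\<^sup>+q. h q \<partial>lborel)"
proof -
  have "(\<integral>\<^sup>+q. h q \<partial>lborel) = (\<integral>\<^sup>+q. h q \<partial>(distr lborel borel ((+) c)))" by (simp add: lborel_distr_plus)
  also have "\<dots> = (\<integral>\<^sup>+q. h (q + c) \<partial>lborel)" by (subst nn_integral_distr) (simp_all add: add.commute)
  finally show ?thesis ..
qed

text \<open>In the straightening coordinates, this is the translation invariance of Lebesgue measure.\<close>

lemma emeasure_carry:
  fixes \<eta> :: real
  assumes P[measurable]: "coord_perm P" and n: "snd w1 \<noteq> 0" "snd w2 \<noteq> 0" and E[measurable]: "E \<in> sets borel"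
  defines "M \<equiv> density lborel (\<lambda>q. ennreal (slowness \<eta> w1 w2 (P q)))"
  shows "emeasure M (carry P \<eta> w1 w2 s ` E) = emeasure M E"
proof -
  have Pm[measurable]: "P \<in> borel_measurable borel" using P by (rule coord_perm_measurable)
  have *: "emeasure M (f -` E) = (\<integral>\<^sup>+g. indicator E (k g) \<partial>lborel)"
    if f[measurable]: "f \<in> borel_measurable borel" and k[measurable]: "k \<in> borel_measurable borel"
      and fk: "\<And>q. f q = k (straighten \<eta> w1 w2 (P q))" for f k
  proof -
    have [measurable]: "f -` E \<in> sets borel" using measurable_sets_borel[OF f E] .
    have "emeasure M (f -` E) = (\<integral>\<^sup>+q. indicator E (k (straighten \<eta> w1 w2 (P q))) * ennreal (slowness \<eta> w1 w2 (P q)) \<partial>lborel)"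
      unfolding M_def by (subst emeasure_density) (auto simp: fk indicator_def mult.commute intro!: nn_integral_cong)
    also have "\<dots> = (\<integral>\<^sup>+q. indicator E (k (straighten \<eta> w1 w2 q)) * ennreal (slowness \<eta> w1 w2 q) \<partial>lborel)"
      by (rule nn_integral_coord_perm[OF P, where h="\<lambda>q. indicator E (k (straighten \<eta> w1 w2 q)) * ennreal (slowness \<eta> w1 w2 q)"]) measurable
    also have "\<dots> = (\<integral>\<^sup>+g. indicator E (k g) \<partial>lborel)"
      by (rule nn_integral_straighten[OF _ n, where h="\<lambda>g. indicator E (k g)"]) measurable
    finally show ?thesis .
  qed
  have "emeasure M (carry P \<eta> w1 w2 s ` E) = (\<integral>\<^sup>+g. indicator E (P (unstraighten \<eta> w1 w2 (g + (0, - s)))) \<partial>lborel)"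
    unfolding carry_image_eq_vimage[OF P n]
    by (rule *) (use carry_measurable[OF P] in \<open>auto simp: carry_def\<close>)
  also have "\<dots> = (\<integral>\<^sup>+g. indicator E (P (unstraighten \<eta> w1 w2 g)) \<partial>lborel)"
    by (rule nn_integral_translate[where h="\<lambda>g. indicator E (P (unstraighten \<eta> w1 w2 g))"]) measurable
  also have "\<dots> = emeasure M ((\<lambda>q. q) -` E)"
    by (rule *[symmetric]) (use P n in \<open>auto simp: straighten_inverse coord_perm_simps\<close>)
  finally show ?thesis by simp
qed

section \<open>Solutions near a line of discontinuity\<close>

text \<open>The condition \<open>Q\<close> is asked for off the starting time only, so that curves
  starting at a zero or on a line of discontinuity are covered; the segment allows both directions
  of time.\<close>

lemma lipschitz_AE_affine_segment:
  fixes g :: "real \<Rightarrow> 'a::real_normed_vector"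
  assumes lip: "C-lipschitz_on {c..d} g" and t: "t0 \<in> {c..d}" "t1 \<in> {c..d}"
    and der: "AE t in lborel. t \<in> {c..d} \<longrightarrow> Q t \<longrightarrow> (g has_vector_derivative m) (at t within {c..d})"
    and Q: "\<And>t. t \<in> closed_segment t0 t1 \<Longrightarrow> t \<noteq> t0 \<Longrightarrow> Q t"
  shows "g t1 = g t0 + (t1 - t0) *\<^sub>R m"
proof -
  define c' d' where "c' = min t0 t1" and "d' = max t0 t1"
  have seg: "closed_segment t0 t1 = {c'..d'}" by (simp add: c'_def d'_def closed_segment_eq_real_ivl)
  have sub: "{c'..d'} \<subseteq> {c..d}" using t by (auto simp: c'_def d'_def)
  show ?thesis
  proof (rule lipschitz_AE_affine)
    show "C-lipschitz_on {c'..d'} g" by (rule lipschitz_on_subset[OF lip sub])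
    show "AE t in lborel. t \<in> {c'..d'} \<longrightarrow> (g has_vector_derivative m) (at t within {c'..d'})"
      using der AE_lborel_singleton[of t0]
    proof eventually_elim
      case (elim t)
      show ?case
      proof
        assume "t \<in> {c'..d'}"
        then have "(g has_vector_derivative m) (at t within {c..d})" using elim Q[of t] sub seg by auto
        then show "(g has_vector_derivative m) (at t within {c'..d'})"
          by (rule has_vector_derivative_within_subset) (rule sub)
      qed
    qed
  qed (auto simp: c'_def d'_def)
qed

lemma ivt_segment:
  fixes g :: "real \<Rightarrow> real"
  assumes "continuous_on (closed_segment a b) g" "g a * g b \<le> 0"
  shows "\<exists>r\<in>closed_segment a b. g r = 0"
proof -
  have "connected (g ` closed_segment a b)" by (intro connected_continuous_image assms connected_segment)
  then have iv: "is_interval (g ` closed_segment a b)" by (simp add: is_interval_connected_1)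
  have "g a \<in> g ` closed_segment a b" "g b \<in> g ` closed_segment a b" by auto
  moreover have "g a \<le> 0 \<and> 0 \<le> g b \<or> g b \<le> 0 \<and> 0 \<le> g a" using assms(2) by (simp add: mult_le_0_iff) linarith
  ultimately have "0 \<in> g ` closed_segment a b" using iv mem_is_interval_1_I by blast
  then show ?thesis by auto
qed

text \<open>Once zero is reached it cannot be left: after the zero closest to \<open>t1\<close>, the derivative would
  have the wrong sign.\<close>

lemma slide_to_zero:
  fixes g :: "real \<Rightarrow> real"
  assumes lip: "C-lipschitz_on {c..d} g" and t: "t0 \<in> {c..d}" "t1 \<in> {c..d}"
    and der: "AE t in lborel. t \<in> {c..d} \<longrightarrow> (g t < 0 \<longrightarrow> (g has_vector_derivative m) (at t within {c..d})) \<and>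
       (g t > 0 \<longrightarrow> (g has_vector_derivative k) (at t within {c..d}))"
    and mk: "0 \<le> m * (t1 - t0)" "k * (t1 - t0) \<le> 0" and start: "g t0 < 0" "- g t0 \<le> m * (t1 - t0)"
  shows "g t1 = 0"
proof (rule ccontr)
  assume ne: "g t1 \<noteq> 0"
  have sub: "closed_segment t0 t1 \<subseteq> {c..d}" using t by (auto simp: closed_segment_eq_real_ivl split: if_splits)
  have cont: "continuous_on {c..d} g" using lip by (rule lipschitz_on_continuous_on)
  have der1: "AE t in lborel. t \<in> {c..d} \<longrightarrow> g t < 0 \<longrightarrow> (g has_vector_derivative m) (at t within {c..d})"
    and der2: "AE t in lborel. t \<in> {c..d} \<longrightarrow> g t > 0 \<longrightarrow> (g has_vector_derivative k) (at t within {c..d})"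
    using der by (auto elim: eventually_mono)
  have sgn: "g s * g t1 > 0" if s: "s \<in> closed_segment t0 t1" "\<And>r. r \<in> closed_segment s t1 \<Longrightarrow> g r \<noteq> 0" for s
  proof (rule ccontr)
    assume "\<not> g s * g t1 > 0"
    then have "g s * g t1 \<le> 0" by simp
    moreover have "closed_segment s t1 \<subseteq> {c..d}" using s sub by (meson ends_in_segment(2) subset_closed_segment subset_trans)
    ultimately have "\<exists>r\<in>closed_segment s t1. g r = 0" by (intro ivt_segment continuous_on_subset[OF cont])
    then show False using s by auto
  qed
  have between: "closed_segment r t1 \<subseteq> closed_segment t0 t1" if "r \<in> closed_segment t0 t1" for r
    using that by (simp add: subset_closed_segment)
  have scale: "0 \<le> m * (t1 - r) \<and> k * (t1 - r) \<le> 0" if "r \<in> closed_segment t0 t1" for r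
  proof -
    from that[unfolded in_segment] obtain u where u: "0 \<le> u" "u \<le> 1" "r = (1 - u) * t0 + u * t1" by auto
    then have e: "t1 - r = (1 - u) * (t1 - t0)" by (simp add: algebra_simps)
    have "0 \<le> (1 - u) * (m * (t1 - t0))" "(1 - u) * (k * (t1 - t0)) \<le> 0"
      using mk u(2) by (simp_all add: mult_nonneg_nonpos)
    then show ?thesis unfolding e by (metis mult.left_commute)
  qed
  let ?Z = "{s \<in> closed_segment t0 t1. g s = 0}"
  show False
  proof (cases "?Z = {}")
    \<comment> \<open>Without a zero, \<open>g\<close> stays negative and moves towards 0 at the
      constant rate \<open>m\<close>, long enough to reach it.\<close>
    case True
    have neg: "g s < 0 \<and> g t1 < 0" if "s \<in> closed_segment t0 t1" for s
      using sgn[of s] sgn[of t0] True between that start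
      by (auto simp: zero_less_mult_iff)
    have "g t1 = g t0 + (t1 - t0) *\<^sub>R m"
      by (rule lipschitz_AE_affine_segment[OF lip t der1]) (use neg in auto)
    then show False using start neg[of t1] by (simp add: mult.commute)
  next
    case False
    have "closedin (top_of_set (closed_segment t0 t1)) ?Z"
      by (intro continuous_closedin_preimage_constant continuous_on_subset[OF cont sub])
    then have "compact ?Z" by (meson closedin_compact compact_segment)
    then obtain \<tau> where \<tau>: "\<tau> \<in> ?Z" "\<And>s. s \<in> ?Z \<Longrightarrow> dist t1 \<tau> \<le> dist t1 s"
      using False distance_attains_inf[of ?Z t1] compact_imp_closed by blast
    have same: "g s * g t1 > 0" if s: "s \<in> closed_segment \<tau> t1" "s \<noteq> \<tau>" for s
    proof (rule sgn)
      show "s \<in> closed_segment t0 t1" using s between \<tau> by auto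
      fix r assume r: "r \<in> closed_segment s t1"
      have "r \<in> closed_segment t0 t1" using r s between \<tau>
        by (metis (mono_tags, lifting) mem_Collect_eq subset_closed_segment subsetD ends_in_segment(2))
      moreover have "dist t1 r < dist t1 \<tau>"
        using r s by (auto simp: closed_segment_eq_real_ivl dist_real_def split: if_splits)
      ultimately show "g r \<noteq> 0" using \<tau>(2)[of r] by fastforce
    qed
    have \<tau>cd: "\<tau> \<in> {c..d}" using \<tau> sub by auto
    show False
    proof (cases "g t1 < 0")
      case True
      have "g t1 = g \<tau> + (t1 - \<tau>) *\<^sub>R m"
        by (rule lipschitz_AE_affine_segment[OF lip \<tau>cd t(2) der1])
          (use same True in \<open>auto simp: zero_less_mult_iff\<close>)
      then show False using True \<tau> scale[of \<tau>] by (simp add: mult.commute)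
    next
      case False
      then have p: "g t1 > 0" using ne by simp
      have "g t1 = g \<tau> + (t1 - \<tau>) *\<^sub>R k"
        by (rule lipschitz_AE_affine_segment[OF lip \<tau>cd t(2) der2])
          (use same p in \<open>auto simp: zero_less_mult_iff\<close>)
      then show False using p \<tau> scale[of \<tau>] by (simp add: mult.commute)
    qed
  qed
qed

lemma straighten_lipschitz: "\<exists>K. K-lipschitz_on UNIV (straighten \<eta> w1 w2)"
proof -
  let ?p = "\<bar>fst w1 / snd w1\<bar> + \<bar>fst w2 / snd w2\<bar>" and ?q = "\<bar>1 / \<bar>snd w1\<bar>\<bar> + \<bar>1 / \<bar>snd w2\<bar>\<bar>"
  have "(1 + ?p + ?q)-lipschitz_on UNIV (straighten \<eta> w1 w2)"
  proof (rule lipschitz_onI)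
    fix q r :: "real \<times> real"
    have d: "\<bar>fst q - fst r\<bar> \<le> dist q r" "\<bar>snd q - snd r\<bar> \<le> dist q r"
      using dist_fst_le[of q r] dist_snd_le[of q r] by (auto simp: dist_real_def)
    let ?a = "straighten \<eta> w1 w2 q" and ?b = "straighten \<eta> w1 w2 r"
    have "dist ?a ?b \<le> \<bar>fst ?a - fst ?b\<bar> + \<bar>snd ?a - snd ?b\<bar>"
      unfolding dist_prod_def dist_real_def by (rule order_trans[OF sqrt_sum_squares_le_sum_abs]) simp
    also have "\<bar>fst ?a - fst ?b\<bar> \<le> \<bar>fst q - fst r\<bar> +
        \<bar>kink \<eta> (fst w1 / snd w1) (fst w2 / snd w2) (snd q) - kink \<eta> (fst w1 / snd w1) (fst w2 / snd w2) (snd r)\<bar>"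
      by (simp add: straighten_def)
    also have "\<dots> \<le> dist q r + ?p * dist q r"
      using d by (intro add_mono order_trans[OF kink_lipschitz] mult_left_mono) auto
    also have "\<bar>snd ?a - snd ?b\<bar> \<le> ?q * \<bar>snd q - snd r\<bar>"
      unfolding straighten_def snd_conv by (rule kink_lipschitz)
    also have "\<dots> \<le> ?q * dist q r" using d by (intro mult_left_mono) auto
    finally show "dist ?a ?b \<le> (1 + ?p + ?q) * dist q r" by (simp add: algebra_simps)
  qed simp
  then show ?thesis ..
qed

text \<open>Every convex combination of \<open>w1\<close> and \<open>w2\<close> has a normal
  component of the common sign and of size at least \<open>m\<close>, so the height is strictly
  monotone and the line is met at most once. At almost all other times the straightened curve has
  velocity \<open>(0, s)\<close>; being Lipschitz, it is affine.\<close>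

lemma straighten_solution:
  assumes lip: "L-lipschitz_on {c..d} \<zeta>"
    and der: "AE t in lborel. t \<in> {c..d} \<longrightarrow> (\<exists>v. (\<zeta> has_vector_derivative v) (at t within {c..d}) \<and>
       (snd (\<zeta> t) < \<eta> \<longrightarrow> v = w1) \<and> (snd (\<zeta> t) > \<eta> \<longrightarrow> v = w2) \<and> (snd (\<zeta> t) = \<eta> \<longrightarrow> v \<in> convex hull {w1, w2}))"
    and n: "0 < snd w1 * snd w2" and t: "t0 \<in> {c..d}" "t1 \<in> {c..d}"
  shows "straighten \<eta> w1 w2 (\<zeta> t1) = straighten \<eta> w1 w2 (\<zeta> t0) + (0, sgn (snd w1) * (t1 - t0))"
proof -
  define s where "s = sgn (snd w1)"
  define m M where "m = min \<bar>snd w1\<bar> \<bar>snd w2\<bar>" and "M = max \<bar>snd w1\<bar> \<bar>snd w2\<bar>"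
  have n0: "snd w1 \<noteq> 0" "snd w2 \<noteq> 0" using n by auto
  have s: "s * snd w1 = \<bar>snd w1\<bar>" "s * snd w2 = \<bar>snd w2\<bar>" "\<bar>s\<bar> = 1"
    using n by (auto simp: s_def zero_less_mult_iff sgn_if)
  have m: "m > 0" using n0 by (simp add: m_def)
  define T where "T = {t \<in> {c..d}. snd (\<zeta> t) = \<eta>}"
  have "AE t in lborel. t \<in> {c..d} \<longrightarrow> (\<exists>v. m \<le> v \<and> v \<le> M \<and>
      ((\<lambda>t. s * snd (\<zeta> t)) has_vector_derivative v) (at t within {c..d}))"
    using der
  proof eventually_elim
    case (elim t)
    show ?case
    proof
      assume t: "t \<in> {c..d}"
      then obtain v where v: "(\<zeta> has_vector_derivative v) (at t within {c..d})"
        "v = w1 \<or> v = w2 \<or> v \<in> convex hull {w1, w2}"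
        using elim linorder_less_linear[of "snd (\<zeta> t)" \<eta>] by blast
      have "w1 \<in> convex hull {w1, w2}" "w2 \<in> convex hull {w1, w2}" by (auto intro: hull_inc)
      with v(2) have "v \<in> convex hull {w1, w2}" by blast
      then obtain u where u: "0 \<le> u" "u \<le> 1" "v = (1 - u) *\<^sub>R w1 + u *\<^sub>R w2"
        unfolding segment_convex_hull[symmetric] in_segment by blast
      have sv: "s * snd v = (1 - u) * \<bar>snd w1\<bar> + u * \<bar>snd w2\<bar>"
        unfolding s(1,2)[symmetric] u(3) by (simp add: algebra_simps)
      have "(1 - u) * m + u * m \<le> s * snd v" "s * snd v \<le> (1 - u) * M + u * M"
        unfolding sv using u by (intro add_mono mult_left_mono; simp add: m_def M_def)+
      then have "m \<le> s * snd v" "s * snd v \<le> M" by (simp_all add: algebra_simps)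
      moreover have "((\<lambda>t. snd (\<zeta> t)) has_vector_derivative snd v) (at t within {c..d})"
        using bounded_linear.has_vector_derivative[OF bounded_linear_snd v(1)] .
      then have "((\<lambda>t. s * snd (\<zeta> t)) has_vector_derivative s * snd v) (at t within {c..d})"
        by (rule has_vector_derivative_mult_right)
      ultimately show "\<exists>v. m \<le> v \<and> v \<le> M \<and> ((\<lambda>t. s * snd (\<zeta> t)) has_vector_derivative v) (at t within {c..d})"
        by blast
    qed
  qed
  moreover have "L-lipschitz_on {c..d} (\<lambda>t. s * snd (\<zeta> t))"
  proof (rule lipschitz_onI)
    fix a b assume "a \<in> {c..d}" "b \<in> {c..d}"
    then have "dist (\<zeta> a) (\<zeta> b) \<le> L * dist a b" by (rule lipschitz_onD[OF lip])
    moreover have "dist (s * snd (\<zeta> a)) (s * snd (\<zeta> b)) = dist (snd (\<zeta> a)) (snd (\<zeta> b))"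
      using s(3) by (simp add: dist_real_def flip: right_diff_distrib) (simp add: abs_mult)
    ultimately show "dist (s * snd (\<zeta> a)) (s * snd (\<zeta> b)) \<le> L * dist a b"
      using dist_snd_le order_trans by metis
  qed (use lip lipschitz_on_nonneg in auto)
  ultimately have mono: "s * snd (\<zeta> b) - s * snd (\<zeta> a) \<ge> m * (b - a)" if "a \<le> b" "{a..b} \<subseteq> {c..d}" for a b
    using lipschitz_AE_lower_bound that by blast
  have uniq: "a = b" if ab: "a \<in> T" "b \<in> T" for a b
  proof -
    have *: "a = b" if ab: "a \<le> b" "a \<in> T" "b \<in> T" for a b
    proof -
      have "m * (b - a) \<le> 0" using mono[of a b] ab by (auto simp: T_def)
      then show ?thesis using m ab by (simp add: mult_le_0_iff)
    qed
    show ?thesis using *[of a b] *[of b a] ab by linarith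
  qed
  have "finite T"
  proof (cases "T = {}")
    case False
    then obtain \<tau> where "\<tau> \<in> T" by auto
    then have "T \<subseteq> {\<tau>}" using uniq by auto
    then show ?thesis using finite_subset by blast
  qed simp
  then have AT: "AE t in lborel. t \<notin> T" by (intro AE_not_in finite_imp_null_set_lborel)
  obtain K where K: "K-lipschitz_on UNIV (straighten \<eta> w1 w2)" using straighten_lipschitz by blast
  have "straighten \<eta> w1 w2 (\<zeta> t1) = straighten \<eta> w1 w2 (\<zeta> t0) + (t1 - t0) *\<^sub>R (0, s)"
  proof (rule lipschitz_AE_affine[OF _ _ t, where g="\<lambda>t. straighten \<eta> w1 w2 (\<zeta> t)"])
    show "(K * L)-lipschitz_on {c..d} (\<lambda>t. straighten \<eta> w1 w2 (\<zeta> t))"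
      using lipschitz_on_compose2[OF lip lipschitz_on_subset[OF K]] by auto
    show "AE t in lborel. t \<in> {c..d} \<longrightarrow>
        ((\<lambda>t. straighten \<eta> w1 w2 (\<zeta> t)) has_vector_derivative (0, s)) (at t within {c..d})"
      using der AT
    proof eventually_elim
      case (elim t)
      show ?case
      proof
        assume t: "t \<in> {c..d}"
        with elim(2) have ne: "snd (\<zeta> t) \<noteq> \<eta>" by (simp add: T_def)
        define w where "w = (if snd (\<zeta> t) < \<eta> then w1 else w2)"
        have v: "(\<zeta> has_vector_derivative w) (at t within {c..d})"
          using elim(1) t ne unfolding w_def by fastforce
        have f: "((\<lambda>t. fst (\<zeta> t)) has_vector_derivative fst w) (at t within {c..d})"
          and z: "((\<lambda>t. snd (\<zeta> t)) has_vector_derivative snd w) (at t within {c..d})"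
          using bounded_linear.has_vector_derivative[OF bounded_linear_fst v]
            bounded_linear.has_vector_derivative[OF bounded_linear_snd v] by auto
        have k: "((\<lambda>t. kink \<eta> p q (snd (\<zeta> t))) has_vector_derivative snd w * (if snd (\<zeta> t) < \<eta> then p else q))
            (at t within {c..d})" for p q
        proof -
          have "(kink \<eta> p q has_vector_derivative (if snd (\<zeta> t) < \<eta> then p else q)) (at (snd (\<zeta> t)) within (\<lambda>t. snd (\<zeta> t)) ` {c..d})"
            using kink_has_derivative[OF ne, of p q]
            by (simp add: has_real_derivative_iff_has_vector_derivative has_vector_derivative_at_within)
          from vector_diff_chain_within[OF z this] show ?thesis by (simp add: o_def)
        qed
        have "((\<lambda>t. straighten \<eta> w1 w2 (\<zeta> t)) has_vector_derivative
           (fst w - snd w * (if snd (\<zeta> t) < \<eta> then fst w1 / snd w1 else fst w2 / snd w2),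
            snd w * (if snd (\<zeta> t) < \<eta> then 1 / \<bar>snd w1\<bar> else 1 / \<bar>snd w2\<bar>))) (at t within {c..d})"
          unfolding straighten_def by (intro has_vector_derivative_Pair has_vector_derivative_diff f k)
        moreover have "(fst w - snd w * (if snd (\<zeta> t) < \<eta> then fst w1 / snd w1 else fst w2 / snd w2),
            snd w * (if snd (\<zeta> t) < \<eta> then 1 / \<bar>snd w1\<bar> else 1 / \<bar>snd w2\<bar>)) = (0, s)"
          using n n0 by (auto simp: w_def s_def sgn_if abs_if zero_less_mult_iff)
        ultimately show "((\<lambda>t. straighten \<eta> w1 w2 (\<zeta> t)) has_vector_derivative (0, s)) (at t within {c..d})"
          by metis
      qed
    qed
  qed
  then show ?thesis by (simp add: s_def mult.commute)
qed

text \<open>This contains the Filippov set, whatever the regions of continuity. Upper bounds for the flow are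
  proved for this larger inclusion, while solutions are only constructed for the smaller one
  given by \<open>off_field\<close> below; so the components in \<open>filippov_set\<close> never have to be determined.\<close>

definition krasovskii :: "(real \<times> real \<Rightarrow> real \<times> real) \<Rightarrow> real \<times> real \<Rightarrow> (real \<times> real) set" where
  "krasovskii W p = (\<Inter>e\<in>{0<..}. convex hull (W ` ball p e))"

text \<open>Whether the line belongs to \<open>D\<close> is left open, so points of continuity are
  included, with \<open>w1 = w2\<close>. On the line \<open>W\<close> may take either value,
  depending on the convention for the strips.\<close>

definition two_zone ::
  "(real \<times> real \<Rightarrow> real \<times> real) \<Rightarrow> (real \<times> real) set \<Rightarrow> (real \<times> real \<Rightarrow> real \<times> real) \<Rightarrow> real \<Rightarrow>
   real \<times> real \<Rightarrow> real \<times> real \<Rightarrow> (real \<times> real) set \<Rightarrow> bool" where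
  "two_zone W D P \<eta> w1 w2 U \<longleftrightarrow> open U \<and> coord_perm P \<and>
     (\<forall>q\<in>U. (snd (P q) < \<eta> \<longrightarrow> W q = w1 \<and> q \<notin> D) \<and> (snd (P q) > \<eta> \<longrightarrow> W q = w2 \<and> q \<notin> D) \<and>
        (snd (P q) = \<eta> \<longrightarrow> W q \<in> {w1, w2}))"

lemma two_zone_subset: "two_zone W D P \<eta> w1 w2 U \<Longrightarrow> open U' \<Longrightarrow> U' \<subseteq> U \<Longrightarrow> two_zone W D P \<eta> w1 w2 U'"
  by (auto simp: two_zone_def)

lemma krasovskii_subset:
  assumes "open U" "q \<in> U" "W ` U \<subseteq> A" shows "krasovskii W q \<subseteq> convex hull A"
proof -
  obtain e where e: "e > 0" "ball q e \<subseteq> U" using assms open_contains_ball by blast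
  then have "krasovskii W q \<subseteq> convex hull (W ` ball q e)" by (auto simp: krasovskii_def)
  also have "\<dots> \<subseteq> convex hull A" using e assms by (intro hull_mono) blast
  finally show ?thesis .
qed

lemma two_zone_krasovskii:
  assumes tz: "two_zone W D P \<eta> w1 w2 U" and q: "q \<in> U" and v: "v \<in> krasovskii W q"
  shows "snd (P q) < \<eta> \<Longrightarrow> v = w1" "snd (P q) > \<eta> \<Longrightarrow> v = w2" "snd (P q) = \<eta> \<Longrightarrow> v \<in> convex hull {w1, w2}"
proof -
  have U: "open U" and P: "coord_perm P" using tz by (auto simp: two_zone_def)
  have cont: "continuous_on A (\<lambda>q. snd (P q))" for A
    by (intro continuous_on_snd linear_continuous_on coord_perm_bounded_linear P)
  have op: "open (U \<inter> {q. snd (P q) < \<eta>})" "open (U \<inter> {q. \<eta> < snd (P q)})"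
    using U by (auto intro!: open_Int open_Collect_less cont continuous_on_const)
  { assume "snd (P q) < \<eta>"
    then have "krasovskii W q \<subseteq> convex hull {w1}"
      using tz q by (intro krasovskii_subset[OF op(1)]) (auto simp: two_zone_def)
    then show "v = w1" using v by auto }
  { assume "snd (P q) > \<eta>"
    then have "krasovskii W q \<subseteq> convex hull {w2}"
      using tz q by (intro krasovskii_subset[OF op(2)]) (auto simp: two_zone_def)
    then show "v = w2" using v by auto }
  have "W r \<in> {w1, w2}" if "r \<in> U" for r
    using tz that linorder_less_linear[of "snd (P r)" \<eta>] unfolding two_zone_def by blast
  then have "krasovskii W q \<subseteq> convex hull {w1, w2}"
    using tz q by (intro krasovskii_subset[OF U]) auto
  then show "v \<in> convex hull {w1, w2}" using v by auto
qed

lemma two_zone_solution_AE: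
  assumes tz: "two_zone W D P \<eta> w1 w2 U" and sol: "inclusion_solution L (krasovskii W) {c..d} \<psi>"
    and U: "\<psi> ` {c..d} \<subseteq> U"
  shows "AE t in lborel. t \<in> {c..d} \<longrightarrow> (\<exists>v. ((\<lambda>t. P (\<psi> t)) has_vector_derivative v) (at t within {c..d}) \<and>
       (snd (P (\<psi> t)) < \<eta> \<longrightarrow> v = P w1) \<and> (snd (P (\<psi> t)) > \<eta> \<longrightarrow> v = P w2) \<and>
       (snd (P (\<psi> t)) = \<eta> \<longrightarrow> v \<in> convex hull {P w1, P w2}))"
proof -
  have P: "coord_perm P" using tz by (auto simp: two_zone_def)
  have bl: "bounded_linear P" by (rule coord_perm_bounded_linear[OF P])
  have "AE t in lborel. t \<in> {c..d} \<longrightarrow> (\<exists>v\<in>krasovskii W (\<psi> t). (\<psi> has_vector_derivative v) (at t within {c..d}))"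
    using sol by (auto simp: inclusion_solution_def)
  then show ?thesis
  proof eventually_elim
    case (elim t)
    show ?case
    proof
      assume t: "t \<in> {c..d}"
      then obtain v where v: "v \<in> krasovskii W (\<psi> t)" "(\<psi> has_vector_derivative v) (at t within {c..d})" using elim by auto
      have q: "\<psi> t \<in> U" using U t by auto
      have "((\<lambda>t. P (\<psi> t)) has_vector_derivative P v) (at t within {c..d})"
        using bounded_linear.has_vector_derivative[OF bl v(2)] .
      moreover have "P ` (convex hull {w1, w2}) = convex hull {P w1, P w2}"
        using convex_hull_linear_image[OF bounded_linear.linear[OF bl], of "{w1, w2}"] by simp
      ultimately show "\<exists>v. ((\<lambda>t. P (\<psi> t)) has_vector_derivative v) (at t within {c..d}) \<and>
       (snd (P (\<psi> t)) < \<eta> \<longrightarrow> v = P w1) \<and> (snd (P (\<psi> t)) > \<eta> \<longrightarrow> v = P w2) \<and>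
       (snd (P (\<psi> t)) = \<eta> \<longrightarrow> v \<in> convex hull {P w1, P w2})"
        using two_zone_krasovskii[OF tz q v(1)] by blast
    qed
  qed
qed

lemma coord_perm_lipschitz:
  assumes "coord_perm P" "inclusion_solution L V I \<psi>"
  shows "L-lipschitz_on I (\<lambda>t. P (\<psi> t))"
  using assms by (auto simp: inclusion_solution_def lipschitz_on_def coord_perm_simps)

lemma lipschitz_on_snd: "L-lipschitz_on I f \<Longrightarrow> L-lipschitz_on I (\<lambda>t. snd (f t))"
  using dist_snd_le order_trans unfolding lipschitz_on_def by metis

lemma two_zone_crossing:
  assumes tz: "two_zone W D P \<eta> w1 w2 U" and sol: "inclusion_solution L (krasovskii W) {c..d} \<psi>"
    and U: "\<psi> ` {c..d} \<subseteq> U" and n: "0 < snd (P w1) * snd (P w2)" and t: "t0 \<in> {c..d}" "t1 \<in> {c..d}"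
  shows "straighten \<eta> (P w1) (P w2) (P (\<psi> t1)) =
      straighten \<eta> (P w1) (P w2) (P (\<psi> t0)) + (0, sgn (snd (P w1)) * (t1 - t0))"
    and "\<psi> t1 = carry P \<eta> (P w1) (P w2) (sgn (snd (P w1)) * (t1 - t0)) (\<psi> t0)"
proof -
  have P: "coord_perm P" using tz by (auto simp: two_zone_def)
  show *: "straighten \<eta> (P w1) (P w2) (P (\<psi> t1)) =
      straighten \<eta> (P w1) (P w2) (P (\<psi> t0)) + (0, sgn (snd (P w1)) * (t1 - t0))"
    by (rule straighten_solution[OF coord_perm_lipschitz[OF P sol] two_zone_solution_AE[OF tz sol U] n t])
  have "snd (P w1) \<noteq> 0" "snd (P w2) \<noteq> 0" using n by auto
  then show "\<psi> t1 = carry P \<eta> (P w1) (P w2) (sgn (snd (P w1)) * (t1 - t0)) (\<psi> t0)"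
    unfolding carry_def *[symmetric] by (simp add: straighten_inverse coord_perm_simps[OF P])
qed

text \<open>All convex combinations of the two fields are parallel to the line, so the distance from
  it is conserved. A curve starting off the line therefore stays in one zone, whereas the velocity
  along the line itself is not determined.\<close>

lemma two_zone_tangential:
  assumes tz: "two_zone W D P \<eta> w1 w2 U" and sol: "inclusion_solution L (krasovskii W) {c..d} \<psi>"
    and U: "\<psi> ` {c..d} \<subseteq> U" and n: "snd (P w1) = 0" "snd (P w2) = 0" and t: "t0 \<in> {c..d}" "t1 \<in> {c..d}"
  shows "snd (P (\<psi> t1)) = snd (P (\<psi> t0))"
    and "snd (P (\<psi> t0)) < \<eta> \<Longrightarrow> \<psi> t1 = \<psi> t0 + (t1 - t0) *\<^sub>R w1"
    and "snd (P (\<psi> t0)) > \<eta> \<Longrightarrow> \<psi> t1 = \<psi> t0 + (t1 - t0) *\<^sub>R w2"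
proof -
  have P: "coord_perm P" using tz by (auto simp: two_zone_def)
  note lip = coord_perm_lipschitz[OF P sol] and AE = two_zone_solution_AE[OF tz sol U]
  have const: "snd (P (\<psi> t)) = snd (P (\<psi> t0))" if t': "t \<in> {c..d}" for t
  proof -
    have "snd (P (\<psi> t)) = snd (P (\<psi> t0)) + (t - t0) *\<^sub>R 0"
    proof (rule lipschitz_AE_affine[OF lipschitz_on_snd[OF lip] _ t(1) t'])
      show "AE t in lborel. t \<in> {c..d} \<longrightarrow> ((\<lambda>t. snd (P (\<psi> t))) has_vector_derivative 0) (at t within {c..d})"
        using AE
      proof eventually_elim
        case (elim t)
        show ?case
        proof
          assume t: "t \<in> {c..d}"
          then obtain v where v: "((\<lambda>t. P (\<psi> t)) has_vector_derivative v) (at t within {c..d})"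
            "v = P w1 \<or> v = P w2 \<or> v \<in> convex hull {P w1, P w2}"
            using elim linorder_less_linear[of "snd (P (\<psi> t))" \<eta>] by blast
          have "P w1 \<in> convex hull {P w1, P w2}" "P w2 \<in> convex hull {P w1, P w2}" by (auto intro: hull_inc)
          with v(2) have "v \<in> convex hull {P w1, P w2}" by blast
          then obtain u where "v = (1 - u) *\<^sub>R P w1 + u *\<^sub>R P w2"
            unfolding segment_convex_hull[symmetric] in_segment by blast
          then have "snd v = 0" using n by simp
          then show "((\<lambda>t. snd (P (\<psi> t))) has_vector_derivative 0) (at t within {c..d})"
            using bounded_linear.has_vector_derivative[OF bounded_linear_snd v(1)] by simp
        qed
      qed
    qed
    then show ?thesis by simp
  qed
  show "snd (P (\<psi> t1)) = snd (P (\<psi> t0))" by (rule const[OF t(2)])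
  have aff: "\<psi> t1 = \<psi> t0 + (t1 - t0) *\<^sub>R w"
    if "AE t in lborel. t \<in> {c..d} \<longrightarrow> ((\<lambda>t. P (\<psi> t)) has_vector_derivative P w) (at t within {c..d})" for w
  proof -
    have "P (\<psi> t1) = P (\<psi> t0) + (t1 - t0) *\<^sub>R P w"
      by (rule lipschitz_AE_affine[OF lip that t])
    then have "P (P (\<psi> t1)) = P (P (\<psi> t0 + (t1 - t0) *\<^sub>R w))" by (simp add: coord_perm_simps[OF P])
    then show ?thesis by (simp add: coord_perm_simps[OF P])
  qed
  { assume a: "snd (P (\<psi> t0)) < \<eta>"
    have "AE t in lborel. t \<in> {c..d} \<longrightarrow> ((\<lambda>t. P (\<psi> t)) has_vector_derivative P w1) (at t within {c..d})"
      using AE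
    proof eventually_elim
      case (elim t)
      show ?case
      proof
        assume t: "t \<in> {c..d}"
        then show "((\<lambda>t. P (\<psi> t)) has_vector_derivative P w1) (at t within {c..d})"
          using elim a const[OF t] by auto
      qed
    qed
    then show "\<psi> t1 = \<psi> t0 + (t1 - t0) *\<^sub>R w1" by (rule aff) }
  { assume a: "snd (P (\<psi> t0)) > \<eta>"
    have "AE t in lborel. t \<in> {c..d} \<longrightarrow> ((\<lambda>t. P (\<psi> t)) has_vector_derivative P w2) (at t within {c..d})"
      using AE
    proof eventually_elim
      case (elim t)
      show ?case
      proof
        assume t: "t \<in> {c..d}"
        then show "((\<lambda>t. P (\<psi> t)) has_vector_derivative P w2) (at t within {c..d})"
          using elim a const[OF t] by auto
      qed
    qed
    then show "\<psi> t1 = \<psi> t0 + (t1 - t0) *\<^sub>R w2" by (rule aff) }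
qed

text \<open>The sign hypotheses say that, in the direction from \<open>t0\<close> to
  \<open>t1\<close>, neither zone pushes away from the line; the last premise of each claim gives
  the starting point enough time to arrive.\<close>

lemma two_zone_sliding:
  assumes tz: "two_zone W D P \<eta> w1 w2 U" and sol: "inclusion_solution L (krasovskii W) {c..d} \<psi>"
    and U: "\<psi> ` {c..d} \<subseteq> U" and t: "t0 \<in> {c..d}" "t1 \<in> {c..d}"
    and n: "0 \<le> snd (P w1) * (t1 - t0)" "snd (P w2) * (t1 - t0) \<le> 0"
  shows "snd (P (\<psi> t0)) < \<eta> \<Longrightarrow> \<eta> - snd (P (\<psi> t0)) \<le> snd (P w1) * (t1 - t0) \<Longrightarrow> snd (P (\<psi> t1)) = \<eta>"
    and "snd (P (\<psi> t0)) > \<eta> \<Longrightarrow> snd (P (\<psi> t0)) - \<eta> \<le> - snd (P w2) * (t1 - t0) \<Longrightarrow> snd (P (\<psi> t1)) = \<eta>"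
proof -
  have P: "coord_perm P" using tz by (auto simp: two_zone_def)
  note lip = lipschitz_on_snd[OF coord_perm_lipschitz[OF P sol]]
  have AE: "AE t in lborel. t \<in> {c..d} \<longrightarrow>
      (snd (P (\<psi> t)) < \<eta> \<longrightarrow> ((\<lambda>t. snd (P (\<psi> t))) has_vector_derivative snd (P w1)) (at t within {c..d})) \<and>
      (snd (P (\<psi> t)) > \<eta> \<longrightarrow> ((\<lambda>t. snd (P (\<psi> t))) has_vector_derivative snd (P w2)) (at t within {c..d}))"
    using two_zone_solution_AE[OF tz sol U]
  proof eventually_elim
    case (elim t)
    show ?case
    proof
      assume "t \<in> {c..d}"
      then obtain v where v: "((\<lambda>t. P (\<psi> t)) has_vector_derivative v) (at t within {c..d})"
        "snd (P (\<psi> t)) < \<eta> \<longrightarrow> v = P w1" "snd (P (\<psi> t)) > \<eta> \<longrightarrow> v = P w2" using elim by blast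
      show "(snd (P (\<psi> t)) < \<eta> \<longrightarrow> ((\<lambda>t. snd (P (\<psi> t))) has_vector_derivative snd (P w1)) (at t within {c..d})) \<and>
        (snd (P (\<psi> t)) > \<eta> \<longrightarrow> ((\<lambda>t. snd (P (\<psi> t))) has_vector_derivative snd (P w2)) (at t within {c..d}))"
        using bounded_linear.has_vector_derivative[OF bounded_linear_snd v(1)] v(2,3) by auto
    qed
  qed
  have lip': "L-lipschitz_on {c..d} (\<lambda>t. k * (snd (P (\<psi> t)) - \<eta>))" if "\<bar>k\<bar> = 1" for k
    using lip that unfolding lipschitz_on_def
    by (simp add: dist_real_def flip: right_diff_distrib) (simp add: abs_mult)
  have D: "((\<lambda>t. k * (snd (P (\<psi> t)) - \<eta>)) has_vector_derivative k * w) F"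
    if "((\<lambda>t. snd (P (\<psi> t))) has_vector_derivative w) F" for k w F
    using has_vector_derivative_mult_right[OF has_vector_derivative_diff[OF that has_vector_derivative_const]]
    by simp
  { assume a: "snd (P (\<psi> t0)) < \<eta>" "\<eta> - snd (P (\<psi> t0)) \<le> snd (P w1) * (t1 - t0)"
    have "AE t in lborel. t \<in> {c..d} \<longrightarrow>
      (1 * (snd (P (\<psi> t)) - \<eta>) < 0 \<longrightarrow> ((\<lambda>t. 1 * (snd (P (\<psi> t)) - \<eta>)) has_vector_derivative snd (P w1)) (at t within {c..d})) \<and>
      (1 * (snd (P (\<psi> t)) - \<eta>) > 0 \<longrightarrow> ((\<lambda>t. 1 * (snd (P (\<psi> t)) - \<eta>)) has_vector_derivative snd (P w2)) (at t within {c..d}))"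
      using AE
    proof eventually_elim
      case (elim t)
      then show ?case
        using D[where k=1 and w="snd (P w1)" and F="at t within {c..d}"]
          D[where k=1 and w="snd (P w2)" and F="at t within {c..d}"] by simp
    qed
    from slide_to_zero[OF lip' t this] n a show "snd (P (\<psi> t1)) = \<eta>" by simp }
  { assume a: "snd (P (\<psi> t0)) > \<eta>" "snd (P (\<psi> t0)) - \<eta> \<le> - snd (P w2) * (t1 - t0)"
    have "AE t in lborel. t \<in> {c..d} \<longrightarrow>
      ((-1) * (snd (P (\<psi> t)) - \<eta>) < 0 \<longrightarrow> ((\<lambda>t. (-1) * (snd (P (\<psi> t)) - \<eta>)) has_vector_derivative - snd (P w2)) (at t within {c..d})) \<and>
      ((-1) * (snd (P (\<psi> t)) - \<eta>) > 0 \<longrightarrow> ((\<lambda>t. (-1) * (snd (P (\<psi> t)) - \<eta>)) has_vector_derivative - snd (P w1)) (at t within {c..d}))"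
      using AE
    proof eventually_elim
      case (elim t)
      then show ?case
        using D[where k="-1" and w="snd (P w1)" and F="at t within {c..d}"]
          D[where k="-1" and w="snd (P w2)" and F="at t within {c..d}"] by simp
    qed
    from slide_to_zero[OF lip' t this] n a show "snd (P (\<psi> t1)) = \<eta>" by simp }
qed

section \<open>Flow boxes\<close>

text \<open>The order of \<open>t0\<close> and \<open>t1\<close> is free, so motion backward in time
  is included. Confinement to \<open>K\<close> keeps the curves where the field is
  understood.\<close>

definition reach :: "real \<Rightarrow> (real \<times> real \<Rightarrow> (real \<times> real) set) \<Rightarrow> (real \<times> real) set \<Rightarrow> real \<Rightarrow> real \<Rightarrow>
    (real \<times> real) set \<Rightarrow> (real \<times> real) set" where
  "reach L V K t0 t1 E = {\<psi> t1 | \<psi>. inclusion_solution L V (closed_segment t0 t1) \<psi> \<and>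
     \<psi> ` closed_segment t0 t1 \<subseteq> K \<and> \<psi> t0 \<in> E}"

text \<open>Empty on \<open>D\<close>: a solution of this inclusion spends only a null set of times
  on \<open>D\<close>, so no velocity has to be exhibited there.\<close>

definition off_field :: "(real \<times> real \<Rightarrow> real \<times> real) \<Rightarrow> (real \<times> real) set \<Rightarrow> real \<times> real \<Rightarrow> (real \<times> real) set" where
  "off_field W D p = (if p \<in> D then {} else {W p})"

text \<open>The estimate of measure and the conservation of \<open>F\<close> concern the larger
  inclusion, existence the smaller one. Existence is not asked on the levels in \<open>C\<close>,
  since a curve running along a line of discontinuity may solve the larger inclusion but never the
  smaller one.\<close>

definition flow_box where
  "flow_box L W D wt F C U \<longleftrightarrow> open U \<and>
     (\<forall>t0 t1 E. E \<in> sets borel \<longrightarrow> E \<subseteq> U \<longrightarrow>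
        outer_measure_of (density lborel wt) (reach L (krasovskii W) U t0 t1 E) \<le> emeasure (density lborel wt) E) \<and>
     (\<forall>c d \<psi>. inclusion_solution L (krasovskii W) {c..d} \<psi> \<longrightarrow> \<psi> ` {c..d} \<subseteq> U \<longrightarrow>
        (\<forall>t0\<in>{c..d}. \<forall>t1\<in>{c..d}. F (\<psi> t1) = F (\<psi> t0))) \<and>
     (\<forall>p\<in>U. \<exists>\<epsilon>>0. \<exists>\<rho>>0. \<forall>q\<in>ball p \<rho>. F q \<notin> C \<longrightarrow>
        (\<forall>\<tau>. \<exists>\<psi>. inclusion_solution L (off_field W D) {\<tau> - \<epsilon>..\<tau> + \<epsilon>} \<psi> \<and> \<psi> \<tau> = q))"

lemma closed_segment_real: "closed_segment a b = {min a b..max a (b::real)}"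
  by (simp add: closed_segment_eq_real_ivl)

lemma coord_half_planes_borel:
  assumes P: "coord_perm P"
  shows "{q. snd (P q) < \<eta>} \<in> sets borel" "{q. snd (P q) > \<eta>} \<in> sets borel" "{q. snd (P q) = \<eta>} \<in> sets borel"
proof -
  have "(\<lambda>q. snd (P q)) \<in> borel_measurable borel"
    by (intro borel_measurable_continuous_onI continuous_on_snd linear_continuous_on coord_perm_bounded_linear P)
  note * = measurable_sets_borel[OF this]
  show "{q. snd (P q) < \<eta>} \<in> sets borel" "{q. snd (P q) > \<eta>} \<in> sets borel" "{q. snd (P q) = \<eta>} \<in> sets borel"
    using *[of "{..<\<eta>}"] *[of "{\<eta><..}"] *[of "{\<eta>}"] by (simp_all add: vimage_def)
qed

lemma line_null:
  assumes P: "coord_perm P"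
  shows "{q. snd (P q) = \<eta>} \<in> null_sets lborel"
proof -
  have [measurable]: "P \<in> borel_measurable borel" using P by (rule coord_perm_measurable)
  note s = coord_half_planes_borel(3)[OF P, of \<eta>]
  have "emeasure lborel {q. snd (P q) = \<eta>} = (\<integral>\<^sup>+q. indicator {q. snd q = \<eta>} (P q) \<partial>lborel)"
  proof -
    have "(\<integral>\<^sup>+q. indicator {q. snd q = \<eta>} (P q) \<partial>lborel) = (\<integral>\<^sup>+q. indicator {q. snd (P q) = \<eta>} q \<partial>lborel)"
      by (rule nn_integral_cong) (simp add: indicator_def)
    then show ?thesis using s by simp
  qed
  also have "\<dots> = (\<integral>\<^sup>+q. indicator {q. snd q = \<eta>} q \<partial>(lborel :: (real \<times> real) measure))"
    using coord_half_planes_borel(3)[of id \<eta>]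
    by (intro nn_integral_coord_perm[OF P, where h="\<lambda>q. indicator {q. snd q = \<eta>} q"]) (simp add: coord_perm_def)
  also have "{q :: real \<times> real. snd q = \<eta>} = UNIV \<times> {\<eta>}" by auto
  also have "(\<integral>\<^sup>+q. indicator ((UNIV :: real set) \<times> {\<eta>}) q \<partial>lborel) = emeasure (lborel \<Otimes>\<^sub>M lborel) ((UNIV :: real set) \<times> {\<eta>})"
    using borel_closed[OF closed_Times[of "UNIV :: real set" "{\<eta>}"]] by (simp add: lborel_prod)
  also have "\<dots> = 0" by (subst lborel.emeasure_pair_measure_Times) auto
  finally show ?thesis using s by (auto intro: null_setsI)
qed

abbreviation slow_measure where
  "slow_measure P \<eta> w1 w2 \<equiv> density lborel (\<lambda>q. ennreal (slowness \<eta> w1 w2 (P q)))"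

lemma emeasure_density_proportional:
  fixes wt s :: "real \<times> real \<Rightarrow> ennreal"
  assumes [measurable]: "wt \<in> borel_measurable borel" "s \<in> borel_measurable borel" "X \<in> sets borel"
    and "AE q in lborel. q \<in> X \<longrightarrow> wt q = c * s q"
  shows "emeasure (density lborel wt) X = c * emeasure (density lborel s) X"
proof -
  have "emeasure (density lborel wt) X = (\<integral>\<^sup>+q. c * (s q * indicator X q) \<partial>lborel)"
    using assms(4) by (subst emeasure_density)
      (auto intro!: nn_integral_cong_AE elim!: eventually_mono simp: indicator_def)
  also have "\<dots> = c * emeasure (density lborel s) X"
    by (subst nn_integral_cmult) (auto simp: emeasure_density)
  finally show ?thesis .
qed

lemma slow_measurable: "coord_perm P \<Longrightarrow> (\<lambda>q. ennreal (slowness \<eta> w1 w2 (P q))) \<in> borel_measurable borel"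
  using coord_perm_measurable[of P] by (auto intro!: measurable_compose[OF _ straighten_measurable(3)])

lemma two_zone_coord_perm: "two_zone W D P \<eta> w1 w2 U \<Longrightarrow> coord_perm P"
  by (simp add: two_zone_def)

lemma reach_crossing_subset:
  assumes tz: "two_zone W D P \<eta> w1 w2 U" and n: "0 < snd (P w1) * snd (P w2)"
  shows "reach L (krasovskii W) U t0 t1 E \<subseteq> carry P \<eta> (P w1) (P w2) (sgn (snd (P w1)) * (t1 - t0)) ` E \<inter> U"
proof
  fix q assume "q \<in> reach L (krasovskii W) U t0 t1 E"
  then obtain \<psi> where \<psi>: "inclusion_solution L (krasovskii W) {min t0 t1..max t0 t1} \<psi>"
    "\<psi> ` {min t0 t1..max t0 t1} \<subseteq> U" "\<psi> t0 \<in> E" "q = \<psi> t1" by (auto simp: reach_def closed_segment_real)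
  have "q = carry P \<eta> (P w1) (P w2) (sgn (snd (P w1)) * (t1 - t0)) (\<psi> t0)"
    unfolding \<psi>(4) by (rule two_zone_crossing(2)[OF tz \<psi>(1,2) n]) auto
  moreover have "q \<in> U" using \<psi> by auto
  ultimately show "q \<in> carry P \<eta> (P w1) (P w2) (sgn (snd (P w1)) * (t1 - t0)) ` E \<inter> U" using \<psi> by blast
qed

text \<open>The factors \<open>c1\<close> and \<open>c2\<close> between weight and slowness are the
  fluxes through the line on the side of \<open>E\<close> and on the side of the image;
  \<open>carry\<close> preserves the measure whose density is the slowness. Equal fluxes give
  invariance, and unequal ones the inequality that later forces them to agree.\<close>

lemma outer_reach_crossing:
  fixes wt :: "real \<times> real \<Rightarrow> ennreal"
  assumes tz: "two_zone W D P \<eta> w1 w2 U" and n: "0 < snd (P w1) * snd (P w2)"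
    and wt[measurable]: "wt \<in> borel_measurable borel" and E: "E \<in> sets borel" "E \<subseteq> U"
    and X: "reach L (krasovskii W) U t0 t1 E \<subseteq> X" "X \<in> sets borel"
    and w1: "AE q in lborel. q \<in> E \<longrightarrow> wt q = c1 * ennreal (slowness \<eta> (P w1) (P w2) (P q))"
    and w2: "AE q in lborel. q \<in> X \<inter> U \<longrightarrow> wt q = c2 * ennreal (slowness \<eta> (P w1) (P w2) (P q))"
  shows "c1 * outer_measure_of (density lborel wt) (reach L (krasovskii W) U t0 t1 E) \<le>
    c2 * emeasure (density lborel wt) E"
proof -
  have P: "coord_perm P" using tz by (rule two_zone_coord_perm)
  have n0: "snd (P w1) \<noteq> 0" "snd (P w2) \<noteq> 0" using n by auto
  note sm = slow_measurable[OF P]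
  define Y where "Y = X \<inter> U \<inter> carry P \<eta> (P w1) (P w2) (sgn (snd (P w1)) * (t1 - t0)) ` E"
  let ?N = "slow_measure P \<eta> (P w1) (P w2)"
  have U: "U \<in> sets borel" using tz by (auto simp: two_zone_def)
  have cE: "carry P \<eta> (P w1) (P w2) s ` E \<in> sets borel" for s by (rule carry_image_measurable[OF P n0 E(1)])
  have Y: "Y \<in> sets borel" unfolding Y_def by (intro sets.Int X U cE)
  have w2': "AE q in lborel. q \<in> Y \<longrightarrow> wt q = c2 * ennreal (slowness \<eta> (P w1) (P w2) (P q))"
    using w2 by eventually_elim (auto simp: Y_def)
  have "outer_measure_of (density lborel wt) (reach L (krasovskii W) U t0 t1 E) \<le> outer_measure_of (density lborel wt) Y"
    using reach_crossing_subset[OF tz n, of L t0 t1 E] X unfolding Y_def by (intro outer_measure_of_mono) auto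
  also have "\<dots> = emeasure (density lborel wt) Y" using Y by simp
  also have "\<dots> = c2 * emeasure ?N Y" by (rule emeasure_density_proportional[OF wt sm Y w2'])
  also have "emeasure ?N Y \<le> emeasure ?N (carry P \<eta> (P w1) (P w2) (sgn (snd (P w1)) * (t1 - t0)) ` E)"
    using cE by (intro emeasure_mono) (auto simp: Y_def)
  also have "\<dots> = emeasure ?N E" by (rule emeasure_carry[OF P n0 E(1)])
  finally have "c1 * outer_measure_of (density lborel wt) (reach L (krasovskii W) U t0 t1 E) \<le> c1 * (c2 * emeasure ?N E)"
    by (simp add: mult_left_mono)
  also have "\<dots> = c2 * (c1 * emeasure ?N E)" by (simp add: ac_simps)
  also have "c1 * emeasure ?N E = emeasure (density lborel wt) E"
    by (rule emeasure_density_proportional[OF wt sm E(1) w1, symmetric])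
  finally show ?thesis .
qed

lemma AE_not_line: "coord_perm P \<Longrightarrow> AE q in lborel. snd (P q) \<noteq> \<eta>"
  using AE_not_in[OF line_null[of P \<eta>]] by simp

lemma line_solution:
  assumes w: "norm w \<le> L" and ae: "AE t in lborel. t \<in> {a..b} \<longrightarrow> p + (t - \<theta>) *\<^sub>R w \<notin> D \<and> W (p + (t - \<theta>) *\<^sub>R w) = w"
    and \<psi>: "\<And>t. t \<in> {a..b} \<Longrightarrow> \<psi> t = p + (t - \<theta>) *\<^sub>R w"
  shows "inclusion_solution L (off_field W D) {a..b} \<psi>"
proof -
  have "inclusion_solution L (off_field W D) {a..b} (\<lambda>t. p + (t - \<theta>) *\<^sub>R w)"
    unfolding inclusion_solution_def
  proof
    show "L-lipschitz_on {a..b} (\<lambda>t. p + (t - \<theta>) *\<^sub>R w)"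
    proof (rule lipschitz_onI)
      fix s t :: real
      have "dist (p + (s - \<theta>) *\<^sub>R w) (p + (t - \<theta>) *\<^sub>R w) = norm ((s - t) *\<^sub>R w)"
        by (simp add: dist_norm algebra_simps)
      then show "dist (p + (s - \<theta>) *\<^sub>R w) (p + (t - \<theta>) *\<^sub>R w) \<le> L * dist s t"
        using w by (simp add: dist_real_def mult_right_mono mult.commute[of "\<bar>s - t\<bar>"])
    qed (use w norm_ge_zero order_trans in blast)
    show "AE t in lborel. t \<in> {a..b} \<longrightarrow> (\<exists>v\<in>off_field W D (p + (t - \<theta>) *\<^sub>R w).
        ((\<lambda>t. p + (t - \<theta>) *\<^sub>R w) has_vector_derivative v) (at t within {a..b}))"
      using ae
    proof eventually_elim
      case (elim t)
      have "((\<lambda>t. p + (t - \<theta>) *\<^sub>R w) has_vector_derivative w) (at t within {a..b})"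
        by (auto intro!: derivative_eq_intros)
      then show ?case using elim by (auto simp: off_field_def)
    qed
  qed
  then show ?thesis by (rule inclusion_solution_cong) (use \<psi> in auto)
qed

lemma inclusion_solution_glue':
  assumes "\<theta> > a \<Longrightarrow> inclusion_solution L V {a..min \<theta> b} \<psi>" "\<theta> < b \<Longrightarrow> inclusion_solution L V {max \<theta> a..b} \<psi>" "a \<le> b"
    "a < b"
  shows "inclusion_solution L V {a..b} \<psi>"
proof -
  consider "\<theta> \<le> a" | "b \<le> \<theta>" | "a < \<theta>" "\<theta> < b" by linarith
  then show ?thesis
  proof cases
    case 3 then show ?thesis using assms by (intro inclusion_solution_glue[of L V a \<theta> \<psi> b]) auto
  qed (use assms in \<open>auto simp: min_def max_def split: if_splits\<close>)
qed

lemma two_zone_crossing_exists: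
  assumes tz: "two_zone W D P \<eta> w1 w2 U" and n: "0 < snd (P w1) * snd (P w2)"
    and w: "norm w1 \<le> L" "norm w2 \<le> L" and \<epsilon>: "\<epsilon> > 0" and U: "cball q (L * \<epsilon>) \<subseteq> U"
  shows "\<exists>\<psi>. inclusion_solution L (off_field W D) {\<tau> - \<epsilon>..\<tau> + \<epsilon>} \<psi> \<and> \<psi> \<tau> = q"
proof -
  have P: "coord_perm P" using tz by (rule two_zone_coord_perm)
  note Ps = coord_perm_simps[OF P]
  have n0: "snd (P w1) \<noteq> 0" "snd (P w2) \<noteq> 0" using n by auto
  define w0 where "w0 = (if snd (P q) \<le> \<eta> then w1 else w2)"
  \<comment> \<open>\<open>\<theta>\<close> is the time at which the straight motion through
    \<open>q\<close>, with the velocity of its own zone, meets the line, and \<open>b\<close> below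
    is the meeting point. If \<open>\<theta>\<close> lies outside the time interval, no bend occurs
    there.\<close>
  define \<theta> where "\<theta> = \<tau> - (snd (P q) - \<eta>) / snd (P w0)"
  define b where "b = q - (\<tau> - \<theta>) *\<^sub>R w0"
  \<comment> \<open>The zone traversed before \<open>\<theta>\<close> is the lower one exactly if
    the field points upward.\<close>
  define wa wb where "wa = (if snd (P w1) > 0 then w1 else w2)" and "wb = (if snd (P w1) > 0 then w2 else w1)"
  define \<psi> where "\<psi> t = b + (t - \<theta>) *\<^sub>R (if t \<le> \<theta> then wa else wb)" for t
  have w0: "snd (P w0) \<noteq> 0" using n0 by (simp add: w0_def)
  have Pb: "snd (P b) = \<eta>"
  proof -
    have "P b = P q - (\<tau> - \<theta>) *\<^sub>R P w0"
      unfolding b_def using linear_diff[OF bounded_linear.linear[OF coord_perm_bounded_linear[OF P]]]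
        Ps(4) by simp
    then show ?thesis using w0 by (simp add: \<theta>_def)
  qed
  have PP: "snd (P (b + s *\<^sub>R v)) = \<eta> + s * snd (P v)" for s v by (simp add: Ps Pb)
  have \<psi>\<tau>: "\<psi> \<tau> = q"
  proof (cases "\<tau> = \<theta>")
    case True then show ?thesis by (simp add: \<psi>_def b_def)
  next
    case False
    have "(if \<tau> \<le> \<theta> then wa else wb) = w0"
    proof -
      have "(snd (P q) - \<eta>) / snd (P w0) \<noteq> 0" "\<tau> \<le> \<theta> \<longleftrightarrow> (snd (P q) - \<eta>) / snd (P w0) \<le> 0"
        using False by (auto simp: \<theta>_def)
      then show ?thesis using n unfolding w0_def wa_def wb_def
        by (auto simp: divide_le_0_iff zero_less_mult_iff split: if_splits)
    qed
    then show ?thesis by (simp add: \<psi>_def b_def)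
  qed
  have nw: "norm wa \<le> L" "norm wb \<le> L" using w by (auto simp: wa_def wb_def)
  have L: "0 \<le> L" using w norm_ge_zero order_trans by blast
  have lip: "L-lipschitz_on UNIV \<psi>"
  proof -
    have *: "dist (\<psi> s) (\<psi> t) \<le> L * \<bar>s - t\<bar>" if st: "s \<le> t" for s t
    proof -
      consider "t \<le> \<theta>" | "\<theta> < s" | "s \<le> \<theta>" "\<theta> < t" using st by linarith
      then show ?thesis
      proof cases
        case 1
        then have "dist (\<psi> s) (\<psi> t) = norm ((s - t) *\<^sub>R wa)"
          using st by (simp add: \<psi>_def dist_norm algebra_simps)
        then show ?thesis using nw st by (simp add: mult.commute[of L] mult_left_mono)
      next
        case 2
        then have "dist (\<psi> s) (\<psi> t) = norm ((s - t) *\<^sub>R wb)"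
          using st by (simp add: \<psi>_def dist_norm algebra_simps)
        then show ?thesis using nw st by (simp add: mult.commute[of L] mult_left_mono)
      next
        case 3
        then have "dist (\<psi> s) (\<psi> t) = norm ((s - \<theta>) *\<^sub>R wa - (t - \<theta>) *\<^sub>R wb)"
          by (simp add: \<psi>_def dist_norm)
        also have "\<dots> \<le> norm ((s - \<theta>) *\<^sub>R wa) + norm ((t - \<theta>) *\<^sub>R wb)" by (rule norm_triangle_ineq4)
        also have "\<dots> = (\<theta> - s) * norm wa + (t - \<theta>) * norm wb" using 3 by simp
        also have "\<dots> \<le> (\<theta> - s) * L + (t - \<theta>) * L" using 3 nw by (intro add_mono mult_left_mono) auto
        finally show ?thesis using 3 by (simp add: algebra_simps)
      qed
    qed
    show ?thesis
    proof (rule lipschitz_onI)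
      fix s t show "dist (\<psi> s) (\<psi> t) \<le> L * dist s t"
        using *[of s t] *[of t s] by (cases "s \<le> t") (auto simp: dist_real_def dist_commute abs_minus_commute)
    qed fact
  qed
  have inU: "\<psi> t \<in> U" if "t \<in> {\<tau> - \<epsilon>..\<tau> + \<epsilon>}" for t
  proof -
    have "dist q (\<psi> t) \<le> L * dist \<tau> t" using lipschitz_onD[OF lip, of \<tau> t] \<psi>\<tau> by simp
    also have "\<dots> \<le> L * \<epsilon>" using that L by (intro mult_left_mono) (auto simp: dist_real_def)
    finally show ?thesis using U by auto
  qed
  have "inclusion_solution L (off_field W D) {\<tau> - \<epsilon>..\<tau> + \<epsilon>} \<psi>"
  proof (rule inclusion_solution_glue'[where \<theta>=\<theta>])
    show "\<tau> - \<epsilon> \<le> \<tau> + \<epsilon>" "\<tau> - \<epsilon> < \<tau> + \<epsilon>" using \<epsilon> by auto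
    have off: "b + (t - \<theta>) *\<^sub>R v \<notin> D \<and> W (b + (t - \<theta>) *\<^sub>R v) = v"
      if "t \<in> {\<tau> - \<epsilon>..\<tau> + \<epsilon>}" "t < \<theta> \<and> v = wa \<or> \<theta> < t \<and> v = wb" for t v
    proof -
      have e: "\<psi> t = b + (t - \<theta>) *\<^sub>R v" using that by (auto simp: \<psi>_def)
      have "snd (P (\<psi> t)) = \<eta> + (t - \<theta>) * snd (P v)" unfolding e by (rule PP)
      then have "snd (P (\<psi> t)) < \<eta> \<and> v = w1 \<or> snd (P (\<psi> t)) > \<eta> \<and> v = w2"
        using that(2) n unfolding wa_def wb_def
        by (auto simp: zero_less_mult_iff mult_less_0_iff split: if_splits)
      then show ?thesis using tz inU[OF that(1)] unfolding e two_zone_def by blast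
    qed
    show "inclusion_solution L (off_field W D) {\<tau> - \<epsilon>..min \<theta> (\<tau> + \<epsilon>)} \<psi>"
    proof (rule line_solution[OF nw(1)])
      show "AE t in lborel. t \<in> {\<tau> - \<epsilon>..min \<theta> (\<tau> + \<epsilon>)} \<longrightarrow> b + (t - \<theta>) *\<^sub>R wa \<notin> D \<and> W (b + (t - \<theta>) *\<^sub>R wa) = wa"
        using AE_lborel_singleton[of \<theta>]
      proof eventually_elim
        case (elim t) then show ?case using off[of t wa] by auto
      qed
    qed (simp add: \<psi>_def)
    show "inclusion_solution L (off_field W D) {max \<theta> (\<tau> - \<epsilon>)..\<tau> + \<epsilon>} \<psi>"
    proof (rule line_solution[OF nw(2)])
      show "AE t in lborel. t \<in> {max \<theta> (\<tau> - \<epsilon>)..\<tau> + \<epsilon>} \<longrightarrow> b + (t - \<theta>) *\<^sub>R wb \<notin> D \<and> W (b + (t - \<theta>) *\<^sub>R wb) = wb"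
        using AE_lborel_singleton[of \<theta>]
      proof eventually_elim
        case (elim t) then show ?case using off[of t wb] by auto
      qed
    qed (auto simp: \<psi>_def)
  qed
  then show ?thesis using \<psi>\<tau> by blast
qed

lemma nearby_ball:
  assumes "open U" "p \<in> U" "(L::real) \<ge> 0"
  shows "\<exists>\<epsilon>>0. \<exists>\<rho>>0. \<forall>q\<in>ball p \<rho>. cball q (L * \<epsilon>) \<subseteq> U"
proof -
  obtain r where r: "r > 0" "ball p r \<subseteq> U" using assms open_contains_ball by blast
  define e where "e = r / (2 * (L + 1))"
  have e: "e > 0" "L * e < r / 2"
  proof -
    show "e > 0" using r assms by (simp add: e_def)
    then have "L * e < (L + 1) * e" by simp
    also have "\<dots> = r / 2" using assms by (simp add: e_def field_simps)
    finally show "L * e < r / 2" .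
  qed
  have "cball q (L * e) \<subseteq> U" if "q \<in> ball p (r / 2)" for q
  proof
    fix x assume "x \<in> cball q (L * e)"
    then have "dist p x < r" using that e(2) dist_triangle[of p x q] by auto
    then show "x \<in> U" using r by auto
  qed
  then show ?thesis using e r by (intro exI[of _ e] conjI exI[of _ "r/2"]) auto
qed

text \<open>The constant \<open>k\<close> is the flux through the line, equal from both sides; it
  makes the weight a multiple of the slowness, which \<open>carry\<close> preserves. A function of
  the first straightening coordinate is conserved because that coordinate is.\<close>

lemma crossing_flow_box:
  fixes wt :: "real \<times> real \<Rightarrow> ennreal"
  assumes tz: "two_zone W D P \<eta> w1 w2 U" and n: "0 < snd (P w1) * snd (P w2)"
    and w: "norm w1 \<le> L" "norm w2 \<le> L" and wt: "wt \<in> borel_measurable borel"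
    and wt1: "\<And>q. q \<in> U \<Longrightarrow> snd (P q) < \<eta> \<Longrightarrow> wt q = ennreal (k / \<bar>snd (P w1)\<bar>)"
    and wt2: "\<And>q. q \<in> U \<Longrightarrow> snd (P q) > \<eta> \<Longrightarrow> wt q = ennreal (k / \<bar>snd (P w2)\<bar>)"
    and k: "k > 0"
    and F: "\<And>q. q \<in> U \<Longrightarrow> F q = F1 (fst (straighten \<eta> (P w1) (P w2) (P q)))"
  shows "flow_box L W D wt F C U"
  unfolding flow_box_def
proof (intro conjI allI impI ballI)
  have P: "coord_perm P" using tz by (rule two_zone_coord_perm)
  show U: "open U" using tz by (simp add: two_zone_def)
  show "outer_measure_of (density lborel wt) (reach L (krasovskii W) U t0 t1 E) \<le> emeasure (density lborel wt) E"
    if E: "E \<in> sets borel" "E \<subseteq> U" for t0 t1 E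
  proof -
    have ae: "AE q in lborel. q \<in> U \<longrightarrow> wt q = ennreal k * ennreal (slowness \<eta> (P w1) (P w2) (P q))"
      using AE_not_line[OF P, of \<eta>]
    proof eventually_elim
      case (elim q)
      then show ?case using wt1[of q] wt2[of q] k
        by (cases "snd (P q) < \<eta>") (auto simp: slowness_def ennreal_mult[symmetric])
    qed
    have "ennreal k * outer_measure_of (density lborel wt) (reach L (krasovskii W) U t0 t1 E) \<le>
      ennreal k * emeasure (density lborel wt) E"
    proof (rule outer_reach_crossing[OF tz n wt E, where X=UNIV])
      show "AE q in lborel. q \<in> E \<longrightarrow> wt q = ennreal k * ennreal (slowness \<eta> (P w1) (P w2) (P q))"
        using ae by eventually_elim (use E in auto)
      show "AE q in lborel. q \<in> UNIV \<inter> U \<longrightarrow> wt q = ennreal k * ennreal (slowness \<eta> (P w1) (P w2) (P q))"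
        using ae by simp
    qed auto
    then show ?thesis using k by (simp add: ennreal_mult_le_mult_iff)
  qed
  show "F (\<psi> t1) = F (\<psi> t0)"
    if sol: "inclusion_solution L (krasovskii W) {c..d} \<psi>" "\<psi> ` {c..d} \<subseteq> U" "t0 \<in> {c..d}" "t1 \<in> {c..d}" for c d \<psi> t0 t1
  proof -
    have "\<psi> t0 \<in> U" "\<psi> t1 \<in> U" using sol by auto
    then show ?thesis using two_zone_crossing(1)[OF tz sol(1,2) n sol(3,4)] by (simp add: F)
  qed
  show "\<exists>\<epsilon>>0. \<exists>\<rho>>0. \<forall>q\<in>ball p \<rho>. F q \<notin> C \<longrightarrow>
        (\<forall>\<tau>. \<exists>\<psi>. inclusion_solution L (off_field W D) {\<tau> - \<epsilon>..\<tau> + \<epsilon>} \<psi> \<and> \<psi> \<tau> = q)" if "p \<in> U" for p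
    using nearby_ball[OF U that, of L] two_zone_crossing_exists[OF tz n w] w(1) norm_ge_zero order_trans by meson
qed

text \<open>Nothing crosses the line, so the weights on its two sides are unrelated: each zone is
  translated along itself. Starting points on the line stay on it, which is a null set, and the
  question of existence for them is avoided by having their levels in \<open>C\<close>.\<close>

lemma tangential_flow_box:
  fixes wt :: "real \<times> real \<Rightarrow> ennreal"
  assumes tz: "two_zone W D P \<eta> w1 w2 U" and n: "snd (P w1) = 0" "snd (P w2) = 0"
    and w: "norm w1 \<le> L" "norm w2 \<le> L" and wt[measurable]: "wt \<in> borel_measurable borel"
    and wt1: "\<And>q. q \<in> U \<Longrightarrow> snd (P q) < \<eta> \<Longrightarrow> wt q = k1"
    and wt2: "\<And>q. q \<in> U \<Longrightarrow> snd (P q) > \<eta> \<Longrightarrow> wt q = k2"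
    and F: "\<And>q. q \<in> U \<Longrightarrow> F q = F1 (snd (P q))"
    and C: "\<And>q. q \<in> U \<Longrightarrow> snd (P q) = \<eta> \<Longrightarrow> F q \<in> C"
  shows "flow_box L W D wt F C U"
  unfolding flow_box_def
proof (intro conjI allI impI ballI)
  have P: "coord_perm P" using tz by (rule two_zone_coord_perm)
  note Ps = coord_perm_simps[OF P]
  have [measurable]: "P \<in> borel_measurable borel" using P by (rule coord_perm_measurable)
  show U: "open U" using tz by (simp add: two_zone_def)
  note Z[measurable] = coord_half_planes_borel[OF P, of \<eta>]
  show "outer_measure_of (density lborel wt) (reach L (krasovskii W) U t0 t1 E) \<le> emeasure (density lborel wt) E"
    if E[measurable]: "E \<in> sets borel" and EU: "E \<subseteq> U" for t0 t1 E
  proof -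
    let ?\<nu> = "density lborel wt"
    have [measurable]: "U \<in> sets borel" using U by auto
    define A B A' B' where "A = E \<inter> {q. snd (P q) < \<eta>}" and "B = E \<inter> {q. snd (P q) > \<eta>}"
      and "A' = {q. q - (t1 - t0) *\<^sub>R w1 \<in> A} \<inter> U" and "B' = {q. q - (t1 - t0) *\<^sub>R w2 \<in> B} \<inter> U"
    have AB[measurable]: "A \<in> sets borel" "B \<in> sets borel" by (simp_all add: A_def B_def)
    have tr: "{q. q - v \<in> X} \<in> sets borel" if "X \<in> sets borel" for v :: "real \<times> real" and X
      using measurable_sets_borel[of "\<lambda>q. q - v" borel X] that by (simp add: vimage_def)
    have AB': "A' \<in> sets borel" "B' \<in> sets borel" unfolding A'_def B'_def using tr AB by auto
    have tm: "emeasure lborel {q. q - v \<in> X} = emeasure lborel X" if X: "X \<in> sets borel" for v :: "real \<times> real" and X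
    proof -
      have "emeasure lborel {q. q - v \<in> X} = (\<integral>\<^sup>+q. indicator X (q + - v) \<partial>lborel)"
      proof -
        have "(\<integral>\<^sup>+q. indicator X (q + - v) \<partial>lborel) = (\<integral>\<^sup>+q. indicator {q. q - v \<in> X} q \<partial>(lborel :: (real \<times> real) measure))"
          by (rule nn_integral_cong) (simp add: indicator_def)
        then show ?thesis using tr[OF X] by simp
      qed
      also have "\<dots> = (\<integral>\<^sup>+q. indicator X q \<partial>lborel)" by (rule nn_integral_translate) (use X in measurable)
      finally show ?thesis using X by simp
    qed
    have const: "emeasure ?\<nu> X = k * emeasure lborel X" if X: "X \<in> sets borel" "\<And>q. q \<in> X \<Longrightarrow> wt q = k" for X k
      using emeasure_density_proportional[OF wt borel_measurable_const[of 1] X(1), of k] X(2)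
      by (simp add: density_1)
    have PA: "snd (P q) = snd (P (q - (t1 - t0) *\<^sub>R w1))" "snd (P q) = snd (P (q - (t1 - t0) *\<^sub>R w2))" for q
      using linear_diff[OF bounded_linear.linear[OF coord_perm_bounded_linear[OF P]]] n by (auto simp: Ps)
    have sub: "reach L (krasovskii W) U t0 t1 E \<subseteq> A' \<union> B' \<union> {q. snd (P q) = \<eta>}"
    proof
      fix q assume "q \<in> reach L (krasovskii W) U t0 t1 E"
      then obtain \<psi> where \<psi>: "inclusion_solution L (krasovskii W) {min t0 t1..max t0 t1} \<psi>"
        "\<psi> ` {min t0 t1..max t0 t1} \<subseteq> U" "\<psi> t0 \<in> E" "q = \<psi> t1" by (auto simp: reach_def closed_segment_real)
      have t: "t0 \<in> {min t0 t1..max t0 t1}" "t1 \<in> {min t0 t1..max t0 t1}" by auto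
      note T = two_zone_tangential[OF tz \<psi>(1,2) n t]
      have "q \<in> U" using \<psi> by auto
      consider "snd (P (\<psi> t0)) < \<eta>" | "snd (P (\<psi> t0)) > \<eta>" | "snd (P (\<psi> t0)) = \<eta>" by linarith
      then show "q \<in> A' \<union> B' \<union> {q. snd (P q) = \<eta>}"
        using T \<psi> \<open>q \<in> U\<close> by cases (auto simp: A'_def B'_def A_def B_def)
    qed
    have "outer_measure_of ?\<nu> (reach L (krasovskii W) U t0 t1 E) \<le> outer_measure_of ?\<nu> (A' \<union> B' \<union> {q. snd (P q) = \<eta>})"
      by (rule outer_measure_of_mono[OF sub])
    also have "\<dots> = emeasure ?\<nu> (A' \<union> B' \<union> {q. snd (P q) = \<eta>})" using AB' Z by simp
    also have "\<dots> \<le> emeasure ?\<nu> A' + emeasure ?\<nu> B' + emeasure ?\<nu> {q. snd (P q) = \<eta>}"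
      using AB' Z by (intro order_trans[OF emeasure_subadditive] add_right_mono) auto
    also have "emeasure ?\<nu> {q. snd (P q) = \<eta>} = 0"
      using line_null[OF P, of \<eta>] Z by (subst emeasure_density) (auto intro!: nn_integral_null_set)
    also have "emeasure ?\<nu> A' = k1 * emeasure lborel A'"
      by (rule const) (use AB' wt1 PA(1) in \<open>auto simp: A'_def A_def\<close>)
    also have "\<dots> \<le> k1 * emeasure lborel A"
      unfolding tm[OF AB(1), of "(t1 - t0) *\<^sub>R w1", symmetric]
      using tr[OF AB(1)] by (intro mult_left_mono emeasure_mono) (auto simp: A'_def)
    also have "k1 * emeasure lborel A = emeasure ?\<nu> A"
      by (rule const[symmetric]) (use AB wt1 EU in \<open>auto simp: A_def\<close>)
    also have "emeasure ?\<nu> B' = k2 * emeasure lborel B'"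
      by (rule const) (use AB' wt2 PA(2) in \<open>auto simp: B'_def B_def\<close>)
    also have "\<dots> \<le> k2 * emeasure lborel B"
      unfolding tm[OF AB(2), of "(t1 - t0) *\<^sub>R w2", symmetric]
      using tr[OF AB(2)] by (intro mult_left_mono emeasure_mono) (auto simp: B'_def)
    also have "k2 * emeasure lborel B = emeasure ?\<nu> B"
      by (rule const[symmetric]) (use AB wt2 EU in \<open>auto simp: B_def\<close>)
    also have "emeasure ?\<nu> A + emeasure ?\<nu> B + 0 = emeasure ?\<nu> (A \<union> B)"
      using AB by (subst plus_emeasure) (auto simp: A_def B_def)
    also have "\<dots> \<le> emeasure ?\<nu> E" by (intro emeasure_mono) (auto simp: A_def B_def)
    finally show ?thesis by (simp add: add_left_mono add_right_mono)
  qed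
  show "F (\<psi> t1) = F (\<psi> t0)"
    if sol: "inclusion_solution L (krasovskii W) {c..d} \<psi>" "\<psi> ` {c..d} \<subseteq> U" "t0 \<in> {c..d}" "t1 \<in> {c..d}" for c d \<psi> t0 t1
  proof -
    have "\<psi> t0 \<in> U" "\<psi> t1 \<in> U" using sol by auto
    then show ?thesis using two_zone_tangential(1)[OF tz sol(1,2) n sol(3,4)] by (simp add: F)
  qed
  have L: "L \<ge> 0" using w norm_ge_zero order_trans by blast
  have ex: "\<exists>\<psi>. inclusion_solution L (off_field W D) {\<tau> - \<epsilon>..\<tau> + \<epsilon>} \<psi> \<and> \<psi> \<tau> = q"
    if q: "cball q (L * \<epsilon>) \<subseteq> U" "F q \<notin> C" and e: "\<epsilon> > 0" for \<epsilon> \<tau> q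
  proof -
    define v where "v = (if snd (P q) < \<eta> then w1 else w2)"
    have v: "norm v \<le> L" "snd (P v) = 0" using w n by (auto simp: v_def)
    have qU: "q \<in> U" using q L e by auto
    have "inclusion_solution L (off_field W D) {\<tau> - \<epsilon>..\<tau> + \<epsilon>} (\<lambda>t. q + (t - \<tau>) *\<^sub>R v)"
    proof (rule line_solution[OF v(1)])
      have "q + (t - \<tau>) *\<^sub>R v \<notin> D \<and> W (q + (t - \<tau>) *\<^sub>R v) = v" if t: "t \<in> {\<tau> - \<epsilon>..\<tau> + \<epsilon>}" for t
      proof -
        have "norm ((t - \<tau>) *\<^sub>R v) \<le> \<epsilon> * L" using t v L e by (simp add: mult_mono abs_le_iff)
        then have "q + (t - \<tau>) *\<^sub>R v \<in> U" using q by (auto simp: dist_norm mult.commute)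
        moreover have "snd (P (q + (t - \<tau>) *\<^sub>R v)) = snd (P q)" by (simp add: Ps v)
        moreover have "snd (P q) \<noteq> \<eta>" using C[OF qU] q by auto
        ultimately show ?thesis using tz unfolding two_zone_def v_def by (metis linorder_neqE_linordered_idom)
      qed
      then show "AE t in lborel. t \<in> {\<tau> - \<epsilon>..\<tau> + \<epsilon>} \<longrightarrow>
          q + (t - \<tau>) *\<^sub>R v \<notin> D \<and> W (q + (t - \<tau>) *\<^sub>R v) = v" by auto
    qed simp
    then show ?thesis by (intro exI[of _ "\<lambda>t. q + (t - \<tau>) *\<^sub>R v"]) simp
  qed
  show "\<exists>\<epsilon>>0. \<exists>\<rho>>0. \<forall>q\<in>ball p \<rho>. F q \<notin> C \<longrightarrow>
        (\<forall>\<tau>. \<exists>\<psi>. inclusion_solution L (off_field W D) {\<tau> - \<epsilon>..\<tau> + \<epsilon>} \<psi> \<and> \<psi> \<tau> = q)" if "p \<in> U" for p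
    using nearby_ball[OF U that L] ex by meson
qed

section \<open>Planar systems with a first integral\<close>

lemma outer_measure_of_countably_subadditive:
  assumes "\<And>i::nat. A i \<subseteq> space M"
  shows "outer_measure_of M (\<Union>i. A i) \<le> (\<Sum>i. outer_measure_of M (A i))"
proof -
  obtain B where B: "\<And>i. B i \<in> sets M" "\<And>i. A i \<subseteq> B i" "\<And>i. outer_measure_of M (A i) = emeasure M (B i)"
    using outer_measure_of_attain[OF assms] by metis
  have "outer_measure_of M (\<Union>i. A i) \<le> outer_measure_of M (\<Union>i. B i)"
    using B by (intro outer_measure_of_mono) blast
  also have "\<dots> = emeasure M (\<Union>i. B i)" using B by (intro outer_measure_of_eq) auto
  also have "\<dots> \<le> (\<Sum>i. emeasure M (B i))" using B by (intro emeasure_subadditive_countably) auto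
  finally show ?thesis by (simp add: B)
qed

lemma outer_measure_of_Un_null:
  assumes "A \<subseteq> space M" "N \<in> null_sets M"
  shows "outer_measure_of M (A \<union> N) = outer_measure_of M A"
proof (rule antisym)
  obtain B where B: "B \<in> sets M" "A \<subseteq> B" "outer_measure_of M A = emeasure M B"
    using outer_measure_of_attain[OF assms(1)] by metis
  have "outer_measure_of M (A \<union> N) \<le> outer_measure_of M (B \<union> N)" using B by (intro outer_measure_of_mono) auto
  also have "\<dots> = emeasure M (B \<union> N)" using B assms by (intro outer_measure_of_eq) auto
  also have "\<dots> = emeasure M B" using B assms by (simp add: emeasure_Un_null_set)
  finally show "outer_measure_of M (A \<union> N) \<le> outer_measure_of M A" using B by simp
qed (auto intro: outer_measure_of_mono)

lemma inclusion_solution_singleton: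
  assumes "L \<ge> 0" shows "inclusion_solution L V {\<tau>..\<tau>} \<psi>"
  unfolding inclusion_solution_def
proof
  show "L-lipschitz_on {\<tau>..\<tau>} \<psi>" using assms by (simp add: lipschitz_on_def)
  show "AE t in lborel. t \<in> {\<tau>..\<tau>} \<longrightarrow> (\<exists>v\<in>V (\<psi> t). (\<psi> has_vector_derivative v) (at t within {\<tau>..\<tau>}))"
    using AE_lborel_singleton[of \<tau>] by eventually_elim auto
qed

lemma inclusion_solution_join:
  assumes "inclusion_solution L V {a..b} \<psi>" "inclusion_solution L V {b..c} \<phi>" "\<psi> b = \<phi> b" "a \<le> b" "b \<le> c"
  shows "inclusion_solution L V {a..c} (\<lambda>t. if t \<le> b then \<psi> t else \<phi> t)"
proof (rule inclusion_solution_glue[OF _ _ assms(4,5)])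
  show "inclusion_solution L V {a..b} (\<lambda>t. if t \<le> b then \<psi> t else \<phi> t)"
    by (rule inclusion_solution_cong[OF assms(1)]) auto
  show "inclusion_solution L V {b..c} (\<lambda>t. if t \<le> b then \<psi> t else \<phi> t)"
    by (rule inclusion_solution_cong[OF assms(2)]) (use assms(3) in auto)
qed

lemma off_field_subset_krasovskii: "off_field W D p \<subseteq> krasovskii W p"
  by (auto simp: off_field_def krasovskii_def intro!: hull_inc)

lemma krasovskii_norm_le:
  assumes "\<And>p. norm (W p) \<le> L" "v \<in> krasovskii W p"
  shows "norm v \<le> L"
proof -
  have "v \<in> convex hull (W ` ball p 1)" using assms(2) unfolding krasovskii_def by (rule INT_D) simp
  also have "convex hull (W ` ball p 1) \<subseteq> cball 0 L"
    using assms(1) by (intro hull_minimal) auto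
  finally show ?thesis by simp
qed

lemma solution_dist_le:
  "inclusion_solution L V I \<psi> \<Longrightarrow> s \<in> I \<Longrightarrow> t \<in> I \<Longrightarrow> dist (\<psi> s) (\<psi> t) \<le> L * \<bar>s - t\<bar>"
  by (auto simp: inclusion_solution_def dist_real_def dest: lipschitz_onD)

text \<open>Flow boxes are assumed off \<open>Cn\<close> only. A compact curve that avoids this
  closed set keeps a positive distance from it, and one that meets it is confined to the null set of
  exceptional levels.\<close>

locale planar_system =
  fixes W :: "real \<times> real \<Rightarrow> real \<times> real" and D :: "(real \<times> real) set" and L :: real
    and wt :: "real \<times> real \<Rightarrow> ennreal" and F :: "real \<times> real \<Rightarrow> real" and Cn :: "(real \<times> real) set"
  assumes L_pos: "L > 0" and W_le: "\<And>p. norm (W p) \<le> L"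
    and wt[measurable]: "wt \<in> borel_measurable borel"
    and Cn: "closed Cn" "countable Cn" and F_cont: "continuous_on UNIV F"
    and boxes: "\<And>p. p \<notin> Cn \<Longrightarrow> \<exists>U. p \<in> U \<and> flow_box L W D wt F (F ` Cn) U"
    and level_null: "{p. F p \<in> F ` Cn} \<in> null_sets lborel"
begin

abbreviation "sol I \<psi> \<equiv> inclusion_solution L (krasovskii W) I \<psi>"
abbreviation "osol I \<psi> \<equiv> inclusion_solution L (off_field W D) I \<psi>"
abbreviation "\<nu> \<equiv> density lborel wt"

lemma osol_sol: "osol I \<psi> \<Longrightarrow> sol I \<psi>"
  by (erule inclusion_solution_mono) (rule off_field_subset_krasovskii)

text \<open>The first integral takes countably many values along a solution: countably many on the open
  set of times where a flow box is available, and countably many at the exceptional points.\<close>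

lemma first_integral_constant:
  assumes s: "sol {c..d} \<psi>" and t: "t0 \<in> {c..d}" "t1 \<in> {c..d}"
  shows "F (\<psi> t1) = F (\<psi> t0)"
proof -
  define g where "g t = F (\<psi> t)" for t
  have \<psi>c: "continuous_on {c..d} \<psi>"
    using s lipschitz_on_continuous_on by (auto simp: inclusion_solution_def)
  have gc: "continuous_on {c..d} g" unfolding g_def
    using continuous_on_compose2[OF F_cont \<psi>c] by auto
  define S where "S = {t \<in> {c..d}. \<psi> t \<notin> Cn}"
  have loc: "\<exists>e>0. \<forall>r\<in>{c..d} \<inter> ball t e. g r = g t" if t: "t \<in> S" for t
  proof -
    have tcd: "t \<in> {c..d}" "\<psi> t \<notin> Cn" using t by (auto simp: S_def)
    then obtain U where U: "\<psi> t \<in> U" "flow_box L W D wt F (F ` Cn) U" using boxes by blast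
    then have "open U" by (simp add: flow_box_def)
    then obtain \<epsilon> where \<epsilon>: "\<epsilon> > 0" "ball (\<psi> t) \<epsilon> \<subseteq> U" using U open_contains_ball by blast
    have "g r = g t" if r: "r \<in> {c..d} \<inter> ball t (\<epsilon> / L)" for r
    proof -
      have sub: "{min t r..max t r} \<subseteq> {c..d}" using r tcd by auto
      have "\<psi> u \<in> U" if u: "u \<in> {min t r..max t r}" for u
      proof -
        have "dist (\<psi> t) (\<psi> u) \<le> L * \<bar>t - u\<bar>" using solution_dist_le[OF s tcd(1) subsetD[OF sub u]] .
        also have "\<dots> \<le> L * \<bar>t - r\<bar>" using L_pos u by (intro mult_left_mono) auto
        also have "\<dots> < \<epsilon>" using r L_pos by (simp add: dist_real_def pos_less_divide_eq mult.commute)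
        finally show ?thesis using \<epsilon> by auto
      qed
      then have "\<psi> ` {min t r..max t r} \<subseteq> U" by auto
      moreover have "r \<in> {min t r..max t r}" "t \<in> {min t r..max t r}" by auto
      ultimately show ?thesis
        using U(2) inclusion_solution_subset[OF s sub] unfolding flow_box_def g_def by blast
    qed
    then show ?thesis using \<epsilon> L_pos by (intro exI[of _ "\<epsilon> / L"]) auto
  qed
  then obtain e where e: "\<And>t. t \<in> S \<Longrightarrow> e t > 0" "\<And>t r. t \<in> S \<Longrightarrow> r \<in> {c..d} \<inter> ball t (e t) \<Longrightarrow> g r = g t"
    by metis
  \<comment> \<open>Countably many of the balls cover \<open>S\<close>, and \<open>g\<close> is
    constant on the times in each of them.\<close>
  obtain \<B> where \<B>: "\<B> \<subseteq> (\<lambda>t. ball t (e t)) ` S" "countable \<B>" "\<Union>\<B> = \<Union>((\<lambda>t. ball t (e t)) ` S)"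
    using Lindelof[of "(\<lambda>t. ball t (e t)) ` S"] by auto
  have "countable (g ` ({c..d} \<inter> B))" if B: "B \<in> \<B>" for B
  proof -
    obtain t where "t \<in> S" "B = ball t (e t)" using B \<B>(1) by auto
    then have "g ` ({c..d} \<inter> B) \<subseteq> {g t}" using e(2) by blast
    then show ?thesis by (rule countable_subset) simp
  qed
  then have "countable ((\<Union>B\<in>\<B>. g ` ({c..d} \<inter> B)) \<union> F ` Cn)" using \<B>(2) Cn(2) by simp
  moreover have "g ` {c..d} \<subseteq> (\<Union>B\<in>\<B>. g ` ({c..d} \<inter> B)) \<union> F ` Cn"
  proof
    fix y assume "y \<in> g ` {c..d}"
    then obtain t where ty: "t \<in> {c..d}" "y = g t" by auto
    show "y \<in> (\<Union>B\<in>\<B>. g ` ({c..d} \<inter> B)) \<union> F ` Cn"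
    proof (cases "\<psi> t \<in> Cn")
      case False
      then have "t \<in> S" using ty by (simp add: S_def)
      then have "t \<in> \<Union>\<B>" unfolding \<B>(3) using e(1) by force
      then show ?thesis using ty by blast
    qed (use ty in \<open>auto simp: g_def\<close>)
  qed
  ultimately have "countable (g ` {c..d})" using countable_subset by blast
  \<comment> \<open>A countable connected set of reals has at most one point.\<close>
  moreover have "connected (g ` {c..d})" by (intro connected_continuous_image gc connected_Icc)
  ultimately have "g t1 = g t0" using connected_uncountable[of "g ` {c..d}" "g t1" "g t0"] t by blast
  then show ?thesis by (simp add: g_def)
qed

lemma flow_box_uniform:
  assumes "compact K" "K \<inter> Cn = {}"
  obtains e where "e > 0" "\<And>x. x \<in> K \<Longrightarrow> \<exists>U. flow_box L W D wt F (F ` Cn) U \<and> ball x e \<subseteq> U"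
proof -
  have 1: "K \<subseteq> \<Union>{U. flow_box L W D wt F (F ` Cn) U}" using boxes assms by blast
  have 2: "open U" if "U \<in> {U. flow_box L W D wt F (F ` Cn) U}" for U
    using that by (simp add: flow_box_def)
  obtain e where "0 < e" "\<And>x. x \<in> K \<Longrightarrow> \<exists>G \<in> {U. flow_box L W D wt F (F ` Cn) U}. ball x e \<subseteq> G"
    by (rule Heine_Borel_lemma[OF assms(1) 1 2], assumption, rule that)
  then show ?thesis using that by blast
qed

text \<open>The plane is cut into grid squares so small that the part of a set in one square,
  together with all curves in \<open>K\<close> of short duration issuing from it, fits into one flow
  box. Countable subadditivity adds up the pieces.\<close>

lemma outer_reach_step:
  assumes K: "compact K" "K \<inter> Cn = {}"
  obtains \<epsilon> where "\<epsilon> > 0" "\<And>t0 t1 E. \<bar>t1 - t0\<bar> \<le> \<epsilon> \<Longrightarrow>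
    outer_measure_of \<nu> (reach L (krasovskii W) K t0 t1 E) \<le> outer_measure_of \<nu> E"
proof -
  obtain e where e: "e > 0" "\<And>x. x \<in> K \<Longrightarrow> \<exists>U. flow_box L W D wt F (F ` Cn) U \<and> ball x e \<subseteq> U"
    by (rule flow_box_uniform[OF K], rule that)
  \<comment> \<open>Grid squares of side \<open>e / 4\<close> have diameter below
    \<open>e / 2\<close>, and a curve of duration \<open>e / (2 * L)\<close> travels at most
    \<open>e / 2\<close>, so both together stay within \<open>e\<close>.\<close>
  define \<eta> where "\<eta> = e / 4"
  have \<eta>: "\<eta> > 0" using e by (simp add: \<eta>_def)
  define idx where "idx q = (\<lfloor>fst q / \<eta>\<rfloor>, \<lfloor>snd q / \<eta>\<rfloor>)" for q :: "real \<times> real"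
  have close: "dist x y < e / 2" if "idx x = idx y" for x y
  proof -
    have *: "\<bar>u - v\<bar> < \<eta>" if "\<lfloor>u / \<eta>\<rfloor> = \<lfloor>v / \<eta>\<rfloor>" for u v
    proof -
      have "\<bar>u / \<eta> - v / \<eta>\<bar> < 1" using that by linarith
      then show ?thesis using \<eta> by (simp add: field_simps flip: diff_divide_distrib)
    qed
    have "dist x y \<le> \<bar>fst x - fst y\<bar> + \<bar>snd x - snd y\<bar>"
      unfolding dist_prod_def dist_real_def by (rule order_trans[OF sqrt_sum_squares_le_sum_abs]) simp
    also have "\<dots> < \<eta> + \<eta>" using that by (intro add_strict_mono *) (auto simp: idx_def)
    finally show ?thesis by (simp add: \<eta>_def)
  qed
  have idxm: "{q. to_nat (idx q) = n} \<in> sets borel" for n :: nat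
  proof -
    have *: "{q. \<lfloor>f q / \<eta>\<rfloor> = i} \<in> sets borel" if "continuous_on UNIV f" for f :: "real \<times> real \<Rightarrow> real" and i
    proof -
      have [measurable]: "f \<in> borel_measurable borel" using that by (rule borel_measurable_continuous_onI)
      have "{q. \<lfloor>f q / \<eta>\<rfloor> = i} = (\<lambda>q. f q / \<eta>) -` {of_int i..<of_int i + 1}"
        by (auto simp: floor_eq_iff)
      then show ?thesis using measurable_sets_borel[of "\<lambda>q. f q / \<eta>" borel "{of_int i..<of_int i + 1}"] by simp
    qed
    have "{q. idx q = ij} \<in> sets borel" for ij
    proof -
      have "{q. idx q = ij} = {q. \<lfloor>fst q / \<eta>\<rfloor> = fst ij} \<inter> {q. \<lfloor>snd q / \<eta>\<rfloor> = snd ij}"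
        by (auto simp: idx_def prod_eq_iff)
      moreover have "{q :: real \<times> real. \<lfloor>fst q / \<eta>\<rfloor> = fst ij} \<in> sets borel"
        "{q :: real \<times> real. \<lfloor>snd q / \<eta>\<rfloor> = snd ij} \<in> sets borel"
        using *[OF continuous_on_fst[OF continuous_on_id]] *[OF continuous_on_snd[OF continuous_on_id]] by simp_all
      ultimately show ?thesis by auto
    qed
    then have "(\<Union>ij\<in>{ij. to_nat ij = n}. {q. idx q = ij}) \<in> sets borel"
      by (intro sets.countable_UN'') auto
    moreover have "(\<Union>ij\<in>{ij. to_nat ij = n}. {q. idx q = ij}) = {q. to_nat (idx q) = n}" by auto
    ultimately show ?thesis by simp
  qed
  show thesis
  proof (rule that[of "e / (2 * L)"])
    show "e / (2 * L) > 0" using e L_pos by simp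
    fix t0 t1 :: real and E assume t: "\<bar>t1 - t0\<bar> \<le> e / (2 * L)"
    obtain B where B: "B \<in> sets \<nu>" "E \<subseteq> B" "outer_measure_of \<nu> E = emeasure \<nu> B"
      using outer_measure_of_attain[of E \<nu>] by auto
    define A where "A n = B \<inter> {q. to_nat (idx q) = n}" for n
    have A: "A n \<in> sets borel" for n using B idxm by (auto simp: A_def)
    have UA: "(\<Union>n. A n) = B" by (auto simp: A_def)
    have dis: "disjoint_family A" by (auto simp: disjoint_family_on_def A_def)
    have step: "outer_measure_of \<nu> (reach L (krasovskii W) K t0 t1 (A n)) \<le> emeasure \<nu> (A n)" for n
    proof (cases "reach L (krasovskii W) K t0 t1 (A n) = {}")
      case False
      then obtain \<psi>0 where \<psi>0: "\<psi>0 ` closed_segment t0 t1 \<subseteq> K" "\<psi>0 t0 \<in> A n" by (auto simp: reach_def)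
      then have "\<psi>0 t0 \<in> K" by auto
      then obtain U where U: "flow_box L W D wt F (F ` Cn) U" "ball (\<psi>0 t0) e \<subseteq> U" using e(2) by blast
      have near: "dist (\<psi>0 t0) x < e / 2" if "x \<in> A n" for x
        by (rule close) (use \<psi>0(2) that in \<open>auto simp: A_def\<close>)
      have "A n \<subseteq> U" using near U(2) e(1) by (force simp: subset_iff)
      have "reach L (krasovskii W) K t0 t1 (A n) \<subseteq> reach L (krasovskii W) U t0 t1 (A n)"
      proof
        fix q assume "q \<in> reach L (krasovskii W) K t0 t1 (A n)"
        then obtain \<psi> where \<psi>: "sol (closed_segment t0 t1) \<psi>" "\<psi> t0 \<in> A n" "q = \<psi> t1" by (auto simp: reach_def)
        have "\<psi> s \<in> U" if s: "s \<in> closed_segment t0 t1" for s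
        proof -
          have "dist (\<psi> t0) (\<psi> s) \<le> L * \<bar>t0 - s\<bar>" using solution_dist_le[OF \<psi>(1) _ s] by simp
          also have "\<dots> \<le> L * (e / (2 * L))"
            using L_pos t s by (intro mult_left_mono) (auto simp: closed_segment_real)
          also have "\<dots> = e / 2" using L_pos by simp
          finally have "dist (\<psi>0 t0) (\<psi> s) < e"
            using near[OF \<psi>(2)] dist_triangle[of "\<psi>0 t0" "\<psi> s" "\<psi> t0"] by simp
          then show ?thesis using U(2) by auto
        qed
        then show "q \<in> reach L (krasovskii W) U t0 t1 (A n)" using \<psi> by (auto simp: reach_def)
      qed
      then have "outer_measure_of \<nu> (reach L (krasovskii W) K t0 t1 (A n)) \<le>
          outer_measure_of \<nu> (reach L (krasovskii W) U t0 t1 (A n))" by (rule outer_measure_of_mono)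
      also have "\<dots> \<le> emeasure \<nu> (A n)" using U(1) A[of n] \<open>A n \<subseteq> U\<close> by (simp add: flow_box_def)
      finally show ?thesis .
    qed (simp add: outer_measure_of_eq)
    have "reach L (krasovskii W) K t0 t1 E \<subseteq> (\<Union>n. reach L (krasovskii W) K t0 t1 (A n))"
    proof
      fix q assume "q \<in> reach L (krasovskii W) K t0 t1 E"
      then obtain \<psi> where \<psi>: "sol (closed_segment t0 t1) \<psi>" "\<psi> ` closed_segment t0 t1 \<subseteq> K"
        "\<psi> t0 \<in> E" "q = \<psi> t1" unfolding reach_def by blast
      then have "\<psi> t0 \<in> (\<Union>n. A n)" using B(2) UA by auto
      then obtain n where "\<psi> t0 \<in> A n" by blast
      then have "q \<in> reach L (krasovskii W) K t0 t1 (A n)" using \<psi> unfolding reach_def by blast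
      then show "q \<in> (\<Union>n. reach L (krasovskii W) K t0 t1 (A n))" by blast
    qed
    then have "outer_measure_of \<nu> (reach L (krasovskii W) K t0 t1 E) \<le>
        outer_measure_of \<nu> (\<Union>n. reach L (krasovskii W) K t0 t1 (A n))" by (rule outer_measure_of_mono)
    also have "\<dots> \<le> (\<Sum>n. outer_measure_of \<nu> (reach L (krasovskii W) K t0 t1 (A n)))"
      by (rule outer_measure_of_countably_subadditive) simp
    also have "\<dots> \<le> (\<Sum>n. emeasure \<nu> (A n))" using step by (intro suminf_le) auto
    also have "\<dots> = emeasure \<nu> (\<Union>n. A n)" using A dis by (intro suminf_emeasure) auto
    finally show "outer_measure_of \<nu> (reach L (krasovskii W) K t0 t1 E) \<le> outer_measure_of \<nu> E"
      by (simp add: UA B)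
  qed
qed

text \<open>The short-time estimate is iterated. It is stated for arbitrary sets, in outer measure,
  because the intermediate sets of reached points need not be measurable.\<close>

lemma outer_reach_avoiding:
  assumes K: "compact K" "K \<inter> Cn = {}"
  shows "outer_measure_of \<nu> (reach L (krasovskii W) K t0 t1 E) \<le> outer_measure_of \<nu> E"
proof -
  obtain \<epsilon> where \<epsilon>: "\<epsilon> > 0" "\<And>t0 t1 E. \<bar>t1 - t0\<bar> \<le> \<epsilon> \<Longrightarrow>
    outer_measure_of \<nu> (reach L (krasovskii W) K t0 t1 E) \<le> outer_measure_of \<nu> E"
    by (rule outer_reach_step[OF K], rule that)
  obtain N :: nat where N: "\<bar>t1 - t0\<bar> / \<epsilon> < N" using reals_Archimedean2 by blast
  moreover have "0 \<le> \<bar>t1 - t0\<bar> / \<epsilon>" using \<epsilon>(1) by simp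
  ultimately have N0: "real N > 0" by linarith
  define \<tau> where "\<tau> i = t0 + real i * ((t1 - t0) / N)" for i
  have step: "\<bar>\<tau> (Suc i) - \<tau> i\<bar> \<le> \<epsilon>" for i
  proof -
    have "\<tau> (Suc i) - \<tau> i = (t1 - t0) / N" by (simp add: \<tau>_def distrib_right add_divide_distrib)
    moreover have "\<bar>t1 - t0\<bar> \<le> \<epsilon> * N" using N \<epsilon>(1) by (simp add: divide_less_eq mult.commute)
    ultimately show ?thesis using N0 by (simp add: abs_divide divide_le_eq)
  qed
  have mem: "\<tau> i \<in> closed_segment t0 (\<tau> (Suc i))" for i
  proof -
    have S: "\<tau> (Suc i) = \<tau> i + (t1 - t0) / N" by (simp add: \<tau>_def distrib_right add_divide_distrib)
    have "0 \<le> real i * ((t1 - t0) / N)" "0 \<le> (t1 - t0) / N" if "t0 \<le> t1"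
      using that N0 by auto
    moreover have "real i * ((t1 - t0) / N) \<le> 0" "(t1 - t0) / N \<le> 0" if "t1 \<le> t0"
    proof -
      show "(t1 - t0) / N \<le> 0" using that N0 by (simp add: divide_nonpos_pos)
      then show "real i * ((t1 - t0) / N) \<le> 0" by (intro mult_nonneg_nonpos) auto
    qed
    ultimately have "t0 \<le> t1 \<Longrightarrow> t0 \<le> \<tau> i \<and> \<tau> i \<le> \<tau> (Suc i)" "t1 \<le> t0 \<Longrightarrow> \<tau> i \<le> t0 \<and> \<tau> (Suc i) \<le> \<tau> i"
      unfolding S by (auto simp: \<tau>_def)
    then show ?thesis by (cases "t0 \<le> t1") (auto simp: closed_segment_real)
  qed
  have "outer_measure_of \<nu> (reach L (krasovskii W) K t0 (\<tau> i) E) \<le> outer_measure_of \<nu> E" for i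
  proof (induction i)
    case 0
    have "reach L (krasovskii W) K t0 (\<tau> 0) E \<subseteq> E" by (auto simp: reach_def \<tau>_def)
    then show ?case by (rule outer_measure_of_mono)
  next
    case (Suc i)
    have "reach L (krasovskii W) K t0 (\<tau> (Suc i)) E \<subseteq>
        reach L (krasovskii W) K (\<tau> i) (\<tau> (Suc i)) (reach L (krasovskii W) K t0 (\<tau> i) E)"
    proof
      fix q assume "q \<in> reach L (krasovskii W) K t0 (\<tau> (Suc i)) E"
      then obtain \<psi> where \<psi>: "sol (closed_segment t0 (\<tau> (Suc i))) \<psi>" "\<psi> ` closed_segment t0 (\<tau> (Suc i)) \<subseteq> K"
        "\<psi> t0 \<in> E" "q = \<psi> (\<tau> (Suc i))" by (auto simp: reach_def)
      have sub: "closed_segment t0 (\<tau> i) \<subseteq> closed_segment t0 (\<tau> (Suc i))"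
        "closed_segment (\<tau> i) (\<tau> (Suc i)) \<subseteq> closed_segment t0 (\<tau> (Suc i))"
        using mem[of i] by (auto simp: subset_closed_segment)
      have "\<psi> (\<tau> i) \<in> reach L (krasovskii W) K t0 (\<tau> i) E"
        using \<psi>(2,3) sub(1) inclusion_solution_subset[OF \<psi>(1) sub(1)] unfolding reach_def by blast
      then show "q \<in> reach L (krasovskii W) K (\<tau> i) (\<tau> (Suc i)) (reach L (krasovskii W) K t0 (\<tau> i) E)"
        using \<psi>(2,4) sub(2) inclusion_solution_subset[OF \<psi>(1) sub(2)] unfolding reach_def[of _ _ _ "\<tau> i"] by blast
    qed
    then have "outer_measure_of \<nu> (reach L (krasovskii W) K t0 (\<tau> (Suc i)) E) \<le>
        outer_measure_of \<nu> (reach L (krasovskii W) K (\<tau> i) (\<tau> (Suc i)) (reach L (krasovskii W) K t0 (\<tau> i) E))"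
      by (rule outer_measure_of_mono)
    also have "\<dots> \<le> outer_measure_of \<nu> (reach L (krasovskii W) K t0 (\<tau> i) E)" by (rule \<epsilon>(2)[OF step])
    also note Suc
    finally show ?case .
  qed
  from this[of N] show ?thesis using N0 by (simp add: \<tau>_def)
qed

text \<open>A curve that meets \<open>Cn\<close> ends on an exceptional level, hence in a null set;
  one that avoids it stays in some compact \<open>K k\<close>. Outer measure is continuous along the
  increasing union over \<open>k\<close>.\<close>

lemma outer_reach:
  assumes E: "E \<in> sets borel" "bounded E"
  shows "outer_measure_of \<nu> (reach L (krasovskii W) UNIV t0 t1 E) \<le> emeasure \<nu> E"
proof -
  obtain R where R: "\<And>x. x \<in> E \<Longrightarrow> norm x \<le> R" using E(2) by (auto simp: bounded_iff)
  \<comment> \<open>The ball contains every curve of the given duration that starts in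
    \<open>E\<close>.\<close>
  define K where "K k = {x \<in> cball 0 (R + L * \<bar>t1 - t0\<bar>). \<forall>c\<in>Cn. inverse (real (Suc k)) \<le> dist x c}" for k
  have Kc: "compact (K k)" for k
  proof -
    have "K k = cball 0 (R + L * \<bar>t1 - t0\<bar>) \<inter> (\<Inter>c\<in>Cn. {x. inverse (real (Suc k)) \<le> dist x c})" by (auto simp: K_def)
    moreover have "closed (\<Inter>c\<in>Cn. {x. inverse (real (Suc k)) \<le> dist x c})"
      by (intro closed_INT ballI closed_Collect_le continuous_intros)
    ultimately show ?thesis by (simp add: compact_Int_closed)
  qed
  have KC: "K k \<inter> Cn = {}" for k
  proof -
    have "inverse (real (Suc k)) > 0" by simp
    then show ?thesis unfolding K_def by fastforce
  qed
  have Kmono: "K k \<subseteq> K l" if "k \<le> l" for k l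
  proof -
    have "inverse (real (Suc l)) \<le> inverse (real (Suc k))" using that by (intro le_imp_inverse_le) auto
    then have "\<forall>c\<in>Cn. inverse (real (Suc k)) \<le> dist x c \<Longrightarrow> \<forall>c\<in>Cn. inverse (real (Suc l)) \<le> dist x c" for x
      using order_trans by blast
    then show ?thesis unfolding K_def by blast
  qed
  have inc: "incseq (\<lambda>k. reach L (krasovskii W) (K k) t0 t1 E)"
    unfolding incseq_def reach_def using Kmono by blast
  have sub: "reach L (krasovskii W) UNIV t0 t1 E \<subseteq> (\<Union>k. reach L (krasovskii W) (K k) t0 t1 E) \<union> {p. F p \<in> F ` Cn}"
  proof
    fix q assume "q \<in> reach L (krasovskii W) UNIV t0 t1 E"
    then obtain \<psi> where \<psi>: "sol (closed_segment t0 t1) \<psi>" "\<psi> t0 \<in> E" "q = \<psi> t1" by (auto simp: reach_def)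
    show "q \<in> (\<Union>k. reach L (krasovskii W) (K k) t0 t1 E) \<union> {p. F p \<in> F ` Cn}"
    proof (cases "\<exists>s\<in>closed_segment t0 t1. \<psi> s \<in> Cn")
      case True
      then obtain s where s: "s \<in> closed_segment t0 t1" "\<psi> s \<in> Cn" by blast
      have "F (\<psi> t1) = F (\<psi> s)"
        using first_integral_constant[of "min t0 t1" "max t0 t1" \<psi> s t1] \<psi> s by (simp add: closed_segment_real)
      then show ?thesis using s \<psi> by auto
    next
      case False
      have "compact (\<psi> ` closed_segment t0 t1)"
        using \<psi>(1) by (intro compact_continuous_image compact_segment)
          (auto simp: inclusion_solution_def intro: lipschitz_on_continuous_on)
      then obtain r where r: "r > 0" "\<And>x y. x \<in> \<psi> ` closed_segment t0 t1 \<Longrightarrow> y \<in> Cn \<Longrightarrow> r \<le> dist x y"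
        using separate_compact_closed[of "\<psi> ` closed_segment t0 t1" Cn] Cn(1) False by blast
      obtain k where k: "inverse (real (Suc k)) < r" using reals_Archimedean r(1) by blast
      have "\<psi> s \<in> K k" if s: "s \<in> closed_segment t0 t1" for s
      proof -
        have "dist (\<psi> t0) (\<psi> s) \<le> L * \<bar>t0 - s\<bar>" using solution_dist_le[OF \<psi>(1) _ s] by simp
        also have "\<dots> \<le> L * \<bar>t1 - t0\<bar>" using L_pos s by (intro mult_left_mono) (auto simp: closed_segment_real)
        finally have "norm (\<psi> s) \<le> R + L * \<bar>t1 - t0\<bar>"
          using R[OF \<psi>(2)] norm_triangle_ineq2[of "\<psi> s" "\<psi> t0"] by (simp add: dist_norm norm_minus_commute)
        moreover have "inverse (real (Suc k)) \<le> dist (\<psi> s) c" if "c \<in> Cn" for c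
          using r(2)[of "\<psi> s" c] k s that by fastforce
        ultimately show ?thesis by (simp add: K_def)
      qed
      then show ?thesis using \<psi> by (auto simp: reach_def)
    qed
  qed
  have null: "{p. F p \<in> F ` Cn} \<in> null_sets \<nu>"
    using level_null by (auto simp: null_sets_density_iff AE_density intro: AE_not_in elim!: eventually_mono[OF AE_not_in])
  have "outer_measure_of \<nu> (reach L (krasovskii W) UNIV t0 t1 E) \<le>
      outer_measure_of \<nu> ((\<Union>k. reach L (krasovskii W) (K k) t0 t1 E) \<union> {p. F p \<in> F ` Cn})"
    by (rule outer_measure_of_mono[OF sub])
  also have "\<dots> = outer_measure_of \<nu> (\<Union>k. reach L (krasovskii W) (K k) t0 t1 E)"
    by (rule outer_measure_of_Un_null[OF _ null]) simp
  also have "\<dots> = (SUP k. outer_measure_of \<nu> (reach L (krasovskii W) (K k) t0 t1 E))"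
    by (rule SUP_outer_measure_of_incseq[symmetric]) (use inc in auto)
  also have "\<dots> \<le> outer_measure_of \<nu> E" by (intro SUP_least outer_reach_avoiding Kc KC)
  also have "\<dots> = emeasure \<nu> E" using E by simp
  finally show ?thesis .
qed

text \<open>Fixing a good level keeps the points away from \<open>Cn\<close>: the part of the level
  inside a ball is compact and misses \<open>Cn\<close>, so finitely many local existence times
  suffice.\<close>

lemma local_solution_uniform:
  assumes c: "c \<notin> F ` Cn"
  obtains \<epsilon> where "\<epsilon> > 0" "\<And>q \<tau>. norm q \<le> R \<Longrightarrow> F q = c \<Longrightarrow> \<exists>\<psi>. osol {\<tau> - \<epsilon>..\<tau> + \<epsilon>} \<psi> \<and> \<psi> \<tau> = q"
proof -
  define X where "X = cball 0 R \<inter> {q. F q = c}"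
  have "closed {q. F q = c}" using F_cont by (intro closed_Collect_eq continuous_on_const)
  then have X: "compact X" unfolding X_def by (intro compact_Int_closed) auto
  have "\<exists>\<epsilon>>0. \<exists>\<rho>>0. \<forall>q\<in>ball p \<rho>. F q \<notin> F ` Cn \<longrightarrow> (\<forall>\<tau>. \<exists>\<psi>. osol {\<tau> - \<epsilon>..\<tau> + \<epsilon>} \<psi> \<and> \<psi> \<tau> = q)" if "p \<in> X" for p
  proof -
    have "p \<notin> Cn" using that c by (auto simp: X_def)
    then obtain U where "p \<in> U" "flow_box L W D wt F (F ` Cn) U" using boxes by blast
    then show ?thesis by (simp add: flow_box_def)
  qed
  then obtain \<epsilon> \<rho> where \<epsilon>\<rho>: "\<And>p. p \<in> X \<Longrightarrow> \<epsilon> p > 0" "\<And>p. p \<in> X \<Longrightarrow> \<rho> p > 0"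
    "\<And>p q \<tau>. p \<in> X \<Longrightarrow> q \<in> ball p (\<rho> p) \<Longrightarrow> F q \<notin> F ` Cn \<Longrightarrow> \<exists>\<psi>. osol {\<tau> - \<epsilon> p..\<tau> + \<epsilon> p} \<psi> \<and> \<psi> \<tau> = q"
    by metis
  have "X \<subseteq> (\<Union>p\<in>X. ball p (\<rho> p))" using \<epsilon>\<rho>(2) by force
  then obtain Y where Y: "Y \<subseteq> X" "finite Y" "X \<subseteq> (\<Union>p\<in>Y. ball p (\<rho> p))"
    using compactE_image[OF X, of X "\<lambda>p. ball p (\<rho> p)"] by auto
  define e where "e = Min (insert 1 (\<epsilon> ` Y))"
  have e: "e > 0" "\<And>p. p \<in> Y \<Longrightarrow> e \<le> \<epsilon> p" using Y \<epsilon>\<rho>(1) by (auto simp: e_def)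
  show thesis
  proof (rule that[OF e(1)])
    fix q \<tau> assume q: "norm q \<le> R" "F q = c"
    then have "q \<in> X" by (simp add: X_def)
    then obtain p where p: "p \<in> Y" "q \<in> ball p (\<rho> p)" using Y by auto
    then obtain \<psi> where "osol {\<tau> - \<epsilon> p..\<tau> + \<epsilon> p} \<psi>" "\<psi> \<tau> = q" using \<epsilon>\<rho>(3)[of p q \<tau>] Y q c by auto
    then show "\<exists>\<psi>. osol {\<tau> - e..\<tau> + e} \<psi> \<and> \<psi> \<tau> = q"
      using inclusion_solution_subset[of L _ "{\<tau> - \<epsilon> p..\<tau> + \<epsilon> p}" \<psi> "{\<tau> - e..\<tau> + e}"] e(2)[OF p(1)] by auto
  qed
qed

text \<open>Conservation of \<open>F\<close> keeps the growing solution on its level and the speed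
  limit keeps it in a ball, so every step can use the same existence time.\<close>

lemma extend_solution:
  assumes s: "osol {a..b} \<psi>" and ab: "a \<le> b" and c: "F (\<psi> a) \<notin> F ` Cn"
  shows "\<exists>\<phi>. osol {a - 1..b + 1} \<phi> \<and> (\<forall>t\<in>{a..b}. \<phi> t = \<psi> t)"
proof -
  \<comment> \<open>Large enough for every point that the solution can reach on the interval
    extended by 1 on both sides.\<close>
  define R where "R = norm (\<psi> a) + L * (b - a + 2)"
  obtain \<epsilon> where \<epsilon>: "\<epsilon> > 0" "\<And>q \<tau>. norm q \<le> R \<Longrightarrow> F q = F (\<psi> a) \<Longrightarrow> \<exists>\<psi>. osol {\<tau> - \<epsilon>..\<tau> + \<epsilon>} \<psi> \<and> \<psi> \<tau> = q"
    by (rule local_solution_uniform[OF c], rule that)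
  obtain N :: nat where N: "1 / \<epsilon> < N" using reals_Archimedean2 by blast
  moreover have "0 \<le> 1 / \<epsilon>" using \<epsilon>(1) by simp
  ultimately have N0: "real N > 0" by linarith
  define h where "h = 1 / real N"
  have h: "h > 0" "h \<le> \<epsilon>" "real N * h = 1"
    using N N0 \<epsilon>(1) by (simp_all add: h_def divide_le_eq divide_less_eq mult.commute)
  have "\<exists>\<phi>. osol {a - real k * h..b + real k * h} \<phi> \<and> (\<forall>t\<in>{a..b}. \<phi> t = \<psi> t)" if "k \<le> N" for k
    using that
  proof (induction k)
    case 0
    then show ?case using s by auto
  next
    case (Suc k)
    then obtain \<phi> where \<phi>: "osol {a - real k * h..b + real k * h} \<phi>" "\<forall>t\<in>{a..b}. \<phi> t = \<psi> t" by auto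
    define a' b' where "a' = a - real k * h" and "b' = b + real k * h"
    have kh: "0 \<le> real k * h" "real k * h \<le> 1"
    proof -
      have "real k * h \<le> real N * h" using Suc.prems h(1) by (intro mult_right_mono) auto
      then show "real k * h \<le> 1" using h(3) by simp
    qed (use h in auto)
    have "a' \<le> a" "b \<le> b'" using kh by (auto simp: a'_def b'_def)
    then have a'b': "a' \<le> a" "b \<le> b'" "a' \<le> b'" using ab by auto
    note \<phi>' = \<phi>(1)[folded a'_def b'_def]
    have q: "norm (\<phi> t) \<le> R \<and> F (\<phi> t) = F (\<psi> a)" if t: "t \<in> {a'..b'}" for t
    proof
      have "dist (\<phi> a) (\<phi> t) \<le> L * \<bar>a - t\<bar>" using solution_dist_le[OF \<phi>', of a t] t a'b' ab by auto
      also have "\<dots> \<le> L * (b - a + 2)" using t kh ab L_pos by (intro mult_left_mono) (auto simp: a'_def b'_def)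
      finally show "norm (\<phi> t) \<le> R"
        using norm_triangle_ineq2[of "\<phi> t" "\<phi> a"] \<phi>(2) ab by (simp add: R_def dist_norm norm_minus_commute)
      show "F (\<phi> t) = F (\<psi> a)"
        using first_integral_constant[OF osol_sol[OF \<phi>'], of a t] t a'b' ab \<phi>(2) by auto
    qed
    obtain \<zeta>1 where 1: "osol {b' - \<epsilon>..b' + \<epsilon>} \<zeta>1" "\<zeta>1 b' = \<phi> b'" using \<epsilon>(2)[of "\<phi> b'" b'] q[of b'] a'b' by auto
    obtain \<zeta>2 where 2: "osol {a' - \<epsilon>..a' + \<epsilon>} \<zeta>2" "\<zeta>2 a' = \<phi> a'" using \<epsilon>(2)[of "\<phi> a'" a'] q[of a'] a'b' by auto
    define \<phi>1 where "\<phi>1 t = (if t \<le> b' then \<phi> t else \<zeta>1 t)" for t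
    define \<phi>2 where "\<phi>2 t = (if t \<le> a' then \<zeta>2 t else \<phi>1 t)" for t
    have "osol {b'..b' + h} \<zeta>1" by (rule inclusion_solution_subset[OF 1(1)]) (use h in auto)
    then have s1: "osol {a'..b' + h} \<phi>1"
      unfolding \<phi>1_def using inclusion_solution_join[OF \<phi>', of "b' + h" \<zeta>1] 1(2) a'b' h by simp
    have "osol {a' - h..a'} \<zeta>2" by (rule inclusion_solution_subset[OF 2(1)]) (use h in auto)
    then have s2: "osol {a' - h..b' + h} \<phi>2"
      unfolding \<phi>2_def using inclusion_solution_join[of L _ "a' - h" a' \<zeta>2 "b' + h" \<phi>1] s1 2(2) a'b' h
      by (simp add: \<phi>1_def)
    have "\<phi>2 t = \<psi> t" if t: "t \<in> {a..b}" for t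
    proof (cases "t = a'")
      case True then show ?thesis using t 2(2) \<phi>(2) by (simp add: \<phi>2_def)
    next
      case False then show ?thesis using t \<phi>(2) a'b' by (auto simp: \<phi>2_def \<phi>1_def)
    qed
    moreover have "a' - h = a - real (Suc k) * h" "b' + h = b + real (Suc k) * h" by (auto simp: a'_def b'_def algebra_simps)
    ultimately show ?case using s2 by metis
  qed
  from this[of N] show ?thesis using h(3) by simp
qed

lemma global_solution:
  assumes q: "F q \<notin> F ` Cn"
  shows "\<exists>\<psi>. (\<forall>n::nat. osol {\<tau> - real n..\<tau> + real n} \<psi>) \<and> \<psi> \<tau> = q"
proof -
  have "\<exists>f. \<forall>n::nat. (osol {\<tau> - real n..\<tau> + real n} (f n) \<and> f n \<tau> = q) \<and>
     (\<forall>t\<in>{\<tau> - real n..\<tau> + real n}. f (Suc n) t = f n t)"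
  proof (rule dependent_nat_choice[where P="\<lambda>n f. osol {\<tau> - real n..\<tau> + real n} f \<and> f \<tau> = q"
        and Q="\<lambda>n f g. \<forall>t\<in>{\<tau> - real n..\<tau> + real n}. g t = f t"])
    show "\<exists>x. osol {\<tau> - real 0..\<tau> + real 0} x \<and> x \<tau> = q"
      using inclusion_solution_singleton[of L "off_field W D" \<tau> "\<lambda>_. q"] L_pos by auto
    fix \<psi> and n :: nat assume \<psi>: "osol {\<tau> - real n..\<tau> + real n} \<psi> \<and> \<psi> \<tau> = q"
    then have "F (\<psi> (\<tau> - real n)) = F q"
      using first_integral_constant[of "\<tau> - real n" "\<tau> + real n" \<psi> \<tau> "\<tau> - real n"] osol_sol by auto
    then obtain \<phi> where \<phi>: "osol {\<tau> - real n - 1..\<tau> + real n + 1} \<phi>" "\<forall>t\<in>{\<tau> - real n..\<tau> + real n}. \<phi> t = \<psi> t"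
      using extend_solution[of "\<tau> - real n" "\<tau> + real n" \<psi>] \<psi> q by auto
    then show "\<exists>\<phi>. (osol {\<tau> - real (Suc n)..\<tau> + real (Suc n)} \<phi> \<and> \<phi> \<tau> = q) \<and>
        (\<forall>t\<in>{\<tau> - real n..\<tau> + real n}. \<phi> t = \<psi> t)"
      using \<psi> by (intro exI[of _ \<phi>]) (auto simp: algebra_simps)
  qed
  then obtain f where f: "\<And>n::nat. osol {\<tau> - real n..\<tau> + real n} (f n)" "\<And>n. f n \<tau> = q"
    "\<And>n t. t \<in> {\<tau> - real n..\<tau> + real n} \<Longrightarrow> f (Suc n) t = f n t" by blast
  have agree: "f (n + k) t = f n t" if "t \<in> {\<tau> - real n..\<tau> + real n}" for n k t
  proof (induction k)
    case (Suc k) then show ?case using f(3)[of t "n + k"] that by auto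
  qed simp
  \<comment> \<open>The index is that of the first interval around \<open>\<tau>\<close> containing
    \<open>t\<close>; all later extensions agree with it there.\<close>
  define \<psi> where "\<psi> t = f (nat \<lceil>\<bar>t - \<tau>\<bar>\<rceil>) t" for t
  have eq: "\<psi> t = f n t" if t: "t \<in> {\<tau> - real n..\<tau> + real n}" for n t
  proof -
    define m where "m = nat \<lceil>\<bar>t - \<tau>\<bar>\<rceil>"
    have "\<bar>t - \<tau>\<bar> \<le> real n" using t by auto
    then have "m \<le> n" by (simp add: m_def nat_le_iff ceiling_le_iff)
    moreover have "\<bar>t - \<tau>\<bar> \<le> real m" unfolding m_def by linarith
    then have "t \<in> {\<tau> - real m..\<tau> + real m}" by auto
    ultimately show ?thesis using agree[of t m "n - m"] by (simp add: \<psi>_def m_def)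
  qed
  have "osol {\<tau> - real n..\<tau> + real n} \<psi>" for n
    by (rule inclusion_solution_cong[OF f(1)]) (use eq in auto)
  moreover have "\<psi> \<tau> = q" using eq[of \<tau> 0] f(2) by simp
  ultimately show ?thesis by blast
qed

end

section \<open>Flat surfaces\<close>

text \<open>Since \<open>W\<close> has finite range, its limit along a region is a value attained
  arbitrarily close to \<open>p\<close>, whatever the shape of the region.\<close>

lemma filippov_set_subset_krasovskii:
  assumes fin: "finite (range W)"
  shows "filippov_set D W p \<subseteq> krasovskii W p"
proof (cases "p \<in> D")
  case True
  have "v \<in> convex hull (W ` ball p e)" if e: "e > 0" and R: "R \<in> components (- D)" "p \<in> closure R" "(W \<longlongrightarrow> v) (at p within R)" for v R and e :: real
  proof -
    have "p \<notin> R" using R(1) True in_components_subset by fastforce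
    then have "p islimpt R" using R(2) by (simp add: closure_def)
    then have nb: "at p within R \<noteq> bot" by (simp add: trivial_limit_within)
    have "closed (W ` ball p e)" using fin by (intro finite_imp_closed finite_subset[OF _ fin]) auto
    moreover have "eventually (\<lambda>x. W x \<in> W ` ball p e) (at p within R)"
      unfolding eventually_at using e by (intro exI[of _ e]) (auto simp: dist_commute)
    ultimately have "v \<in> W ` ball p e" using Lim_in_closed_set[OF _ _ nb R(3)] by blast
    then show ?thesis by (rule hull_inc)
  qed
  then have "{v. \<exists>R \<in> components (- D). p \<in> closure R \<and> (W \<longlongrightarrow> v) (at p within R)} \<subseteq> krasovskii W p"
    unfolding krasovskii_def by blast
  moreover have "convex (krasovskii W p)" unfolding krasovskii_def by (intro convex_INT convex_convex_hull)
  ultimately show ?thesis using True by (simp add: filippov_set_def hull_minimal)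
qed (auto simp: filippov_set_def krasovskii_def intro: hull_inc)

lemma krasovskii_isometry:
  assumes A: "linear A" "\<And>x. norm (A x) = norm x" and W: "\<And>x. W (c + A x) = A (W x)"
    and v: "v \<in> krasovskii W q"
  shows "A v \<in> krasovskii W (c + A q)"
  unfolding krasovskii_def
proof
  fix e :: real assume e: "e \<in> {0<..}"
  have "v \<in> convex hull (W ` ball q e)" using v e unfolding krasovskii_def by blast
  then have "A v \<in> A ` (convex hull (W ` ball q e))" by blast
  also have "\<dots> = convex hull (A ` W ` ball q e)" by (rule convex_hull_linear_image[OF A(1)])
  also have "\<dots> \<subseteq> convex hull (W ` ball (c + A q) e)"
  proof (intro hull_mono subsetI)
    fix y assume "y \<in> A ` W ` ball q e"
    then obtain x where x: "x \<in> ball q e" "y = W (c + A x)" using W by auto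
    have "dist (c + A q) (c + A x) = dist q x"
      using A(2)[of "q - x"] by (simp add: dist_norm linear_diff[OF A(1)])
    then show "y \<in> W ` ball (c + A q) e" using x by auto
  qed
  finally show "A v \<in> convex hull (W ` ball (c + A q) e)" .
qed

lemma isometry_solution:
  assumes A: "linear A" "\<And>x. norm (A x) = norm x" and W: "\<And>x. W (c + A x) = A (W x)"
    and s: "inclusion_solution L (krasovskii W) I \<psi>"
  shows "inclusion_solution L (krasovskii W) I (\<lambda>t. c + A (\<psi> t))"
  unfolding inclusion_solution_def
proof
  have "dist (c + A x) (c + A y) = dist x y" for x y
    using A(2)[of "x - y"] by (simp add: dist_norm linear_diff[OF A(1)])
  then show "L-lipschitz_on I (\<lambda>t. c + A (\<psi> t))"
    using s by (simp add: inclusion_solution_def lipschitz_on_def)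
  have "AE t in lborel. t \<in> I \<longrightarrow> (\<exists>v\<in>krasovskii W (\<psi> t). (\<psi> has_vector_derivative v) (at t within I))"
    using s by (simp add: inclusion_solution_def)
  then show "AE t in lborel. t \<in> I \<longrightarrow>
      (\<exists>v\<in>krasovskii W (c + A (\<psi> t)). ((\<lambda>t. c + A (\<psi> t)) has_vector_derivative v) (at t within I))"
  proof eventually_elim
    case (elim t)
    show ?case
    proof
      assume "t \<in> I"
      then obtain v where v: "v \<in> krasovskii W (\<psi> t)" "(\<psi> has_vector_derivative v) (at t within I)" using elim by auto
      have "bounded_linear A" using A(1) by (simp add: linear_conv_bounded_linear)
      then have "((\<lambda>t. A (\<psi> t)) has_vector_derivative A v) (at t within I)"
        using bounded_linear.has_vector_derivative v(2) by blast
      then have "((\<lambda>t. c + A (\<psi> t)) has_vector_derivative 0 + A v) (at t within I)"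
        by (intro has_vector_derivative_add has_vector_derivative_const)
      then show "\<exists>v\<in>krasovskii W (c + A (\<psi> t)). ((\<lambda>t. c + A (\<psi> t)) has_vector_derivative v) (at t within I)"
        using krasovskii_isometry[OF A W v(1)] by auto
    qed
  qed
qed

lemma nn_integral_axis_isometry:
  fixes h :: "real \<times> real \<Rightarrow> ennreal"
  assumes h[measurable]: "h \<in> borel_measurable borel" and \<sigma>: "\<bar>\<sigma>\<bar> = 1"
  shows "(\<integral>\<^sup>+q. h (fst q + k, \<sigma> * snd q + l) \<partial>lborel) = (\<integral>\<^sup>+q. h q \<partial>lborel)"
proof -
  have h'[measurable]: "h \<in> borel_measurable (borel \<Otimes>\<^sub>M borel)" using h by (simp add: borel_prod)
  have "(\<integral>\<^sup>+q. h q \<partial>(lborel \<Otimes>\<^sub>M lborel)) = (\<integral>\<^sup>+y. \<integral>\<^sup>+x. h (x, y) \<partial>lborel \<partial>lborel)"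
    by (subst lborel_pair.nn_integral_snd[symmetric]) simp_all
  also have "\<dots> = (\<integral>\<^sup>+y. \<integral>\<^sup>+x. h (x, l + \<sigma> * y) \<partial>lborel \<partial>lborel)"
    using \<sigma> by (subst nn_integral_real_affine[where c=\<sigma> and t=l]) auto
  also have "\<dots> = (\<integral>\<^sup>+y. \<integral>\<^sup>+x. h (k + 1 * x, l + \<sigma> * y) \<partial>lborel \<partial>lborel)"
    by (rule nn_integral_cong, subst nn_integral_real_affine[where c=1 and t=k]) simp_all
  also have "\<dots> = (\<integral>\<^sup>+q. h (fst q + k, \<sigma> * snd q + l) \<partial>(lborel \<Otimes>\<^sub>M lborel))"
    by (subst lborel_pair.nn_integral_snd[symmetric]) (simp_all add: add.commute)
  finally show ?thesis by (simp add: lborel_prod)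
qed

text \<open>The complement of a measurable cover of \<open>Y\<close> and \<open>N\<close> lies
  inside \<open>X\<close>, so the upper bound for \<open>Y\<close> becomes a lower bound for a
  measurable part of \<open>X\<close>. As the measure is finite, it meets the upper bound, and
  \<open>X\<close> lies between measurable sets of equal measure.\<close>

lemma completion_squeeze:
  assumes fin: "finite_measure M" and A: "A \<in> sets M" and XY: "X \<subseteq> space M" "Y \<subseteq> space M" "N \<subseteq> space M"
    and cover: "space M \<subseteq> X \<union> Y \<union> N" and X: "outer_measure_of M X \<le> emeasure M A"
    and Y: "outer_measure_of M Y \<le> emeasure M (space M - A)" and N: "outer_measure_of M N = 0"
  shows "X \<in> sets (completion M) \<and> emeasure (completion M) X = emeasure M A"
proof -
  interpret finite_measure M by fact
  obtain B1 where B1: "B1 \<in> sets M" "X \<subseteq> B1" "emeasure M B1 \<le> emeasure M A"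
    using outer_measure_of_attain[OF XY(1)] X by metis
  obtain B2 where B2: "B2 \<in> sets M" "Y \<subseteq> B2" "emeasure M B2 \<le> emeasure M (space M - A)"
    using outer_measure_of_attain[OF XY(2)] Y by metis
  obtain B3 where B3: "B3 \<in> sets M" "N \<subseteq> B3" "emeasure M B3 = 0"
    using outer_measure_of_attain[OF XY(3)] N by metis
  define B0 where "B0 = space M - (B2 \<union> B3)"
  have B0: "B0 \<in> sets M" using B2 B3 by (auto simp: B0_def)
  have sub: "B0 \<subseteq> X" using cover B2 B3 by (auto simp: B0_def)
  have "measure M (B2 \<union> B3) \<le> measure M B2 + measure M B3"
    using B2 B3 by (intro measure_Un_le)
  also have "measure M B3 = 0" using B3(3) by (simp add: measure_def)
  also have "measure M B2 \<le> measure M (space M - A)" using B2(3) by (simp add: emeasure_eq_measure)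
  also have "\<dots> = measure M (space M) - measure M A" using A by (simp add: finite_measure_compl)
  finally have "measure M A \<le> measure M B0"
    using B2 B3 by (simp add: B0_def finite_measure_compl)
  moreover have "measure M B0 \<le> measure M B1" using sub B1 B0 by (intro finite_measure_mono) auto
  moreover have "measure M B1 \<le> measure M A" using B1(3) by (simp add: emeasure_eq_measure)
  ultimately have eq: "measure M B0 = measure M A" "measure M B1 = measure M A" by auto
  have "measure M (B1 - B0) = 0"
    using eq B0 B1 sub by (subst finite_measure_Diff) auto
  then have n: "B1 - B0 \<in> null_sets M" using B0 B1 by (auto simp: null_sets_def emeasure_eq_measure)
  have XB: "X = B0 \<union> (X - B0)" using sub by auto
  have Xs: "X \<in> sets (completion M)"
    by (rule sets_completionI[OF XB _ n B0]) (use B1 in auto)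
  have "emeasure M B0 \<le> emeasure (completion M) X"
    using emeasure_mono[OF sub Xs] B0 by simp
  moreover have "emeasure (completion M) X \<le> emeasure M B1"
    using emeasure_mono[OF B1(2), of "completion M"] B1(1) by simp
  ultimately show ?thesis using Xs eq by (simp add: emeasure_eq_measure)
qed

section \<open>The surface measure read in the plane\<close>

abbreviation open_square :: "(real \<times> real) set" where
  "open_square \<equiv> {0<..<1} \<times> {0<..<1}"

abbreviation cell :: "int \<Rightarrow> int \<Rightarrow> (real \<times> real) set" where
  "cell k l \<equiv> {of_int k<..<of_int k + 1} \<times> {of_int l<..<of_int l + 1}"

text \<open>By \<open>fold_cell\<close> every open unit cell is developed isometrically onto the
  interior of the square, with \<open>\<sigma> = - 1\<close> where a column is reflected. By
  \<open>deck\<close> two lifts of one point differ by an isometry under which the chart field is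
  equivariant. The first transports measures between plane and surface, the second
  solutions.\<close>

locale flat_surface =
  fixes pt :: "real \<times> real \<Rightarrow> 'q" and fold :: "real \<times> real \<Rightarrow> real \<times> real" and dev :: "real \<times> real \<Rightarrow> 'q"
    and D :: "'q set" and W :: "real \<times> real \<Rightarrow> real \<times> real" and f :: "real \<times> real \<Rightarrow> real" and L :: real
  assumes dev: "\<And>p. dev p = pt (fold p)" and fold_square: "\<And>p. fold p \<in> unit_square"
    and fold_id: "\<And>p. p \<in> open_square \<Longrightarrow> fold p = p"
    and dev_square: "\<And>p. p \<in> unit_square \<Longrightarrow> dev p = pt p"
    and pt_inj: "\<And>p q. p \<in> open_square \<Longrightarrow> q \<in> unit_square \<Longrightarrow> pt p = pt q \<Longrightarrow> p = q"
    and fold_cell: "\<And>k l. \<exists>\<sigma> c. \<bar>\<sigma>\<bar> = 1 \<and> (\<forall>p\<in>cell k l. fold p \<in> open_square \<and> fold p = (fst p - of_int k, \<sigma> * (snd p - c))) \<and>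
        (\<forall>p\<in>open_square. (fst p + of_int k, \<sigma> * snd p + c) \<in> cell k l)"
    and fold_lines: "\<And>p. fst p \<in> \<int> \<or> snd p \<in> \<int> \<Longrightarrow> fold p \<notin> open_square"
    and deck: "\<And>p q. dev p = dev q \<Longrightarrow> \<exists>c A. linear A \<and> (\<forall>x. norm (A x) = norm x) \<and> c + A p = q \<and>
        (\<forall>x. dev (c + A x) = dev x) \<and> (\<forall>x. W (c + A x) = A (W x))"
    and L_pos': "L > 0" and W_le': "\<And>p. norm (W p) \<le> L" and W_fin: "finite (range W)"
    and f_meas[measurable]: "f \<in> borel_measurable borel" and fold_meas[measurable]: "fold \<in> borel_measurable borel"
    and f_bound: "\<exists>B. \<forall>p. f p \<le> B"
begin

definition "M = weighted_area pt f"

definition weight :: "real \<times> real \<Rightarrow> ennreal" where "weight p = ennreal (f (fold p))"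

abbreviation "\<mu> \<equiv> density lborel weight"

lemma weight_measurable[measurable]: "weight \<in> borel_measurable borel"
  unfolding weight_def[abs_def] by measurable

lemma space_M: "space M = pt ` unit_square" and sets_M: "sets M = sets (quotient_borel pt)"
  by (auto simp: M_def weighted_area_def quotient_borel_def space_measure_of_conv)

lemma quotient_sets:
  "sets M = sigma_sets (pt ` unit_square) {U. U \<subseteq> pt ` unit_square \<and> openin (top_of_set unit_square) {p \<in> unit_square. pt p \<in> U}}"
  unfolding sets_M quotient_borel_def by (rule sets_measure_of) auto

lemma unit_square_borel[measurable]: "unit_square \<in> sets borel"
  unfolding unit_square_def by (intro borel_closed closed_Times) auto

lemma open_square_sub: "open_square \<subseteq> unit_square" by (auto simp: unit_square_def)

lemma pt_measurable[measurable]: "pt \<in> measurable (restrict_space lborel unit_square) (quotient_borel pt)"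
  unfolding quotient_borel_def
proof (rule measurable_measure_of)
  fix U assume "U \<in> {U. U \<subseteq> pt ` unit_square \<and> openin (top_of_set unit_square) {p \<in> unit_square. pt p \<in> U}}"
  then obtain T where "open T" "{p \<in> unit_square. pt p \<in> U} = unit_square \<inter> T" by (auto simp: openin_open)
  then show "pt -` U \<inter> space (restrict_space lborel unit_square) \<in> sets (restrict_space lborel unit_square)"
    by (auto simp: space_restrict_space sets_restrict_space vimage_def Int_def conj_commute)
qed (auto simp: space_restrict_space)

lemma preimage_borel:
  assumes "A \<in> sets M" shows "{p \<in> unit_square. pt p \<in> A} \<in> sets borel"
proof -
  have "pt -` A \<inter> space (restrict_space lborel unit_square) \<in> sets (restrict_space lborel unit_square)"
    using assms by (intro measurable_sets[OF pt_measurable]) (simp add: sets_M)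
  moreover have "pt -` A \<inter> space (restrict_space lborel unit_square) = {p \<in> unit_square. pt p \<in> A}"
    by (auto simp: space_restrict_space)
  ultimately show ?thesis by (simp add: sets_restrict_space_iff)
qed

lemma AE_unit_square: "AE p in lborel. p \<in> unit_square \<longrightarrow> p \<in> open_square"
proof -
  have id: "coord_perm id" and sw: "coord_perm prod.swap" by (auto simp: coord_perm_def)
  show ?thesis
    using AE_not_line[OF id, of 0] AE_not_line[OF id, of 1] AE_not_line[OF sw, of 0] AE_not_line[OF sw, of 1]
    by eventually_elim (auto simp: unit_square_def)
qed

lemma emeasure_M:
  assumes A: "A \<in> sets M"
  shows "emeasure M A = emeasure \<mu> {p \<in> unit_square. pt p \<in> A}"
proof -
  have A': "A \<in> sets (quotient_borel pt)" using A by (simp add: sets_M)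
  note [measurable] = preimage_borel[OF A]
  have fr: "(\<lambda>p. ennreal (f p)) \<in> borel_measurable (restrict_space lborel unit_square)"
    by (intro measurable_restrict_space1) measurable
  have "emeasure M A = emeasure (density (restrict_space lborel unit_square) (\<lambda>p. ennreal (f p)))
      (pt -` A \<inter> space (restrict_space lborel unit_square))"
    unfolding M_def weighted_area_def using A' by (subst emeasure_distr) auto
  also have "\<dots> = (\<integral>\<^sup>+p. ennreal (f p) * indicator (pt -` A \<inter> space (restrict_space lborel unit_square)) p
      \<partial>(restrict_space lborel unit_square))"
    using fr by (rule emeasure_density) (use measurable_sets[OF pt_measurable A'] in simp)
  also have "\<dots> = (\<integral>\<^sup>+p. ennreal (f p) * indicator {p \<in> unit_square. pt p \<in> A} p \<partial>lborel)"
    by (subst nn_integral_restrict_space) (auto simp: space_restrict_space indicator_def intro!: nn_integral_cong)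
  also have "\<dots> = (\<integral>\<^sup>+p. weight p * indicator {p \<in> unit_square. pt p \<in> A} p \<partial>lborel)"
    by (rule nn_integral_cong_AE) (use AE_unit_square in eventually_elim, auto simp: weight_def fold_id indicator_def)
  also have "\<dots> = emeasure \<mu> {p \<in> unit_square. pt p \<in> A}"
    by (subst emeasure_density) auto
  finally show ?thesis .
qed

lemma finite_M: "finite_measure M"
proof
  obtain B where B: "f p \<le> B" for p using f_bound by blast
  have "emeasure M (space M) = emeasure \<mu> {p \<in> unit_square. pt p \<in> space M}" by (rule emeasure_M) simp
  also have "\<dots> \<le> (\<integral>\<^sup>+p. ennreal B * indicator unit_square p \<partial>lborel)"
    using preimage_borel[of "space M"]
    by (subst emeasure_density) (auto intro!: nn_integral_mono simp: weight_def indicator_def B ennreal_leI)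
  also have "\<dots> = ennreal B * emeasure lborel unit_square" by (subst nn_integral_cmult_indicator) auto
  also have "\<dots> < \<infinity>"
    using emeasure_bounded_finite[of unit_square] bounded_Times[of "{0..1::real}" "{0..1::real}"]
    by (auto simp: unit_square_def ennreal_mult_less_top)
  finally show "emeasure M (space M) \<noteq> \<infinity>" by simp
qed

lemma saturated_open_square:
  assumes "X \<subseteq> open_square" shows "{p \<in> unit_square. pt p \<in> pt ` X} = X"
proof
  show "{p \<in> unit_square. pt p \<in> pt ` X} \<subseteq> X"
  proof
    fix p assume "p \<in> {p \<in> unit_square. pt p \<in> pt ` X}"
    then obtain x where "p \<in> unit_square" "x \<in> X" "pt x = pt p" by auto
    then show "p \<in> X" using pt_inj[of x p] assms by auto
  qed
  show "X \<subseteq> {p \<in> unit_square. pt p \<in> pt ` X}" using assms open_square_sub by auto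
qed

lemma inj_open_square: "inj_on pt open_square"
  using pt_inj open_square_sub by (intro inj_onI) blast

lemma pt_open_sets:
  assumes "open S" "S \<subseteq> open_square" shows "pt ` S \<in> sets M"
proof -
  have "openin (top_of_set unit_square) {p \<in> unit_square. pt p \<in> pt ` S}"
    unfolding saturated_open_square[OF assms(2)] using assms open_square_sub by (intro open_subset) auto
  moreover have "pt ` S \<subseteq> pt ` unit_square" by (intro image_mono subset_trans[OF assms(2) open_square_sub])
  ultimately show ?thesis unfolding quotient_sets by (intro sigma_sets.Basic) simp
qed

lemma open_open_square: "open open_square" by (intro open_Times open_greaterThanLessThan)

text \<open>The quotient sigma-algebra is given by generators, which suggests an induction over
  Borel sets. It starts because interior points are glued to nothing, so open subsets of the
  interior stay open in the quotient; injectivity carries it through complements.\<close>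

lemma pt_open_square_sets:
  assumes "X \<in> sets borel"
  shows "pt ` (X \<inter> open_square) \<in> sets M"
proof -
  have "X \<in> sigma_sets UNIV {S. open S}" using assms by (simp add: sets_borel)
  then show ?thesis
  proof (induction rule: sigma_sets.induct)
    case (Basic S)
    then show ?case by (intro pt_open_sets open_Int open_open_square) auto
  next
    case Empty show ?case by simp
  next
    case (Compl S)
    have "pt ` open_square \<in> sets M" by (rule pt_open_sets[OF open_open_square order_refl])
    moreover have "(UNIV - S) \<inter> open_square = open_square - S \<inter> open_square" by auto
    then have "pt ` ((UNIV - S) \<inter> open_square) = pt ` open_square - pt ` (S \<inter> open_square)"
      using inj_on_image_set_diff[OF inj_open_square, of open_square "S \<inter> open_square"] by simp
    ultimately show ?case using Compl by auto
  next
    case (Union S)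
    have "pt ` (\<Union>(range S) \<inter> open_square) = (\<Union>i. pt ` (S i \<inter> open_square))" by auto
    then show ?case using Union by auto
  qed
qed

lemma emeasure_pt:
  assumes "X \<in> sets borel" "X \<subseteq> open_square"
  shows "pt ` X \<in> sets M" "emeasure M (pt ` X) = emeasure \<mu> X"
proof -
  have "X \<inter> open_square = X" using assms by auto
  then show s: "pt ` X \<in> sets M" using pt_open_square_sets[OF assms(1)] by simp
  show "emeasure M (pt ` X) = emeasure \<mu> X" using emeasure_M[OF s] saturated_open_square[OF assms(2)] by simp
qed

lemma emeasure_dev_cell:
  assumes E[measurable]: "E \<in> sets borel" and sub: "E \<subseteq> cell k l"
  shows "dev ` E \<in> sets M" "emeasure M (dev ` E) = emeasure \<mu> E"
proof -
  obtain \<sigma> c where \<sigma>: "\<bar>\<sigma>\<bar> = 1" "\<And>p. p \<in> cell k l \<Longrightarrow> fold p \<in> open_square \<and> fold p = (fst p - of_int k, \<sigma> * (snd p - c))"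
    "\<And>p. p \<in> open_square \<Longrightarrow> (fst p + of_int k, \<sigma> * snd p + c) \<in> cell k l"
    using fold_cell[of k l] by blast
  \<comment> \<open>\<open>h\<close> inverts \<open>fold\<close> on the cell. It is an isometry and
    leaves the weight unchanged, since the weight depends on a point only through
    \<open>fold\<close>.\<close>
  define h where "h p = (fst p + of_int k, \<sigma> * snd p + c)" for p :: "real \<times> real"
  have h[measurable]: "h \<in> borel_measurable borel" unfolding h_def[abs_def]
    by (intro borel_measurable_continuous_onI continuous_intros)
  have \<sigma>\<sigma>: "\<sigma> * (\<sigma> * x) = x" for x using \<sigma>(1) by (cases "\<sigma> \<ge> 0") auto
  have fh: "fold (h p) = p" if "p \<in> open_square" for p
    using \<sigma>(2)[OF \<sigma>(3)[OF that]] \<sigma>\<sigma> by (simp add: h_def)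
  have hf: "h (fold p) = p" if "p \<in> cell k l" for p
    using \<sigma>(2)[OF that] by (simp add: h_def \<sigma>\<sigma> prod_eq_iff)
  define X where "X = h -` E \<inter> open_square"
  have X: "X \<in> sets borel" "X \<subseteq> open_square"
  proof -
    have "open open_square" by (intro open_Times) auto
    then show "X \<in> sets borel" unfolding X_def using measurable_sets_borel[OF h E] by auto
  qed (auto simp: X_def)
  have fE: "fold ` E = X"
  proof
    show "fold ` E \<subseteq> X"
    proof
      fix y assume "y \<in> fold ` E"
      then obtain p where p: "p \<in> E" "y = fold p" by blast
      then have "p \<in> cell k l" using sub by blast
      have "h y \<in> E" using hf[OF \<open>p \<in> cell k l\<close>] p by simp
      moreover have "y \<in> open_square" unfolding p(2) using \<sigma>(2)[OF \<open>p \<in> cell k l\<close>] by (rule conjunct1)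
      ultimately show "y \<in> X" by (simp add: X_def)
    qed
    show "X \<subseteq> fold ` E"
    proof
      fix y assume "y \<in> X"
      then have "h y \<in> E" "fold (h y) = y" using fh[of y] by (auto simp: X_def)
      then show "y \<in> fold ` E" by (metis image_eqI)
    qed
  qed
  have dE: "dev ` E = pt ` X" unfolding fE[symmetric] by (auto simp: dev)
  show "dev ` E \<in> sets M" using emeasure_pt(1)[OF X] dE by simp
  have "emeasure M (dev ` E) = emeasure \<mu> X" using emeasure_pt(2)[OF X] dE by simp
  also have "\<dots> = (\<integral>\<^sup>+p. weight p * indicator X p \<partial>lborel)" using X by (subst emeasure_density) auto
  also have "\<dots> = (\<integral>\<^sup>+p. weight (h p) * indicator E (h p) \<partial>lborel)"
  proof (intro nn_integral_cong)
    fix p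
    show "weight p * indicator X p = weight (h p) * indicator E (h p)"
    proof (cases "p \<in> open_square")
      case True then show ?thesis by (simp add: weight_def fh fold_id X_def indicator_def)
    next
      case False
      have "h p \<notin> E"
      proof
        assume "h p \<in> E"
        then have "h p \<in> cell k l" using sub by auto
        note 1 = \<sigma>(2)[OF this]
        have "fold (h p) = p" using conjunct2[OF 1] by (simp add: h_def \<sigma>\<sigma>)
        then have "p \<in> open_square" using conjunct1[OF 1] by metis
        then show False using False by simp
      qed
      then show ?thesis using False by (simp add: X_def)
    qed
  qed
  also have "\<dots> = (\<integral>\<^sup>+p. weight p * indicator E p \<partial>lborel)"
    unfolding h_def by (rule nn_integral_axis_isometry[OF _ \<sigma>(1), where h="\<lambda>p. weight p * indicator E p"]) measurable
  also have "\<dots> = emeasure \<mu> E" by (subst emeasure_density) auto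
  finally show "emeasure M (dev ` E) = emeasure \<mu> E" .
qed

lemma dev_in_space: "dev p \<in> space M"
  using fold_square by (auto simp: dev space_M)

lemma dev_lines_null:
  obtains Z where "Z \<in> null_sets M" "\<And>p. fst p \<in> \<int> \<or> snd p \<in> \<int> \<Longrightarrow> dev p \<in> Z"
proof (rule that[of "space M - pt ` open_square"])
  have s: "space M - pt ` open_square \<in> sets M"
    using pt_open_square_sets[of UNIV] by auto
  have "emeasure M (space M - pt ` open_square) = emeasure \<mu> {p \<in> unit_square. pt p \<in> space M - pt ` open_square}"
    by (rule emeasure_M[OF s])
  also have "\<dots> = 0"
  proof -
    have "AE p in lborel. p \<notin> {p \<in> unit_square. pt p \<in> space M - pt ` open_square}"
      using AE_unit_square by eventually_elim auto
    then have "AE p in lborel. weight p * indicator {p \<in> unit_square. pt p \<in> space M - pt ` open_square} p = 0"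
      by eventually_elim auto
    then show ?thesis using preimage_borel[OF s]
      by (subst emeasure_density) (auto simp: nn_integral_0_iff_AE)
  qed
  finally show "space M - pt ` open_square \<in> null_sets M" using s by auto
  fix p :: "real \<times> real" assume "fst p \<in> \<int> \<or> snd p \<in> \<int>"
  then have "fold p \<notin> open_square" by (rule fold_lines)
  moreover have "fold p \<in> open_square" if "pt (fold p) \<in> pt ` open_square"
    using that saturated_open_square[OF order_refl] fold_square[of p] by blast
  ultimately have "pt (fold p) \<notin> pt ` open_square" by metis
  then show "dev p \<in> space M - pt ` open_square" using dev_in_space[of p] by (simp add: dev)
qed

text \<open>\<open>dev\<close> preserves measure on each of the countably many unit cells and sends
  the cell boundaries into a null set. Overlaps between the images of different cells can only lower
  the measure, hence an inequality.\<close>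

lemma outer_dev:
  shows "outer_measure_of M (dev ` E) \<le> outer_measure_of \<mu> E"
proof -
  obtain B where B: "B \<in> sets \<mu>" "E \<subseteq> B" "outer_measure_of \<mu> E = emeasure \<mu> B"
    using outer_measure_of_attain[of E \<mu>] by auto
  obtain Z where Z: "Z \<in> null_sets M" "\<And>p. fst p \<in> \<int> \<or> snd p \<in> \<int> \<Longrightarrow> dev p \<in> Z" by (rule dev_lines_null, rule that)
  \<comment> \<open>\<open>from_nat\<close> need not be injective; the test keeps a single code for
    every cell, which makes the sets disjoint.\<close>
  define C where "C n = (let kl = from_nat n in if to_nat kl = n then cell (fst kl) (snd kl) else {})" for n
  define A where "A n = B \<inter> C n" for n
  have Cb: "C n \<in> sets borel" for n
    unfolding C_def Let_def by (auto intro!: borel_open open_Times)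
  have A: "A n \<in> sets borel" for n using B(1) Cb by (auto simp: A_def)
  have "disjoint_family C"
    unfolding disjoint_family_on_def
  proof (intro ballI impI)
    fix m n :: nat assume mn: "m \<noteq> n"
    show "C m \<inter> C n = {}"
    proof (rule ccontr)
      assume "C m \<inter> C n \<noteq> {}"
      then obtain p where p: "p \<in> C m" "p \<in> C n" by auto
      have *: "n = to_nat (\<lfloor>fst p\<rfloor>, \<lfloor>snd p\<rfloor>)" if "p \<in> C n" for n
      proof -
        obtain k l :: int where kl: "from_nat n = (k, l)" using prod.exhaust by blast
        have "to_nat (k, l) = n" "p \<in> cell k l" using that unfolding C_def kl by (auto simp: Let_def split: if_splits)
        moreover then have "\<lfloor>fst p\<rfloor> = k" "\<lfloor>snd p\<rfloor> = l" by (auto simp: floor_eq_iff)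
        ultimately show ?thesis by simp
      qed
      show False using *[OF p(1)] *[OF p(2)] mn by simp
    qed
  qed
  then have dis: "disjoint_family A" by (auto simp: disjoint_family_on_def A_def)
  have dA: "dev ` A n \<in> sets M \<and> emeasure M (dev ` A n) = emeasure \<mu> (A n)" for n
  proof (cases "A n = {}")
    case False
    have "C n \<subseteq> cell (fst (from_nat n :: int \<times> int)) (snd (from_nat n :: int \<times> int))" by (simp add: C_def Let_def)
    then have "A n \<subseteq> cell (fst (from_nat n :: int \<times> int)) (snd (from_nat n :: int \<times> int))" by (auto simp: A_def)
    then show ?thesis using emeasure_dev_cell[OF A] by blast
  qed simp
  have sub: "dev ` E \<subseteq> (\<Union>n. dev ` A n) \<union> Z"
  proof
    fix y assume "y \<in> dev ` E"
    then obtain p where p: "p \<in> B" "y = dev p" using B(2) by auto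
    show "y \<in> (\<Union>n. dev ` A n) \<union> Z"
    proof (cases "fst p \<in> \<int> \<or> snd p \<in> \<int>")
      case False
      have fl: "of_int \<lfloor>x\<rfloor> < x \<and> x < of_int \<lfloor>x\<rfloor> + 1" if "x \<notin> \<int>" for x :: real
      proof -
        have "of_int \<lfloor>x\<rfloor> \<noteq> x" using that Ints_of_int[of "\<lfloor>x\<rfloor>"] by metis
        then have "of_int \<lfloor>x\<rfloor> < x" using of_int_floor_le[of x] by (metis order_le_neq_trans)
        then show ?thesis using real_of_int_floor_add_one_gt[of x] by simp
      qed
      have "p \<in> C (to_nat (\<lfloor>fst p\<rfloor>, \<lfloor>snd p\<rfloor>))" using fl[of "fst p"] fl[of "snd p"] False
        by (auto simp: C_def mem_Times_iff)
      then have "p \<in> A (to_nat (\<lfloor>fst p\<rfloor>, \<lfloor>snd p\<rfloor>))" using p by (simp add: A_def)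
      then show ?thesis using p by blast
    qed (use Z(2) p in auto)
  qed
  have "outer_measure_of M (dev ` E) \<le> outer_measure_of M ((\<Union>n. dev ` A n) \<union> Z)"
    by (rule outer_measure_of_mono[OF sub])
  also have "\<dots> = emeasure M ((\<Union>n. dev ` A n) \<union> Z)" using dA Z by (intro outer_measure_of_eq) auto
  also have "\<dots> = emeasure M (\<Union>n. dev ` A n)" using dA Z by (intro emeasure_Un_null_set) auto
  also have "\<dots> \<le> (\<Sum>n. emeasure M (dev ` A n))" using dA by (intro emeasure_subadditive_countably) auto
  also have "\<dots> = (\<Sum>n. emeasure \<mu> (A n))" using dA by simp
  also have "\<dots> = emeasure \<mu> (\<Union>n. A n)" using A dis by (intro suminf_emeasure) auto
  also have "\<dots> \<le> emeasure \<mu> B" using B(1) by (intro emeasure_mono) (auto simp: A_def)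
  finally show ?thesis using B by simp
qed

section \<open>Lifting solutions from the surface to the plane\<close>

abbreviation "lift_sol I \<psi> \<equiv> inclusion_solution L (krasovskii W) I \<psi>"

text \<open>A deck transformation moves a lift to any prescribed point over the same surface point,
  so that separate local lifts can be joined.\<close>

lemma align:
  assumes "lift_sol I \<psi>" "dev (\<psi> s) = dev p"
  shows "\<exists>\<phi>. lift_sol I \<phi> \<and> \<phi> s = p \<and> (\<forall>t. dev (\<phi> t) = dev (\<psi> t))"
proof -
  obtain c A where A: "linear A" "\<forall>x. norm (A x) = norm x" "c + A (\<psi> s) = p" "\<forall>x. dev (c + A x) = dev x"
    "\<forall>x. W (c + A x) = A (W x)" using deck[OF assms(2)] by blast
  then have "lift_sol I (\<lambda>t. c + A (\<psi> t))" using isometry_solution[of A W c L I \<psi>] assms(1) by blast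
  then show ?thesis using A(3,4) by blast
qed

text \<open>Path lifting by bisection: the chart readings in the definition of a solution supply
  short lifts, and adjacent ones are joined after a deck transformation of the second.\<close>

lemma lift_exists:
  assumes sol: "filippov_solution dev D W I \<phi>" and ab: "a \<le> b" "{a..b} \<subseteq> I"
  shows "\<exists>\<psi>. lift_sol {a..b} \<psi> \<and> (\<forall>t\<in>{a..b}. \<phi> t = dev (\<psi> t))"
proof -
  have "{a..b} \<subseteq> I \<longrightarrow> (\<exists>\<psi>. lift_sol {a..b} \<psi> \<and> (\<forall>t\<in>{a..b}. \<phi> t = dev (\<psi> t)))"
    using ab(1)
  proof (induction rule: Bolzano)
    case (trans a b c)
    show ?case
    proof
      assume I: "{a..c} \<subseteq> I"
      have "{a..b} \<subseteq> I" "{b..c} \<subseteq> I" using I trans by auto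
      then obtain \<psi>1 \<psi>2 where 1: "lift_sol {a..b} \<psi>1" "\<forall>t\<in>{a..b}. \<phi> t = dev (\<psi>1 t)"
        and 2: "lift_sol {b..c} \<psi>2" "\<forall>t\<in>{b..c}. \<phi> t = dev (\<psi>2 t)" using trans by auto
      have "dev (\<psi>2 b) = dev (\<psi>1 b)" using 1(2) 2(2) trans by (metis atLeastAtMost_iff order_refl)
      then obtain \<psi>3 where 3: "lift_sol {b..c} \<psi>3" "\<psi>3 b = \<psi>1 b" "\<forall>t. dev (\<psi>3 t) = dev (\<psi>2 t)"
        using align[OF 2(1)] by blast
      have "lift_sol {a..c} (\<lambda>t. if t \<le> b then \<psi>1 t else \<psi>3 t)"
        by (rule inclusion_solution_join[OF 1(1) 3(1)]) (use 3 trans in auto)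
      moreover have "\<forall>t\<in>{a..c}. \<phi> t = dev (if t \<le> b then \<psi>1 t else \<psi>3 t)"
        using 1(2) 2(2) 3(3) by auto
      ultimately show "\<exists>\<psi>. lift_sol {a..c} \<psi> \<and> (\<forall>t\<in>{a..c}. \<phi> t = dev (\<psi> t))" by blast
    qed
  next
    case (local s)
    show ?case
    proof (cases "s \<in> I")
      case False
      then show ?thesis by (intro exI[of _ 1]) auto
    next
      case True
      then obtain e \<psi> where e: "e > 0" and \<psi>: "locally_abs_continuous_on (I \<inter> ball s e) \<psi>"
        "\<forall>t \<in> I \<inter> ball s e. \<phi> t = dev (\<psi> t)"
        "AE t in lborel. t \<in> I \<inter> ball s e \<longrightarrow>
           (\<exists>v \<in> filippov_set (dev -` D) W (\<psi> t). (\<psi> has_vector_derivative v) (at t within I \<inter> ball s e))"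
        using sol unfolding filippov_solution_def by blast
      have "\<exists>\<psi>. lift_sol {a..b} \<psi> \<and> (\<forall>t\<in>{a..b}. \<phi> t = dev (\<psi> t))"
        if ab: "a \<le> s \<and> s \<le> b \<and> b - a < e" "{a..b} \<subseteq> I" for a b
      proof -
        have sub: "{a..b} \<subseteq> I \<inter> ball s e" using ab by (auto simp: dist_real_def)
        have "lift_sol {a..b} \<psi>"
        proof (rule abs_continuous_inclusion_solution)
          show "locally_abs_continuous_on {a..b} \<psi>" by (rule locally_abs_continuous_on_subset[OF \<psi>(1) sub])
          show "norm v \<le> L" if "v \<in> krasovskii W p" for p v using krasovskii_norm_le[OF W_le' that] .
          show "AE t in lborel. t \<in> {a..b} \<longrightarrow> (\<exists>v\<in>krasovskii W (\<psi> t). (\<psi> has_vector_derivative v) (at t within {a..b}))"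
            using \<psi>(3)
          proof eventually_elim
            case (elim t)
            show ?case
            proof
              assume "t \<in> {a..b}"
              then obtain v where v: "v \<in> filippov_set (dev -` D) W (\<psi> t)"
                "(\<psi> has_vector_derivative v) (at t within I \<inter> ball s e)" using elim sub by auto
              show "\<exists>v\<in>krasovskii W (\<psi> t). (\<psi> has_vector_derivative v) (at t within {a..b})"
                using filippov_set_subset_krasovskii[OF W_fin] v(1) has_vector_derivative_within_subset[OF v(2) sub] by blast
            qed
          qed
        qed (use L_pos' in auto)
        then show ?thesis using \<psi>(2) sub by blast
      qed
      then show ?thesis using e by blast
    qed
  qed
  then show ?thesis using ab by blast
qed

lemma image_subset_reach:
  "filippov_image dev D W t (dev ` E) \<subseteq> dev ` reach L (krasovskii W) UNIV 0 t E"
proof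
  fix y assume "y \<in> filippov_image dev D W t (dev ` E)"
  then obtain q I \<phi> where q: "q \<in> dev ` E" "filippov_solution dev D W I \<phi>" "0 \<in> I" "t \<in> I" "\<phi> 0 = q" "y = \<phi> t"
    unfolding filippov_image_def maximal_solutions_def by blast
  obtain p where p: "p \<in> E" "q = dev p" using q(1) by auto
  have iv: "is_interval I" using q(2) by (simp add: filippov_solution_def)
  have sub: "{min 0 t..max 0 t} \<subseteq> I"
  proof
    fix s assume "s \<in> {min 0 t..max 0 t}"
    then show "s \<in> I" using iv q(3,4) by (cases "0 \<le> t") (auto intro: mem_is_interval_1_I)
  qed
  obtain \<psi> where \<psi>: "lift_sol {min 0 t..max 0 t} \<psi>" "\<forall>s\<in>{min 0 t..max 0 t}. \<phi> s = dev (\<psi> s)"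
    using lift_exists[OF q(2) _ sub] by (meson max.coboundedI1 min.cobounded1)
  have "dev (\<psi> 0) = dev p" using \<psi>(2) q(5) p by auto
  then obtain \<psi>' where \<psi>': "lift_sol {min 0 t..max 0 t} \<psi>'" "\<psi>' 0 = p" "\<forall>s. dev (\<psi>' s) = dev (\<psi> s)"
    using align[OF \<psi>(1)] by blast
  have "\<psi>' t \<in> reach L (krasovskii W) UNIV 0 t E"
    unfolding reach_def closed_segment_real using \<psi>' p by blast
  moreover have "y = dev (\<psi>' t)" using q(6) \<psi>(2) \<psi>'(3) by auto
  ultimately show "y \<in> dev ` reach L (krasovskii W) UNIV 0 t E" by blast
qed

text \<open>A solution for all times is maximal simply because no set of times properly contains
  \<open>UNIV\<close>.\<close>

lemma global_solution_maximal:
  assumes \<psi>: "\<And>n::nat. inclusion_solution L (off_field W (dev -` D)) {\<tau> - real n..\<tau> + real n} \<psi>"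
  shows "(UNIV, \<lambda>t. dev (\<psi> t)) \<in> maximal_solutions dev D W (dev (\<psi> 0))"
proof -
  have "filippov_solution dev D W UNIV (\<lambda>t. dev (\<psi> t))"
    unfolding filippov_solution_def
  proof (intro conjI ballI is_interval_univ)
    fix s :: real
    obtain n :: nat where n: "\<bar>s - \<tau>\<bar> + 1 < real n" using reals_Archimedean2 by blast
    have sub: "ball s 1 \<subseteq> {\<tau> - real n..\<tau> + real n}" using n by (auto simp: dist_real_def)
    have b: "inclusion_solution L (off_field W (dev -` D)) (UNIV \<inter> ball s 1) \<psi>"
      using inclusion_solution_subset[OF \<psi> sub] by simp
    have off: "off_field W (dev -` D) p \<subseteq> filippov_set (dev -` D) W p" for p
      by (auto simp: off_field_def filippov_set_def)
    from inclusion_solution_mono[OF b off]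
    have "locally_abs_continuous_on (UNIV \<inter> ball s 1) \<psi>"
      "AE t in lborel. t \<in> UNIV \<inter> ball s 1 \<longrightarrow> (\<exists>v\<in>filippov_set (dev -` D) W (\<psi> t). (\<psi> has_vector_derivative v) (at t within UNIV \<inter> ball s 1))"
      using lipschitz_imp_locally_abs_continuous unfolding inclusion_solution_def by blast+
    then show "\<exists>e>0. \<exists>\<psi>'. locally_abs_continuous_on (UNIV \<inter> ball s e) \<psi>' \<and>
        (\<forall>t\<in>UNIV \<inter> ball s e. dev (\<psi> t) = dev (\<psi>' t)) \<and>
        (AE t in lborel. t \<in> UNIV \<inter> ball s e \<longrightarrow>
           (\<exists>v\<in>filippov_set (dev -` D) W (\<psi>' t). (\<psi>' has_vector_derivative v) (at t within UNIV \<inter> ball s e)))"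
      by (intro exI[of _ 1] conjI exI[of _ \<psi>]) auto
  qed
  then show ?thesis unfolding maximal_solutions_def by auto
qed

end

locale conservative_surface = flat_surface pt fold dev D W f L +
  planar_system W "dev -` D" L "\<lambda>p. ennreal (f (fold p))" F Cn
  for pt :: "real \<times> real \<Rightarrow> 'q" and fold dev D W f L F Cn
begin

theorem preserves: "preserves_measure (filippov_image dev D W) (weighted_area pt f)"
  unfolding preserves_measure_def
proof (intro ballI allI)
  fix A t assume "A \<in> sets (weighted_area pt f)"
  then have A: "A \<in> sets M" by (simp add: M_def)
  let ?Z = "filippov_image dev D W t"
  have w: "weight = (\<lambda>p. ennreal (f (fold p)))" by (auto simp: weight_def)
  have le: "outer_measure_of M (?Z B) \<le> emeasure M B" if B: "B \<in> sets M" for B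
  proof -
    let ?E = "{p \<in> unit_square. pt p \<in> B}"
    have "bounded ?E" by (rule bounded_subset[of unit_square]) (auto simp: unit_square_def intro: bounded_Times)
    have "B = dev ` ?E" using sets.sets_into_space[OF B] dev_square by (auto simp: space_M image_iff)
    then have "outer_measure_of M (?Z B) \<le> outer_measure_of M (dev ` reach L (krasovskii W) UNIV 0 t ?E)"
      using image_subset_reach[of t ?E] by (intro outer_measure_of_mono) simp
    also have "\<dots> \<le> outer_measure_of \<mu> (reach L (krasovskii W) UNIV 0 t ?E)" by (rule outer_dev)
    also have "\<dots> \<le> emeasure \<mu> ?E"
      unfolding w by (rule outer_reach[OF preimage_borel[OF B] \<open>bounded ?E\<close>])
    also have "\<dots> = emeasure M B" using emeasure_M[OF B] by simp
    finally show ?thesis .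
  qed
  have sp: "?Z B \<subseteq> space M" for B
  proof
    fix y assume "y \<in> ?Z B"
    then obtain I \<phi> where \<phi>: "filippov_solution dev D W I \<phi>" "t \<in> I" "y = \<phi> t"
      unfolding filippov_image_def maximal_solutions_def by blast
    then obtain e \<psi> where "e > 0" "\<forall>t \<in> I \<inter> ball t e. \<phi> t = dev (\<psi> t)" unfolding filippov_solution_def by blast
    then show "y \<in> space M" using \<phi> dev_in_space by auto
  qed
  define N where "N = dev ` {p. F p \<in> F ` Cn}"
  have "{p. F p \<in> F ` Cn} \<in> null_sets \<mu>"
    using level_null unfolding w by (auto simp: null_sets_density_iff intro: eventually_mono[OF AE_not_in])
  then have "outer_measure_of \<mu> {p. F p \<in> F ` Cn} = 0" by (simp add: null_sets_def)
  then have N0: "outer_measure_of M N = 0" using outer_dev[of "{p. F p \<in> F ` Cn}"] by (simp add: N_def)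
  \<comment> \<open>Through a point on a good level runs a solution for all times that passes it at
    time \<open>t\<close>; its position at time 0 lies in \<open>A\<close> or in the
    complement.\<close>
  have cover: "space M \<subseteq> ?Z A \<union> ?Z (space M - A) \<union> N"
  proof
    fix q assume q: "q \<in> space M"
    then obtain p where p: "p \<in> unit_square" "q = dev p" using space_M dev_square by auto
    show "q \<in> ?Z A \<union> ?Z (space M - A) \<union> N"
    proof (cases "F p \<in> F ` Cn")
      case False
      obtain \<psi> where \<psi>: "\<And>n::nat. osol {t - real n..t + real n} \<psi>" "\<psi> t = p"
        using global_solution[OF False, of t] by blast
      note m = global_solution_maximal[OF \<psi>(1)]
      have "q \<in> {\<phi> t |I \<phi>. (I, \<phi>) \<in> maximal_solutions dev D W (dev (\<psi> 0)) \<and> t \<in> I}"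
        by (rule CollectI, rule exI[of _ UNIV], rule exI[of _ "\<lambda>t. dev (\<psi> t)"]) (use m \<psi>(2) p in simp)
      moreover have "dev (\<psi> 0) \<in> A \<union> (space M - A)" using dev_in_space by auto
      ultimately show ?thesis unfolding filippov_image_def by blast
    qed (use p in \<open>auto simp: N_def\<close>)
  qed
  have "?Z A \<in> sets (completion M) \<and> emeasure (completion M) (?Z A) = emeasure M A"
  proof (rule completion_squeeze[OF finite_M A sp sp _ cover le[OF A] le N0])
    show "N \<subseteq> space M" using dev_in_space by (auto simp: N_def)
  qed (use A in auto)
  then show "?Z A \<in> sets (completion (weighted_area pt f)) \<and>
      emeasure (completion (weighted_area pt f)) (?Z A) = emeasure (weighted_area pt f) A"
    by (simp add: M_def)
qed

end

section \<open>The field on horizontal strips and the torus\<close>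

locale strips =
  fixes n :: nat and h a b :: "nat \<Rightarrow> real"
  assumes n2: "n \<ge> 2" and h0: "h 0 = 0" and hSuc: "\<And>i. i < n \<Longrightarrow> h i < h (Suc i)" and hn: "h n = 1"
    and b_pos: "\<And>i. i \<in> {1..n} \<Longrightarrow> b i > 0" and a0: "a 0 = a n" and b0: "b 0 = b n"
begin

text \<open>Strips are numbered cyclically from below by \<open>0, ..., n - 1\<close>, while the
  data call the lowest one \<open>n\<close>.\<close>

definition idx :: "nat \<Rightarrow> nat" where "idx i = (if i = 0 then n else i)"

definition zone :: "real \<Rightarrow> nat" where "zone y = strip n h (frac y)"

definition H :: "real set" where "H = {y. frac y \<in> h ` {..<n}}"

definition slope :: "nat \<Rightarrow> real" where "slope i = a i / b i"

lemma h_less: "i < j \<Longrightarrow> j \<le> n \<Longrightarrow> h i < h j"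
proof (induction j)
  case (Suc j)
  then show ?case using hSuc[of j] by (cases "i = j") auto
qed simp

lemma h_le: "i \<le> j \<Longrightarrow> j \<le> n \<Longrightarrow> h i \<le> h j"
  using h_less[of i j] by (cases "i = j") auto

lemma h_less_iff: "i \<le> n \<Longrightarrow> j \<le> n \<Longrightarrow> h i < h j \<longleftrightarrow> i < j"
  using h_less[of i j] h_le[of j i] by (cases "i < j") auto

lemma h_range: "i \<le> n \<Longrightarrow> 0 \<le> h i \<and> h i \<le> 1" "i < n \<Longrightarrow> h i < 1"
  using h_le[of 0 i] h_le[of i n] h_less[of i n] h0 hn by auto

lemma idx_range: "i < n \<Longrightarrow> idx i \<in> {1..n}" and idx_simps: "a (idx i) = a i" "b (idx i) = b i"
  using n2 a0 b0 by (auto simp: idx_def)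

lemma b_pos': "i < n \<Longrightarrow> b i > 0"
  using b_pos[OF idx_range] idx_simps by metis

lemma idx_surj: "j \<in> {1..n} \<Longrightarrow> \<exists>i<n. j = idx i"
proof (cases "j = n")
  case True then show ?thesis using n2 by (intro exI[of _ 0]) (auto simp: idx_def)
next
  case False assume "j \<in> {1..n}" then show ?thesis using False by (intro exI[of _ j]) (auto simp: idx_def)
qed

lemma strip_eq:
  assumes i: "i < n" and y: "h i \<le> y" "y < h (Suc i)"
  shows "strip n h y = idx i"
proof (cases "i = 0")
  case True then show ?thesis using y by (simp add: strip_def idx_def)
next
  case False
  have "h 1 \<le> y" using h_le[of 1 i] False i y by auto
  moreover have "Max {j \<in> {1..n - 1}. h j \<le> y} = i"
  proof (rule Max_eqI)
    fix j assume j: "j \<in> {j \<in> {1..n - 1}. h j \<le> y}"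
    then have "h j < h (Suc i)" using y by auto
    moreover have "j \<le> n" "Suc i \<le> n" using j i by auto
    ultimately show "j \<le> i" using h_less_iff[of j "Suc i"] by simp
  qed (use False i y in auto)
  ultimately show ?thesis using False by (simp add: strip_def idx_def)
qed

lemma strip_exists:
  assumes "0 \<le> y" "y < 1"
  obtains i where "i < n" "h i \<le> y" "y < h (Suc i)"
proof -
  define i where "i = Max {j. j < n \<and> h j \<le> y}"
  have ne: "0 \<in> {j. j < n \<and> h j \<le> y}" using n2 h0 assms by auto
  have "i \<in> {j. j < n \<and> h j \<le> y}" unfolding i_def using ne by (intro Max_in) auto
  then have i: "i < n" "h i \<le> y" by auto
  have "y < h (Suc i)"
  proof (rule ccontr)
    assume c: "\<not> y < h (Suc i)"
    then have "Suc i \<noteq> n" using hn assms by auto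
    then have "Suc i \<in> {j. j < n \<and> h j \<le> y}" using c i by auto
    then have "Suc i \<le> i" unfolding i_def by (intro Max_ge) auto
    then show False by simp
  qed
  then show thesis using i that by blast
qed

lemma frac_int_add: "0 \<le> t \<Longrightarrow> t < 1 \<Longrightarrow> frac (of_int k + t) = t"
  by (simp add: frac_unique_iff)

lemma zone_eq:
  assumes i: "i < n" and y: "of_int k + h i \<le> y" "y < of_int k + h (Suc i)"
  shows "zone y = idx i"
proof -
  have "0 \<le> y - of_int k" "y - of_int k < 1" using y h_range[of i] h_range[of "Suc i"] i by auto
  then have "frac y = y - of_int k" using frac_int_add[of "y - of_int k" k] by simp
  then show ?thesis using strip_eq[OF i, of "y - of_int k"] y by (simp add: zone_def)
qed

lemma not_H:
  assumes i: "i < n" and y: "of_int k + h i < y" "y < of_int k + h (Suc i)"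
  shows "y \<notin> H"
proof
  assume "y \<in> H"
  have "0 \<le> y - of_int k" "y - of_int k < 1" using y h_range[of i] h_range[of "Suc i"] i by auto
  then have "frac y = y - of_int k" using frac_int_add[of "y - of_int k" k] by simp
  then obtain j where j: "j < n" "h j = y - of_int k" using \<open>y \<in> H\<close> by (auto simp: H_def)
  then have "h i < h j" "h j < h (Suc i)" using y by auto
  then show False using h_less_iff[of i j] h_less_iff[of j "Suc i"] i j by auto
qed

lemma zone_exists:
  obtains i where "i < n" "of_int \<lfloor>y\<rfloor> + h i \<le> y" "y < of_int \<lfloor>y\<rfloor> + h (Suc i)"
proof -
  obtain i where "i < n" "h i \<le> frac y" "frac y < h (Suc i)"
    by (rule strip_exists[of "frac y"]) (auto simp: frac_lt_1)
  then show thesis using that[of i] by (simp add: frac_def)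
qed

lemma zone_range: "zone y \<in> {1..n}"
  by (rule zone_exists[of y]) (use zone_eq idx_range in metis)

text \<open>The length of the part of strip \<open>i\<close> that lies below
  \<open>t\<close>.\<close>

definition clamp_len :: "nat \<Rightarrow> real \<Rightarrow> real" where
  "clamp_len i t = max (h i) (min t (h (Suc i))) - h i"

definition S_period :: "real \<Rightarrow> real" where
  "S_period t = (\<Sum>i<n. slope i * clamp_len i t)"

text \<open>A primitive of the slope of the field, extended quasi-periodically.\<close>

definition S :: "real \<Rightarrow> real" where
  "S y = of_int \<lfloor>y\<rfloor> * S_period 1 + S_period (frac y)"

text \<open>The formula holds also at the right end point, where the floor jumps, because
  \<open>S_period 0 = 0\<close>. Hence \<open>S\<close> is affine on closed strips, including those
  that end at an integer.\<close>

lemma S_eq: 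
  assumes "of_int k \<le> y" "y \<le> of_int k + 1"
  shows "S y = of_int k * S_period 1 + S_period (y - of_int k)"
proof (cases "y = of_int k + 1")
  case True
  have "\<lfloor>y\<rfloor> = k + 1" using True by simp
  moreover have "S_period 0 = 0" unfolding S_period_def
  proof (rule sum.neutral, rule)
    fix i assume "i \<in> {..<n}"
    then show "slope i * clamp_len i 0 = 0" using h_range(1)[of i] h_range(1)[of "Suc i"] by (simp add: clamp_len_def)
  qed
  ultimately show ?thesis using True by (simp add: S_def frac_def algebra_simps)
next
  case False
  then have "\<lfloor>y\<rfloor> = k" using assms by (simp add: floor_eq_iff)
  then show ?thesis by (simp add: S_def frac_def)
qed

text \<open>Only the summand of strip \<open>i\<close> changes: lower strips are full and higher
  ones are empty at both arguments.\<close>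

lemma S_period_affine:
  assumes i: "i < n" and s: "s \<in> {h i..h (Suc i)}" and t: "t \<in> {h i..h (Suc i)}"
  shows "S_period s - S_period t = slope i * (s - t)"
proof -
  have "S_period s - S_period t = (\<Sum>j<n. slope j * clamp_len j s - slope j * clamp_len j t)"
    by (simp add: S_period_def sum_subtractf)
  also have "\<dots> = (\<Sum>j<n. if j = i then slope i * (s - t) else 0)"
  proof (intro sum.cong refl)
    fix j assume j: "j \<in> {..<n}"
    consider "j = i" | "j < i" | "i < j" by linarith
    then show "slope j * clamp_len j s - slope j * clamp_len j t = (if j = i then slope i * (s - t) else 0)"
    proof cases
      case 1
      then show ?thesis using s t by (simp add: clamp_len_def max_def min_def algebra_simps)
    next
      case 2
      then have "h (Suc j) \<le> h i" using h_le[of "Suc j" i] i by auto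
      then have "clamp_len j s = clamp_len j t" using s t by (auto simp: clamp_len_def)
      then show ?thesis using 2 by simp
    next
      case 3
      then have "h (Suc i) \<le> h j" using h_le[of "Suc i" j] j by auto
      then have "clamp_len j s = clamp_len j t" using s t by (auto simp: clamp_len_def max_def min_def)
      then show ?thesis using 3 by simp
    qed
  qed
  also have "\<dots> = slope i * (s - t)" using i by simp
  finally show ?thesis .
qed

lemma S_affine:
  assumes i: "i < n" and y: "y \<in> {of_int k + h i..of_int k + h (Suc i)}" and z: "z \<in> {of_int k + h i..of_int k + h (Suc i)}"
  shows "S z = S y + slope i * (z - y)"
proof -
  have "0 \<le> h i" "h (Suc i) \<le> 1" using h_range[of i] h_range[of "Suc i"] i by auto
  then have "S y = of_int k * S_period 1 + S_period (y - of_int k)" "S z = of_int k * S_period 1 + S_period (z - of_int k)"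
    using y z by (auto intro!: S_eq)
  moreover have "S_period (z - of_int k) - S_period (y - of_int k) = slope i * ((z - of_int k) - (y - of_int k))"
    using y z by (intro S_period_affine[OF i]) auto
  ultimately show ?thesis by simp
qed

text \<open>\<open>i\<close> and \<open>j\<close> number the strips just below and just above
  \<open>y\<close>. They may differ only at a height in \<open>H\<close>, and \<open>y\<close>
  itself counts as belonging to the upper one.\<close>

lemma local_structure:
  obtains \<rho> i j where "\<rho> > 0" "i < n" "j < n"
    "\<And>z. y - \<rho> < z \<Longrightarrow> z < y \<Longrightarrow> zone z = idx i \<and> z \<notin> H"
    "\<And>z. y < z \<Longrightarrow> z < y + \<rho> \<Longrightarrow> zone z = idx j \<and> z \<notin> H" "zone y = idx j"
    "\<And>z. y - \<rho> < z \<Longrightarrow> z \<le> y \<Longrightarrow> S z = S y + slope i * (z - y)"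
    "\<And>z. y \<le> z \<Longrightarrow> z < y + \<rho> \<Longrightarrow> S z = S y + slope j * (z - y)"
    "y \<notin> H \<Longrightarrow> i = j"
proof -
  define k where "k = \<lfloor>y\<rfloor>"
  obtain j where j: "j < n" "of_int k + h j \<le> y" "y < of_int k + h (Suc j)"
    unfolding k_def by (rule zone_exists)
  show thesis
  proof (cases "of_int k + h j < y")
    case True
    define \<rho> where "\<rho> = min (y - (of_int k + h j)) (of_int k + h (Suc j) - y)"
    have *: "z \<in> {of_int k + h j<..<of_int k + h (Suc j)}" if "y - \<rho> < z" "z < y + \<rho>" for z
      using that by (auto simp: \<rho>_def min_def split: if_splits)
    have y: "y \<in> {of_int k + h j..of_int k + h (Suc j)}" using j by auto
    have pos: "\<rho> > 0" using True j by (simp add: \<rho>_def)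
    show thesis
    proof (rule that[OF pos j(1) j(1)])
      show "zone z = idx j \<and> z \<notin> H" if "y - \<rho> < z" "z < y" for z
        using *[of z] that pos zone_eq[OF j(1), of k z] not_H[OF j(1), of k z] by auto
      show "zone z = idx j \<and> z \<notin> H" if "y < z" "z < y + \<rho>" for z
        using *[of z] that pos zone_eq[OF j(1), of k z] not_H[OF j(1), of k z] by auto
      show "zone y = idx j" by (rule zone_eq[OF j])
      show "S z = S y + slope j * (z - y)" if "y - \<rho> < z" "z \<le> y" for z
        using *[of z] that pos by (intro S_affine[OF j(1) y]) auto
      show "S z = S y + slope j * (z - y)" if "y \<le> z" "z < y + \<rho>" for z
        using *[of z] that pos by (intro S_affine[OF j(1) y]) auto
    qed simp
  next
    case False
    then have yeq: "y = of_int k + h j" using j by simp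
    have "frac y = h j" unfolding yeq using h_range[of j] j by (intro frac_int_add) auto
    then have yH: "y \<in> H" using j by (simp add: H_def)
    \<comment> \<open>For \<open>j = 0\<close> the strip below is the top one of the preceding
      period, so the integer shift \<open>l\<close> is smaller by one.\<close>
    obtain i l where i: "i < n" "y = of_int l + h (Suc i)"
    proof (cases "j = 0")
      case True
      then show thesis using that[of "n - 1" "k - 1"] n2 yeq h0 hn by simp
    next
      case False
      then show thesis using that[of "j - 1" k] j yeq by simp
    qed
    define \<rho> where "\<rho> = min (h (Suc i) - h i) (h (Suc j) - h j)"
    have pos: "\<rho> > 0" using hSuc i j by (simp add: \<rho>_def)
    have up: "z \<in> {of_int k + h j<..<of_int k + h (Suc j)}" if "y < z" "z < y + \<rho>" for z
      using that yeq by (auto simp: \<rho>_def)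
    have lo: "z \<in> {of_int l + h i<..<of_int l + h (Suc i)}" if "y - \<rho> < z" "z < y" for z
      using that i(2) by (auto simp: \<rho>_def)
    have y1: "y \<in> {of_int k + h j..of_int k + h (Suc j)}" using j by auto
    have y2: "y \<in> {of_int l + h i..of_int l + h (Suc i)}" using i hSuc[of i] by auto
    show thesis
    proof (rule that[OF pos i(1) j(1)])
      show "zone z = idx i \<and> z \<notin> H" if "y - \<rho> < z" "z < y" for z
        using lo[OF that] zone_eq[OF i(1), of l z] not_H[OF i(1), of l z] by auto
      show "zone z = idx j \<and> z \<notin> H" if "y < z" "z < y + \<rho>" for z
        using up[OF that] zone_eq[OF j(1), of k z] not_H[OF j(1), of k z] by auto
      show "zone y = idx j" by (rule zone_eq[OF j])
      show "S z = S y + slope i * (z - y)" if "y - \<rho> < z" "z \<le> y" for z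
        using lo[of z] that y2 by (intro S_affine[OF i(1) y2]) (cases "z = y"; auto)
      show "S z = S y + slope j * (z - y)" if "y \<le> z" "z < y + \<rho>" for z
        using up[of z] that y1 by (intro S_affine[OF j(1) y1]) (cases "z = y"; auto)
    qed (use yH in simp)
  qed
qed

lemma open_not_H: "open (- H)"
  unfolding open_dist
proof
  fix y assume "y \<in> - H"
  then have yH: "y \<notin> H" by simp
  obtain \<rho> i j where \<rho>: "\<rho> > 0" "\<And>z. y - \<rho> < z \<Longrightarrow> z < y \<Longrightarrow> zone z = idx i \<and> z \<notin> H"
    "\<And>z. y < z \<Longrightarrow> z < y + \<rho> \<Longrightarrow> zone z = idx j \<and> z \<notin> H"
    by (rule local_structure[of y]) blast
  have "z \<notin> H" if "dist z y < \<rho>" for z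
  proof -
    consider "z < y" | "z = y" | "y < z" by linarith
    then show ?thesis using \<rho>(2)[of z] \<rho>(3)[of z] yH that by cases (auto simp: dist_real_def)
  qed
  then show "\<exists>e>0. \<forall>z. dist z y < e \<longrightarrow> z \<in> - H" using \<rho>(1) by auto
qed

lemma countable_H: "countable H"
proof -
  have "H \<subseteq> (\<Union>i\<in>{..<n}. \<Union>k::int. {of_int k + h i})"
  proof
    fix y assume "y \<in> H"
    then obtain i where "i < n" "frac y = h i" by (auto simp: H_def)
    then have "y = of_int \<lfloor>y\<rfloor> + h i" by (simp add: frac_def)
    then show "y \<in> (\<Union>i\<in>{..<n}. \<Union>k::int. {of_int k + h i})" using \<open>i < n\<close> by blast
  qed
  moreover have "countable (\<Union>i\<in>{..<n}. \<Union>k::int. {of_int k + h i})" by auto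
  ultimately show ?thesis by (rule countable_subset)
qed

definition speed :: real where "speed = 1 + (\<Sum>i\<in>{1..n}. \<bar>a i\<bar> + \<bar>b i\<bar>)"

lemma speed_pos: "speed > 0"
  unfolding speed_def by (intro add_pos_nonneg sum_nonneg) auto

lemma speed_le: "i \<in> {1..n} \<Longrightarrow> \<bar>s\<bar> = 1 \<Longrightarrow> norm (a i, s * b i) \<le> speed"
proof -
  assume i: "i \<in> {1..n}" and s: "\<bar>s\<bar> = 1"
  have "norm (a i, s * b i) \<le> \<bar>a i\<bar> + \<bar>b i\<bar>"
    using s by (simp add: norm_prod_def) (metis abs_mult mult_1 power2_abs power_mult_distrib power_one sqrt_sum_squares_le_sum_abs)
  also have "\<dots> \<le> (\<Sum>i\<in>{1..n}. \<bar>a i\<bar> + \<bar>b i\<bar>)" using i by (intro member_le_sum) auto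
  finally show ?thesis by (simp add: speed_def)
qed

lemma frac_h: "i \<le> n \<Longrightarrow> frac (h i) \<in> h ` {..<n}"
proof (cases "i = n")
  case True then show ?thesis using hn h0 n2 by (auto intro!: image_eqI[of _ _ 0])
next
  case False assume "i \<le> n"
  then have "i < n" using False by simp
  then have "frac (h i) = h i" using h_range[of i] by (simp add: frac_eq)
  then show ?thesis using \<open>i < n\<close> by auto
qed

text \<open>The maximum in \<open>strip\<close> is unfolded into a finite sum of cases, exactly one
  of whose conditions holds from height \<open>h 1\<close> on.\<close>

lemma strip_measurable:
  "(\<lambda>p :: real \<times> real. g (strip n h (snd p))) \<in> borel_measurable borel" for g :: "nat \<Rightarrow> real"
proof -
  have "(\<lambda>y. g (strip n h y)) = (\<lambda>y. if y < h 1 then g n else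
      (\<Sum>j\<in>{1..n-1}. if h j \<le> y \<and> (j = n - 1 \<or> y < h (Suc j)) then g j else 0))"
  proof
    fix y
    show "g (strip n h y) = (if y < h 1 then g n else
      (\<Sum>j\<in>{1..n-1}. if h j \<le> y \<and> (j = n - 1 \<or> y < h (Suc j)) then g j else 0))"
    proof (cases "y < h 1")
      case False
      define i where "i = Max {i \<in> {1..n-1}. h i \<le> y}"
      have "1 \<in> {i \<in> {1..n-1}. h i \<le> y}" using False n2 by auto
      then have "i \<in> {i \<in> {1..n-1}. h i \<le> y}" unfolding i_def by (intro Max_in) auto
      then have i: "i \<in> {1..n-1}" "h i \<le> y" by auto
      have iff: "h j \<le> y \<and> (j = n - 1 \<or> y < h (Suc j)) \<longleftrightarrow> j = i" if j: "j \<in> {1..n-1}" for j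
      proof
        assume j': "h j \<le> y \<and> (j = n - 1 \<or> y < h (Suc j))"
        have "j \<le> i" unfolding i_def using j j' by (intro Max_ge) auto
        moreover have "i \<le> j"
        proof (rule ccontr)
          assume "\<not> i \<le> j"
          then have sj: "Suc j \<le> i" "j \<noteq> n - 1" using i by auto
          moreover have "i \<le> n" using i by auto
          ultimately have "h (Suc j) \<le> y" using h_le[of "Suc j" i] i by linarith
          then show False using j' sj by auto
        qed
        ultimately show "j = i" by simp
      next
        assume "j = i"
        moreover have "i = n - 1 \<or> y < h (Suc i)"
        proof (rule ccontr)
          assume c: "\<not> (i = n - 1 \<or> y < h (Suc i))"
          then have "Suc i \<in> {i \<in> {1..n-1}. h i \<le> y}" using i by auto
          then have "Suc i \<le> i" unfolding i_def by (intro Max_ge) auto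
          then show False by simp
        qed
        ultimately show "h j \<le> y \<and> (j = n - 1 \<or> y < h (Suc j))" using i by auto
      qed
      have "(\<Sum>j\<in>{1..n-1}. if h j \<le> y \<and> (j = n - 1 \<or> y < h (Suc j)) then g j else 0) = (\<Sum>j\<in>{1..n-1}. if j = i then g j else 0)"
        using iff by (intro sum.cong) auto
      also have "\<dots> = g i" using i by simp
      finally show ?thesis using False by (simp add: strip_def i_def)
    qed (simp add: strip_def)
  qed
  moreover have "(\<lambda>y. if y < h 1 then g n else
      (\<Sum>j\<in>{1..n-1}. if h j \<le> y \<and> (j = n - 1 \<or> y < h (Suc j)) then g j else 0)) \<in> borel_measurable borel"
    by measurable
  ultimately have "(\<lambda>y. g (strip n h y)) \<in> borel_measurable borel" by simp
  moreover have "(snd :: real \<times> real \<Rightarrow> real) \<in> borel_measurable borel"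
    by (intro borel_measurable_continuous_onI continuous_intros)
  ultimately show ?thesis using measurable_compose by blast
qed

lemma strip_any_range: "strip n h y \<in> {1..n}"
proof (cases "y < h 1")
  case False
  then have "1 \<in> {i \<in> {1..n-1}. h i \<le> y}" using n2 by auto
  then have "Max {i \<in> {1..n-1}. h i \<le> y} \<in> {i \<in> {1..n-1}. h i \<le> y}" by (intro Max_in) auto
  then show ?thesis using False by (auto simp: strip_def)
qed (use n2 in \<open>auto simp: strip_def\<close>)

lemma strip_bound: "\<exists>B. \<forall>y. g (strip n h y) \<le> B" for g :: "nat \<Rightarrow> real"
  using strip_any_range by (intro exI[of _ "Max (g ` {1..n})"]) (auto intro!: Max_ge)

end

section \<open>The torus\<close>

lemma equivclp_invariant:
  assumes "equivclp r p q" and "\<And>x y. r x y \<Longrightarrow> R x y" "\<And>x. R x x" "\<And>x y. R x y \<Longrightarrow> R y x" "\<And>x y z. R x y \<Longrightarrow> R y z \<Longrightarrow> R x z"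
  shows "R p q"
  using assms(1) by (induction rule: equivclp_induct) (use assms(2-5) in blast)+

lemma torus_pt_eq_iff: "torus_pt p = torus_pt q \<longleftrightarrow> equivclp torus_glue p q"
  unfolding torus_pt_def by (auto intro: equivclp_sym equivclp_trans)

lemma klein_pt_eq_iff: "klein_pt p = klein_pt q \<longleftrightarrow> equivclp klein_glue p q"
  unfolding klein_pt_def by (auto intro: equivclp_sym equivclp_trans)

text \<open>The orbit relation of the integer translations of the plane. It contains the gluing and
  relates every point to its fold, so it bounds from outside what the gluing can identify.\<close>

definition torus_eq :: "real \<times> real \<Rightarrow> real \<times> real \<Rightarrow> bool" where
  "torus_eq p q \<longleftrightarrow> fst q - fst p \<in> \<int> \<and> snd q - snd p \<in> \<int>"

lemma torus_eq_trans: "torus_eq p q \<Longrightarrow> torus_eq q r \<Longrightarrow> torus_eq p r"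
  unfolding torus_eq_def using Ints_add[of "fst r - fst q" "fst q - fst p"] Ints_add[of "snd r - snd q" "snd q - snd p"] by simp

lemma torus_eq_sym: "torus_eq p q \<Longrightarrow> torus_eq q p"
  unfolding torus_eq_def using Ints_minus[of "fst q - fst p"] Ints_minus[of "snd q - snd p"] by simp

lemma torus_pt_eqD: "torus_pt p = torus_pt q \<Longrightarrow> torus_eq p q"
  unfolding torus_pt_eq_iff
  by (erule equivclp_invariant)
    (auto elim!: torus_glue.cases intro: torus_eq_trans torus_eq_sym simp: torus_eq_def[of "(_, _)"] torus_eq_def[of x x for x])

lemma torus_eq_fold: "torus_eq (torus_fold p) p"
  by (simp add: torus_eq_def torus_fold_def frac_def)

lemma torus_dev_eqD: "torus_dev p = torus_dev q \<Longrightarrow> torus_eq p q"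
  unfolding torus_dev_def
  using torus_pt_eqD torus_eq_fold torus_eq_sym torus_eq_trans by metis

text \<open>An interior point occurs in no gluing pair, so a chain of gluings cannot leave
  it.\<close>

lemma glue_interior:
  assumes "p \<in> {0<..<1} \<times> {0<..<1}" "equivclp r p q"
    and "\<And>x y. r x y \<Longrightarrow> x \<notin> {0<..<1} \<times> {0<..<1} \<and> y \<notin> {0<..<1} \<times> {0<..<1}"
  shows "p = q"
  using assms(2) by (induction rule: equivclp_induct) (use assms(1,3) in blast)+

lemma fold_unit: "torus_fold p \<in> unit_square" "klein_fold p \<in> unit_square"
  by (auto simp: torus_fold_def klein_fold_def unit_square_def less_imp_le frac_lt_1)

lemma frac_add_Ints: "z \<in> \<int> \<Longrightarrow> frac (z + x) = frac (x::real)"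
  by (metis add.commute frac_add_int_right Ints_cases)

lemma frac_measurable[measurable]: "(frac :: real \<Rightarrow> real) \<in> borel_measurable borel"
  unfolding frac_def[abs_def] by measurable

lemma fst_snd_measurable_real: "(fst :: real \<times> real \<Rightarrow> real) \<in> borel_measurable borel" "(snd :: real \<times> real \<Rightarrow> real) \<in> borel_measurable borel"
  by (intro borel_measurable_continuous_onI continuous_intros)+

lemma floor_open_cell:
  assumes "p \<in> cell k l" shows "\<lfloor>fst p\<rfloor> = k" "\<lfloor>snd p\<rfloor> = l"
  using assms by (auto simp: floor_eq_iff)


lemma torus_glue_boundary: "torus_glue x y \<Longrightarrow> x \<notin> open_square \<and> y \<notin> open_square"
  by (auto elim!: torus_glue.cases)

lemma klein_glue_boundary: "klein_glue x y \<Longrightarrow> x \<notin> open_square \<and> y \<notin> open_square"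
  by (auto elim!: klein_glue.cases)

locale weighted_strips = strips +
  fixes \<alpha> :: "nat \<Rightarrow> real"
  assumes \<alpha>_pos: "\<And>i. i \<in> {1..n} \<Longrightarrow> \<alpha> i > 0"
begin

lemma \<alpha>_zone_pos: "\<alpha> (zone y) > 0" "b (zone y) > 0"
  using \<alpha>_pos b_pos zone_range by auto

abbreviation "W_torus \<equiv> torus_field (strip_field n h a b)"

lemma W_torus: "W_torus q = (a (zone (snd q)), b (zone (snd q)))"
  by (simp add: torus_field_def strip_field_def torus_fold_def zone_def)

lemma torus_density: "strip_density n h \<alpha> (torus_fold q) = \<alpha> (zone (snd q))"
  by (simp add: strip_density_def torus_fold_def zone_def)

lemma torus_disc_H: "torus_dev q \<in> torus_disc n h \<Longrightarrow> snd q \<in> H"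
proof -
  assume "torus_dev q \<in> torus_disc n h"
  then obtain i x where i: "i \<in> {1..n}" "torus_pt (torus_fold q) = torus_pt (x, h i)"
    by (auto simp: torus_disc_def torus_dev_def)
  then have "torus_eq (torus_fold q) (x, h i)" using torus_pt_eqD by blast
  then have "torus_eq (x, h i) q" using torus_eq_fold torus_eq_sym torus_eq_trans by blast
  then have "snd q - h i \<in> \<int>" by (simp add: torus_eq_def)
  then have "frac (snd q) = frac (h i)" using frac_add_Ints[of "snd q - h i" "h i"] by simp
  then show "snd q \<in> H" using frac_h[of i] i by (simp add: H_def)
qed

lemma flat_torus: "flat_surface torus_pt torus_fold torus_dev W_torus (strip_density n h \<alpha>) speed"
proof
  show "torus_dev p = torus_pt (torus_fold p)" for p by (simp add: torus_dev_def)
  show "torus_fold p \<in> unit_square" for p by (rule fold_unit)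
  show "torus_fold p = p" if "p \<in> open_square" for p
    using that by (cases p) (auto simp: torus_fold_def frac_eq)
  show "torus_dev p = torus_pt p" if "p \<in> unit_square" for p using that by (rule torus_dev_square)
  show "p = q" if "p \<in> open_square" "q \<in> unit_square" "torus_pt p = torus_pt q" for p q
    using glue_interior[OF that(1) that(3)[unfolded torus_pt_eq_iff] torus_glue_boundary] .
  show "\<exists>\<sigma> c. \<bar>\<sigma>\<bar> = 1 \<and> (\<forall>p\<in>cell k l. torus_fold p \<in> open_square \<and> torus_fold p = (fst p - of_int k, \<sigma> * (snd p - c))) \<and>
        (\<forall>p\<in>open_square. (fst p + of_int k, \<sigma> * snd p + c) \<in> cell k l)" for k l :: int
  proof (rule exI[of _ 1], rule exI[of _ "of_int l"], intro conjI ballI)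
    fix p assume p: "p \<in> cell k l"
    then show "torus_fold p = (fst p - of_int k, 1 * (snd p - of_int l))"
      by (simp add: torus_fold_def frac_def floor_open_cell[OF p])
    then show "torus_fold p \<in> open_square" using p by auto
  qed auto
  show "torus_fold p \<notin> open_square" if "fst p \<in> \<int> \<or> snd p \<in> \<int>" for p
    using that by (auto simp: torus_fold_def)
  show "\<exists>c A. linear A \<and> (\<forall>x. norm (A x) = norm x) \<and> c + A p = q \<and>
        (\<forall>x. torus_dev (c + A x) = torus_dev x) \<and> (\<forall>x. W_torus (c + A x) = A (W_torus x))"
    if "torus_dev p = torus_dev q" for p q
  proof -
    have e: "torus_eq p q" using torus_dev_eqD[OF that] .
    then have f: "torus_fold ((q - p) + x) = torus_fold x" for x
      by (simp add: torus_fold_def torus_eq_def frac_add_Ints)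
    show ?thesis
      by (intro exI[of _ "q - p"] exI[of _ "\<lambda>x. x"]) (simp add: f torus_dev_def torus_field_def linear_id[unfolded id_def])
  qed
  show "speed > 0" by (rule speed_pos)
  show "norm (W_torus p) \<le> speed" for p unfolding W_torus using speed_le[OF zone_range, of 1] by simp
  have "range W_torus \<subseteq> (\<lambda>i. (a i, b i)) ` {1..n}" using zone_range by (auto simp: W_torus)
  then show "finite (range W_torus)" by (rule finite_subset) simp
  show "strip_density n h \<alpha> \<in> borel_measurable borel"
    unfolding strip_density_def[abs_def] by (rule strip_measurable)
  note [measurable] = fst_snd_measurable_real
  show "torus_fold \<in> borel_measurable borel"
    unfolding torus_fold_def[abs_def] by measurable
  show "\<exists>B. \<forall>p. strip_density n h \<alpha> p \<le> B" using strip_bound[of \<alpha>] by (auto simp: strip_density_def)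
qed

lemma torus_two_zone:
  obtains \<rho> i j where "\<rho> > 0" "i < n" "j < n" "zone (snd p) = idx j"
    "two_zone W_torus (torus_dev -` torus_disc n h) id (snd p) (a i, b i) (a j, b j) (ball p \<rho>)"
    "\<And>q. q \<in> ball p \<rho> \<Longrightarrow> snd q < snd p \<Longrightarrow> zone (snd q) = idx i"
    "\<And>q. q \<in> ball p \<rho> \<Longrightarrow> snd q > snd p \<Longrightarrow> zone (snd q) = idx j"
proof -
  obtain \<rho> i j where \<rho>: "\<rho> > 0" "i < n" "j < n"
    "\<And>z. snd p - \<rho> < z \<Longrightarrow> z < snd p \<Longrightarrow> zone z = idx i \<and> z \<notin> H"
    "\<And>z. snd p < z \<Longrightarrow> z < snd p + \<rho> \<Longrightarrow> zone z = idx j \<and> z \<notin> H" "zone (snd p) = idx j"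
    by (rule local_structure[of "snd p"]) blast
  have near: "snd p - \<rho> < snd q \<and> snd q < snd p + \<rho>" if "q \<in> ball p \<rho>" for q
    using dist_snd_le[of p q] that by (auto simp: dist_real_def)
  show thesis
  proof (rule that[OF \<rho>(1,2,3,6)])
    show "two_zone W_torus (torus_dev -` torus_disc n h) id (snd p) (a i, b i) (a j, b j) (ball p \<rho>)"
      unfolding two_zone_def
    proof (intro conjI ballI impI)
      fix q assume q: "q \<in> ball p \<rho>"
      show "W_torus q = (a i, b i)" "q \<notin> torus_dev -` torus_disc n h" if "snd (id q) < snd p"
        using \<rho>(4)[of "snd q"] near[OF q] that torus_disc_H[of q] by (auto simp: W_torus idx_simps)
      show "W_torus q = (a j, b j)" "q \<notin> torus_dev -` torus_disc n h" if "snd (id q) > snd p"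
        using \<rho>(5)[of "snd q"] near[OF q] that torus_disc_H[of q] by (auto simp: W_torus idx_simps)
      show "W_torus q \<in> {(a i, b i), (a j, b j)}" if "snd (id q) = snd p"
        using that \<rho>(6) by (simp add: W_torus idx_simps)
    qed (auto simp: coord_perm_def)
  qed (use \<rho>(4,5) near in auto)
qed

text \<open>Since every \<open>b i\<close> is positive, the field crosses all lines and flow boxes
  exist everywhere: there are no exceptional points, and a constant serves as first
  integral.\<close>

lemma torus_sufficient:
  assumes C: "C > 0" "\<And>i. i \<in> {1..n} \<Longrightarrow> \<alpha> i = C / b i"
  shows "preserves_measure (torus_flow n h a b) (weighted_area torus_pt (strip_density n h \<alpha>))"
proof -
  interpret flat_surface torus_pt torus_fold torus_dev "torus_disc n h" W_torus "strip_density n h \<alpha>" speed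
    by (rule flat_torus)
  have "conservative_surface torus_pt torus_fold torus_dev (torus_disc n h) W_torus (strip_density n h \<alpha>) speed (\<lambda>_. 0) {}"
  proof
    fix p :: "real \<times> real"
    obtain \<rho> i j where \<rho>: "\<rho> > 0" "i < n" "j < n"
      and tz: "two_zone W_torus (torus_dev -` torus_disc n h) id (snd p) (a i, b i) (a j, b j) (ball p \<rho>)"
      and z: "\<And>q. q \<in> ball p \<rho> \<Longrightarrow> snd q < snd p \<Longrightarrow> zone (snd q) = idx i"
        "\<And>q. q \<in> ball p \<rho> \<Longrightarrow> snd q > snd p \<Longrightarrow> zone (snd q) = idx j"
      by (rule torus_two_zone[of p]) blast
    have bp: "b i > 0" "b j > 0" using b_pos' \<rho> by auto
    have "flow_box speed W_torus (torus_dev -` torus_disc n h) (\<lambda>p. ennreal (strip_density n h \<alpha> (torus_fold p)))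
        (\<lambda>_. 0) ((\<lambda>_. 0) ` {}) (ball p \<rho>)"
    proof (rule crossing_flow_box[OF tz _ _ _ _ _ _ C(1), where ?F1.0="\<lambda>_. 0"])
      show "norm (a i, b i) \<le> speed" "norm (a j, b j) \<le> speed"
        using speed_le[OF idx_range[OF \<rho>(2)], of 1] speed_le[OF idx_range[OF \<rho>(3)], of 1] by (simp_all add: idx_simps)
      show "ennreal (strip_density n h \<alpha> (torus_fold q)) = ennreal (C / \<bar>snd (id (a i, b i))\<bar>)"
        if "q \<in> ball p \<rho>" "snd (id q) < snd p" for q
        using that z(1)[of q] C(2)[OF idx_range[OF \<rho>(2)]] bp by (simp add: torus_density idx_simps)
      show "ennreal (strip_density n h \<alpha> (torus_fold q)) = ennreal (C / \<bar>snd (id (a j, b j))\<bar>)"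
        if "q \<in> ball p \<rho>" "snd (id q) > snd p" for q
        using that z(2)[of q] C(2)[OF idx_range[OF \<rho>(3)]] bp by (simp add: torus_density idx_simps)
    qed (use bp in auto)
    then show "\<exists>U. p \<in> U \<and> flow_box speed W_torus (torus_dev -` torus_disc n h) (\<lambda>p. ennreal (strip_density n h \<alpha> (torus_fold p)))
        (\<lambda>_. 0) ((\<lambda>_. 0) ` {}) U" using \<rho>(1) by (intro exI[of _ "ball p \<rho>"]) auto
  qed (use speed_pos W_le' in \<open>auto simp: continuous_on_const\<close>)
  then show ?thesis unfolding torus_flow_def by (rule conservative_surface.preserves)
qed

end

section \<open>The Klein bottle\<close>

text \<open>The orbit relation of the group generated by unit translations of the second coordinate
  and the glide reflection from \<open>(x, y)\<close> to \<open>(x + 1, 1 - y)\<close>; an odd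
  number of glides negates the height modulo integers.\<close>

definition klein_eq :: "real \<times> real \<Rightarrow> real \<times> real \<Rightarrow> bool" where
  "klein_eq p q \<longleftrightarrow> (\<exists>m::int. fst q = fst p + of_int m \<and> (if even m then snd q - snd p \<in> \<int> else snd q + snd p \<in> \<int>))"

lemma klein_eq_refl: "klein_eq p p"
  by (auto simp: klein_eq_def intro: exI[of _ 0])

lemma klein_eq_sym: "klein_eq p q \<Longrightarrow> klein_eq q p"
proof -
  assume "klein_eq p q"
  then obtain m :: int where m: "fst q = fst p + of_int m" "if even m then snd q - snd p \<in> \<int> else snd q + snd p \<in> \<int>"
    by (auto simp: klein_eq_def)
  show ?thesis unfolding klein_eq_def
    using m Ints_minus[of "snd q - snd p"] by (intro exI[of _ "- m"]) (auto simp: add.commute)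
qed

lemma klein_eq_trans: "klein_eq p q \<Longrightarrow> klein_eq q r \<Longrightarrow> klein_eq p r"
proof -
  assume "klein_eq p q" "klein_eq q r"
  then obtain m l :: int where m: "fst q = fst p + of_int m" "if even m then snd q - snd p \<in> \<int> else snd q + snd p \<in> \<int>"
    and l: "fst r = fst q + of_int l" "if even l then snd r - snd q \<in> \<int> else snd r + snd q \<in> \<int>"
    by (auto simp: klein_eq_def)
  have "if even (m + l) then snd r - snd p \<in> \<int> else snd r + snd p \<in> \<int>"
    using m(2) l(2) Ints_add[of "snd r - snd q" "snd q - snd p"] Ints_add[of "snd r - snd q" "snd q + snd p"]
      Ints_diff[of "snd r + snd q" "snd q - snd p"] Ints_diff[of "snd r + snd q" "snd q + snd p"]
    by (auto split: if_splits)
  then show ?thesis unfolding klein_eq_def using m(1) l(1) by (intro exI[of _ "m + l"]) simp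
qed

lemma klein_glue_eqv: "klein_glue p q \<Longrightarrow> klein_eq p q"
proof (induction rule: klein_glue.induct)
  case (1 x) then show ?case by (auto simp: klein_eq_def intro: exI[of _ 0])
next
  case (2 y) then show ?case unfolding klein_eq_def by (intro exI[of _ 1]) auto
qed

lemma klein_pt_eqD: "klein_pt p = klein_pt q \<Longrightarrow> klein_eq p q"
  unfolding klein_pt_eq_iff
  by (erule equivclp_invariant) (auto intro: klein_glue_eqv klein_eq_refl klein_eq_sym klein_eq_trans)

lemma klein_eq_fold: "klein_eq (klein_fold p) p"
proof -
  have "snd p + frac (1 - snd p) \<in> \<int>"
  proof -
    have "snd p + frac (1 - snd p) = of_int (1 - \<lfloor>1 - snd p\<rfloor>)" by (simp add: frac_def)
    then show ?thesis by (metis Ints_of_int)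
  qed
  moreover have "snd p - frac (snd p) \<in> \<int>" by (simp add: frac_def)
  ultimately show ?thesis unfolding klein_eq_def klein_fold_def
    by (intro exI[of _ "\<lfloor>fst p\<rfloor>"]) (simp add: frac_def)
qed

lemma klein_dev_eqD: "klein_dev p = klein_dev q \<Longrightarrow> klein_eq p q"
  unfolding klein_dev_def
  using klein_pt_eqD klein_eq_fold klein_eq_sym klein_eq_trans by metis

context weighted_strips begin

abbreviation "W_klein \<equiv> klein_field (strip_field n h a b)"

text \<open>Up to an integer, the height in the square of the surface point below \<open>q\<close>:
  odd columns are developed with the second coordinate reversed.\<close>

definition fibre :: "real \<times> real \<Rightarrow> real" where
  "fibre q = (if even \<lfloor>fst q\<rfloor> then snd q else 1 - snd q)"

definition orient :: "real \<times> real \<Rightarrow> real" where "orient q = (if even \<lfloor>fst q\<rfloor> then 1 else - 1)"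

lemma W_klein: "W_klein q = (a (zone (fibre q)), orient q * b (zone (fibre q)))"
  by (simp add: klein_field_def strip_field_def klein_fold_def zone_def fibre_def orient_def Let_def)

lemma klein_density: "strip_density n h \<alpha> (klein_fold q) = \<alpha> (zone (fibre q))"
  by (simp add: strip_density_def klein_fold_def zone_def fibre_def)

lemma klein_disc_H: "klein_dev q \<in> klein_disc n h \<Longrightarrow> fst q \<in> \<int> \<or> fibre q \<in> H"
proof -
  assume "klein_dev q \<in> klein_disc n h"
  then obtain r where r: "klein_pt (klein_fold q) = klein_pt r" "r \<in> (\<Union>i\<in>{1..n}. {0..1} \<times> {h i}) \<union> {0} \<times> {0..1}"
    by (auto simp: klein_disc_def klein_dev_def)
  then have "klein_eq r q" using klein_pt_eqD klein_eq_fold klein_eq_sym klein_eq_trans by metis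
  then obtain m :: int where m: "fst q = fst r + of_int m" "if even m then snd q - snd r \<in> \<int> else snd q + snd r \<in> \<int>"
    by (auto simp: klein_eq_def)
  show ?thesis
  proof (cases "fst q \<in> \<int>")
    case False
    then have "fst r \<noteq> 0" "fst r \<noteq> 1" using m(1) by (auto simp flip: of_int_add)
    then obtain i where i: "i \<in> {1..n}" "0 < fst r" "fst r < 1" "snd r = h i"
      using r(2) by (auto simp: less_le)
    then have fl: "\<lfloor>fst q\<rfloor> = m" using m(1) by (simp add: floor_eq_iff)
    have "frac (fibre q) = frac (h i)"
    proof (cases "even m")
      case True
      then show ?thesis using m(2) i frac_add_Ints[of "snd q - h i" "h i"] by (simp add: fibre_def fl)
    next
      case False
      then have "snd q + h i \<in> \<int>" using m(2) i by simp
      then have "1 - (snd q + h i) \<in> \<int>" by (intro Ints_diff) auto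
      then show ?thesis using False frac_add_Ints[of "1 - (snd q + h i)" "h i"] by (simp add: fibre_def fl)
    qed
    then show ?thesis using frac_h[of i] i by (simp add: H_def)
  qed simp
qed

lemma klein_fold_deck:
  assumes "fst c = of_int m" "snd c \<in> \<int>"
  shows "klein_fold (c + (fst x, (if even m then 1 else - 1) * snd x)) = klein_fold x"
proof -
  obtain l :: int where l: "snd c = of_int l" using assms(2) by (auto elim: Ints_cases)
  have f: "frac (of_int i + t) = frac t" for i and t :: real by (rule frac_add_Ints) simp
  have fl: "\<lfloor>of_int m + fst x\<rfloor> = m + \<lfloor>fst x\<rfloor>" by simp
  have "frac (1 - (of_int l + snd x)) = frac (1 - snd x)" using f[of "- l" "1 - snd x"] by (simp add: algebra_simps)
  moreover have "frac (1 - (of_int l - snd x)) = frac (snd x)" using f[of "1 - l" "snd x"] by (simp add: algebra_simps)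
  moreover have "frac (of_int l - snd x) = frac (1 - snd x)" using f[of "l - 1" "1 - snd x"] by (simp add: algebra_simps)
  ultimately show ?thesis using assms(1) l by (auto simp: klein_fold_def f fl)
qed

lemma flat_klein: "flat_surface klein_pt klein_fold klein_dev W_klein (strip_density n h \<alpha>) speed"
proof
  show "klein_dev p = klein_pt (klein_fold p)" for p by (simp add: klein_dev_def)
  show "klein_fold p \<in> unit_square" for p by (rule fold_unit)
  show "klein_fold p = p" if "p \<in> open_square" for p
  proof -
    have "\<lfloor>fst p\<rfloor> = 0" using that by (auto simp: floor_eq_iff)
    then show ?thesis using that by (cases p) (auto simp: klein_fold_def frac_eq)
  qed
  show "klein_dev p = klein_pt p" if "p \<in> unit_square" for p using that by (rule klein_dev_square)
  show "p = q" if "p \<in> open_square" "q \<in> unit_square" "klein_pt p = klein_pt q" for p q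
    using glue_interior[OF that(1) that(3)[unfolded klein_pt_eq_iff] klein_glue_boundary] .
  show "\<exists>\<sigma> c. \<bar>\<sigma>\<bar> = 1 \<and> (\<forall>p\<in>cell k l. klein_fold p \<in> open_square \<and> klein_fold p = (fst p - of_int k, \<sigma> * (snd p - c))) \<and>
        (\<forall>p\<in>open_square. (fst p + of_int k, \<sigma> * snd p + c) \<in> cell k l)" for k l :: int
  proof (cases "even k")
    case True
    show ?thesis
    proof (rule exI[of _ 1], rule exI[of _ "of_int l"], intro conjI ballI)
      fix p assume p: "p \<in> cell k l"
      then show "klein_fold p = (fst p - of_int k, 1 * (snd p - of_int l))"
        using True by (simp add: klein_fold_def frac_def floor_open_cell[OF p])
      then show "klein_fold p \<in> open_square" using p by auto
    qed auto
  next
    case False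
    show ?thesis
    \<comment> \<open>On an odd column the fold takes a height \<open>y\<close> of the cell to
      \<open>of_int l + 1 - y\<close>.\<close>
    proof (rule exI[of _ "-1"], rule exI[of _ "of_int l + 1"], intro conjI ballI)
      fix p assume p: "p \<in> cell k l"
      have "frac (1 - snd p) = 1 - snd p + of_int l"
        using p frac_int_add[of "1 - snd p + of_int l" "- l"] by auto
      then show "klein_fold p = (fst p - of_int k, - 1 * (snd p - (of_int l + 1)))"
        using False by (simp add: klein_fold_def frac_def[of "fst p"] floor_open_cell[OF p])
      then show "klein_fold p \<in> open_square" using p by auto
    qed auto
  qed
  show "klein_fold p \<notin> open_square" if "fst p \<in> \<int> \<or> snd p \<in> \<int>" for p
    using that Ints_diff[OF Ints_1, of "snd p"] by (auto simp: klein_fold_def)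
  show "\<exists>c A. linear A \<and> (\<forall>x. norm (A x) = norm x) \<and> c + A p = q \<and>
        (\<forall>x. klein_dev (c + A x) = klein_dev x) \<and> (\<forall>x. W_klein (c + A x) = A (W_klein x))"
    if pq: "klein_dev p = klein_dev q" for p q
  proof -
    obtain m :: int where m: "fst q = fst p + of_int m" "if even m then snd q - snd p \<in> \<int> else snd q + snd p \<in> \<int>"
      using klein_dev_eqD[OF pq] by (auto simp: klein_eq_def)
    define s :: real where "s = (if even m then 1 else - 1)"
    define A :: "real \<times> real \<Rightarrow> real \<times> real" where "A x = (fst x, s * snd x)" for x
    define c where "c = q - A p"
    have c: "fst c = of_int m" "snd c \<in> \<int>" using m by (auto simp: c_def A_def s_def)
    have fold: "klein_fold (c + A x) = klein_fold x" for x
      using klein_fold_deck[OF c, of x] by (simp add: A_def s_def)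
    have "linear A" by (intro linearI) (auto simp: A_def algebra_simps)
    moreover have "norm (A x) = norm x" for x by (simp add: A_def s_def norm_prod_def)
    moreover have "W_klein (c + A x) = A (W_klein x)" for x
    proof -
      have "\<lfloor>fst (c + A x)\<rfloor> = m + \<lfloor>fst x\<rfloor>" using c by (simp add: A_def)
      then show ?thesis unfolding klein_field_def fold by (simp add: Let_def A_def s_def)
    qed
    ultimately show ?thesis using fold by (intro exI[of _ c] exI[of _ A]) (simp add: c_def klein_dev_def)
  qed
  show "speed > 0" by (rule speed_pos)
  show "norm (W_klein p) \<le> speed" for p unfolding W_klein using speed_le[OF zone_range] by (simp add: orient_def)
  have "range W_klein \<subseteq> (\<lambda>(i, s). (a i, s * b i)) ` ({1..n} \<times> {1, - 1})"
  proof
    fix w assume "w \<in> range W_klein"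
    then obtain q where "w = (\<lambda>(i, s). (a i, s * b i)) (zone (fibre q), orient q)" by (auto simp: W_klein)
    moreover have "(zone (fibre q), orient q) \<in> {1..n} \<times> {1, - 1}" using zone_range by (simp add: orient_def)
    ultimately show "w \<in> (\<lambda>(i, s). (a i, s * b i)) ` ({1..n} \<times> {1, - 1})" by blast
  qed
  then show "finite (range W_klein)" by (rule finite_subset) simp
  show "strip_density n h \<alpha> \<in> borel_measurable borel"
    unfolding strip_density_def[abs_def] by (rule strip_measurable)
  note [measurable] = fst_snd_measurable_real
  \<comment> \<open>Parity of the floor, rewritten so that it is visibly a Borel condition on
    \<open>x\<close>.\<close>
  have e: "even \<lfloor>x\<rfloor> \<longleftrightarrow> frac (x / 2) < 1 / 2" for x :: real
  proof -
    have "x / 2 = of_int (\<lfloor>x\<rfloor> div 2) + (of_int (\<lfloor>x\<rfloor> mod 2) + frac x) / 2"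
    proof -
      have "real_of_int \<lfloor>x\<rfloor> = 2 * of_int (\<lfloor>x\<rfloor> div 2) + of_int (\<lfloor>x\<rfloor> mod 2)"
        by (metis mult_div_mod_eq of_int_add of_int_mult of_int_numeral)
      moreover have "x = of_int \<lfloor>x\<rfloor> + frac x" by (simp add: frac_def)
      moreover have "x / 2 = D + (m + f) / 2" if "z = 2 * D + m" "x = z + f" for D m z f :: real
        using that by simp
      ultimately show ?thesis by blast
    qed
    moreover have "0 \<le> (of_int (\<lfloor>x\<rfloor> mod 2) + frac x) / 2" "(of_int (\<lfloor>x\<rfloor> mod 2) + frac x) / 2 < 1"
      using frac_lt_1[of x] frac_ge_0[of x] by (cases "even \<lfloor>x\<rfloor>"; simp add: even_iff_mod_2_eq_zero odd_iff_mod_2_eq_one)+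
    ultimately have f: "frac (x / 2) = (of_int (\<lfloor>x\<rfloor> mod 2) + frac x) / 2" using frac_int_add by metis
    show ?thesis unfolding f using frac_lt_1[of x] frac_ge_0[of x]
      by (cases "even \<lfloor>x\<rfloor>") (simp_all add: even_iff_mod_2_eq_zero odd_iff_mod_2_eq_one not_less)
  qed
  show "klein_fold \<in> borel_measurable borel"
    unfolding klein_fold_def[abs_def] e by measurable
  show "\<exists>B. \<forall>p. strip_density n h \<alpha> p \<le> B" using strip_bound[of \<alpha>] by (auto simp: strip_density_def)
qed

lemma klein_column_two_zone:
  assumes p: "fst p \<notin> \<int>"
  obtains \<rho> i j where "\<rho> > 0" "i < n" "j < n"
    "two_zone W_klein (klein_dev -` klein_disc n h) id (snd p) (a i, orient p * b i) (a j, orient p * b j) (ball p \<rho>)"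
    "\<And>q. q \<in> ball p \<rho> \<Longrightarrow> \<lfloor>fst q\<rfloor> = \<lfloor>fst p\<rfloor>"
    "\<And>q. q \<in> ball p \<rho> \<Longrightarrow> snd q < snd p \<Longrightarrow> zone (fibre q) = idx i \<and> fibre q \<notin> H"
    "\<And>q. q \<in> ball p \<rho> \<Longrightarrow> snd q > snd p \<Longrightarrow> zone (fibre q) = idx j \<and> fibre q \<notin> H"
proof -
  obtain \<rho>0 i0 j0 where r: "\<rho>0 > 0" "i0 < n" "j0 < n"
    "\<And>z. fibre p - \<rho>0 < z \<Longrightarrow> z < fibre p \<Longrightarrow> zone z = idx i0 \<and> z \<notin> H"
    "\<And>z. fibre p < z \<Longrightarrow> z < fibre p + \<rho>0 \<Longrightarrow> zone z = idx j0 \<and> z \<notin> H" "zone (fibre p) = idx j0"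
    by (rule local_structure[of "fibre p"]) blast
  define k where "k = \<lfloor>fst p\<rfloor>"
  have kp: "of_int k < fst p" "fst p < of_int k + 1"
  proof -
    have "of_int k \<noteq> fst p" using p Ints_of_int[of k] by metis
    then show "of_int k < fst p" unfolding k_def using of_int_floor_le[of "fst p"] by (metis order_le_neq_trans)
    show "fst p < of_int k + 1" unfolding k_def by simp
  qed
  \<comment> \<open>The ball stays within one column, away from the seams.\<close>
  define \<rho> where "\<rho> = Min {\<rho>0, fst p - of_int k, of_int k + 1 - fst p}"
  have \<rho>: "\<rho> > 0" "\<rho> \<le> \<rho>0" "\<rho> \<le> fst p - of_int k" "\<rho> \<le> of_int k + 1 - fst p" using r(1) kp by (auto simp: \<rho>_def)
  have near: "\<bar>snd p - snd q\<bar> < \<rho>0" "\<lfloor>fst q\<rfloor> = k" "fst q \<notin> \<int>" if "q \<in> ball p \<rho>" for q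
  proof -
    have d: "\<bar>snd p - snd q\<bar> < \<rho>" "\<bar>fst p - fst q\<bar> < \<rho>"
      using dist_snd_le[of p q] dist_fst_le[of p q] that by (auto simp: dist_real_def)
    then show "\<bar>snd p - snd q\<bar> < \<rho>0" using \<rho> by simp
    have "of_int k < fst q" "fst q < of_int k + 1" using d \<rho> by linarith+
    then show f: "\<lfloor>fst q\<rfloor> = k" by (simp add: floor_eq_iff)
    show "fst q \<notin> \<int>" using \<open>of_int k < fst q\<close> f floor_of_int by (metis Ints_cases less_irrefl)
  qed
  \<comment> \<open>In a reflected column, what lies above in the square lies below in the
    plane.\<close>
  define i j where "i = (if even k then i0 else j0)" and "j = (if even k then j0 else i0)"
  have lo: "zone (fibre q) = idx i \<and> fibre q \<notin> H" if "q \<in> ball p \<rho>" "snd q < snd p" for q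
    using near[OF that(1)] that(2) r(4)[of "fibre q"] r(5)[of "fibre q"]
    by (cases "even k") (auto simp: fibre_def i_def k_def)
  have up: "zone (fibre q) = idx j \<and> fibre q \<notin> H" if "q \<in> ball p \<rho>" "snd q > snd p" for q
    using near[OF that(1)] that(2) r(4)[of "fibre q"] r(5)[of "fibre q"]
    by (cases "even k") (auto simp: fibre_def j_def k_def)
  have mid: "zone (fibre q) \<in> {idx i, idx j}" if "q \<in> ball p \<rho>" "snd q = snd p" for q
    using near[OF that(1)] that(2) r(6) by (auto simp: fibre_def i_def j_def k_def)
  have or: "orient q = orient p" if "q \<in> ball p \<rho>" for q using near(2)[OF that] by (simp add: orient_def k_def)
  show thesis
  proof (rule that[OF \<rho>(1), of i j])
    show "i < n" "j < n" using r by (auto simp: i_def j_def)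
    show "two_zone W_klein (klein_dev -` klein_disc n h) id (snd p) (a i, orient p * b i) (a j, orient p * b j) (ball p \<rho>)"
      unfolding two_zone_def
    proof (intro conjI ballI impI)
      fix q assume q: "q \<in> ball p \<rho>"
      show "W_klein q = (a i, orient p * b i)" "q \<notin> klein_dev -` klein_disc n h" if "snd (id q) < snd p"
        using lo[OF q] that near(3)[OF q] klein_disc_H[of q] by (auto simp: W_klein idx_simps or[OF q])
      show "W_klein q = (a j, orient p * b j)" "q \<notin> klein_dev -` klein_disc n h" if "snd (id q) > snd p"
        using up[OF q] that near(3)[OF q] klein_disc_H[of q] by (auto simp: W_klein idx_simps or[OF q])
      show "W_klein q \<in> {(a i, orient p * b i), (a j, orient p * b j)}" if "snd (id q) = snd p"
        using that mid[OF q] by (auto simp: W_klein idx_simps or[OF q])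
    qed (auto simp: coord_perm_def)
  qed (use lo up near k_def in auto)
qed

text \<open>Away from the corners each side of a seam lies in a single strip. Exactly one of the two
  adjacent columns is reflected, so the strips are those of \<open>snd p\<close> and
  \<open>1 - snd p\<close>, and the vertical velocities have opposite signs.\<close>

lemma klein_seam_two_zone:
  assumes p: "fst p = of_int k" and y: "snd p \<notin> H" "1 - snd p \<notin> H"
  defines "l \<equiv> (if even k then zone (1 - snd p) else zone (snd p))"
    and "r \<equiv> (if even k then zone (snd p) else zone (1 - snd p))" and "s \<equiv> (if even k then 1 else - 1 :: real)"
  obtains \<rho> where "\<rho> > 0" "\<rho> \<le> 1"
    "two_zone W_klein (klein_dev -` klein_disc n h) prod.swap (of_int k) (a l, - s * b l) (a r, s * b r) (ball p \<rho>)"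
    "\<And>q. q \<in> ball p \<rho> \<Longrightarrow> fst q < of_int k \<Longrightarrow> zone (fibre q) = l"
    "\<And>q. q \<in> ball p \<rho> \<Longrightarrow> fst q > of_int k \<Longrightarrow> zone (fibre q) = r"
    "\<And>q. q \<in> ball p \<rho> \<Longrightarrow> S (snd q) = S (snd p) + slope (zone (snd p)) * (snd q - snd p)"
    "\<And>q. q \<in> ball p \<rho> \<Longrightarrow> \<bar>fst q - of_int k\<bar> < 1"
proof -
  have single: "\<exists>\<rho>>0. \<forall>z. \<bar>z - y\<bar> < \<rho> \<longrightarrow> zone z = zone y \<and> z \<notin> H \<and> S z = S y + slope (zone y) * (z - y)"
    if yH: "y \<notin> H" for y
  proof -
    obtain \<rho> i j where r: "\<rho> > 0" "i < n" "j < n"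
      "\<And>z. y - \<rho> < z \<Longrightarrow> z < y \<Longrightarrow> zone z = idx i \<and> z \<notin> H"
      "\<And>z. y < z \<Longrightarrow> z < y + \<rho> \<Longrightarrow> zone z = idx j \<and> z \<notin> H" "zone y = idx j"
      "\<And>z. y - \<rho> < z \<Longrightarrow> z \<le> y \<Longrightarrow> S z = S y + slope i * (z - y)"
      "\<And>z. y \<le> z \<Longrightarrow> z < y + \<rho> \<Longrightarrow> S z = S y + slope j * (z - y)"
      "y \<notin> H \<Longrightarrow> i = j"
      by (rule local_structure[of y]) blast
    have ij: "i = j" using r(9) yH by simp
    have sl: "slope (zone y) = slope j" by (simp add: r(6) slope_def idx_simps)
    have "zone z = zone y \<and> z \<notin> H \<and> S z = S y + slope (zone y) * (z - y)" if "\<bar>z - y\<bar> < \<rho>" for z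
    proof -
      consider "z < y" | "z = y" | "y < z" by linarith
      then show ?thesis using r(4)[of z] r(5)[of z] r(6) r(7)[of z] r(8)[of z] ij that sl yH by cases auto
    qed
    then show ?thesis using r(1) by blast
  qed
  obtain \<rho>1 where 1: "\<rho>1 > 0" "\<And>z. \<bar>z - snd p\<bar> < \<rho>1 \<Longrightarrow> zone z = zone (snd p) \<and> z \<notin> H \<and> S z = S (snd p) + slope (zone (snd p)) * (z - snd p)"
    using single[OF y(1)] by blast
  obtain \<rho>2 where 2: "\<rho>2 > 0" "\<And>z. \<bar>z - (1 - snd p)\<bar> < \<rho>2 \<Longrightarrow> zone z = zone (1 - snd p) \<and> z \<notin> H"
    using single[OF y(2)] by blast
  define \<rho> where "\<rho> = Min {\<rho>1, \<rho>2, 1}"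
  have \<rho>: "\<rho> > 0" "\<rho> \<le> \<rho>1" "\<rho> \<le> \<rho>2" "\<rho> \<le> 1" using 1(1) 2(1) by (auto simp: \<rho>_def)
  have d: "\<bar>snd q - snd p\<bar> < \<rho>" "\<bar>fst q - of_int k\<bar> < \<rho>" if "q \<in> ball p \<rho>" for q
    using dist_snd_le[of p q] dist_fst_le[of p q] that p by (auto simp: dist_real_def)
  have z: "zone (snd q) = zone (snd p) \<and> snd q \<notin> H" "zone (1 - snd q) = zone (1 - snd p) \<and> 1 - snd q \<notin> H"
    if "q \<in> ball p \<rho>" for q using 1(2)[of "snd q"] 2(2)[of "1 - snd q"] d[OF that] \<rho> by auto
  have fl: "\<lfloor>fst q\<rfloor> = k - 1" if "q \<in> ball p \<rho>" "fst q < of_int k" for q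
    using d[OF that(1)] that \<rho> by (simp add: floor_eq_iff)
  have fr: "\<lfloor>fst q\<rfloor> = k" if "q \<in> ball p \<rho>" "fst q \<ge> of_int k" for q
    using d[OF that(1)] that \<rho> by (simp add: floor_eq_iff)
  have L: "zone (fibre q) = l \<and> fibre q \<notin> H \<and> orient q = - s" if "q \<in> ball p \<rho>" "fst q < of_int k" for q
    using z[OF that(1)] by (simp add: fibre_def fl[OF that] l_def s_def orient_def)
  have R: "zone (fibre q) = r \<and> fibre q \<notin> H \<and> orient q = s" if "q \<in> ball p \<rho>" "fst q \<ge> of_int k" for q
    using z[OF that(1)] by (simp add: fibre_def fr[OF that] r_def s_def orient_def)
  have nI: "fst q \<notin> \<int>" if "q \<in> ball p \<rho>" "fst q \<noteq> of_int k" for q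
  proof
    assume "fst q \<in> \<int>"
    then obtain m :: int where "fst q = of_int m" by (auto elim: Ints_cases)
    then have "\<bar>m - k\<bar> < 1" using d(2)[OF that(1)] \<rho>(4) by linarith
    then show False using that(2) \<open>fst q = of_int m\<close> by simp
  qed
  show thesis
  proof (rule that[OF \<rho>(1,4)])
    show "two_zone W_klein (klein_dev -` klein_disc n h) prod.swap (of_int k) (a l, - s * b l) (a r, s * b r) (ball p \<rho>)"
      unfolding two_zone_def
    proof (intro conjI ballI impI)
      fix q assume q: "q \<in> ball p \<rho>"
      show "W_klein q = (a l, - s * b l)" "q \<notin> klein_dev -` klein_disc n h" if "snd (prod.swap q) < of_int k"
        using L[OF q] nI[OF q] that klein_disc_H[of q] by (auto simp: W_klein)
      show "W_klein q = (a r, s * b r)" "q \<notin> klein_dev -` klein_disc n h" if "snd (prod.swap q) > of_int k"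
        using R[OF q] nI[OF q] that klein_disc_H[of q] by (auto simp: W_klein)
      show "W_klein q \<in> {(a l, - s * b l), (a r, s * b r)}" if "snd (prod.swap q) = of_int k"
        using R[OF q] that by (auto simp: W_klein)
    qed (auto simp: coord_perm_def)
    show "S (snd q) = S (snd p) + slope (zone (snd p)) * (snd q - snd p)" if "q \<in> ball p \<rho>" for q
      using 1(2)[of "snd q"] d(1)[OF that] \<rho> by auto
    show "\<bar>fst q - of_int k\<bar> < 1" if "q \<in> ball p \<rho>" for q using d(2)[OF that] \<rho> by auto
  qed (use L R in auto)
qed

end

text \<open>The distance to the nearest even integer; its slope is 1 on even and -1 on odd columns,
  like the orientation of the field.\<close>

definition tri :: "real \<Rightarrow> real" where "tri x = (if even \<lfloor>x\<rfloor> then frac x else 1 - frac x)"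

lemma tri_near: "\<bar>x - of_int k\<bar> < 1 \<Longrightarrow> tri x = (if even k then \<bar>x - of_int k\<bar> else 1 - \<bar>x - of_int k\<bar>)"
proof (cases "x < of_int k")
  case True
  assume "\<bar>x - of_int k\<bar> < 1"
  then have "\<lfloor>x\<rfloor> = k - 1" using True by (simp add: floor_eq_iff)
  then show ?thesis using True by (simp add: tri_def frac_def)
next
  case False
  assume "\<bar>x - of_int k\<bar> < 1"
  then have "\<lfloor>x\<rfloor> = k" using False by (simp add: floor_eq_iff)
  then show ?thesis using False by (simp add: tri_def frac_def)
qed

lemma tri_continuous: "continuous_on UNIV tri"
proof (intro continuous_at_imp_continuous_on ballI)
  fix x :: real
  define k where "k = \<lfloor>x\<rfloor>"
  have x: "\<bar>x - of_int k\<bar> < 1" unfolding k_def by linarith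
  have "eventually (\<lambda>y. y \<in> {of_int k - 1<..<of_int k + 1}) (nhds x)"
    using x by (intro eventually_nhds_in_open) auto
  then have "eventually (\<lambda>y. tri y = (if even k then \<bar>y - of_int k\<bar> else 1 - \<bar>y - of_int k\<bar>)) (nhds x)"
    by (rule eventually_mono) (intro tri_near, auto)
  then have "isCont tri x \<longleftrightarrow> isCont (\<lambda>y. if even k then \<bar>y - of_int k\<bar> else 1 - \<bar>y - of_int k\<bar>) x"
    by (rule isCont_cong)
  then show "isCont tri x" by (cases "even k") auto
qed

lemma countable_tri_level: "countable {x. tri x = c}"
proof -
  have "{x. tri x = c} \<subseteq> (\<Union>k::int. {of_int k + c, of_int k + 1 - c})"
  proof
    fix x assume "x \<in> {x. tri x = c}"
    then have "x = of_int \<lfloor>x\<rfloor> + c \<or> x = of_int \<lfloor>x\<rfloor> + 1 - c" by (auto simp: tri_def frac_def split: if_splits)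
    then show "x \<in> (\<Union>k::int. {of_int k + c, of_int k + 1 - c})" by blast
  qed
  then show ?thesis by (rule countable_subset) auto
qed

lemma kink_continuous: "isCont (kink \<eta> p q) y"
proof -
  have "(\<bar>p\<bar> + \<bar>q\<bar>)-lipschitz_on UNIV (kink \<eta> p q)"
    using kink_lipschitz by (intro lipschitz_onI) (auto simp: dist_real_def)
  then have "continuous_on UNIV (kink \<eta> p q)" by (rule lipschitz_on_continuous_on)
  then show ?thesis by (simp add: continuous_on_eq_continuous_at)
qed

context strips begin

lemma S_continuous: "continuous_on UNIV S"
proof (intro continuous_at_imp_continuous_on ballI)
  fix y
  obtain \<rho> i j where r: "\<rho> > 0"
    "\<And>z. y - \<rho> < z \<Longrightarrow> z \<le> y \<Longrightarrow> S z = S y + slope i * (z - y)"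
    "\<And>z. y \<le> z \<Longrightarrow> z < y + \<rho> \<Longrightarrow> S z = S y + slope j * (z - y)"
    by (rule local_structure[of y], rule that)
  have "eventually (\<lambda>z. z \<in> {y - \<rho><..<y + \<rho>}) (nhds y)"
    using r(1) by (intro eventually_nhds_in_open) auto
  then have "eventually (\<lambda>z. S z = S y + kink y (slope i) (slope j) z) (nhds y)"
  proof (rule eventually_mono)
    fix z assume z: "z \<in> {y - \<rho><..<y + \<rho>}"
    show "S z = S y + kink y (slope i) (slope j) z"
    proof (cases "z \<le> y")
      case True
      then have "S z = S y + slope i * (z - y)" using z by (intro r(2)) auto
      then show ?thesis unfolding kink_def by (simp only: True if_True)
    next
      case False
      then have "S z = S y + slope j * (z - y)" using z by (intro r(3)) auto
      then show ?thesis unfolding kink_def by (simp only: False if_False)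
    qed
  qed
  then have "isCont S y \<longleftrightarrow> isCont (\<lambda>z. S y + kink y (slope i) (slope j) z) y" by (rule isCont_cong)
  then show "isCont S y" by (simp add: continuous_add kink_continuous)
qed

lemma slope_idx: "slope (idx i) = slope i" by (simp add: slope_def idx_simps)

end

section \<open>Sufficiency on the Klein bottle\<close>

locale klein_conservative = weighted_strips +
  fixes C :: real
  assumes C_pos: "C > 0" and \<alpha>_eq: "\<And>i. i \<in> {1..n} \<Longrightarrow> \<alpha> i = C / b i"
    and slope_sym: "\<And>z. z \<notin> H \<Longrightarrow> 1 - z \<notin> H \<Longrightarrow> slope (zone z) = slope (zone (1 - z))"
begin

text \<open>Up to a constant factor, the field is the Hamiltonian field of this function divided by the
  density; the triangle wave accounts for the reversed orientation of every other column.\<close>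

definition hamiltonian :: "real \<times> real \<Rightarrow> real" where "hamiltonian p = tri (fst p) - S (snd p)"

text \<open>A seam point has, up to integers, the heights \<open>y\<close> and \<open>1 - y\<close>
  in the two adjacent columns; at a corner a line of discontinuity arrives from at least one side,
  and more than two zones may meet.\<close>

definition corners :: "(real \<times> real) set" where
  "corners = {p. fst p \<in> \<int> \<and> (snd p \<in> H \<or> 1 - snd p \<in> H)}"

lemma hamiltonian_continuous: "continuous_on UNIV hamiltonian"
  unfolding hamiltonian_def[abs_def]
  by (intro continuous_on_diff continuous_on_compose2[OF tri_continuous] continuous_on_compose2[OF S_continuous] continuous_intros) auto

lemma corners_closed: "closed corners"
proof -
  have H: "closed H" using open_not_H by (simp add: closed_def)
  have "corners = (fst -` \<int>) \<inter> ((snd -` H) \<union> ((\<lambda>p. 1 - snd p) -` H))" by (auto simp: corners_def)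
  moreover have "closed \<dots>"
    by (intro closed_Int closed_Un closed_vimage H closed_Ints continuous_intros)
  ultimately show ?thesis by simp
qed

lemma corners_countable: "countable corners"
proof -
  have "corners \<subseteq> \<int> \<times> (H \<union> (\<lambda>y. 1 - y) ` H)"
  proof
    fix p assume "p \<in> corners"
    then have p: "fst p \<in> \<int>" "snd p \<in> H \<or> 1 - snd p \<in> H" by (auto simp: corners_def)
    moreover have "snd p \<in> (\<lambda>y. 1 - y) ` H" if "1 - snd p \<in> H"
      using imageI[OF that, of "\<lambda>y. 1 - y"] by simp
    ultimately show "p \<in> \<int> \<times> (H \<union> (\<lambda>y. 1 - y) ` H)" by (auto simp: mem_Times_iff)
  qed
  moreover have "countable (\<int> \<times> (H \<union> (\<lambda>y. 1 - y) ` H) :: (real \<times> real) set)"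
    using countable_H by (intro countable_SIGMA countable_Un countable_image countable_int)
  ultimately show ?thesis by (rule countable_subset)
qed

text \<open>Every level meets each horizontal line in a countable set and is null by Fubini; only
  countably many levels occur.\<close>

lemma hamiltonian_level_null: "{p. hamiltonian p \<in> hamiltonian ` corners} \<in> null_sets lborel"
proof -
  have lev: "{p. hamiltonian p = c} \<in> null_sets lborel" for c
  proof -
    have "closed {p. hamiltonian p = c}" by (intro closed_Collect_eq hamiltonian_continuous continuous_on_const)
    then have s: "{p. hamiltonian p = c} \<in> sets borel" by simp
    then have s': "{p. hamiltonian p = c} \<in> sets (lborel \<Otimes>\<^sub>M lborel)"
      by (simp only: lborel_prod sets_lborel)
    have "emeasure lborel {p. hamiltonian p = c} = emeasure (lborel \<Otimes>\<^sub>M lborel) {p. hamiltonian p = c}"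
      by (simp add: lborel_prod)
    also have "\<dots> = (\<integral>\<^sup>+y. emeasure lborel ((\<lambda>x. (x, y)) -` {p. hamiltonian p = c}) \<partial>lborel)"
      by (rule lborel_pair.emeasure_pair_measure_alt2[OF s'])
    also have "\<dots> = (\<integral>\<^sup>+y. 0 \<partial>(lborel :: real measure))"
    proof (intro nn_integral_cong)
      fix y :: real
      have "(\<lambda>x. (x, y)) -` {p. hamiltonian p = c} = {x. tri x = c + S y}" by (auto simp: hamiltonian_def)
      then show "emeasure lborel ((\<lambda>x. (x, y)) -` {p. hamiltonian p = c}) = 0"
        using countable_imp_null_set_lborel[OF countable_tri_level[of "c + S y"]] by (simp add: null_sets_def)
    qed
    finally show ?thesis using s by (auto intro: null_setsI)
  qed
  have "{p. hamiltonian p \<in> hamiltonian ` corners} = (\<Union>c\<in>hamiltonian ` corners. {p. hamiltonian p = c})" by auto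
  moreover have "\<dots> \<in> null_sets lborel" using corners_countable lev by (intro null_sets_UN') auto
  ultimately show ?thesis by simp
qed

text \<open>The field at \<open>q\<close> is governed by the strip of \<open>fibre q\<close>, the
  Hamiltonian by that of \<open>snd q\<close>. In odd columns these are mirror images, and the
  symmetry of the slopes reconciles them.\<close>

lemma column_box:
  assumes p: "fst p \<notin> \<int>"
  shows "\<exists>U. p \<in> U \<and> flow_box speed W_klein (klein_dev -` klein_disc n h)
     (\<lambda>p. ennreal (strip_density n h \<alpha> (klein_fold p))) hamiltonian X U"
proof -
  let ?D = "klein_dev -` klein_disc n h"
  obtain \<rho>1 i j where 1: "\<rho>1 > 0" "i < n" "j < n"
    and tz1: "two_zone W_klein ?D id (snd p) (a i, orient p * b i) (a j, orient p * b j) (ball p \<rho>1)"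
    and fl: "\<And>q. q \<in> ball p \<rho>1 \<Longrightarrow> \<lfloor>fst q\<rfloor> = \<lfloor>fst p\<rfloor>"
    and lo: "\<And>q. q \<in> ball p \<rho>1 \<Longrightarrow> snd q < snd p \<Longrightarrow> zone (fibre q) = idx i \<and> fibre q \<notin> H"
    and up: "\<And>q. q \<in> ball p \<rho>1 \<Longrightarrow> snd q > snd p \<Longrightarrow> zone (fibre q) = idx j \<and> fibre q \<notin> H"
    by (rule klein_column_two_zone[OF p]) blast
  obtain \<rho>2 i' j' where 2: "\<rho>2 > 0"
    "\<And>z. snd p - \<rho>2 < z \<Longrightarrow> z < snd p \<Longrightarrow> zone z = idx i' \<and> z \<notin> H"
    "\<And>z. snd p < z \<Longrightarrow> z < snd p + \<rho>2 \<Longrightarrow> zone z = idx j' \<and> z \<notin> H"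
    "\<And>z. snd p - \<rho>2 < z \<Longrightarrow> z \<le> snd p \<Longrightarrow> S z = S (snd p) + slope i' * (z - snd p)"
    "\<And>z. snd p \<le> z \<Longrightarrow> z < snd p + \<rho>2 \<Longrightarrow> S z = S (snd p) + slope j' * (z - snd p)"
    by (rule local_structure[of "snd p"], rule that)
  define \<rho> where "\<rho> = min \<rho>1 \<rho>2"
  have \<rho>: "\<rho> > 0" "ball p \<rho> \<subseteq> ball p \<rho>1" using 1(1) 2(1) by (auto simp: \<rho>_def)
  have near: "snd p - \<rho>2 < snd q \<and> snd q < snd p + \<rho>2" if "q \<in> ball p \<rho>" for q
    using dist_snd_le[of p q] that by (auto simp: dist_real_def \<rho>_def)
  have fib: "slope (zone (fibre q)) = slope (zone (snd q))" if "snd q \<notin> H" "fibre q \<notin> H" for q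
    using that slope_sym[of "snd q"] by (auto simp: fibre_def split: if_splits)
  have inb: "(fst p, snd p + t) \<in> ball p \<rho>" if "\<bar>t\<bar> < \<rho>" for t
    using that by (simp add: dist_prod_def dist_real_def)
  \<comment> \<open>The slopes are compared at a test point half a radius below \<open>p\<close>,
    where both local descriptions apply.\<close>
  have si: "slope i = slope i'"
    using fib[of "(fst p, snd p + - \<rho> / 2)"] inb[of "- \<rho> / 2"] lo[of "(fst p, snd p + - \<rho> / 2)"]
      near[of "(fst p, snd p + - \<rho> / 2)"] 2(2)[of "snd p + - \<rho> / 2"] \<rho> by (auto simp: slope_idx)
  have sj: "slope j = slope j'"
    using fib[of "(fst p, snd p + \<rho> / 2)"] inb[of "\<rho> / 2"] up[of "(fst p, snd p + \<rho> / 2)"]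
      near[of "(fst p, snd p + \<rho> / 2)"] 2(3)[of "snd p + \<rho> / 2"] \<rho> by (auto simp: slope_idx)
  have tz: "two_zone W_klein ?D id (snd p) (a i, orient p * b i) (a j, orient p * b j) (ball p \<rho>)"
    by (rule two_zone_subset[OF tz1 _ \<rho>(2)]) simp
  have bp: "b i > 0" "b j > 0" using b_pos' 1 by auto
  have o: "orient p * orient p = 1" "\<bar>orient p\<bar> = 1" "orient p = 1 \<or> orient p = - 1" by (auto simp: orient_def)
  have "flow_box speed W_klein ?D (\<lambda>p. ennreal (strip_density n h \<alpha> (klein_fold p))) hamiltonian X (ball p \<rho>)"
  \<comment> \<open>Up to a constant, the Hamiltonian is the first straightening coordinate on even
    columns and its negative on odd ones, where the triangle wave descends.\<close>
  proof (rule crossing_flow_box[OF tz _ _ _ _ _ _ C_pos,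
      where ?F1.0="\<lambda>g. if even \<lfloor>fst p\<rfloor> then g - of_int \<lfloor>fst p\<rfloor> - S (snd p) else 1 + of_int \<lfloor>fst p\<rfloor> - g - S (snd p)"])
    show "norm (a i, orient p * b i) \<le> speed" "norm (a j, orient p * b j) \<le> speed"
      using speed_le[OF idx_range[OF 1(2)], of "orient p"] speed_le[OF idx_range[OF 1(3)], of "orient p"] o by (simp_all add: idx_simps)
    show "0 < snd (id (a i, orient p * b i)) * snd (id (a j, orient p * b j))"
      using o(3) bp by auto
    show "ennreal (strip_density n h \<alpha> (klein_fold q)) = ennreal (C / \<bar>snd (id (a i, orient p * b i))\<bar>)"
      if "q \<in> ball p \<rho>" "snd (id q) < snd p" for q
      using that lo[of q] \<rho>(2) \<alpha>_eq[OF idx_range[OF 1(2)]] bp o by (auto simp: klein_density idx_simps abs_mult)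
    show "ennreal (strip_density n h \<alpha> (klein_fold q)) = ennreal (C / \<bar>snd (id (a j, orient p * b j))\<bar>)"
      if "q \<in> ball p \<rho>" "snd (id q) > snd p" for q
      using that up[of q] \<rho>(2) \<alpha>_eq[OF idx_range[OF 1(3)]] bp o by (auto simp: klein_density idx_simps abs_mult)
    show "(\<lambda>p. ennreal (strip_density n h \<alpha> (klein_fold p))) \<in> borel_measurable borel"
    proof -
      interpret flat_surface klein_pt klein_fold klein_dev "klein_disc n h" W_klein "strip_density n h \<alpha>" speed by (rule flat_klein)
      show ?thesis by measurable
    qed
    fix q assume q: "q \<in> ball p \<rho>"
    have k: "kink (snd p) (c * slope i) (c * slope j) (snd q) = c * (S (snd q) - S (snd p))" for c
    proof (cases "snd q \<le> snd p")
      case True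
      then have "S (snd q) = S (snd p) + slope i' * (snd q - snd p)" using near[OF q] by (intro 2(4)) auto
      then have "S (snd q) - S (snd p) = slope i' * (snd q - snd p)" by linarith
      then show ?thesis using True by (simp only: kink_def if_True si mult.assoc)
    next
      case False
      then have "S (snd q) = S (snd p) + slope j' * (snd q - snd p)" using near[OF q] by (intro 2(5)) auto
      then have "S (snd q) - S (snd p) = slope j' * (snd q - snd p)" by linarith
      then show ?thesis using False by (simp only: kink_def if_False sj mult.assoc)
    qed
    have G: "fst (straighten (snd p) (id (a i, orient p * b i)) (id (a j, orient p * b j)) (id q)) =
        fst q - orient p * (S (snd q) - S (snd p))"
      using k[of "orient p"] o(3) by (auto simp: straighten_def slope_def)
    have t: "tri (fst q) = (if even \<lfloor>fst p\<rfloor> then fst q - of_int \<lfloor>fst p\<rfloor> else 1 - (fst q - of_int \<lfloor>fst p\<rfloor>))"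
      using fl[of q] q \<rho>(2) by (auto simp: tri_def frac_def)
    show "hamiltonian q = (if even \<lfloor>fst p\<rfloor>
        then fst (straighten (snd p) (id (a i, orient p * b i)) (id (a j, orient p * b j)) (id q)) - of_int \<lfloor>fst p\<rfloor> - S (snd p)
        else 1 + of_int \<lfloor>fst p\<rfloor> - fst (straighten (snd p) (id (a i, orient p * b i)) (id (a j, orient p * b j)) (id q)) - S (snd p))"
      unfolding G by (simp add: hamiltonian_def t orient_def)
  qed
  then show ?thesis using \<rho>(1) by (intro exI[of _ "ball p \<rho>"]) simp
qed

text \<open>The common slope \<open>m\<close> of the two sides decides: for \<open>m = 0\<close>
  both fields are parallel to the seam; otherwise they cross it in the same direction, since
  \<open>a = m * b\<close> with \<open>b > 0\<close> on both sides.\<close>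

lemma seam_box:
  assumes p: "fst p = of_int k" and y: "snd p \<notin> H" "1 - snd p \<notin> H"
  shows "\<exists>U. p \<in> U \<and> flow_box speed W_klein (klein_dev -` klein_disc n h)
     (\<lambda>p. ennreal (strip_density n h \<alpha> (klein_fold p))) hamiltonian (hamiltonian ` corners) U"
proof -
  let ?D = "klein_dev -` klein_disc n h" and ?wt = "\<lambda>p. ennreal (strip_density n h \<alpha> (klein_fold p))"
  define l where "l = (if even k then zone (1 - snd p) else zone (snd p))"
  define r where "r = (if even k then zone (snd p) else zone (1 - snd p))"
  define s :: real where "s = (if even k then 1 else - 1)"
  obtain \<rho> where \<rho>: "\<rho> > 0" "\<rho> \<le> 1"
    and tz: "two_zone W_klein ?D prod.swap (of_int k) (a l, - s * b l) (a r, s * b r) (ball p \<rho>)"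
    and lo: "\<And>q. q \<in> ball p \<rho> \<Longrightarrow> fst q < of_int k \<Longrightarrow> zone (fibre q) = l"
    and up: "\<And>q. q \<in> ball p \<rho> \<Longrightarrow> fst q > of_int k \<Longrightarrow> zone (fibre q) = r"
    and S: "\<And>q. q \<in> ball p \<rho> \<Longrightarrow> S (snd q) = S (snd p) + slope (zone (snd p)) * (snd q - snd p)"
    and nr: "\<And>q. q \<in> ball p \<rho> \<Longrightarrow> \<bar>fst q - of_int k\<bar> < 1"
    by (rule klein_seam_two_zone[OF p y, folded l_def r_def s_def]) blast
  define m where "m = slope (zone (snd p))"
  have lr: "l \<in> {1..n}" "r \<in> {1..n}" unfolding l_def r_def using zone_range by (auto simp del: atLeastAtMost_iff)
  have bp: "b l > 0" "b r > 0" using b_pos lr by auto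
  have sl: "slope l = m" "slope r = m" using slope_sym[OF y] by (auto simp: l_def r_def m_def)
  have "a l = slope l * b l" "a r = slope r * b r" using bp by (simp_all add: slope_def)
  then have am: "a l = m * b l" "a r = m * b r" by (simp_all only: sl)
  have ss: "s * s = 1" "\<bar>s\<bar> = 1" "s = 1 \<or> s = - 1" by (auto simp: s_def)
  have sp: "norm (a l, - s * b l) \<le> speed" "norm (a r, s * b r) \<le> speed"
    using speed_le[OF lr(1), of "- s"] speed_le[OF lr(2), of s] ss by auto
  have wt: "?wt \<in> borel_measurable borel"
  proof -
    interpret flat_surface klein_pt klein_fold klein_dev "klein_disc n h" W_klein "strip_density n h \<alpha>" speed by (rule flat_klein)
    show ?thesis by measurable
  qed
  have F: "hamiltonian q = (if even k then \<bar>fst q - of_int k\<bar> else 1 - \<bar>fst q - of_int k\<bar>) - S (snd p) - m * (snd q - snd p)"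
    if q: "q \<in> ball p \<rho>" for q
    using tri_near[OF nr[OF q]] S[OF q] by (simp add: hamiltonian_def m_def)
  have "flow_box speed W_klein ?D ?wt hamiltonian (hamiltonian ` corners) (ball p \<rho>)"
  proof (cases "m = 0")
    case True
    show ?thesis
    proof (rule tangential_flow_box[OF tz _ _ sp wt, where ?k1.0="ennreal (\<alpha> l)" and ?k2.0="ennreal (\<alpha> r)"
          and ?F1.0="\<lambda>x. (if even k then \<bar>x - of_int k\<bar> else 1 - \<bar>x - of_int k\<bar>) - S (snd p)"])
      show "hamiltonian q \<in> hamiltonian ` corners" if q: "q \<in> ball p \<rho>" "snd (prod.swap q) = of_int k" for q
      proof -
        \<comment> \<open>Slope zero makes \<open>S\<close> constant on the strip of
          \<open>snd p\<close>, so the seam next to \<open>p\<close> has the level of the corner at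
          the upper end of that strip.\<close>
        obtain i where i: "i < n" "of_int \<lfloor>snd p\<rfloor> + h i \<le> snd p" "snd p < of_int \<lfloor>snd p\<rfloor> + h (Suc i)"
          by (rule zone_exists)
        have si: "slope i = 0" using zone_eq[OF i] True by (simp add: m_def slope_idx)
        define y' where "y' = of_int \<lfloor>snd p\<rfloor> + h (Suc i)"
        have "frac y' = frac (h (Suc i))" unfolding y'_def by (rule frac_add_Ints) simp
        then have "y' \<in> H" using frac_h[of "Suc i"] i by (simp add: H_def)
        then have c: "(of_int k, y') \<in> corners" by (simp add: corners_def)
        have "S y' = S (snd p)"
          using S_affine[OF i(1), of "snd p" "\<lfloor>snd p\<rfloor>" y'] i si h_less[of i "Suc i"] by (simp add: y'_def)
        moreover have "tri (of_int k) = (if even k then 0 else 1)" using tri_near[of "of_int k" k] by simp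
        ultimately have "hamiltonian q = hamiltonian (of_int k, y')"
          using F[OF q(1)] q(2) True by (simp add: hamiltonian_def)
        then show ?thesis using c by blast
      qed
    qed (use am True lo up F in \<open>auto simp: klein_density\<close>)
  next
    case False
    show ?thesis
    \<comment> \<open>The flux through the seam is \<open>\<alpha> * \<bar>a\<bar>\<close>; with
      \<open>\<alpha> = C / b\<close> and \<open>a = m * b\<close> this is
      \<open>C * \<bar>m\<bar>\<close> on both sides.\<close>
    proof (rule crossing_flow_box[OF tz _ sp wt, where k="C * \<bar>m\<bar>" and
          ?F1.0="\<lambda>g. - m * g - S (snd p) + m * snd p + (if even k then 0 else 1)"])
      have "0 < m\<^sup>2 * (b l * b r)" using bp False by simp
      then show "0 < snd (prod.swap (a l, - s * b l)) * snd (prod.swap (a r, s * b r))"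
        by (simp add: am power2_eq_square ac_simps)
      show "?wt q = ennreal (C * \<bar>m\<bar> / \<bar>snd (prod.swap (a l, - s * b l))\<bar>)"
        if "q \<in> ball p \<rho>" "snd (prod.swap q) < of_int k" for q
        using lo[OF that(1)] that(2) False bp \<alpha>_eq[OF lr(1)] by (simp add: klein_density am abs_mult)
      show "?wt q = ennreal (C * \<bar>m\<bar> / \<bar>snd (prod.swap (a r, s * b r))\<bar>)"
        if "q \<in> ball p \<rho>" "snd (prod.swap q) > of_int k" for q
        using up[OF that(1)] that(2) False bp \<alpha>_eq[OF lr(2)] by (simp add: klein_density am abs_mult)
      show "0 < C * \<bar>m\<bar>" using C_pos False by simp
      fix q assume q: "q \<in> ball p \<rho>"
      have "fst (straighten (of_int k) (prod.swap (a l, - s * b l)) (prod.swap (a r, s * b r)) (prod.swap q)) =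
          snd q - kink (of_int k) (- s / m) (s / m) (fst q)"
        using bp False by (simp add: straighten_def am)
      also have "kink (of_int k) (- s / m) (s / m) (fst q) = s * \<bar>fst q - of_int k\<bar> / m"
        by (auto simp: kink_def algebra_simps diff_divide_distrib)
      finally have G: "fst (straighten (of_int k) (prod.swap (a l, - s * b l)) (prod.swap (a r, s * b r)) (prod.swap q)) =
          snd q - s * \<bar>fst q - of_int k\<bar> / m" .
      show "hamiltonian q = - m * fst (straighten (of_int k) (prod.swap (a l, - s * b l)) (prod.swap (a r, s * b r)) (prod.swap q))
          - S (snd p) + m * snd p + (if even k then 0 else 1)"
        unfolding G F[OF q] using False by (cases "even k") (simp_all add: s_def algebra_simps)
    qed
  qed
  then show ?thesis using \<rho>(1) by (intro exI[of _ "ball p \<rho>"]) simp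
qed

lemma klein_sufficient:
  "preserves_measure (klein_flow n h a b) (weighted_area klein_pt (strip_density n h \<alpha>))"
proof -
  interpret flat_surface klein_pt klein_fold klein_dev "klein_disc n h" W_klein "strip_density n h \<alpha>" speed
    by (rule flat_klein)
  have "conservative_surface klein_pt klein_fold klein_dev (klein_disc n h) W_klein (strip_density n h \<alpha>) speed hamiltonian corners"
  proof
    fix p assume p: "p \<notin> corners"
    show "\<exists>U. p \<in> U \<and> flow_box speed W_klein (klein_dev -` klein_disc n h)
       (\<lambda>p. ennreal (strip_density n h \<alpha> (klein_fold p))) hamiltonian (hamiltonian ` corners) U"
    proof (cases "fst p \<in> \<int>")
      case True
      then obtain k where "fst p = of_int k" by (auto elim: Ints_cases)
      then show ?thesis using seam_box[of p k] p True by (auto simp: corners_def)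
    qed (rule column_box)
  qed (use speed_pos W_le' corners_closed corners_countable hamiltonian_continuous hamiltonian_level_null in auto)
  then show ?thesis unfolding klein_flow_def by (rule conservative_surface.preserves)
qed

end

section \<open>Necessity\<close>

lemma emeasure_completion_le_outer:
  assumes "X \<in> sets (completion M)"
  shows "emeasure (completion M) X \<le> outer_measure_of M X"
proof -
  have "X \<subseteq> space M" using sets.sets_into_space[OF assms] by simp
  then obtain B where B: "B \<in> sets M" "X \<subseteq> B" "outer_measure_of M X = emeasure M B"
    using outer_measure_of_attain by metis
  have "emeasure (completion M) X \<le> emeasure (completion M) B" using B by (intro emeasure_mono) auto
  then show ?thesis using B by simp
qed

lemma emeasure_lborel_open_pos:
  fixes E :: "'a::euclidean_space set"
  assumes "open E" "E \<noteq> {}" shows "emeasure lborel E > 0"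
proof (rule ccontr)
  assume "\<not> emeasure lborel E > 0"
  then have "E \<in> null_sets lborel" using assms by (auto intro: null_setsI)
  then have "negligible E" by (simp add: negligible_iff_null_sets null_sets_completionI)
  then show False using open_not_negligible assms by blast
qed

context flat_surface begin

text \<open>Invariance bounds the set of reached points from below, whereas the local analysis
  bounds it from above; comparing the two yields all necessary conditions. \<open>E\<close> is taken
  in one cell, where \<open>dev\<close> preserves measure exactly.\<close>

lemma preserves_le_reach:
  assumes pres: "preserves_measure (filippov_image dev D W) (weighted_area pt f)"
    and E: "E \<in> sets borel" "E \<subseteq> cell k l"
  shows "emeasure \<mu> E \<le> outer_measure_of \<mu> (reach L (krasovskii W) UNIV 0 t E)"
proof -
  let ?Z = "filippov_image dev D W t (dev ` E)"
  have A: "dev ` E \<in> sets M" by (rule emeasure_dev_cell(1)[OF E])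
  have Z: "?Z \<in> sets (completion M)" "emeasure (completion M) ?Z = emeasure M (dev ` E)"
    using pres A unfolding preserves_measure_def M_def by blast+
  have "emeasure \<mu> E = emeasure (completion M) ?Z" unfolding Z(2) by (rule emeasure_dev_cell(2)[OF E, symmetric])
  also have "\<dots> \<le> outer_measure_of M ?Z" by (rule emeasure_completion_le_outer[OF Z(1)])
  also have "\<dots> \<le> outer_measure_of M (dev ` reach L (krasovskii W) UNIV 0 t E)"
    by (rule outer_measure_of_mono[OF image_subset_reach])
  also have "\<dots> \<le> outer_measure_of \<mu> (reach L (krasovskii W) UNIV 0 t E)" by (rule outer_dev)
  finally show ?thesis .
qed

lemma reach_local:
  assumes "E \<subseteq> ball p r" "r + L * \<bar>t\<bar> \<le> \<rho>"
  shows "reach L (krasovskii W) UNIV 0 t E \<subseteq> reach L (krasovskii W) (ball p \<rho>) 0 t E"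
proof
  fix q assume "q \<in> reach L (krasovskii W) UNIV 0 t E"
  then obtain \<psi> where \<psi>: "lift_sol (closed_segment 0 t) \<psi>" "\<psi> 0 \<in> E" "q = \<psi> t" unfolding reach_def by blast
  have "\<psi> s \<in> ball p \<rho>" if s: "s \<in> closed_segment 0 t" for s
  proof -
    have "dist (\<psi> 0) (\<psi> s) \<le> L * \<bar>0 - s\<bar>" by (rule solution_dist_le[OF \<psi>(1) _ s]) simp
    also have "\<dots> \<le> L * \<bar>t\<bar>" using L_pos' s by (intro mult_left_mono) (auto simp: closed_segment_real)
    finally have "dist (\<psi> 0) (\<psi> s) \<le> L * \<bar>t\<bar>" .
    moreover have "dist p (\<psi> 0) < r" using \<psi>(2) assms(1) by auto
    ultimately have "dist p (\<psi> s) < \<rho>" using dist_triangle[of p "\<psi> s" "\<psi> 0"] assms(2) by linarith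
    then show ?thesis by simp
  qed
  then show "q \<in> reach L (krasovskii W) (ball p \<rho>) 0 t E" using \<psi> unfolding reach_def by blast
qed

lemma one_sided_ball:
  assumes P: "coord_perm P" and p: "snd (P p) = \<eta>" and \<kappa>: "\<bar>\<kappa>\<bar> = 1" and r: "r > 0"
  defines "E \<equiv> {q \<in> ball p r. \<kappa> * (snd (P q) - \<eta>) < 0}"
  shows "open E" "E \<in> sets borel" "emeasure lborel E > 0" "emeasure lborel E < \<infinity>"
proof -
  have "open {q. \<kappa> * (snd (P q) - \<eta>) < 0}"
    by (intro open_Collect_less continuous_intros continuous_on_snd linear_continuous_on coord_perm_bounded_linear P)
  then have "open (ball p r \<inter> {q. \<kappa> * (snd (P q) - \<eta>) < 0})" by (intro open_Int open_ball)
  then show o: "open E" by (simp add: E_def Int_def)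
  then show "E \<in> sets borel" by simp
  note Ps = coord_perm_simps[OF P]
  have \<kappa>\<kappa>: "\<kappa> * \<kappa> = 1" using \<kappa> by (cases "\<kappa> \<ge> 0") auto
  have "norm (P (0, x)) = \<bar>x\<bar>" for x using Ps(2)[of "(0, x)"] by (simp add: norm_prod_def)
  then have "dist p (p + P (0, - \<kappa> * r / 2)) = r / 2" using \<kappa> r by (simp add: dist_norm abs_mult)
  moreover have "\<kappa> * (snd (P (p + P (0, - \<kappa> * r / 2))) - \<eta>) = - (\<kappa> * \<kappa>) * r / 2" by (simp add: Ps p)
  ultimately have "p + P (0, - \<kappa> * r / 2) \<in> E" using \<kappa>\<kappa> r by (simp add: E_def)
  then have ne: "E \<noteq> {}" by auto
  show "emeasure lborel E > 0" by (rule emeasure_lborel_open_pos[OF o ne])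
  have "bounded E" by (rule bounded_subset[OF bounded_ball[of p r]]) (auto simp: E_def)
  then show "emeasure lborel E < \<infinity>" by (rule emeasure_bounded_finite)
qed

lemma emeasure_weight_const:
  assumes "E \<in> sets borel" "\<And>q. q \<in> E \<Longrightarrow> weight q = c"
  shows "emeasure \<mu> E = c * emeasure lborel E"
  using emeasure_density_proportional[OF weight_measurable borel_measurable_const[of 1] assms(1), of c] assms(2)
  by (simp add: density_1)

text \<open>A thin layer on the side \<open>\<kappa>\<close> of the line is pushed across it. Since only an upper bound for the
  image is needed, no solution has to be constructed.\<close>

lemma preserves_flux_le:
  assumes pres: "preserves_measure (filippov_image dev D W) (weighted_area pt f)"
    and tz: "two_zone W (dev -` D) P \<eta> w1 w2 (ball p \<rho>)" and p: "snd (P p) = \<eta>" and \<rho>: "\<rho> > 0"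
    and n: "0 < snd (P w1) * snd (P w2)" and \<kappa>: "\<kappa> = 1 \<or> \<kappa> = - 1"
    and cell: "{q \<in> ball p \<delta>. \<kappa> * (snd (P q) - \<eta>) < 0} \<subseteq> cell k l" and \<delta>: "\<delta> > 0"
    and w1: "\<And>q. q \<in> ball p \<rho> \<Longrightarrow> snd (P q) < \<eta> \<Longrightarrow> weight q = ennreal c1"
    and w2: "\<And>q. q \<in> ball p \<rho> \<Longrightarrow> snd (P q) > \<eta> \<Longrightarrow> weight q = ennreal c2" and c: "c1 > 0" "c2 > 0"
  shows "\<kappa> * (c1 * \<bar>snd (P w1)\<bar>) \<le> \<kappa> * (c2 * \<bar>snd (P w2)\<bar>)"
proof -
  have P: "coord_perm P" using tz by (rule two_zone_coord_perm)
  define n1 n2 where "n1 = \<bar>snd (P w1)\<bar>" and "n2 = \<bar>snd (P w2)\<bar>"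
  have n12: "n1 > 0" "n2 > 0" using n by (auto simp: n1_def n2_def)
  \<comment> \<open>Weight and normal speed on the side where the layer starts and on the side where
    it ends.\<close>
  define cs ns ce ne where "cs = (if \<kappa> = 1 then c1 else c2)" and "ns = (if \<kappa> = 1 then n1 else n2)"
    and "ce = (if \<kappa> = 1 then c2 else c1)" and "ne = (if \<kappa> = 1 then n2 else n1)"
  \<comment> \<open>A layer of thickness \<open>r\<close> leaves its side within time
    \<open>r / ns\<close>, during which a curve travels at most \<open>L * (r / ns)\<close>; this
    choice keeps all curves within \<open>min \<rho> \<delta>\<close> of \<open>p\<close>.\<close>
  define r where "r = min \<rho> \<delta> / (1 + L / ns)"
  have ns: "ns > 0" "1 + L / ns > 0" "ne > 0" "cs > 0" "ce > 0"
    using n12 L_pos' c by (auto simp: ns_def ne_def cs_def ce_def intro: add_pos_pos)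
  have "r * (1 + L / ns) = min \<rho> \<delta>" using ns by (simp add: r_def)
  moreover have "r + L * (r / ns) = r * (1 + L / ns)" by (simp add: algebra_simps)
  moreover have "r > 0" using ns \<rho> \<delta> by (simp add: r_def)
  ultimately have r: "r > 0" "r + L * (r / ns) = min \<rho> \<delta>" by simp_all
  have r2: "r \<le> min \<rho> \<delta>" using r L_pos' ns by (smt (verit) divide_pos_pos mult_pos_pos)
  define E where "E = {q \<in> ball p r. \<kappa> * (snd (P q) - \<eta>) < 0}"
  have \<kappa>1: "\<bar>\<kappa>\<bar> = 1" using \<kappa> by auto
  note E = one_sided_ball[OF P p \<kappa>1 r(1), folded E_def]
  \<comment> \<open>The sign makes the normal displacement point in the direction
    \<open>\<kappa>\<close>, whichever way the field crosses.\<close>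
  define t where "t = \<kappa> * sgn (snd (P w1)) * (r / ns)"
  have s: "\<bar>sgn (snd (P w1))\<bar> = 1" "sgn (snd (P w1)) * sgn (snd (P w1)) = 1" using n by (auto simp: sgn_if)
  have abst: "\<bar>t\<bar> = r / ns" using \<kappa>1 s r ns by (simp add: t_def abs_mult)
  have st: "sgn (snd (P w1)) * (t - 0) = \<kappa> * (r / ns)" using s by (simp add: t_def algebra_simps)
  have EU: "E \<subseteq> ball p \<rho>" using r2 by (auto simp: E_def)
  define X where "X = {q. \<kappa> * (snd (P q) - \<eta>) > 0}"
  have X: "X \<in> sets borel"
    using coord_half_planes_borel[OF P, of \<eta>] \<kappa> by (auto simp: X_def)
  have sub: "reach L (krasovskii W) (ball p \<rho>) 0 t E \<subseteq> X"
  proof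
    fix q assume "q \<in> reach L (krasovskii W) (ball p \<rho>) 0 t E"
    then obtain \<psi> where \<psi>: "lift_sol {min 0 t..max 0 t} \<psi>" "\<psi> ` {min 0 t..max 0 t} \<subseteq> ball p \<rho>" "\<psi> 0 \<in> E" "q = \<psi> t"
      unfolding reach_def closed_segment_real by blast
    have "straighten \<eta> (P w1) (P w2) (P (\<psi> t)) = straighten \<eta> (P w1) (P w2) (P (\<psi> 0)) + (0, \<kappa> * (r / ns))"
      using two_zone_crossing(1)[OF tz \<psi>(1,2) n, of 0 t] st by simp
    then have T: "kink \<eta> (1 / n1) (1 / n2) (snd (P q)) = kink \<eta> (1 / n1) (1 / n2) (snd (P (\<psi> 0))) + \<kappa> * (r / ns)"
      by (simp add: straighten_def n1_def n2_def \<psi>(4))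
    define z where "z = snd (P (\<psi> 0))"
    have "\<bar>z - \<eta>\<bar> \<le> dist (P p) (P (\<psi> 0))"
      using dist_snd_le[of "P p" "P (\<psi> 0)"] p by (simp add: z_def dist_real_def abs_minus_commute)
    also have "\<dots> < r" using \<psi>(3) by (simp add: E_def coord_perm_simps[OF P])
    finally have z: "\<bar>z - \<eta>\<bar> < r" "\<kappa> * (z - \<eta>) < 0" using \<psi>(3) by (auto simp: E_def z_def)
    have "kink \<eta> (1 / n1) (1 / n2) z = (z - \<eta>) / ns"
      using \<kappa> z(2) by (auto simp: kink_def ns_def)
    then have "\<kappa> * kink \<eta> (1 / n1) (1 / n2) (snd (P q)) = (\<kappa> * (z - \<eta>) + r) / ns"
      using T \<kappa> by (auto simp: z_def add_divide_distrib diff_divide_distrib)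
    moreover have "\<kappa> * (z - \<eta>) + r > 0" using z \<kappa> by auto
    ultimately have "\<kappa> * kink \<eta> (1 / n1) (1 / n2) (snd (P q)) > 0" using ns by simp
    then have "\<kappa> * (snd (P q) - \<eta>) > 0"
      using \<kappa> n12 by (auto simp: kink_def zero_less_divide_iff divide_less_0_iff split: if_splits)
    then show "q \<in> X" by (simp add: X_def)
  qed
  have ws: "weight q = ennreal cs" if "q \<in> ball p \<rho>" "\<kappa> * (snd (P q) - \<eta>) < 0" for q
    using w1[OF that(1)] w2[OF that(1)] that(2) \<kappa> by (auto simp: cs_def)
  have we: "weight q = ennreal ce" if "q \<in> ball p \<rho>" "\<kappa> * (snd (P q) - \<eta>) > 0" for q
    using w1[OF that(1)] w2[OF that(1)] that(2) \<kappa> by (auto simp: ce_def)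
  have cr: "ennreal (cs * ns) * outer_measure_of \<mu> (reach L (krasovskii W) (ball p \<rho>) 0 t E) \<le> ennreal (ce * ne) * emeasure \<mu> E"
  proof (rule outer_reach_crossing[OF tz n weight_measurable E(2) EU sub X])
    show "AE q in lborel. q \<in> E \<longrightarrow> weight q = ennreal (cs * ns) * ennreal (slowness \<eta> (P w1) (P w2) (P q))"
    proof (intro AE_I2 impI)
      fix q assume q: "q \<in> E"
      have "slowness \<eta> (P w1) (P w2) (P q) = 1 / ns" using q \<kappa> by (auto simp: E_def slowness_def ns_def n1_def n2_def)
      then show "weight q = ennreal (cs * ns) * ennreal (slowness \<eta> (P w1) (P w2) (P q))"
        using ws[of q] q EU ns by (auto simp: E_def ennreal_mult[symmetric])
    qed
    show "AE q in lborel. q \<in> X \<inter> ball p \<rho> \<longrightarrow> weight q = ennreal (ce * ne) * ennreal (slowness \<eta> (P w1) (P w2) (P q))"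
    proof (intro AE_I2 impI)
      fix q assume q: "q \<in> X \<inter> ball p \<rho>"
      have "slowness \<eta> (P w1) (P w2) (P q) = 1 / ne" using q \<kappa> by (auto simp: X_def slowness_def ne_def n1_def n2_def)
      then show "weight q = ennreal (ce * ne) * ennreal (slowness \<eta> (P w1) (P w2) (P q))"
        using we[of q] q ns by (auto simp: X_def ennreal_mult[symmetric])
    qed
  qed
  have "E \<subseteq> {q \<in> ball p \<delta>. \<kappa> * (snd (P q) - \<eta>) < 0}" using r2 by (auto simp: E_def)
  then have "E \<subseteq> cell k l" using cell by (rule subset_trans)
  then have "emeasure \<mu> E \<le> outer_measure_of \<mu> (reach L (krasovskii W) UNIV 0 t E)"
    by (rule preserves_le_reach[OF pres E(2)])
  also have "\<dots> \<le> outer_measure_of \<mu> (reach L (krasovskii W) (ball p \<rho>) 0 t E)"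
    by (intro outer_measure_of_mono reach_local[of _ _ r]) (use r abst in \<open>auto simp: E_def\<close>)
  finally have "ennreal (cs * ns) * emeasure \<mu> E \<le> ennreal (cs * ns) * outer_measure_of \<mu> (reach L (krasovskii W) (ball p \<rho>) 0 t E)"
    by (rule mult_left_mono) simp
  also note cr
  finally have le: "ennreal (cs * ns) * emeasure \<mu> E \<le> ennreal (ce * ne) * emeasure \<mu> E" .
  have "emeasure \<mu> E = ennreal cs * emeasure lborel E"
    by (rule emeasure_weight_const[OF E(2)]) (use ws EU in \<open>auto simp: E_def\<close>)
  then obtain m where m: "emeasure \<mu> E = ennreal m" "m > 0"
    using E(3,4) ns(4) by (cases "emeasure lborel E") (auto simp: ennreal_mult[symmetric] ennreal_less_top)
  have "cs * ns * m \<le> ce * ne * m"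
    using le m ns by (simp add: ennreal_mult[symmetric])
  then have "cs * ns \<le> ce * ne" using m by simp
  then show ?thesis using \<kappa> by (auto simp: cs_def ns_def ce_def ne_def n1_def n2_def)
qed

text \<open>If in the time direction \<open>\<sigma>\<close> neither side pushes away from the line
  and the side of the layer moves, the whole layer lies on the line after time
  \<open>r / ns\<close>: a set of positive measure would be mapped into a null set.\<close>

lemma preserves_no_sliding:
  assumes pres: "preserves_measure (filippov_image dev D W) (weighted_area pt f)"
    and tz: "two_zone W (dev -` D) P \<eta> w1 w2 (ball p \<rho>)" and p: "snd (P p) = \<eta>" and \<rho>: "\<rho> > 0"
    and \<kappa>: "\<kappa> = 1 \<or> \<kappa> = - 1" and \<sigma>: "\<sigma> = 1 \<or> \<sigma> = - 1"
    and n: "0 \<le> snd (P w1) * \<sigma>" "snd (P w2) * \<sigma> \<le> 0" and n0: "snd (P (if \<kappa> = 1 then w1 else w2)) \<noteq> 0"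
    and cell: "{q \<in> ball p \<delta>. \<kappa> * (snd (P q) - \<eta>) < 0} \<subseteq> cell k l" and \<delta>: "\<delta> > 0"
    and w: "\<And>q. q \<in> ball p \<rho> \<Longrightarrow> \<kappa> * (snd (P q) - \<eta>) < 0 \<Longrightarrow> weight q = ennreal c" and c: "c > 0"
  shows False
proof -
  have P: "coord_perm P" using tz by (rule two_zone_coord_perm)
  define ns where "ns = \<bar>snd (P (if \<kappa> = 1 then w1 else w2))\<bar>"
  have ns: "ns > 0" "1 + L / ns > 0" using n0 L_pos' by (auto simp: ns_def intro: add_pos_pos)
  define r where "r = min \<rho> \<delta> / (1 + L / ns)"
  have "r * (1 + L / ns) = min \<rho> \<delta>" using ns by (simp add: r_def)
  moreover have "r + L * (r / ns) = r * (1 + L / ns)" by (simp add: algebra_simps)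
  moreover have "r > 0" using ns \<rho> \<delta> by (simp add: r_def)
  ultimately have r: "r > 0" "r + L * (r / ns) = min \<rho> \<delta>" by simp_all
  have r2: "r \<le> min \<rho> \<delta>" using r L_pos' ns by (smt (verit) divide_pos_pos mult_pos_pos)
  define E where "E = {q \<in> ball p r. \<kappa> * (snd (P q) - \<eta>) < 0}"
  have \<kappa>1: "\<bar>\<kappa>\<bar> = 1" using \<kappa> by auto
  note E = one_sided_ball[OF P p \<kappa>1 r(1), folded E_def]
  define t where "t = \<sigma> * (r / ns)"
  have abst: "\<bar>t\<bar> = r / ns" using \<sigma> r ns by (auto simp: t_def)
  have nt: "0 \<le> snd (P w1) * (t - 0)" "snd (P w2) * (t - 0) \<le> 0"
  proof -
    have "0 \<le> r / ns" using r ns by simp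
    then have "0 \<le> (snd (P w1) * \<sigma>) * (r / ns)" "(snd (P w2) * \<sigma>) * (r / ns) \<le> 0"
      using n by (simp_all only: mult_nonneg_nonneg mult_nonpos_nonneg)
    then show "0 \<le> snd (P w1) * (t - 0)" "snd (P w2) * (t - 0) \<le> 0" by (simp_all add: t_def mult.assoc)
  qed
  have sub: "reach L (krasovskii W) (ball p \<rho>) 0 t E \<subseteq> {q. snd (P q) = \<eta>}"
  proof
    fix q assume "q \<in> reach L (krasovskii W) (ball p \<rho>) 0 t E"
    then obtain \<psi> where \<psi>: "lift_sol {min 0 t..max 0 t} \<psi>" "\<psi> ` {min 0 t..max 0 t} \<subseteq> ball p \<rho>" "\<psi> 0 \<in> E" "q = \<psi> t"
      unfolding reach_def closed_segment_real by blast
    define z where "z = snd (P (\<psi> 0))"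
    have "\<bar>z - \<eta>\<bar> \<le> dist (P p) (P (\<psi> 0))"
      using dist_snd_le[of "P p" "P (\<psi> 0)"] p by (simp add: z_def dist_real_def abs_minus_commute)
    also have "\<dots> < r" using \<psi>(3) by (simp add: E_def coord_perm_simps[OF P])
    finally have z: "\<bar>z - \<eta>\<bar> < r" "\<kappa> * (z - \<eta>) < 0" using \<psi>(3) by (auto simp: E_def z_def)
    have tt: "0 \<in> {min 0 t..max 0 t}" "t \<in> {min 0 t..max 0 t}" by auto
    note sl = two_zone_sliding[OF tz \<psi>(1,2) tt nt]
    have "snd (P (\<psi> t)) = \<eta>"
    proof (cases "\<kappa> = 1")
      case True
      have "snd (P w1) * t = r" using True n \<sigma> ns(1) by (auto simp: t_def ns_def abs_if split: if_splits)
      then show ?thesis using sl(1) z True by (simp add: z_def)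
    next
      case False
      then have k: "\<kappa> = - 1" using \<kappa> by simp
      have "- snd (P w2) * t = r" using False n \<sigma> ns(1) by (auto simp: t_def ns_def abs_if split: if_splits)
      then show ?thesis using sl(2) z k by (simp add: z_def)
    qed
    then show "q \<in> {q. snd (P q) = \<eta>}" using \<psi>(4) by simp
  qed
  have EU: "E \<subseteq> ball p \<rho>" using r2 by (auto simp: E_def)
  have "E \<subseteq> {q \<in> ball p \<delta>. \<kappa> * (snd (P q) - \<eta>) < 0}" using r2 by (auto simp: E_def)
  then have "E \<subseteq> cell k l" using cell by (rule subset_trans)
  then have "emeasure \<mu> E \<le> outer_measure_of \<mu> (reach L (krasovskii W) UNIV 0 t E)"
    by (rule preserves_le_reach[OF pres E(2)])
  also have "\<dots> \<le> outer_measure_of \<mu> (reach L (krasovskii W) (ball p \<rho>) 0 t E)"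
    by (intro outer_measure_of_mono reach_local[of _ _ r]) (use r abst in \<open>auto simp: E_def\<close>)
  also have "\<dots> \<le> outer_measure_of \<mu> {q. snd (P q) = \<eta>}" by (rule outer_measure_of_mono[OF sub])
  also have "\<dots> = emeasure \<mu> {q. snd (P q) = \<eta>}" using coord_half_planes_borel(3)[OF P] by (intro outer_measure_of_eq) simp
  also have "\<dots> = 0"
    using line_null[OF P, of \<eta>] coord_half_planes_borel(3)[OF P, of \<eta>]
    by (subst emeasure_density) (auto intro!: nn_integral_null_set)
  finally have "emeasure \<mu> E = 0" by simp
  moreover have "emeasure \<mu> E = ennreal c * emeasure lborel E"
    by (rule emeasure_weight_const[OF E(2)]) (use w EU in \<open>auto simp: E_def\<close>)
  ultimately show False using E(3) c by simp
qed

end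

section \<open>Flux and slope conditions forced by invariance\<close>

context weighted_strips begin

text \<open>Fluxes that never decrease from strip to strip around a cycle are constant, so a
  one-sided inequality at every line is enough.\<close>

lemma flux_cycle:
  assumes "\<And>i. i \<in> {1..n} \<Longrightarrow> \<alpha> (idx (i - 1)) * b (idx (i - 1)) \<le> \<alpha> (idx (i mod n)) * b (idx (i mod n))"
  shows "\<exists>C>0. \<forall>i\<in>{1..n}. \<alpha> i = C / b i"
proof -
  define \<beta> where "\<beta> i = \<alpha> (idx i) * b (idx i)" for i
  have step: "\<beta> (i - 1) \<le> \<beta> (i mod n)" if "i \<in> {1..n}" for i using assms[OF that] by (simp add: \<beta>_def)
  have up: "\<beta> i \<le> \<beta> j" if "i \<le> j" "j < n" for i j
    using that
  proof (induction j)
    case (Suc j)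
    then show ?case using step[of "Suc j"] by (cases "i = Suc j") auto
  qed simp
  have "\<beta> (n - 1) \<le> \<beta> 0" using step[of n] n2 by simp
  moreover have "\<beta> 0 \<le> \<beta> i" "\<beta> i \<le> \<beta> (n - 1)" if "i < n" for i
    using that by (auto intro!: up)
  ultimately have const: "\<beta> i = \<beta> 0" if "i < n" for i using that by (meson order_antisym order_trans)
  have "\<alpha> i * b i = \<beta> 0" if "i \<in> {1..n}" for i
    using idx_surj[OF that] const by (auto simp: \<beta>_def)
  then have "\<alpha> i = \<beta> 0 / b i" if "i \<in> {1..n}" for i using that b_pos[OF that] by (metis less_irrefl nonzero_mult_div_cancel_right)
  moreover have "\<beta> 0 > 0" using \<alpha>_pos b_pos idx_range[of 0] n2 by (auto simp: \<beta>_def)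
  ultimately show ?thesis by blast
qed

lemma zone_below_above:
  assumes i: "i \<in> {1..n}" and \<rho>: "\<rho> > 0"
  obtains y z where "h i - \<rho> < y" "y < h i" "zone y = idx (i - 1)" "h i < z" "z < h i + \<rho>" "zone z = idx (i mod n)"
proof -
  define y where "y = max (h (i - 1)) (h i - \<rho> / 2)"
  have "h (i - 1) < h i" using h_less[of "i - 1" i] i by auto
  then have y: "h i - \<rho> < y" "y < h i" "h (i - 1) \<le> y" using \<rho> by (auto simp: y_def)
  have zy: "zone y = idx (i - 1)" using zone_eq[of "i - 1" 0 y] y i by auto
  \<comment> \<open>Above \<open>h n = 1\<close> comes the lowest strip of the next period, hence
    the shift by 1.\<close>
  obtain k j where kj: "j < n" "of_int k + h j = h i" "j = i mod n"
  proof (cases "i = n")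
    case True then show thesis using that[of 0 1] n2 h0 hn by auto
  next
    case False then show thesis using that[of i 0] i by auto
  qed
  define d where "d = min \<rho> (h (Suc j) - h j)"
  define z where "z = h i + d / 2"
  have "h j < h (Suc j)" using hSuc kj by auto
  then have "0 < d" "d \<le> \<rho>" "d \<le> h (Suc j) - h j" using \<rho> by (auto simp: d_def)
  then have z: "h i < z" "z < h i + \<rho>" "z < of_int k + h (Suc j)" using kj(2) unfolding z_def by linarith+
  have "zone z = idx (i mod n)" using zone_eq[of j k z] z kj by auto
  then show thesis using that y zy z by blast
qed

lemma torus_necessary:
  assumes pres: "preserves_measure (torus_flow n h a b) (weighted_area torus_pt (strip_density n h \<alpha>))"
  shows "\<exists>C>0. \<forall>i\<in>{1..n}. \<alpha> i = C / b i"
proof (rule flux_cycle)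
  interpret flat_surface torus_pt torus_fold torus_dev "torus_disc n h" W_torus "strip_density n h \<alpha>" speed
    by (rule flat_torus)
  fix m assume m: "m \<in> {1..n}"
  \<comment> \<open>Only a layer below the line is pushed, so it lies in the unit cell even for
    \<open>h m = 1\<close>.\<close>
  define p where "p = (1 / 2 :: real, h m)"
  obtain \<rho> i j where \<rho>: "\<rho> > 0" "i < n" "j < n"
    and tz: "two_zone W_torus (torus_dev -` torus_disc n h) id (snd p) (a i, b i) (a j, b j) (ball p \<rho>)"
    and z: "\<And>q. q \<in> ball p \<rho> \<Longrightarrow> snd q < snd p \<Longrightarrow> zone (snd q) = idx i"
      "\<And>q. q \<in> ball p \<rho> \<Longrightarrow> snd q > snd p \<Longrightarrow> zone (snd q) = idx j"
    by (rule torus_two_zone[of p]) blast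
  obtain y1 y2 where y: "h m - \<rho> < y1" "y1 < h m" "zone y1 = idx (m - 1)" "h m < y2" "y2 < h m + \<rho>" "zone y2 = idx (m mod n)"
    by (rule zone_below_above[OF m \<rho>(1)])
  have ij: "idx i = idx (m - 1)" "idx j = idx (m mod n)"
    using z(1)[of "(1/2, y1)"] z(2)[of "(1/2, y2)"] y by (auto simp: p_def dist_prod_def dist_real_def)
  have bp: "b i > 0" "b j > 0" using b_pos' \<rho> by auto
  have hm: "0 < h m" "h m \<le> 1" using h_less[of 0 m] h0 h_range[of m] m by auto
  have "1 * (\<alpha> (idx i) * \<bar>snd (id (a i, b i))\<bar>) \<le> 1 * (\<alpha> (idx j) * \<bar>snd (id (a j, b j))\<bar>)"
  proof (rule preserves_flux_le[OF pres[unfolded torus_flow_def] tz _ \<rho>(1)])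
    show "{q \<in> ball p (min (1/2) (h m)). 1 * (snd (id q) - snd p) < 0} \<subseteq> cell 0 0"
    proof
      fix q assume q: "q \<in> {q \<in> ball p (min (1/2) (h m)). 1 * (snd (id q) - snd p) < 0}"
      then have "\<bar>1/2 - fst q\<bar> < 1/2" "\<bar>h m - snd q\<bar> < h m" "snd q < h m"
        using dist_fst_le[of p q] dist_snd_le[of p q] by (auto simp: p_def dist_real_def)
      then have "0 < fst q" "fst q < 1" "0 < snd q" "snd q < 1" using hm by linarith+
      then show "q \<in> cell 0 0" by (simp add: mem_Times_iff)
    qed
    show "0 < min (1/2) (h m)" using hm by simp
    show "weight q = ennreal (\<alpha> (idx i))" if "q \<in> ball p \<rho>" "snd (id q) < snd p" for q
      using z(1)[of q] that by (simp add: weight_def torus_density)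
    show "weight q = ennreal (\<alpha> (idx j))" if "q \<in> ball p \<rho>" "snd (id q) > snd p" for q
      using z(2)[of q] that by (simp add: weight_def torus_density)
  qed (use bp \<alpha>_pos idx_range \<rho> in auto)
  then show "\<alpha> (idx (m - 1)) * b (idx (m - 1)) \<le> \<alpha> (idx (m mod n)) * b (idx (m mod n))"
    using bp unfolding ij[symmetric] by (simp add: idx_simps)
qed

lemma klein_necessary_density:
  assumes pres: "preserves_measure (klein_flow n h a b) (weighted_area klein_pt (strip_density n h \<alpha>))"
  shows "\<exists>C>0. \<forall>i\<in>{1..n}. \<alpha> i = C / b i"
proof (rule flux_cycle)
  interpret flat_surface klein_pt klein_fold klein_dev "klein_disc n h" W_klein "strip_density n h \<alpha>" speed
    by (rule flat_klein)
  fix m assume m: "m \<in> {1..n}"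
  \<comment> \<open>In the column with floor 0 nothing is reflected, so heights and signs are those
    of the square.\<close>
  define p where "p = (1 / 2 :: real, h m)"
  have p: "fst p \<notin> \<int>" "\<lfloor>fst p\<rfloor> = 0"
  proof -
    show f: "\<lfloor>fst p\<rfloor> = 0" by (simp add: p_def)
    show "fst p \<notin> \<int>" using f by (auto simp: p_def elim!: Ints_cases)
  qed
  have o: "orient p = 1" by (simp add: orient_def p)
  obtain \<rho> i j where \<rho>: "\<rho> > 0" "i < n" "j < n"
    and tz: "two_zone W_klein (klein_dev -` klein_disc n h) id (snd p) (a i, orient p * b i) (a j, orient p * b j) (ball p \<rho>)"
    and fl: "\<And>q. q \<in> ball p \<rho> \<Longrightarrow> \<lfloor>fst q\<rfloor> = \<lfloor>fst p\<rfloor>"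
    and z: "\<And>q. q \<in> ball p \<rho> \<Longrightarrow> snd q < snd p \<Longrightarrow> zone (fibre q) = idx i \<and> fibre q \<notin> H"
      "\<And>q. q \<in> ball p \<rho> \<Longrightarrow> snd q > snd p \<Longrightarrow> zone (fibre q) = idx j \<and> fibre q \<notin> H"
    by (rule klein_column_two_zone[OF p(1)]) blast
  have fib: "fibre q = snd q" if "q \<in> ball p \<rho>" for q using fl[OF that] by (simp add: fibre_def p)
  obtain y1 y2 where y: "h m - \<rho> < y1" "y1 < h m" "zone y1 = idx (m - 1)" "h m < y2" "y2 < h m + \<rho>" "zone y2 = idx (m mod n)"
    by (rule zone_below_above[OF m \<rho>(1)])
  have in12: "(1/2, y1) \<in> ball p \<rho>" "(1/2, y2) \<in> ball p \<rho>" using y by (auto simp: p_def dist_prod_def dist_real_def)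
  have ij: "idx i = idx (m - 1)" "idx j = idx (m mod n)"
    using z(1)[OF in12(1)] z(2)[OF in12(2)] fib[OF in12(1)] fib[OF in12(2)] y by (auto simp: p_def)
  have bp: "b i > 0" "b j > 0" using b_pos' \<rho> by auto
  have hm: "0 < h m" "h m \<le> 1" using h_less[of 0 m] h0 h_range[of m] m by auto
  have "1 * (\<alpha> (idx i) * \<bar>snd (id (a i, orient p * b i))\<bar>) \<le> 1 * (\<alpha> (idx j) * \<bar>snd (id (a j, orient p * b j))\<bar>)"
  proof (rule preserves_flux_le[OF pres[unfolded klein_flow_def] tz _ \<rho>(1)])
    show "{q \<in> ball p (min (1/2) (h m)). 1 * (snd (id q) - snd p) < 0} \<subseteq> cell 0 0"
    proof
      fix q assume q: "q \<in> {q \<in> ball p (min (1/2) (h m)). 1 * (snd (id q) - snd p) < 0}"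
      then have "\<bar>1/2 - fst q\<bar> < 1/2" "\<bar>h m - snd q\<bar> < h m" "snd q < h m"
        using dist_fst_le[of p q] dist_snd_le[of p q] by (auto simp: p_def dist_real_def)
      then have "0 < fst q" "fst q < 1" "0 < snd q" "snd q < 1" using hm by linarith+
      then show "q \<in> cell 0 0" by (simp add: mem_Times_iff)
    qed
    show "0 < min (1/2) (h m)" using hm by simp
    show "weight q = ennreal (\<alpha> (idx i))" if "q \<in> ball p \<rho>" "snd (id q) < snd p" for q
      using z(1)[of q] that by (simp add: weight_def klein_density)
    show "weight q = ennreal (\<alpha> (idx j))" if "q \<in> ball p \<rho>" "snd (id q) > snd p" for q
      using z(2)[of q] that by (simp add: weight_def klein_density)
  qed (use bp \<alpha>_pos idx_range \<rho> o in auto)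
  then show "\<alpha> (idx (m - 1)) * b (idx (m - 1)) \<le> \<alpha> (idx (m mod n)) * b (idx (m mod n))"
    using bp unfolding ij[symmetric] by (simp add: idx_simps o)
qed

text \<open>At the seam over 1 the left side lies in the strip of \<open>y\<close> and the right
  side in that of \<open>1 - y\<close>. With \<open>\<alpha> = C / b\<close>, equality of the fluxes
  through the seam is equality of \<open>\<bar>a\<bar> / b\<close>, and a disagreement in sign
  causes sliding in one direction of time.\<close>

lemma klein_necessary_slope:
  assumes pres: "preserves_measure (klein_flow n h a b) (weighted_area klein_pt (strip_density n h \<alpha>))"
    and C: "C > 0" "\<And>i. i \<in> {1..n} \<Longrightarrow> \<alpha> i = C / b i"
    and y: "y \<notin> H" "1 - y \<notin> H"
  shows "slope (zone y) = slope (zone (1 - y))"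
proof -
  interpret flat_surface klein_pt klein_fold klein_dev "klein_disc n h" W_klein "strip_density n h \<alpha>" speed
    by (rule flat_klein)
  define p where "p = (1 :: real, y)"
  have p: "fst p = of_int 1" "snd p \<notin> H" "1 - snd p \<notin> H" using y by (auto simp: p_def)
  define l where "l = (if even (1::int) then zone (1 - snd p) else zone (snd p))"
  define r where "r = (if even (1::int) then zone (snd p) else zone (1 - snd p))"
  define s :: real where "s = (if even (1::int) then 1 else - 1)"
  obtain \<rho> where \<rho>: "\<rho> > 0" "\<rho> \<le> 1"
    and tz0: "two_zone W_klein (klein_dev -` klein_disc n h) prod.swap (of_int 1) (a l, - s * b l) (a r, s * b r) (ball p \<rho>)"
    and lo0: "\<And>q. q \<in> ball p \<rho> \<Longrightarrow> fst q < of_int 1 \<Longrightarrow> zone (fibre q) = l"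
    and up0: "\<And>q. q \<in> ball p \<rho> \<Longrightarrow> fst q > of_int 1 \<Longrightarrow> zone (fibre q) = r"
    by (rule klein_seam_two_zone[OF p, folded l_def r_def s_def]) blast
  have lr': "l = zone y" "r = zone (1 - y)" by (simp_all add: l_def r_def p_def)
  have tz: "two_zone W_klein (klein_dev -` klein_disc n h) prod.swap 1 (a l, b l) (a r, - b r) (ball p \<rho>)"
    using tz0 by (simp add: s_def)
  have lo: "zone (fibre q) = l" if "q \<in> ball p \<rho>" "fst q < 1" for q using lo0[OF that(1)] that(2) by simp
  have up: "zone (fibre q) = r" if "q \<in> ball p \<rho>" "fst q > 1" for q using up0[OF that(1)] that(2) by simp
  have bp: "b l > 0" "b r > 0" "\<alpha> l > 0" "\<alpha> r > 0" using \<alpha>_zone_pos by (simp_all add: lr')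
  have lr: "\<alpha> l = C / b l" "\<alpha> r = C / b r" using C(2)[OF zone_range] by (simp_all add: lr')
  have wl: "weight q = ennreal (\<alpha> l)" if "q \<in> ball p \<rho>" "snd (prod.swap q) < 1" for q
    using lo[of q] that by (simp add: weight_def klein_density)
  have wr: "weight q = ennreal (\<alpha> r)" if "q \<in> ball p \<rho>" "snd (prod.swap q) > 1" for q
    using up[of q] that by (simp add: weight_def klein_density)
  \<comment> \<open>Height 0 belongs to \<open>H\<close>, so \<open>y\<close> is not an integer and
    each half of a small ball around \<open>p\<close> lies in a single cell.\<close>
  have "0 \<in> h ` {..<n}" using h0 n2 by (intro image_eqI[of _ _ 0]) auto
  moreover have "frac y \<notin> h ` {..<n}" using y(1) by (simp add: H_def)
  ultimately have "frac y \<noteq> 0" by metis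
  define \<delta> where "\<delta> = min 1 (min (frac y) (1 - frac y))"
  have \<delta>: "\<delta> > 0" using \<open>frac y \<noteq> 0\<close> frac_ge_0[of y] frac_lt_1[of y] unfolding \<delta>_def by linarith
  have ball: "\<bar>fst q - 1\<bar> < 1 \<and> of_int \<lfloor>y\<rfloor> < snd q \<and> snd q < of_int \<lfloor>y\<rfloor> + 1" if "q \<in> ball p \<delta>" for q
  proof -
    have "\<bar>1 - fst q\<bar> < \<delta>" "\<bar>y - snd q\<bar> < \<delta>"
      using that dist_fst_le[of p q] dist_snd_le[of p q] by (auto simp: p_def dist_real_def)
    moreover have "\<delta> \<le> 1" "\<delta> \<le> frac y" "\<delta> \<le> 1 - frac y" by (auto simp: \<delta>_def)
    ultimately show ?thesis unfolding frac_def by linarith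
  qed
  have cl: "{q \<in> ball p \<delta>. 1 * (snd (prod.swap q) - 1) < 0} \<subseteq> cell 0 \<lfloor>y\<rfloor>"
    and cr: "{q \<in> ball p \<delta>. - 1 * (snd (prod.swap q) - 1) < 0} \<subseteq> cell 1 \<lfloor>y\<rfloor>"
    using ball by (force simp: mem_Times_iff)+
  have sp: "snd (prod.swap p) = 1" by (simp add: p_def)
  note pr = pres[unfolded klein_flow_def]
  \<comment> \<open>Equal signs mean crossing, and pushing layers from both sides gives both
    inequalities. Unless both velocities vanish, the seam otherwise attracts in some direction of
    time, and the layer is taken on a side that moves horizontally.\<close>
  consider "0 < a l * a r" | "a l = 0" "a r = 0" | "a l > 0" "a r \<le> 0" | "a l < 0" "a r \<ge> 0" | "a l = 0" "a r < 0" | "a l = 0" "a r > 0"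
    by (metis linorder_less_linear linorder_not_le mult_neg_neg mult_pos_pos)
  then have "a l / b l = a r / b r"
  proof cases
    case 1
    have n: "0 < snd (prod.swap (a l, b l)) * snd (prod.swap (a r, - b r))" using 1 by simp
    have "\<alpha> l * \<bar>a l\<bar> \<le> \<alpha> r * \<bar>a r\<bar>"
      using preserves_flux_le[OF pr tz sp \<rho>(1) n _ cl \<delta> wl wr bp(3,4)] by simp
    moreover have "\<alpha> r * \<bar>a r\<bar> \<le> \<alpha> l * \<bar>a l\<bar>"
      using preserves_flux_le[OF pr tz sp \<rho>(1) n _ cr \<delta> wl wr bp(3,4)] by simp
    ultimately have "C * (\<bar>a l\<bar> / b l) = C * (\<bar>a r\<bar> / b r)" by (simp add: lr)
    then have "\<bar>a l\<bar> / b l = \<bar>a r\<bar> / b r" using C(1) by (metis less_irrefl mult_cancel_left)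
    then show ?thesis using 1 by (auto simp: zero_less_mult_iff)
  next
    case 2 then show ?thesis by simp
  next
    case 3
    have False by (rule preserves_no_sliding[OF pr tz sp \<rho>(1) _ _ _ _ _ cl \<delta> wl bp(3), where \<sigma>=1]) (use 3 in auto)
    then show ?thesis ..
  next
    case 4
    have False by (rule preserves_no_sliding[OF pr tz sp \<rho>(1) _ _ _ _ _ cl \<delta> wl bp(3), where \<sigma>="-1"]) (use 4 in auto)
    then show ?thesis ..
  next
    case 5
    have False by (rule preserves_no_sliding[OF pr tz sp \<rho>(1) _ _ _ _ _ cr \<delta> wr bp(4), where \<sigma>=1]) (use 5 in auto)
    then show ?thesis ..
  next
    case 6
    have False by (rule preserves_no_sliding[OF pr tz sp \<rho>(1) _ _ _ _ _ cr \<delta> wr bp(4), where \<sigma>="-1"]) (use 6 in auto)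
    then show ?thesis ..
  qed
  then show ?thesis by (simp add: slope_def lr')
qed

end


section \<open>Mirror symmetry of the strips\<close>

context strips begin

context
  assumes even: "even n"
    and sym: "\<forall>i\<in>{1..n div 2 - 1}. h i - h (i - 1) = h (n - i + 1) - h (n - i)"
begin

text \<open>The height \<open>h (n div 2)\<close> is not determined by the symmetry assumptions.\<close>

lemma heights_symmetric: "i \<le> n \<Longrightarrow> i \<noteq> n div 2 \<Longrightarrow> h (n - i) = 1 - h i"
proof -
  have low: "h (n - i) = 1 - h i" if "i \<le> n div 2 - 1" for i
    using that
  proof (induction i)
    case 0 then show ?case using h0 hn by simp
  next
    case (Suc i)
    then have "h (Suc i) - h i = h (n - Suc i + 1) - h (n - Suc i)" using sym by force
    moreover have "n - Suc i + 1 = n - i" using Suc.prems n2 by auto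
    moreover have "h (n - i) = 1 - h i" using Suc by simp
    ultimately show ?case by simp
  qed
  assume i: "i \<le> n" "i \<noteq> n div 2"
  show ?thesis
  proof (cases "i < n div 2")
    case True then show ?thesis using low[of i] by simp
  next
    case False
    then have "n - i \<le> n div 2 - 1" using i even by (auto elim!: evenE)
    then show ?thesis using low[of "n - i"] i by simp
  qed
qed

text \<open>Reflection maps the heights to each other except possibly the middle one, so strips
  \<open>i\<close> and \<open>n - 1 - i\<close> are mirror images unless they are the two middle
  strips, which are mirrored only as a pair.\<close>

lemma mirror_index:
  assumes ij: "i < n" "j < n" and y: "h i < y" "y < h (Suc i)" "h j < 1 - y" "1 - y < h (Suc j)"
  shows "j = n - 1 - i \<or> {i, j} \<subseteq> {n div 2 - 1, n div 2}"
proof -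
  obtain N where N: "n = 2 * N" "N \<ge> 1" using even n2 by (auto elim!: evenE)
  show ?thesis
  proof (cases "i = N - 1 \<or> i = N")
    case True
    have a: "h (N - 1) < y" "y < h (N + 1)"
    proof -
      show "h (N - 1) < y" using y(1) h_le[of "N - 1" i] True ij by auto
      have "Suc i \<le> N + 1" "N + 1 \<le> n" using True N by auto
      then show "y < h (N + 1)" using y(2) h_le[of "Suc i" "N + 1"] by simp
    qed
    have "h (N + 1) = 1 - h (N - 1)"
    proof -
      have "n - (N - 1) = N + 1" "N - 1 \<noteq> n div 2" using N by auto
      then show ?thesis using heights_symmetric[of "N - 1"] N by simp
    qed
    then have "h (N - 1) < h (Suc j)" "h j < h (N + 1)" using a y by auto
    then have "N - 1 < Suc j" "j < N + 1" using h_less_iff[of "N - 1" "Suc j"] h_less_iff[of j "N + 1"] ij N by auto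
    then have "j = N - 1 \<or> j = N" by auto
    then show ?thesis using True N by auto
  next
    case False
    then have "i \<noteq> n div 2" "Suc i \<noteq> n div 2" using N by auto
    then have "h (n - i) = 1 - h i" "h (n - Suc i) = 1 - h (Suc i)" using heights_symmetric ij by auto
    then have "h j < h (n - i)" "h (n - Suc i) < h (Suc j)" using y by auto
    then have "j < n - i" "n - Suc i < Suc j" using h_less_iff[of j "n - i"] h_less_iff[of "n - Suc i" "Suc j"] ij by auto
    then show ?thesis using ij by auto
  qed
qed

text \<open>The condition for \<open>i = n div 2 - 1\<close> equates the slopes of the two middle
  strips, which settles every pairing that the free middle height allows. Conversely, strip
  \<open>i\<close> always overlaps the mirror image of strip \<open>n - 1 - i\<close>.\<close>

lemma slope_symmetric_iff:
  "(\<forall>z. z \<notin> H \<longrightarrow> 1 - z \<notin> H \<longrightarrow> slope (zone z) = slope (zone (1 - z))) \<longleftrightarrow>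
   (\<forall>i\<in>{0..n div 2 - 1}. a i / b i = a (n - i - 1) / b (n - i - 1))" (is "?L \<longleftrightarrow> ?R")
proof
  assume R: ?R
  have half: "slope i = slope (n - 1 - i)" if "i < n div 2" for i
  proof -
    have "i \<in> {0..n div 2 - 1}" "n - i - 1 = n - 1 - i" using that by auto
    then show ?thesis using R unfolding slope_def by metis
  qed
  \<comment> \<open>The conditions for the lower half give those for the upper half by exchanging
    the two sides.\<close>
  have R': "slope i = slope (n - 1 - i)" if "i < n" for i
  proof (cases "i < n div 2")
    case False
    then have "n - 1 - i < n div 2" "n - 1 - (n - 1 - i) = i" using that even by (auto elim!: evenE)
    then show ?thesis using half[of "n - 1 - i"] by simp
  qed (rule half)
  show ?L
  proof (intro allI impI)
    fix z assume z: "z \<notin> H" "1 - z \<notin> H"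
    define t where "t = frac z"
    have "t \<noteq> h 0" using z(1) n2 by (auto simp: H_def t_def)
    then have t: "0 < t" "t < 1" using h0 frac_ge_0[of z] frac_lt_1[of z] by (auto simp: t_def less_le)
    have e: "1 - z = of_int (- \<lfloor>z\<rfloor>) + (1 - t)" by (simp add: t_def frac_def)
    have t': "frac (1 - z) = 1 - t" unfolding e using t by (intro frac_int_add) auto
    obtain i where i: "i < n" "h i \<le> t" "t < h (Suc i)" using strip_exists[of t] t by auto
    obtain j where j: "j < n" "h j \<le> 1 - t" "1 - t < h (Suc j)" using strip_exists[of "1 - t"] t by auto
    have "t \<noteq> h i" using z(1) i by (auto simp: H_def t_def)
    moreover have "1 - t \<noteq> h j" using z(2) j t' by (auto simp: H_def)
    ultimately have "j = n - 1 - i \<or> {i, j} \<subseteq> {n div 2 - 1, n div 2}"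
      using mirror_index[OF i(1) j(1), of t] i j by auto
    moreover have "slope (n div 2 - 1) = slope (n div 2)"
    proof -
      have "n - 1 - (n div 2 - 1) = n div 2" "n div 2 - 1 < n" using even n2 by (auto elim!: evenE)
      then show ?thesis using R'[of "n div 2 - 1"] by simp
    qed
    ultimately have "slope i = slope j" using R'[OF i(1)] by auto
    moreover have "zone z = idx i" "zone (1 - z) = idx j"
      using strip_eq[OF i] strip_eq[OF j] by (simp_all add: zone_def t_def[symmetric] t')
    ultimately show "slope (zone z) = slope (zone (1 - z))" by (simp add: slope_def idx_simps)
  qed
next
  assume L: ?L
  show ?R
  proof
    fix i assume i: "i \<in> {0..n div 2 - 1}"
    define j where "j = n - 1 - i"
    have ij: "i < n" "j < n" "Suc j = n - i" "i \<noteq> n div 2" using i n2 by (auto simp: j_def)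
    have s: "h (Suc j) = 1 - h i" using heights_symmetric[of i] ij by simp
    have "h i < h (Suc i)" "h j < h (Suc j)" by (rule hSuc[OF ij(1)], rule hSuc[OF ij(2)])
    \<comment> \<open>Strip \<open>i\<close> and the mirror image of strip \<open>j\<close> both
      start at \<open>h i\<close>; \<open>y\<close> is the middle of their overlap.\<close>
    define y where "y = (h i + min (h (Suc i)) (1 - h j)) / 2"
    have y: "h i < y" "y < h (Suc i)" "h j < 1 - y" "1 - y < h (Suc j)"
    proof -
      define m where "m = min (h (Suc i)) (1 - h j)"
      have m: "m \<le> h (Suc i)" "m \<le> 1 - h j" "h i < m"
        using \<open>h i < h (Suc i)\<close> \<open>h j < h (Suc j)\<close> s by (auto simp: m_def)
      have ym: "y = (h i + m) / 2" by (simp add: y_def m_def)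
      show "h i < y" using m(3) ym by simp
      show "y < h (Suc i)" using m ym by simp
      show "h j < 1 - y" using m ym by simp
      show "1 - y < h (Suc j)" using m(3) ym s by simp
    qed
    have "y \<notin> H" "zone y = idx i" "1 - y \<notin> H" "zone (1 - y) = idx j"
      using not_H[of i 0 y] zone_eq[of i 0 y] not_H[of j 0 "1 - y"] zone_eq[of j 0 "1 - y"] ij y by auto
    then have "slope (idx i) = slope (idx j)" using L by metis
    moreover have "n - i - 1 = j" by (simp add: j_def)
    ultimately show "a i / b i = a (n - i - 1) / b (n - i - 1)" by (simp add: slope_def idx_simps)
  qed
qed

end

end

theorem proposition1:
  fixes n :: nat and h a b \<alpha> :: "nat \<Rightarrow> real"
  assumes "n \<ge> 2" and "even n"
    and "h 0 = 0" and "\<forall>i<n. h i < h (Suc i)" and "h n = 1"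
    and "\<forall>i\<in>{1..n}. b i > 0"
    and "a 0 = a n" and "b 0 = b n"
    and "\<forall>i\<in>{1..n}. \<alpha> i > 0"
  shows
    "(preserves_measure (torus_flow n h a b) (weighted_area torus_pt (strip_density n h \<alpha>))
        \<longleftrightarrow> (\<exists>C>0. \<forall>i\<in>{1..n}. \<alpha> i = C / b i))
     \<and>
     (h 1 = h n - h (n - 1) \<and>
      (\<forall>i\<in>{1..n div 2 - 1}. h i - h (i - 1) = h (n - i + 1) - h (n - i))
      \<longrightarrow>
      (preserves_measure (klein_flow n h a b) (weighted_area klein_pt (strip_density n h \<alpha>))
        \<longleftrightarrow> (\<exists>C>0. \<forall>i\<in>{1..n}. \<alpha> i = C / b i) \<and>
            (\<forall>i\<in>{0..n div 2 - 1}. a i / b i = a (n - i - 1) / b (n - i - 1))))"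
proof -
  interpret weighted_strips n h a b \<alpha>
    by unfold_locales (use assms in auto)
  show ?thesis
  proof (intro conjI impI)
    show "preserves_measure (torus_flow n h a b) (weighted_area torus_pt (strip_density n h \<alpha>))
        \<longleftrightarrow> (\<exists>C>0. \<forall>i\<in>{1..n}. \<alpha> i = C / b i)"
      using torus_necessary torus_sufficient by blast
    assume s: "h 1 = h n - h (n - 1) \<and>
      (\<forall>i\<in>{1..n div 2 - 1}. h i - h (i - 1) = h (n - i + 1) - h (n - i))"
    have iff: "(\<forall>z. z \<notin> H \<longrightarrow> 1 - z \<notin> H \<longrightarrow> slope (zone z) = slope (zone (1 - z))) \<longleftrightarrow>
       (\<forall>i\<in>{0..n div 2 - 1}. a i / b i = a (n - i - 1) / b (n - i - 1))"
      using slope_symmetric_iff[OF assms(2)] s by blast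
    show "preserves_measure (klein_flow n h a b) (weighted_area klein_pt (strip_density n h \<alpha>))
        \<longleftrightarrow> (\<exists>C>0. \<forall>i\<in>{1..n}. \<alpha> i = C / b i) \<and>
            (\<forall>i\<in>{0..n div 2 - 1}. a i / b i = a (n - i - 1) / b (n - i - 1))"
    proof
      assume pres: "preserves_measure (klein_flow n h a b) (weighted_area klein_pt (strip_density n h \<alpha>))"
      obtain C where C: "C > 0" "\<forall>i\<in>{1..n}. \<alpha> i = C / b i" using klein_necessary_density[OF pres] by blast
      have "\<forall>z. z \<notin> H \<longrightarrow> 1 - z \<notin> H \<longrightarrow> slope (zone z) = slope (zone (1 - z))"
        using klein_necessary_slope[OF pres C(1)] C(2) by blast
      then show "(\<exists>C>0. \<forall>i\<in>{1..n}. \<alpha> i = C / b i) \<and>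
            (\<forall>i\<in>{0..n div 2 - 1}. a i / b i = a (n - i - 1) / b (n - i - 1))"
        using C iff by blast
    next
      assume R: "(\<exists>C>0. \<forall>i\<in>{1..n}. \<alpha> i = C / b i) \<and>
            (\<forall>i\<in>{0..n div 2 - 1}. a i / b i = a (n - i - 1) / b (n - i - 1))"
      then obtain C where C: "C > 0" "\<forall>i\<in>{1..n}. \<alpha> i = C / b i" by blast
      have sl: "\<forall>z. z \<notin> H \<longrightarrow> 1 - z \<notin> H \<longrightarrow> slope (zone z) = slope (zone (1 - z))" using R iff by blast
      interpret klein_conservative n h a b \<alpha> C
      proof unfold_locales
        show "C > 0" by fact
        show "\<alpha> i = C / b i" if "i \<in> {1..n}" for i using C(2) that by blast
        show "slope (zone z) = slope (zone (1 - z))" if "z \<notin> H" "1 - z \<notin> H" for z using sl that by blast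
      qed
      show "preserves_measure (klein_flow n h a b) (weighted_area klein_pt (strip_density n h \<alpha>))"
        by (rule klein_sufficient)
    qed
  qed
qed

end
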